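(* Let $X=\mathbb{A}^1_{\mathbb{Q}}-\{\pm1,\pm i\}$ and $x_0=0$. Let $(M,\nabla)$ be a vector bundle with connection over $X$ whose $p$-curvatures vanish for all $p$ (in the sense defined in the context). Assume further that for $p\in\{3,5\}$ (i.e. for $v\mid 15$) the formal horizontal sections of $(M,\nabla)$ around $x_0$ converge over $D(x_0,1)$. Then $(M,\nabla)$ is étale locally trivial, i.e. it becomes isomorphic to a trivial bundle with connection $(\mathcal{O}^{\mathrm{rk}M},d)$ after pullback along some finite étale cover of $X$.
   Context: $D(x_0,r)$ denotes the open rigid analytic $v$-adic disc of radius $r$ centered at $x_0$ (with $|p|=p^{-1}$ for $v\mid p$). **$p$-curvature.** For all but finitely many $p$, $(M,\nabla)$ has a reduction mod $p$ (via an extension to a model over $\mathbb{Z}[1/N]$), and its $p$-curvature is $\psi_p(D)=\nabla(D^p)-\nabla(D)^p$ for derivations $D$, where $\nabla(D)=(D\otimes\mathrm{id})\circ\nabla$. **Definition.** The $p$-curvatures of $(M,\nabla)$ vanish for all $p$ if: (1) $\psi_p\equiv0$ for all but finitely many $p$; and (2) for every finite place $v$, with residue characteristic $p$, all formal horizontal sections of $(M,\nabla)$ around $x_0=0$ converge over $D\big(x_0,p^{-\frac{1}{p(p-1)}}\big)$. *)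

theory Defs
  imports
    "HOL-Computational_Algebra.Computational_Algebra"
    "HOL-Algebra.Algebra"
begin

section \<open>Vector bundles with connection on affine schemes\<close>

text \<open>
  A vector bundle on Spec A is a module that is Zariski-locally free.  The elements
  \<open>e 0, \<dots>, e (r - 1)\<close> of M form a basis of the localisation at g over the localised ring;
  both conditions are written out after clearing powers of g.
\<close>

definition local_basis ::
  "('a, 'x) ring_scheme \<Rightarrow> ('a, 'm, 'y) module_scheme \<Rightarrow> 'a \<Rightarrow> nat \<Rightarrow> (nat \<Rightarrow> 'm) \<Rightarrow> bool"
where
  "local_basis A M g r e \<longleftrightarrow>
     e \<in> {..<r} \<rightarrow> carrier M \<and>
     (\<forall>m\<in>carrier M. \<exists>k::nat. \<exists>a\<in>{..<r} \<rightarrow> carrier A.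
        (g [^]\<^bsub>A\<^esub> k) \<odot>\<^bsub>M\<^esub> m = (\<Oplus>\<^bsub>M\<^esub>i\<in>{..<r}. a i \<odot>\<^bsub>M\<^esub> e i)) \<and>
     (\<forall>a\<in>{..<r} \<rightarrow> carrier A.
        (\<Oplus>\<^bsub>M\<^esub>i\<in>{..<r}. a i \<odot>\<^bsub>M\<^esub> e i) = \<zero>\<^bsub>M\<^esub> \<longrightarrow>
        (\<forall>i<r. \<exists>k::nat. (g [^]\<^bsub>A\<^esub> k) \<otimes>\<^bsub>A\<^esub> a i = \<zero>\<^bsub>A\<^esub>))"

definition vector_bundle ::
  "('a, 'x) ring_scheme \<Rightarrow> ('a, 'm, 'y) module_scheme \<Rightarrow> nat \<Rightarrow> bool"
where
  "vector_bundle A M r \<longleftrightarrow>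
     module A M \<and>
     (\<forall>P. primeideal P A \<longrightarrow> (\<exists>g\<in>carrier A - P. \<exists>e. local_basis A M g r e))"

definition derivation :: "('a, 'x) ring_scheme \<Rightarrow> ('a \<Rightarrow> 'a) \<Rightarrow> bool" where
  "derivation A \<delta> \<longleftrightarrow>
     \<delta> \<in> carrier A \<rightarrow> carrier A \<and>
     (\<forall>a\<in>carrier A. \<forall>b\<in>carrier A. \<delta> (a \<oplus>\<^bsub>A\<^esub> b) = \<delta> a \<oplus>\<^bsub>A\<^esub> \<delta> b) \<and>
     (\<forall>a\<in>carrier A. \<forall>b\<in>carrier A.
        \<delta> (a \<otimes>\<^bsub>A\<^esub> b) = (\<delta> a \<otimes>\<^bsub>A\<^esub> b) \<oplus>\<^bsub>A\<^esub> (a \<otimes>\<^bsub>A\<^esub> \<delta> b))"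

text \<open>
  On every scheme considered below the module of differentials is free on \<open>dx\<close>, so a connection
  \<open>m \<mapsto> \<nabla>(d/dx)(m) \<otimes> dx\<close> is given by the operator \<open>\<nabla>(d/dx)\<close>; here
  \<open>\<delta>\<close> stands for the derivation \<open>d/dx\<close> of A.
\<close>

definition is_connection ::
  "('a, 'x) ring_scheme \<Rightarrow> ('a \<Rightarrow> 'a) \<Rightarrow> ('a, 'm, 'y) module_scheme \<Rightarrow> ('m \<Rightarrow> 'm) \<Rightarrow> bool"
where
  "is_connection A \<delta> M nabla \<longleftrightarrow>
     nabla \<in> carrier M \<rightarrow> carrier M \<and>
     (\<forall>m\<in>carrier M. \<forall>n\<in>carrier M. nabla (m \<oplus>\<^bsub>M\<^esub> n) = nabla m \<oplus>\<^bsub>M\<^esub> nabla n) \<and>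
     (\<forall>a\<in>carrier A. \<forall>m\<in>carrier M.
        nabla (a \<odot>\<^bsub>M\<^esub> m) = (\<delta> a \<odot>\<^bsub>M\<^esub> m) \<oplus>\<^bsub>M\<^esub> (a \<odot>\<^bsub>M\<^esub> nabla m))"

definition connection_iso ::
  "('a, 'x) ring_scheme \<Rightarrow> ('a, 'm, 'y) module_scheme \<Rightarrow> ('m \<Rightarrow> 'm) \<Rightarrow>
   ('a, 'n, 'z) module_scheme \<Rightarrow> ('n \<Rightarrow> 'n) \<Rightarrow> ('m \<Rightarrow> 'n) \<Rightarrow> bool"
where
  "connection_iso A M nabla N nabla' f \<longleftrightarrow>
     bij_betw f (carrier M) (carrier N) \<and>
     (\<forall>m\<in>carrier M. \<forall>n\<in>carrier M. f (m \<oplus>\<^bsub>M\<^esub> n) = f m \<oplus>\<^bsub>N\<^esub> f n) \<and>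
     (\<forall>a\<in>carrier A. \<forall>m\<in>carrier M. f (a \<odot>\<^bsub>M\<^esub> m) = a \<odot>\<^bsub>N\<^esub> f m) \<and>
     (\<forall>m\<in>carrier M. f (nabla m) = nabla' (f m))"

text \<open>The ring multiplication and unit of a module record carry no meaning.\<close>

definition trivial_bundle :: "('a, 'x) ring_scheme \<Rightarrow> nat \<Rightarrow> ('a, nat \<Rightarrow> 'a) module" where
  "trivial_bundle A r =
     \<lparr>carrier = {..<r} \<rightarrow>\<^sub>E carrier A, monoid.mult = undefined, monoid.one = undefined,
      ring.zero = (\<lambda>i\<in>{..<r}. \<zero>\<^bsub>A\<^esub>),
      ring.add = (\<lambda>u v. \<lambda>i\<in>{..<r}. u i \<oplus>\<^bsub>A\<^esub> v i),
      module.smult = (\<lambda>a u. \<lambda>i\<in>{..<r}. a \<otimes>\<^bsub>A\<^esub> u i)\<rparr>"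

definition trivial_connection :: "('a \<Rightarrow> 'a) \<Rightarrow> nat \<Rightarrow> (nat \<Rightarrow> 'a) \<Rightarrow> (nat \<Rightarrow> 'a)" where
  "trivial_connection \<delta> r u = (\<lambda>i\<in>{..<r}. \<delta> (u i))"


section \<open>Pullback\<close>

text \<open>
  The pullback of M along \<open>\<phi> : A \<rightarrow> B\<close> is \<open>B \<otimes>\<^sub>A M\<close>, the free abelian group on the
  symbols \<open>(b, m)\<close> modulo the subgroup of tensor relations.  Its elements are cosets of that
  subgroup.
\<close>

definition tensor_gens ::
  "('b, 'x) ring_scheme \<Rightarrow> ('a, 'm, 'y) module_scheme \<Rightarrow> ('b \<times> 'm \<Rightarrow>\<^sub>0 int) monoid"
where
  "tensor_gens B M = free_Abelian_group (carrier B \<times> carrier M)"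

definition tensor_rels ::
  "('a, 'w) ring_scheme \<Rightarrow> ('b, 'x) ring_scheme \<Rightarrow> ('a \<Rightarrow> 'b) \<Rightarrow> ('a, 'm, 'y) module_scheme
   \<Rightarrow> ('b \<times> 'm \<Rightarrow>\<^sub>0 int) set"
where
  "tensor_rels A B \<phi> M = generate (tensor_gens B M)
     ({frag_of (b \<oplus>\<^bsub>B\<^esub> b', m) - frag_of (b, m) - frag_of (b', m) | b b' m.
         b \<in> carrier B \<and> b' \<in> carrier B \<and> m \<in> carrier M} \<union>
      {frag_of (b, m \<oplus>\<^bsub>M\<^esub> m') - frag_of (b, m) - frag_of (b, m') | b m m'.
         b \<in> carrier B \<and> m \<in> carrier M \<and> m' \<in> carrier M} \<union>
      {frag_of (b \<otimes>\<^bsub>B\<^esub> \<phi> a, m) - frag_of (b, a \<odot>\<^bsub>M\<^esub> m) | a b m.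
         a \<in> carrier A \<and> b \<in> carrier B \<and> m \<in> carrier M})"

text \<open>
  A group endomorphism h of the free group that respects the relations H acts on a coset
  U by \<open>U \<mapsto> H + h(U)\<close>.
\<close>

definition pullback ::
  "('a, 'w) ring_scheme \<Rightarrow> ('b, 'x) ring_scheme \<Rightarrow> ('a \<Rightarrow> 'b) \<Rightarrow> ('a, 'm, 'y) module_scheme
   \<Rightarrow> ('b, ('b \<times> 'm \<Rightarrow>\<^sub>0 int) set) module"
where
  "pullback A B \<phi> M =
     \<lparr>carrier = carrier (tensor_gens B M Mod tensor_rels A B \<phi> M),
      monoid.mult = undefined, monoid.one = undefined,
      ring.zero = tensor_rels A B \<phi> M,
      ring.add = (\<lambda>U V. U <#>\<^bsub>tensor_gens B M\<^esub> V),
      module.smult = (\<lambda>b U. tensor_rels A B \<phi> M <#>\<^bsub>tensor_gens B M\<^esub>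
                  (frag_extend (\<lambda>(b', m). frag_of (b \<otimes>\<^bsub>B\<^esub> b', m)) ` U))\<rparr>"

text \<open>\<open>\<nabla>(b \<otimes> m) = \<delta>(b) \<otimes> m + b \<otimes> \<nabla>(m)\<close>, where the derivation \<open>\<delta>\<close> of B extends that of A.\<close>

definition pullback_connection ::
  "('a, 'w) ring_scheme \<Rightarrow> ('b, 'x) ring_scheme \<Rightarrow> ('a \<Rightarrow> 'b) \<Rightarrow> ('a, 'm, 'y) module_scheme
   \<Rightarrow> ('b \<Rightarrow> 'b) \<Rightarrow> ('m \<Rightarrow> 'm) \<Rightarrow> ('b \<times> 'm \<Rightarrow>\<^sub>0 int) set \<Rightarrow> ('b \<times> 'm \<Rightarrow>\<^sub>0 int) set"
where
  "pullback_connection A B \<phi> M \<delta> nabla U =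
     tensor_rels A B \<phi> M <#>\<^bsub>tensor_gens B M\<^esub>
       (frag_extend (\<lambda>(b, m). frag_of (\<delta> b, m) + frag_of (b, nabla m)) ` U)"


section \<open>Finite etale covers\<close>

definition restrict_scalars ::
  "('b, 'x) ring_scheme \<Rightarrow> ('a \<Rightarrow> 'b) \<Rightarrow> ('a, 'b) module"
where
  "restrict_scalars B \<phi> =
     \<lparr>carrier = carrier B, monoid.mult = monoid.mult B, monoid.one = monoid.one B, ring.zero = ring.zero B, ring.add = ring.add B,
      module.smult = (\<lambda>a b. \<phi> a \<otimes>\<^bsub>B\<^esub> b)\<rparr>"

text \<open>
  The module of Kaehler differentials of B over A is the free abelian group on the symbols
  \<open>(s, t) = s dt\<close> modulo the following relations; the morphism is unramified iff it vanishes.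
\<close>

definition kaehler_rels ::
  "('a, 'w) ring_scheme \<Rightarrow> ('b, 'x) ring_scheme \<Rightarrow> ('a \<Rightarrow> 'b) \<Rightarrow> ('b \<times> 'b \<Rightarrow>\<^sub>0 int) set"
where
  "kaehler_rels A B \<phi> = generate (free_Abelian_group (carrier B \<times> carrier B))
     ({frag_of (s \<oplus>\<^bsub>B\<^esub> s', t) - frag_of (s, t) - frag_of (s', t) | s s' t.
         s \<in> carrier B \<and> s' \<in> carrier B \<and> t \<in> carrier B} \<union>
      {frag_of (s, t \<oplus>\<^bsub>B\<^esub> t') - frag_of (s, t) - frag_of (s, t') | s t t'.
         s \<in> carrier B \<and> t \<in> carrier B \<and> t' \<in> carrier B} \<union>
      {frag_of (s, t \<otimes>\<^bsub>B\<^esub> t') - frag_of (s \<otimes>\<^bsub>B\<^esub> t, t') - frag_of (s \<otimes>\<^bsub>B\<^esub> t', t) | s t t'.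
         s \<in> carrier B \<and> t \<in> carrier B \<and> t' \<in> carrier B} \<union>
      {frag_of (s, \<phi> a) | s a. s \<in> carrier B \<and> a \<in> carrier A})"

definition unramified ::
  "('a, 'w) ring_scheme \<Rightarrow> ('b, 'x) ring_scheme \<Rightarrow> ('a \<Rightarrow> 'b) \<Rightarrow> bool"
where
  "unramified A B \<phi> \<longleftrightarrow>
     kaehler_rels A B \<phi> = carrier (free_Abelian_group (carrier B \<times> carrier B))"

text \<open>
  Finite locally free, unramified, and surjective on spectra.  The rank n is constant because
  this is only used for a connected base.
\<close>

definition finite_etale_cover ::
  "('a, 'w) ring_scheme \<Rightarrow> ('b, 'x) ring_scheme \<Rightarrow> ('a \<Rightarrow> 'b) \<Rightarrow> bool"
where
  "finite_etale_cover A B \<phi> \<longleftrightarrow>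
     cring B \<and> \<phi> \<in> ring_hom A B \<and>
     (\<exists>n. vector_bundle A (restrict_scalars B \<phi>) n) \<and>
     unramified A B \<phi> \<and>
     (\<forall>P. primeideal P A \<longrightarrow> (\<exists>Q. primeideal Q B \<and> {a \<in> carrier A. \<phi> a \<in> Q} = P))"


section \<open>The curve and its completion at the origin\<close>

definition fps_subring :: "rat fps set \<Rightarrow> rat fps ring" where
  "fps_subring C = \<lparr>carrier = C, monoid.mult = (*), monoid.one = 1, ring.zero = 0, ring.add = (+)\<rparr>"

text \<open>
  For a subring C of the rationals, \<open>C[x, 1/(x^4 - 1)]\<close> is identified with its image in
  \<open>\<rat>[[x]]\<close> under Taylor expansion at the origin, which is injective; \<open>x^4 - 1\<close> is a unit there.
  Under this identification the derivation \<open>d/dx\<close> is \<open>fps_deriv\<close>, and the map to the completed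
  local ring at the origin is the inclusion.
\<close>

definition curve_ring :: "rat set \<Rightarrow> rat fps ring" where
  "curve_ring C = fps_subring
     {fps_of_poly a * inverse (fps_of_poly ([:-1, 0, 0, 0, 1:] ^ k)) | a (k::nat).
        \<forall>i. poly.coeff a i \<in> C}"

text \<open>The coordinate ring of the affine line over the rationals without the points \<open>\<plusminus>1, \<plusminus>i\<close>.\<close>

definition O_X :: "rat fps ring" where
  "O_X = curve_ring UNIV"

definition inverted :: "nat \<Rightarrow> rat set" where
  "inverted N = {of_int a / of_nat N ^ k | (a::int) (k::nat). True}"

definition O_formal :: "rat fps ring" where
  "O_formal = fps_subring UNIV"


section \<open>Vanishing of the p-curvatures\<close>

text \<open>
  A model over \<open>\<int>[1/N]\<close> is a vector bundle with connection over \<open>\<int>[1/N][x, 1/(x^4 - 1)]\<close> with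
  generic fibre M, realised as a sublattice L of M.
\<close>

definition model ::
  "(rat fps, 'm) module \<Rightarrow> ('m \<Rightarrow> 'm) \<Rightarrow> nat \<Rightarrow> nat \<Rightarrow> 'm set \<Rightarrow> bool"
where
  "model M nabla r N L \<longleftrightarrow>
     L \<subseteq> carrier M \<and>
     vector_bundle (curve_ring (inverted N)) (M\<lparr>carrier := L\<rparr>) r \<and>
     is_connection (curve_ring (inverted N)) fps_deriv (M\<lparr>carrier := L\<rparr>) nabla \<and>
     (\<forall>m\<in>carrier M. \<exists>n::nat. n > 0 \<and> of_nat n \<odot>\<^bsub>M\<^esub> m \<in> L)"

text \<open>
  \<open>\<nabla>(D^p)(m) - \<nabla>(D)^p(m)\<close> for \<open>D = g d/dx\<close>.  In characteristic p the operator \<open>D^p\<close> is again a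
  derivation, namely \<open>D^p(x) d/dx\<close>.
\<close>

definition p_curvature ::
  "(rat fps, 'm) module \<Rightarrow> ('m \<Rightarrow> 'm) \<Rightarrow> nat \<Rightarrow> rat fps \<Rightarrow> 'm \<Rightarrow> 'm"
where
  "p_curvature M nabla p g m =
     (((\<lambda>f. g * fps_deriv f) ^^ p) fps_X \<odot>\<^bsub>M\<^esub> nabla m) \<ominus>\<^bsub>M\<^esub> ((\<lambda>n. g \<odot>\<^bsub>M\<^esub> nabla n) ^^ p) m"

text \<open>
  The p-curvature of the reduction \<open>L/pL\<close>, computed on lifts to L.  Every derivation of
  \<open>F\<^sub>p[x, 1/(x^4 - 1)]\<close> is of the form \<open>g d/dx\<close> with g lifting to the model.
\<close>

definition p_curvature_vanishes ::
  "(rat fps, 'm) module \<Rightarrow> ('m \<Rightarrow> 'm) \<Rightarrow> nat \<Rightarrow> 'm set \<Rightarrow> nat \<Rightarrow> bool"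
where
  "p_curvature_vanishes M nabla N L p \<longleftrightarrow>
     (\<forall>g\<in>carrier (curve_ring (inverted N)). \<forall>m\<in>L.
        p_curvature M nabla p g m \<in> (\<lambda>n. of_nat p \<odot>\<^bsub>M\<^esub> n) ` L)"

definition padic_abs :: "nat \<Rightarrow> rat \<Rightarrow> real" where
  "padic_abs p q =
     (if q = 0 then 0
      else real p powi (int (multiplicity (int p) (snd (quotient_of q))) -
                        int (multiplicity (int p) (fst (quotient_of q)))))"

text \<open>The power series defining rigid analytic functions on the open p-adic disc of radius \<open>\<rho>\<close>.\<close>

definition convergent_fps :: "nat \<Rightarrow> real \<Rightarrow> rat fps set" where
  "convergent_fps p \<rho> =
     {f. \<forall>s. 0 < s \<and> s < \<rho> \<longrightarrow> (\<lambda>n. padic_abs p (fps_nth f n) * s ^ n) \<longlonglongrightarrow> 0}"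

definition formal_horizontal_sections ::
  "(rat fps, 'm) module \<Rightarrow> ('m \<Rightarrow> 'm) \<Rightarrow> (rat fps \<times> 'm \<Rightarrow>\<^sub>0 int) set set"
where
  "formal_horizontal_sections M nabla =
     {U \<in> carrier (pullback O_X O_formal (\<lambda>f. f) M).
        pullback_connection O_X O_formal (\<lambda>f. f) M fps_deriv nabla U
          = \<zero>\<^bsub>pullback O_X O_formal (\<lambda>f. f) M\<^esub>}"

text \<open>
  A section converges on the disc if it can be written as \<open>\<Sum> f\<^sub>i \<otimes> m\<^sub>i\<close> with all \<open>f\<^sub>i\<close>
  convergent there, i.e. if it is the expansion of a section over the disc.  For
  \<open>\<rho> \<le> 1\<close> the disc does not meet the removed points.
\<close>

definition horizontal_sections_converge ::
  "(rat fps, 'm) module \<Rightarrow> ('m \<Rightarrow> 'm) \<Rightarrow> nat \<Rightarrow> real \<Rightarrow> bool"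
where
  "horizontal_sections_converge M nabla p \<rho> \<longleftrightarrow>
     (\<forall>U\<in>formal_horizontal_sections M nabla.
        \<exists>c\<in>U. Poly_Mapping.keys c \<subseteq> convergent_fps p \<rho> \<times> carrier M)"

definition p_curvatures_vanish ::
  "(rat fps, 'm) module \<Rightarrow> ('m \<Rightarrow> 'm) \<Rightarrow> nat \<Rightarrow> bool"
where
  "p_curvatures_vanish M nabla r \<longleftrightarrow>
     (\<exists>N L. N > 0 \<and> model M nabla r N L \<and>
        finite {p. Factorial_Ring.prime p \<and> \<not> p dvd N \<and> \<not> p_curvature_vanishes M nabla N L p}) \<and>
     (\<forall>p. Factorial_Ring.prime p \<longrightarrow>
        horizontal_sections_converge M nabla p (real p powr (- 1 / (real p * (real p - 1)))))"


section \<open>Etale local triviality\<close>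

text \<open>
  A finite etale cover of the curve is a countable ring, so \<open>nat\<close> carries a copy of each of
  them.  The connection of the trivial bundle on the cover is given by the derivation \<open>\<delta>\<close>
  lifting \<open>d/dx\<close>, which is unique.
\<close>

definition etale_locally_trivial ::
  "(rat fps, 'm) module \<Rightarrow> ('m \<Rightarrow> 'm) \<Rightarrow> nat \<Rightarrow> bool"
where
  "etale_locally_trivial M nabla r \<longleftrightarrow>
     (\<exists>(B :: nat ring) \<phi> \<delta> f.
        finite_etale_cover O_X B \<phi> \<and>
        derivation B \<delta> \<and> (\<forall>a\<in>carrier O_X. \<delta> (\<phi> a) = \<phi> (fps_deriv a)) \<and>
        connection_iso B
          (pullback O_X B \<phi> M) (pullback_connection O_X B \<phi> M \<delta> nabla)
          (trivial_bundle B r) (trivial_connection \<delta> r) f)"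

end

theory Submission
  imports Defs "HOL-Complex_Analysis.Complex_Analysis"
begin

text \<open>
  In a global basis of M the connection is \<open>d/dx + G\<close>, and the formal horizontal sections at the origin form
  a matrix Y with \<open>Y' = - G Y\<close> and \<open>Y(0) = 1\<close>. The theorem says that the entries of Y are algebraic and that
  the ring they generate over the coordinate ring is a finite etale cover. A global basis exists
  (\<open>vector_bundle_coordinates\<close>) because the coordinate ring is a localisation of a polynomial ring in one
  variable.

  Algebraicity follows from a comparison of two numbers in the manner of Chudnovsky and Andre
  (\<open>algebraicity_criterion\<close>). The first is the growth rate of the denominators of the Taylor coefficients of Y.
  Where the p-curvature vanishes, \<open>\<nabla>\<^sup>p\<close> is divisible by p on an integral lattice, which cancels most of the
  denominator \<open>n!\<close> of \<open>\<nabla>\<^sup>n / n!\<close> and leaves \<open>(n div p)!\<close> up to a p-adic unit; such a prime contributes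
  \<open>ln p / (p (p - 1))\<close> (\<open>almost_all_primes_bound\<close>). At each of the finitely many remaining primes the assumed
  radius of convergence gives the same contribution, or none at all for 3 and 5. The sum over all primes
  other than 3 and 5 is less than 0.56 (\<open>prime_weight_sum\<close>). The second number is the logarithm of the
  conformal radius of a disc that maps holomorphically to the complex plane without the fourth roots of unity:
  the square root of \<open>tanh (\<pi> z\<^sup>2 / (1 - z\<^sup>4))\<close> has derivative of absolute value \<open>\<surd>\<pi>\<close> at the origin
  (\<open>disc_avoids_fourth_roots\<close>), and \<open>ln \<surd>\<pi> > 0.57\<close>. The pullback of Y to this disc solves a linear system
  with holomorphic coefficients, so it is holomorphic on the whole disc. As the second number is the larger one, an
  auxiliary polynomial in x and an entry of Y that vanishes to high order at the origin vanishes
  identically.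

  The cover is the algebra A generated by the entries of Y. All that is needed about it holds at first only
  after multiplication by some nonzero function on the curve: A is spanned by finitely many monomials, it
  contains the entries of the inverse of Y, and its differentials over the curve vanish. In each
  case the functions that are admissible as multipliers form an ideal stable under \<open>d/dx\<close>, because A and
  its relations are stable under \<open>d/dx\<close>. In characteristic 0 a nonzero ideal of this kind contains 1
  (\<open>derivation_stable_ideal_unit\<close>), so the multiplier can be taken to be 1. Hence A is finite
  (\<open>differential_algebra_finite\<close>), free, and unramified (\<open>unramified_cover\<close>), and the matrix Y trivialises
  the connection over it (\<open>cover_trivialises\<close>).
\<close>

section \<open>Weighted norms of power series\<close>

definition cfps :: "rat fps \<Rightarrow> complex fps" where
  "cfps f = Abs_fps (\<lambda>n. of_rat (fps_nth f n))"

lemma cfps_nth [simp]: "fps_nth (cfps f) n = of_rat (fps_nth f n)"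
  by (simp add: cfps_def)

lemma cfps_add: "cfps (f + g) = cfps f + cfps g"
  by (rule fps_ext) (simp add: of_rat_add)

lemma cfps_minus: "cfps (- f) = - cfps f"
  by (rule fps_ext) (simp add: of_rat_minus)

lemma cfps_mult: "cfps (f * g) = cfps f * cfps g"
  by (rule fps_ext) (simp add: fps_mult_nth of_rat_sum of_rat_mult)

lemma cfps_0 [simp]: "cfps 0 = 0"
  by (rule fps_ext) simp

lemma cfps_1 [simp]: "cfps 1 = 1"
  by (rule fps_ext) simp

lemma cfps_X [simp]: "cfps fps_X = fps_X"
  by (rule fps_ext) (simp add: fps_X_def)

lemma cfps_const: "cfps (fps_const c) = fps_const (of_rat c)"
  by (rule fps_ext) simp

lemma cfps_power: "cfps (f ^ n) = cfps f ^ n"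
  by (induction n) (simp_all add: cfps_mult)

lemma cfps_sum: "cfps (sum f A) = (\<Sum>a\<in>A. cfps (f a))"
  by (induction A rule: infinite_finite_induct) (simp_all add: cfps_add)

lemma cfps_deriv: "cfps (fps_deriv f) = fps_deriv (cfps f)"
  by (rule fps_ext) (simp add: of_rat_mult of_rat_add)

text \<open>
  The weighted norm \<open>\<Sum> \<bar>f\<^sub>k\<bar> \<rho>\<^sup>k\<close>. Being submultiplicative on formal series, it plays the part of
  the supremum over the circle of radius \<open>\<rho>\<close>, and \<open>bnd_nth\<close> the part of the Cauchy estimate, with no
  function attached to the series.
\<close>

definition bnd :: "real \<Rightarrow> complex fps \<Rightarrow> real \<Rightarrow> bool" where
  "bnd \<rho> f B \<longleftrightarrow> (\<forall>n. (\<Sum>k\<le>n. norm (fps_nth f k) * \<rho> ^ k) \<le> B)"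

lemma bnd_nth:
  assumes "bnd \<rho> f B" "\<rho> > 0"
  shows "norm (fps_nth f n) * \<rho> ^ n \<le> B"
proof -
  have "norm (fps_nth f n) * \<rho> ^ n \<le> (\<Sum>k\<le>n. norm (fps_nth f k) * \<rho> ^ k)"
    by (rule member_le_sum) (use assms in auto)
  also have "\<dots> \<le> B" using assms(1) by (auto simp: bnd_def)
  finally show ?thesis .
qed

lemma bnd_nonneg:
  assumes "bnd \<rho> f B" "\<rho> > 0"
  shows "B \<ge> 0"
proof -
  have "0 \<le> norm (fps_nth f 0) * \<rho> ^ 0" using assms by simp
  also have "\<dots> \<le> B" by (rule bnd_nth[OF assms])
  finally show ?thesis .
qed

lemma bnd_mono: "bnd \<rho> f B \<Longrightarrow> B \<le> B' \<Longrightarrow> bnd \<rho> f B'"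
  unfolding bnd_def by (meson order_trans)

lemma bnd_add:
  assumes "bnd \<rho> f B" "bnd \<rho> g C" "\<rho> > 0"
  shows "bnd \<rho> (f + g) (B + C)"
  unfolding bnd_def
proof
  fix n
  have "(\<Sum>k\<le>n. norm (fps_nth (f + g) k) * \<rho> ^ k)
      \<le> (\<Sum>k\<le>n. norm (fps_nth f k) * \<rho> ^ k + norm (fps_nth g k) * \<rho> ^ k)"
    using assms(3)
    by (intro sum_mono) (auto intro!: mult_right_mono norm_triangle_ineq simp flip: distrib_right)
  also have "\<dots> \<le> B + C"
    using assms(1,2) unfolding bnd_def sum.distrib by (intro add_mono) auto
  finally show "(\<Sum>k\<le>n. norm (fps_nth (f + g) k) * \<rho> ^ k) \<le> B + C" .
qed

lemma bnd_mult:
  assumes "bnd \<rho> f B" "bnd \<rho> g C" "\<rho> > 0"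
  shows "bnd \<rho> (f * g) (B * C)"
  unfolding bnd_def
proof
  fix n
  let ?a = "\<lambda>i. norm (fps_nth f i) * \<rho> ^ i" and ?b = "\<lambda>i. norm (fps_nth g i) * \<rho> ^ i"
  have "(\<Sum>k\<le>n. norm (fps_nth (f * g) k) * \<rho> ^ k)
      \<le> (\<Sum>k\<le>n. \<Sum>i\<le>k. ?a i * ?b (k - i))"
  proof (rule sum_mono)
    fix k
    have "norm (fps_nth (f * g) k) \<le> (\<Sum>i\<le>k. norm (fps_nth f i) * norm (fps_nth g (k - i)))"
      unfolding fps_mult_nth atLeast0AtMost
      by (rule order_trans[OF norm_sum]) (simp add: norm_mult)
    then have "norm (fps_nth (f * g) k) * \<rho> ^ k
        \<le> (\<Sum>i\<le>k. norm (fps_nth f i) * norm (fps_nth g (k - i))) * \<rho> ^ k"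
      using assms(3) by (intro mult_right_mono) auto
    also have "\<dots> = (\<Sum>i\<le>k. ?a i * ?b (k - i))"
      unfolding sum_distrib_right
    proof (rule sum.cong)
      fix i assume "i \<in> {..k}"
      then have "\<rho> ^ k = \<rho> ^ i * \<rho> ^ (k - i)" by (simp flip: power_add)
      then show "norm (fps_nth f i) * norm (fps_nth g (k - i)) * \<rho> ^ k = ?a i * ?b (k - i)"
        by simp
    qed simp
    finally show "norm (fps_nth (f * g) k) * \<rho> ^ k \<le> (\<Sum>i\<le>k. ?a i * ?b (k - i))" .
  qed
  also have "\<dots> = (\<Sum>(k, i)\<in>(SIGMA k:{..n}. {..k}). ?a i * ?b (k - i))"
    by (simp add: sum.Sigma)
  also have "\<dots> = (\<Sum>(i, j)\<in>{(i, j). i + j \<le> n}. ?a i * ?b j)"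
    by (rule sum.reindex_bij_witness[of _ "\<lambda>(i, j). (i + j, i)" "\<lambda>(k, i). (i, k - i)"]) auto
  also have "\<dots> \<le> (\<Sum>(i, j)\<in>{..n} \<times> {..n}. ?a i * ?b j)"
    using assms(3) by (intro sum_mono2) auto
  also have "\<dots> = (\<Sum>i\<le>n. ?a i) * (\<Sum>j\<le>n. ?b j)"
    by (simp add: sum_product sum.cartesian_product)
  also have "\<dots> \<le> B * C"
    using assms bnd_nonneg[OF assms(1,3)] unfolding bnd_def
    by (intro mult_mono) (auto intro!: sum_nonneg)
  finally show "(\<Sum>k\<le>n. norm (fps_nth (f * g) k) * \<rho> ^ k) \<le> B * C" .
qed

lemma bnd_const: "bnd \<rho> (fps_const c) (norm c)"
proof -
  have "(\<Sum>k\<le>n. norm (fps_nth (fps_const c) k) * \<rho> ^ k) = norm c" for n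
  proof -
    have "(\<Sum>k\<le>n. norm (fps_nth (fps_const c) k) * \<rho> ^ k) = (\<Sum>k\<in>{0}. norm (fps_nth (fps_const c) k) * \<rho> ^ k)"
      by (rule sum.mono_neutral_right) auto
    then show ?thesis by simp
  qed
  then show ?thesis by (simp add: bnd_def)
qed

lemma bnd_power:
  assumes "bnd \<rho> f B" "\<rho> > 0"
  shows "bnd \<rho> (f ^ n) (B ^ n)"
proof (induction n)
  case 0
  show ?case using bnd_const[of \<rho> 1] by simp
next
  case (Suc n)
  show ?case using bnd_mult[OF assms(1) Suc assms(2)] by simp
qed

lemma bnd_sum:
  assumes "\<And>a. a \<in> A \<Longrightarrow> bnd \<rho> (f a) (B a)" "\<rho> > 0"
  shows "bnd \<rho> (sum f A) (sum B A)"
  using assms(1)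
proof (induction A rule: infinite_finite_induct)
  case (insert x A)
  then show ?case by (simp add: bnd_add[OF _ _ assms(2)])
qed (use bnd_const[of \<rho> 0] in simp_all)

text \<open>
  Holomorphy on the open unit disc.
\<close>

definition on_disc :: "complex fps \<Rightarrow> bool" where
  "on_disc f \<longleftrightarrow> (\<forall>\<rho>. 0 < \<rho> \<and> \<rho> < 1 \<longrightarrow> (\<exists>B. bnd \<rho> f B))"

lemma on_disc_add: "on_disc f \<Longrightarrow> on_disc g \<Longrightarrow> on_disc (f + g)"
  unfolding on_disc_def using bnd_add by meson

lemma on_disc_mult: "on_disc f \<Longrightarrow> on_disc g \<Longrightarrow> on_disc (f * g)"
  unfolding on_disc_def using bnd_mult by meson

lemma on_disc_const: "on_disc (fps_const c)"
  unfolding on_disc_def using bnd_const by meson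

lemma on_disc_power: "on_disc f \<Longrightarrow> on_disc (f ^ n)"
  unfolding on_disc_def using bnd_power by meson

text \<open>
  Comparison with a geometric series, at a slightly larger radius.
\<close>

lemma on_disc_iff_geometric:
  assumes "\<And>\<rho>. 0 < \<rho> \<Longrightarrow> \<rho> < 1 \<Longrightarrow> \<exists>B. \<forall>n. norm (fps_nth f n) * \<rho> ^ n \<le> B"
  shows "on_disc f"
  unfolding on_disc_def
proof (intro allI impI, elim conjE)
  fix \<rho> :: real assume \<rho>: "0 < \<rho>" "\<rho> < 1"
  then obtain \<sigma> where \<sigma>: "\<rho> < \<sigma>" "\<sigma> < 1" using dense by blast
  with \<rho> obtain B where B: "\<And>n. norm (fps_nth f n) * \<sigma> ^ n \<le> B"
    using assms[of \<sigma>] by auto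
  define q where "q = \<rho> / \<sigma>"
  have q: "0 < q" "q < 1" using \<rho> \<sigma> by (auto simp: q_def)
  have B0: "B \<ge> 0" using B[of 0] by (smt (verit) norm_ge_zero power_0 mult_cancel_left2 mult.right_neutral)
  have "(\<Sum>k\<le>n. norm (fps_nth f k) * \<rho> ^ k) \<le> B * (1 / (1 - q))" for n
  proof -
    have "(\<Sum>k\<le>n. norm (fps_nth f k) * \<rho> ^ k) \<le> (\<Sum>k\<le>n. B * q ^ k)"
    proof (rule sum_mono)
      fix k
      have "norm (fps_nth f k) * \<rho> ^ k = norm (fps_nth f k) * \<sigma> ^ k * q ^ k"
        using \<rho> \<sigma> by (simp add: q_def power_divide)
      also have "\<dots> \<le> B * q ^ k" using B[of k] q by (intro mult_right_mono) auto
      finally show "norm (fps_nth f k) * \<rho> ^ k \<le> B * q ^ k" .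
    qed
    also have "\<dots> = B * (\<Sum>k\<le>n. q ^ k)" by (simp add: sum_distrib_left)
    also have "\<dots> \<le> B * (1 / (1 - q))"
    proof (intro mult_left_mono B0)
      have "(\<Sum>k\<le>n. q ^ k) \<le> suminf (\<lambda>k. q ^ k)"
        using q by (intro sum_le_suminf) (auto intro!: summable_geometric)
      then show "(\<Sum>k\<le>n. q ^ k) \<le> 1 / (1 - q)" using q by (simp add: suminf_geometric)
    qed
    finally show ?thesis .
  qed
  then show "\<exists>B. bnd \<rho> f B" unfolding bnd_def by blast
qed

section \<open>An algebraicity criterion\<close>

text \<open>
  Siegel's lemma, by the pigeonhole principle: there are more vectors with entries in \<open>{0..H}\<close> than
  possible values of the T linear forms on them, and two vectors with the same values differ by a solution.
\<close>

lemma siegel: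
  fixes a :: "nat \<Rightarrow> 'k \<Rightarrow> int" and Q H T :: nat
  assumes I: "finite I"
    and Q: "\<And>n k. n < T \<Longrightarrow> k \<in> I \<Longrightarrow> \<bar>a n k\<bar> \<le> int Q"
    and H: "(2 * (card I * H * Q) + 1) ^ T < (H + 1) ^ card I"
  shows "\<exists>x. (\<forall>k\<in>I. \<bar>x k\<bar> \<le> int H) \<and> (\<exists>k\<in>I. x k \<noteq> 0) \<and> (\<forall>n<T. (\<Sum>k\<in>I. a n k * x k) = 0)"
proof -
  define U where "U = int (card I * H * Q)"
  define XX where "XX = PiE I (\<lambda>_. {0..int H})"
  define Y where "Y = PiE {..<T} (\<lambda>_. {- U..U})"
  define F where "F = (\<lambda>x. \<lambda>n\<in>{..<T}. \<Sum>k\<in>I. a n k * x k)"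
  have cX: "card XX = (H + 1) ^ card I"
    unfolding XX_def by (subst card_PiE[OF I]) (simp add: nat_add_distrib)
  have cY: "card Y = (2 * (card I * H * Q) + 1) ^ T"
  proof -
    have "card {- U..U} = 2 * (card I * H * Q) + 1" unfolding U_def card_atLeastAtMost_int by linarith
    then show ?thesis unfolding Y_def by (subst card_PiE) auto
  qed
  have "F ` XX \<subseteq> Y"
  proof
    fix y assume "y \<in> F ` XX"
    then obtain x where x: "x \<in> XX" "y = F x" by auto
    have "(\<Sum>k\<in>I. a n k * x k) \<in> {- U..U}" if n: "n < T" for n
    proof -
      have "\<bar>\<Sum>k\<in>I. a n k * x k\<bar> \<le> (\<Sum>k\<in>I. \<bar>a n k * x k\<bar>)" by (rule sum_abs)
      also have "\<dots> \<le> (\<Sum>k\<in>I. int Q * int H)"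
      proof (rule sum_mono)
        fix k assume k: "k \<in> I"
        then have "\<bar>x k\<bar> \<le> int H" using x(1) by (auto simp: XX_def PiE_def Pi_def)
        then show "\<bar>a n k * x k\<bar> \<le> int Q * int H"
          using Q[OF n k] by (simp add: abs_mult mult_mono)
      qed
      also have "\<dots> = U" by (simp add: U_def)
      finally show ?thesis by auto
    qed
    then show "y \<in> Y" using x by (auto simp: F_def Y_def)
  qed
  moreover have "finite Y" unfolding Y_def by (auto intro!: finite_PiE)
  ultimately have "card (F ` XX) < card XX"
    using card_mono[of Y "F ` XX"] H cX cY by linarith
  then have "\<not> inj_on F XX" using card_image by fastforce
  then obtain u v where uv: "u \<in> XX" "v \<in> XX" "F u = F v" "u \<noteq> v" by (auto simp: inj_on_def)
  have ne: "\<exists>k\<in>I. u k \<noteq> v k"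
  proof (rule ccontr)
    assume "\<not> (\<exists>k\<in>I. u k \<noteq> v k)"
    then have "u = v" using uv(1,2) unfolding XX_def by (intro PiE_ext) auto
    then show False using uv by simp
  qed
  have z: "(\<Sum>k\<in>I. a n k * (u k - v k)) = 0" if "n < T" for n
    using fun_cong[OF uv(3), of n] that by (simp add: F_def right_diff_distrib sum_subtractf)
  have b: "\<bar>u k - v k\<bar> \<le> int H" if "k \<in> I" for k
  proof -
    have "u k \<in> {0..int H}" "v k \<in> {0..int H}" using uv(1,2) that by (auto simp: XX_def PiE_def Pi_def)
    then show ?thesis by auto
  qed
  show ?thesis
    by (rule exI[of _ "\<lambda>k. u k - v k"]) (use ne z b in auto)
qed

text \<open>
  Algebraicity over \<open>\<rat>(x)\<close>, the equation being cleared of denominators.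
\<close>

definition alg_fps :: "rat fps \<Rightarrow> bool" where
  "alg_fps y \<longleftrightarrow> (\<exists>J P. (\<exists>j<J. P j \<noteq> 0) \<and> (\<Sum>j<J. fps_of_poly (P j) * y ^ j) = (0 :: rat fps))"

lemma fps_compose_nth_leading:
  fixes f \<Phi> :: "complex fps"
  assumes "\<And>i. i < N \<Longrightarrow> fps_nth f i = 0" "fps_nth \<Phi> 0 = 0"
  shows "fps_nth (fps_compose f \<Phi>) N = fps_nth f N * fps_nth \<Phi> 1 ^ N"
proof -
  have "fps_nth (fps_compose f \<Phi>) N = (\<Sum>i\<in>{0..N}. fps_nth f i * fps_nth (\<Phi> ^ i) N)"
    by (simp add: fps_compose_nth)
  also have "\<dots> = (\<Sum>i\<in>{N}. fps_nth f i * fps_nth (\<Phi> ^ i) N)"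
    by (rule sum.mono_neutral_right) (use assms in auto)
  also have "\<dots> = fps_nth f N * fps_nth \<Phi> 1 ^ N"
    using startsby_zero_power_nth_same[OF assms(2), of N] by simp
  finally show ?thesis .
qed


text \<open>
  The method of G. V. Chudnovsky and Andre. The coefficients of the powers \<open>y\<^sup>j\<close> up to order T have a common
  denominator of logarithmic size c T, up to a term linear in j, while y becomes holomorphic on the
  unit disc after substitution of a function \<open>\<Phi>\<close> with \<open>ln \<bar>\<Phi>'(0)\<bar> > c\<close>.
  
  Siegel's lemma provides polynomials \<open>P\<^sub>j\<close> of small height for which \<open>F = \<Sum> P\<^sub>j y\<^sup>j\<close> vanishes at the origin to
  order at least T. If F were nonzero, of exact order \<open>N \<ge> T\<close>, its leading coefficient would be at least
  \<open>exp (- c N)\<close> because it is rational with a small denominator, and at most about \<open>\<bar>\<Phi>'(0)\<bar>\<^sup>-\<^sup>N\<close> because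
  \<open>F \<circ> \<Phi>\<close> is bounded on discs of radius close to 1. These bounds contradict each other for large T. Hence
  \<open>F = 0\<close> is an algebraic equation for y.
\<close>

theorem algebraicity_criterion:
  fixes y :: "rat fps" and \<Phi> :: "complex fps" and \<Lambda> :: "nat \<Rightarrow> nat \<Rightarrow> nat"
  assumes \<Phi>0: "fps_nth \<Phi> 0 = 0" and \<Phi>: "on_disc \<Phi>"
    and w: "on_disc (fps_compose (cfps y) \<Phi>)" and y: "on_disc (cfps y)"
    and den: "\<And>J T j m. j \<le> J \<Longrightarrow> m \<le> T \<Longrightarrow> of_nat (\<Lambda> J T) * fps_nth (y ^ j) m \<in> \<int>"
    and \<Lambda>0: "\<And>J T. \<Lambda> J T > 0"
    and \<Lambda>: "\<And>J T. real (\<Lambda> J T) \<le> exp (k * real J + c * real T)"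
    and k: "k \<ge> 0" and c: "c \<ge> 0" and R: "c < ln (norm (fps_nth \<Phi> 1))" "fps_nth \<Phi> 1 \<noteq> 0"
  shows "alg_fps y"
proof -
  define R where "R = norm (fps_nth \<Phi> 1)"
  have R0: "R > 0" using R(2) by (simp add: R_def)
  obtain \<rho> where \<rho>: "0 < \<rho>" "\<rho> < 1" "c < ln R + ln \<rho>"
  proof -
    have lt: "(c - ln R) / 2 < 0" using R(1) by (simp add: R_def)
    have "c < ln R + ln (exp ((c - ln R) / 2))" using R(1) by (simp add: R_def field_simps)
    with lt show ?thesis by (intro that[of "exp ((c - ln R) / 2)"]) auto
  qed
  define \<eta> where "\<eta> = ln R + ln \<rho> - c"
  have \<eta>: "\<eta> > 0" using \<rho> by (simp add: \<eta>_def)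
  let ?w = "fps_compose (cfps y) \<Phi>"
  have ex: "\<exists>b\<ge>0. bnd \<sigma> f (exp b)" if "on_disc f" "0 < \<sigma>" "\<sigma> < 1" for f \<sigma>
  proof -
    have "\<exists>B. bnd \<sigma> f B" using that unfolding on_disc_def by simp
    then obtain B where B: "bnd \<sigma> f B" by blast
    have "B \<le> exp \<bar>B\<bar>" by (smt (verit) exp_ge_add_one_self)
    then show ?thesis using bnd_mono[OF B] by (intro exI[of _ "\<bar>B\<bar>"]) auto
  qed
  obtain b where b: "b \<ge> 0" "bnd \<rho> \<Phi> (exp b)" using ex[OF \<Phi> \<rho>(1,2)] by blast
  obtain b' where b': "b' \<ge> 0" "bnd \<rho> ?w (exp b')" using ex[OF w \<rho>(1,2)] by blast
  obtain a where a: "a \<ge> 1" "\<And>j m. norm (fps_nth (cfps y ^ j) m) \<le> exp (a * (real j + real m))"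
  proof -
    obtain b'' where b'': "b'' \<ge> 0" "bnd (1/2) (cfps y) (exp b'')" using ex[OF y, of "1/2"] by auto
    have "norm (fps_nth (cfps y ^ j) m) \<le> exp ((b'' + 1) * (real j + real m))" for j m
    proof -
      have "norm (fps_nth (cfps y ^ j) m) * (1/2) ^ m \<le> exp b'' ^ j"
        by (rule bnd_nth[OF bnd_power[OF b''(2)]]) auto
      then have "norm (fps_nth (cfps y ^ j) m) \<le> exp b'' ^ j * 2 ^ m"
        by (simp add: field_simps)
      also have "\<dots> \<le> exp b'' ^ j * exp 1 ^ m"
        using exp_ge_add_one_self[of 1] by (intro mult_left_mono power_mono) auto
      also have "\<dots> = exp (real j * b'' + real m)"
        by (simp add: exp_add exp_of_nat_mult exp_of_nat_mult[of _ 1, simplified])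
      also have "\<dots> \<le> exp ((b'' + 1) * (real j + real m))"
        using b'' by (simp add: algebra_simps)
      finally show ?thesis .
    qed
    then show ?thesis using b'' by (intro that[of "b'' + 1"]) auto
  qed
  \<comment> \<open>M is the number of unknowns per equation. The solution found by Siegel's lemma then has height about
     \<open>V\<^sup>1\<^sup>/\<^sup>(\<^sup>M\<^sup>-\<^sup>1\<^sup>)\<close>, and M is chosen so that this costs at most half of the gain \<open>\<eta>\<close> per order of vanishing.\<close>
  obtain M :: nat where M: "M \<ge> 2" "(c + a) / (real M - 1) \<le> \<eta> / 2"
  proof -
    obtain m :: nat where m: "(c + a) * 2 / \<eta> < real m" using reals_Archimedean2 by blast
    have "real m > 0" using m a c \<eta> by (smt (verit) divide_pos_pos)
    have "(c + a) / real m \<le> \<eta> / 2" using m \<eta> \<open>real m > 0\<close> by (simp add: field_simps)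
    then show ?thesis using \<open>real m > 0\<close> by (intro that[of "m + 1"]) auto
  qed
  \<comment> \<open>C collects all terms that are linear in J; for large s they lose against \<open>\<eta> T / 2\<close>, which is
     quadratic in s.\<close>
  define C where "C = (k + b + b' + 2 + 2 + k + a) * real M + 3"
  have C: "C > 0" using k b b' a M by (auto simp: C_def intro!: add_nonneg_pos mult_nonneg_nonneg)
  obtain s :: nat where s: "2 * C / (\<eta> * real M) < real s" using reals_Archimedean2 by blast
  have s1: "s \<ge> 1"
  proof -
    have "2 * C / (\<eta> * real M) > 0" using C \<eta> M by auto
    then have "real s > 0" using s by linarith
    then show ?thesis by simp
  qed
  define J where "J = M * s"
  define T where "T = M * s * s"
  define I where "I = {..<J} \<times> {..<J}"
  have cI: "card I = M * T" by (simp add: I_def J_def T_def algebra_simps)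
  have J1: "J \<ge> 1" and T1: "T \<ge> 1" using M s1 by (auto simp: J_def T_def)
  define Qr where "Qr = exp (k * real J + c * real T) * exp (a * (real J + real T))"
  have Qr1: "Qr \<ge> 1"
    unfolding Qr_def using k c a by (simp flip: exp_add)
  define Q where "Q = nat \<lceil>Qr\<rceil>"
  have Q: "Qr \<le> real Q" "real Q \<le> 2 * Qr" using Qr1 unfolding Q_def by linarith+
  have Q1: "Q \<ge> 1" using Q Qr1 by linarith
  \<comment> \<open>the conditions \<open>F\<^sub>n = 0\<close> for \<open>n < T\<close>, cleared of denominators\<close>
  define \<alpha> where "\<alpha> = (\<lambda>n (j, i). if i \<le> n then \<lfloor>of_nat (\<Lambda> J T) * fps_nth (y ^ j) (n - i)\<rfloor> else 0)"
  have \<alpha>_eq: "(of_int (\<alpha> n (j, i)) :: rat) = (if i \<le> n then of_nat (\<Lambda> J T) * fps_nth (y ^ j) (n - i) else 0)"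
    if "n < T" "j < J" for n j i
  proof (cases "i \<le> n")
    case True
    then have "of_nat (\<Lambda> J T) * fps_nth (y ^ j) (n - i) \<in> \<int>" using that by (intro den) auto
    then show ?thesis using True by (auto simp: \<alpha>_def)
  qed (auto simp: \<alpha>_def)
  have \<alpha>_bd: "\<bar>\<alpha> n ji\<bar> \<le> int Q" if "n < T" "ji \<in> I" for n ji
  proof -
    obtain j i where ji: "ji = (j, i)" "j < J" using \<open>ji \<in> I\<close> unfolding I_def by blast
    show ?thesis
    proof (cases "i \<le> n")
      case True
      have "real_of_int \<bar>\<alpha> n ji\<bar> = norm (of_rat (of_int (\<alpha> n (j, i))) :: complex)"
        by (simp add: ji)
      also have "\<dots> = real (\<Lambda> J T) * norm (fps_nth (cfps y ^ j) (n - i))"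
        using True \<alpha>_eq[OF that(1) ji(2), of i]
        by (simp add: of_rat_mult norm_mult flip: cfps_power)
      also have "\<dots> \<le> exp (k * real J + c * real T) * exp (a * (real j + real (n - i)))"
        by (intro mult_mono \<Lambda> a) auto
      also have "\<dots> \<le> Qr" unfolding Qr_def
        using that ji a by (intro mult_left_mono) auto
      finally have "real_of_int \<bar>\<alpha> n ji\<bar> \<le> real Q" using Q by linarith
      then show ?thesis by linarith
    qed (auto simp: \<alpha>_def ji)
  qed
  \<comment> \<open>H is the least height with \<open>(H + 1)\<^sup>M\<^sup>-\<^sup>1 > V\<close>, which is what the pigeonhole principle needs\<close>
  define H where "H = nat \<lfloor>(2 * real (M * T) * real Q) powr (1 / (real M - 1))\<rfloor>"
  define V where "V = 2 * real (M * T) * real Q"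
  have V1: "V \<ge> 1"
  proof -
    have "1 \<le> 2 * (M * T) * Q" using M T1 Q1 by simp
    then show ?thesis unfolding V_def by (metis of_nat_1 of_nat_le_iff of_nat_mult of_nat_numeral)
  qed
  have Hle: "real H \<le> V powr (1 / (real M - 1))"
    unfolding H_def V_def[symmetric] by (simp add: of_nat_nat)
  have Hge: "V powr (1 / (real M - 1)) < real H + 1"
    unfolding H_def V_def[symmetric] by (simp add: of_nat_nat)
  have H1: "H \<ge> 1"
  proof -
    have "V powr (1 / (real M - 1)) \<ge> 1" using V1 M by (intro ge_one_powr_ge_zero) auto
    then show ?thesis unfolding H_def V_def[symmetric] by linarith
  qed
  have big: "(2 * (card I * H * Q) + 1) ^ T < (H + 1) ^ card I"
  proof -
    have "V = (V powr (1 / (real M - 1))) powr (real (M - 1))"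
      using V1 M by (simp add: powr_powr of_nat_diff)
    also have "\<dots> < (real H + 1) powr real (M - 1)"
      using Hge M by (intro powr_less_mono2) auto
    also have "\<dots> = real ((H + 1) ^ (M - 1))" by (subst powr_realpow) (simp_all add: add.commute)
    finally have "real (2 * (M * T) * Q) < real ((H + 1) ^ (M - 1))" by (simp add: V_def)
    then have *: "2 * (M * T) * Q < (H + 1) ^ (M - 1)" by linarith
    have "2 * (card I * H * Q) + 1 \<le> 2 * (M * T) * Q * (H + 1)"
    proof -
      have "1 \<le> 2 * (M * T) * Q" using M T1 Q1 by simp
      moreover have "2 * (M * T) * Q * (H + 1) = 2 * (card I * H * Q) + 2 * (M * T) * Q"
        unfolding cI by (simp add: algebra_simps)
      ultimately show ?thesis by linarith
    qed
    also have "\<dots> < (H + 1) ^ (M - 1) * (H + 1)" using * by (intro mult_strict_right_mono) simp_all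
    also have "\<dots> = (H + 1) ^ M" using M by (metis Suc_diff_1 Suc_le_lessD mult.commute numeral_2_eq_2 order_less_le_trans power_Suc zero_less_Suc less_le_trans)
    finally have "(2 * (card I * H * Q) + 1) ^ T < ((H + 1) ^ M) ^ T"
      using T1 by (intro power_strict_mono) auto
    then show ?thesis by (simp add: cI power_mult)
  qed
  obtain x where x: "\<forall>ji\<in>I. \<bar>x ji\<bar> \<le> int H" "\<exists>ji\<in>I. x ji \<noteq> 0"
      "\<forall>n<T. (\<Sum>ji\<in>I. \<alpha> n ji * x ji) = 0"
    using siegel[of I T \<alpha> Q H] \<alpha>_bd big by (auto simp: I_def)
  define F :: "rat fps" where "F = (\<Sum>(j, i)\<in>I. fps_const (of_int (x (j, i))) * fps_X ^ i * y ^ j)"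
  have F_nth: "fps_nth F n = (\<Sum>(j, i)\<in>I. of_int (x (j, i)) * (if i \<le> n then fps_nth (y ^ j) (n - i) else 0))" for n
    unfolding F_def fps_sum_nth
    by (rule sum.cong) (auto simp: mult.assoc fps_X_power_mult_nth split: if_splits)
  have F_T: "fps_nth F n = 0" if n: "n < T" for n
  proof -
    have "of_nat (\<Lambda> J T) * fps_nth F n = (\<Sum>ji\<in>I. of_int (\<alpha> n ji * x ji))"
      unfolding F_nth sum_distrib_left
    proof (rule sum.cong)
      fix ji assume "ji \<in> I"
      then obtain j i where ji: "ji = (j, i)" "j < J" by (auto simp: I_def)
      show "of_nat (\<Lambda> J T) * (case ji of (j, i) \<Rightarrow> of_int (x (j, i)) * (if i \<le> n then fps_nth (y ^ j) (n - i) else 0))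
          = (of_int (\<alpha> n ji * x ji) :: rat)"
        using \<alpha>_eq[OF n ji(2), of i] unfolding ji by auto
    qed simp
    also have "\<dots> = of_int (\<Sum>ji\<in>I. \<alpha> n ji * x ji)" by simp
    also have "\<dots> = 0" using x(3) n by simp
    finally show ?thesis using \<Lambda>0[of J T] by simp
  qed
  have "F = 0"
  proof (rule ccontr)
    assume "F \<noteq> 0"
    define N where "N = subdegree F"
    have FN: "fps_nth F N \<noteq> 0" using \<open>F \<noteq> 0\<close> by (simp add: N_def)
    have NT: "N \<ge> T" using F_T FN by (meson not_le)
    have Flt: "fps_nth F i = 0" if "i < N" for i using that unfolding N_def by (rule nth_less_subdegree_zero)
    \<comment> \<open>arithmetic bound: a nonzero integer has absolute value at least 1\<close>
    have lower: "norm (fps_nth (cfps F) N) \<ge> exp (- (k * real J + c * real N))"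
    proof -
      have "of_nat (\<Lambda> J N) * fps_nth F N \<in> \<int>"
        unfolding F_nth sum_distrib_left
      proof (intro Ints_sum)
        fix ji assume "ji \<in> I"
        then obtain j i where ji: "ji = (j, i)" "j < J" by (auto simp: I_def)
        have "of_int (x (j, i)) * (of_nat (\<Lambda> J N) * fps_nth (y ^ j) (N - i)) \<in> \<int>"
          using ji by (intro Ints_mult den) auto
        then show "of_nat (\<Lambda> J N) * (case ji of (j, i) \<Rightarrow> of_int (x (j, i)) * (if i \<le> N then fps_nth (y ^ j) (N - i) else 0)) \<in> \<int>"
          unfolding ji by (auto simp: mult_ac)
      qed
      then obtain z where z: "of_nat (\<Lambda> J N) * fps_nth F N = of_int z" by (auto elim: Ints_cases)
      then have "z \<noteq> 0" using FN \<Lambda>0[of J N] by auto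
      have "real (\<Lambda> J N) * norm (fps_nth (cfps F) N) = norm (of_rat (of_nat (\<Lambda> J N) * fps_nth F N) :: complex)"
        by (simp add: of_rat_mult norm_mult)
      also have "\<dots> = \<bar>real_of_int z\<bar>" unfolding z by simp
      also have "\<dots> \<ge> 1" using \<open>z \<noteq> 0\<close> by linarith
      finally have 1: "1 \<le> real (\<Lambda> J N) * norm (fps_nth (cfps F) N)" .
      also have "\<dots> \<le> exp (k * real J + c * real N) * norm (fps_nth (cfps F) N)"
        by (intro mult_right_mono \<Lambda>) auto
      finally have 1: "1 \<le> exp (k * real J + c * real N) * norm (fps_nth (cfps F) N)" .
      then have "inverse (exp (k * real J + c * real N)) \<le> norm (fps_nth (cfps F) N)"
        using 1 by (simp add: field_simps)
      then show ?thesis by (simp only: exp_minus)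
    qed
    \<comment> \<open>analytic bound: the coefficient of order N of \<open>F \<circ> \<Phi>\<close> is \<open>F\<^sub>N \<Phi>'(0)\<^sup>N\<close>\<close>
    have comp: "fps_compose (cfps F) \<Phi> = (\<Sum>(j, i)\<in>I. fps_const (of_int (x (j, i))) * \<Phi> ^ i * ?w ^ j)"
      unfolding F_def cfps_sum fps_compose_sum_distrib
      by (rule sum.cong)
         (auto simp: cfps_mult cfps_power cfps_const \<Phi>0 fps_compose_mult_distrib fps_compose_power[symmetric])
    have "bnd \<rho> (fps_compose (cfps F) \<Phi>) (\<Sum>(j, i)\<in>I. real H * exp b ^ J * exp b' ^ J)"
      unfolding comp
    proof (rule bnd_sum)
      fix ji assume ji: "ji \<in> I"
      then obtain j i where e: "ji = (j, i)" "j < J" "i < J" by (auto simp: I_def)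
      have "bnd \<rho> (fps_const (of_int (x (j, i))) * \<Phi> ^ i * ?w ^ j) (norm (of_int (x (j, i)) :: complex) * exp b ^ i * exp b' ^ j)"
        by (intro bnd_mult bnd_const bnd_power b b' \<rho>)
      moreover have "norm (of_int (x (j, i)) :: complex) * exp b ^ i * exp b' ^ j \<le> real H * exp b ^ J * exp b' ^ J"
      proof (intro mult_mono power_increasing)
        have "\<bar>x (j, i)\<bar> \<le> int H" using x(1) ji e by auto
        then show "norm (of_int (x (j, i)) :: complex) \<le> real H" by simp
      qed (use b b' e in auto)
      ultimately show "bnd \<rho> (case ji of (j, i) \<Rightarrow> fps_const (of_int (x (j, i))) * \<Phi> ^ i * ?w ^ j)
          (case ji of (j, i) \<Rightarrow> real H * exp b ^ J * exp b' ^ J)"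
        unfolding e by (auto intro: bnd_mono)
    qed (use \<rho> in auto)
    from bnd_nth[OF this \<rho>(1), of N]
    have "norm (fps_nth (fps_compose (cfps F) \<Phi>) N) * \<rho> ^ N \<le> real (card I) * (real H * exp b ^ J * exp b' ^ J)"
      by (simp add: case_prod_unfold)
    then have upper: "norm (fps_nth (cfps F) N) * R ^ N * \<rho> ^ N \<le> real (M * T) * (real H * exp b ^ J * exp b' ^ J)"
      using fps_compose_nth_leading[of N "cfps F" \<Phi>] Flt \<Phi>0
      by (simp add: R_def norm_mult norm_power cI)
    have "exp (- (k * real J + c * real N)) * (R ^ N * \<rho> ^ N) \<le> real (M * T) * (real H * exp b ^ J * exp b' ^ J)"
    proof -
      have "exp (- (k * real J + c * real N)) * (R ^ N * \<rho> ^ N) \<le> norm (fps_nth (cfps F) N) * (R ^ N * \<rho> ^ N)"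
        using lower R0 \<rho> by (intro mult_right_mono) auto
      then show ?thesis using upper by (simp add: mult.assoc)
    qed
    then have "ln (exp (- (k * real J + c * real N)) * (R ^ N * \<rho> ^ N)) \<le> ln (real (M * T) * (real H * exp b ^ J * exp b' ^ J))"
      using R0 \<rho> M T1 H1 by (subst ln_le_cancel_iff) auto
    then have main: "real N * \<eta> \<le> k * real J + ln (real (M * T)) + ln (real H) + b * real J + b' * real J"
      using R0 \<rho> M T1 H1 by (simp add: ln_mult ln_realpow \<eta>_def algebra_simps del: of_nat_mult)
    have lnMT: "ln (real (M * T)) \<le> 2 * (real M * real s)"
    proof -
      have "real (M * T) = (real M * real s) ^ 2" by (simp add: T_def power2_eq_square)
      then have "ln (real (M * T)) = 2 * ln (real M * real s)" using M s1 by (simp add: ln_realpow)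
      also have "\<dots> \<le> 2 * (real M * real s)"
        using ln_bound[of "real M * real s"] M s1 by simp
      finally show ?thesis .
    qed
    have "ln (real H) \<le> ln V / (real M - 1)"
    proof -
      have "ln (real H) \<le> ln (V powr (1 / (real M - 1)))" using Hle H1 V1 by (subst ln_le_cancel_iff) auto
      then show ?thesis using V1 by (simp add: ln_powr)
    qed
    also have "ln V \<le> 1 + 2 * (real M * real s) + 1 + (k * real J + c * real T) + a * (real J + real T)"
    proof -
      have "ln V = ln 2 + ln (real (M * T)) + ln (real Q)"
        using M T1 Q1 by (simp add: V_def ln_mult)
      also have "ln (real Q) \<le> ln (2 * Qr)" using Q Q1 Qr1 by (subst ln_le_cancel_iff) auto
      also have "ln (2 * Qr) = ln 2 + (k * real J + c * real T) + a * (real J + real T)"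
        using Qr1 by (simp add: ln_mult Qr_def)
      finally show ?thesis using lnMT ln_2_less_1 by linarith
    qed
    finally have "ln (real H) \<le> (1 + 2 * (real M * real s) + 1 + (k * real J + c * real T) + a * (real J + real T)) / (real M - 1)"
      using M by (auto simp: divide_right_mono)
    also have "\<dots> = (2 + (2 + k + a) * real J) / (real M - 1) + (c + a) / (real M - 1) * real T"
      by (simp add: add_divide_distrib[symmetric] J_def algebra_simps)
    also have "(2 + (2 + k + a) * real J) / (real M - 1) \<le> (2 + (2 + k + a) * real J) / 1"
      using M k a by (intro divide_left_mono) auto
    also have "(c + a) / (real M - 1) * real T \<le> \<eta> / 2 * real T"
      using M by (intro mult_right_mono) auto
    finally have lnH: "ln (real H) \<le> 2 + (2 + k + a) * real J + \<eta> / 2 * real T" by simp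
    have "real T * \<eta> \<le> real N * \<eta>" using NT \<eta> by (intro mult_right_mono) auto
    with main lnH lnMT have "\<eta> / 2 * real T \<le> (k + b + b' + 2 + 2 + k + a) * real J + 2"
      by (simp add: J_def algebra_simps)
    also have "\<dots> \<le> C * real s"
    proof -
      have "2 \<le> 3 * real s" using s1 by simp
      then show ?thesis by (simp add: C_def J_def algebra_simps)
    qed
    finally have "\<eta> / 2 * (real M * real s) * real s \<le> C * real s" by (simp add: T_def mult_ac)
    then have "\<eta> / 2 * (real M * real s) \<le> C" using s1 by (simp del: of_nat_mult)
    moreover have "2 * C < real s * (\<eta> * real M)" using s \<eta> M by (simp add: field_simps)
    ultimately show False by (simp add: algebra_simps)
  qed
  define P :: "nat \<Rightarrow> rat poly" where "P = (\<lambda>j. \<Sum>i<J. Polynomial.monom (of_int (x (j, i))) i)"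
  have "(\<Sum>j<J. fps_of_poly (P j) * y ^ j) = F"
    unfolding F_def I_def P_def
    by (simp add: sum.cartesian_product[symmetric] fps_of_poly_sum fps_of_poly_monom sum_distrib_right)
  moreover have "\<exists>j<J. P j \<noteq> 0"
  proof -
    obtain j i where ji: "j < J" "i < J" "x (j, i) \<noteq> 0" using x(2) by (auto simp: I_def)
    have "poly.coeff (P j) i = (\<Sum>i'<J. if i' = i then of_int (x (j, i')) else 0)"
      unfolding P_def by (simp add: coeff_sum)
    also have "\<dots> = of_int (x (j, i))" using ji by simp
    finally have "P j \<noteq> 0" using ji by auto
    then show ?thesis using ji by blast
  qed
  ultimately show ?thesis using \<open>F = 0\<close> unfolding alg_fps_def by blast
qed

section \<open>p-adic absolute values\<close>

lemma padic_abs_fraction: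
  assumes p: "Factorial_Ring.prime p" and "a \<noteq> 0" "b \<noteq> 0"
  shows "padic_abs p (of_int a / of_int b)
    = real p powi (int (multiplicity (int p) b) - int (multiplicity (int p) a))"
proof -
  define q :: rat where "q = of_int a / of_int b"
  obtain n d where nd: "quotient_of q = (n, d)" by (cases "quotient_of q")
  have d0: "d > 0" using quotient_of_denom_pos[OF nd] .
  have "q = of_int n / of_int d" using quotient_of_div[OF nd] .
  then have "(of_int (n * b) :: rat) = of_int (a * d)"
    using assms d0 by (simp add: q_def field_simps)
  then have e: "n * b = a * d" by (simp only: of_int_eq_iff)
  have n0: "n \<noteq> 0" using e assms d0 by auto
  have "prime_elem (int p)" using p by (simp add: prime_imp_prime_elem)
  then have "multiplicity (int p) n + multiplicity (int p) b = multiplicity (int p) a + multiplicity (int p) d"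
    using arg_cong[OF e, of "multiplicity (int p)"] n0 assms d0
    by (simp add: prime_elem_multiplicity_mult_distrib)
  then have "int (multiplicity (int p) d) - int (multiplicity (int p) n)
      = int (multiplicity (int p) b) - int (multiplicity (int p) a)" by linarith
  moreover have "q \<noteq> 0" using assms by (simp add: q_def)
  ultimately have "padic_abs p q = real p powi (int (multiplicity (int p) b) - int (multiplicity (int p) a))"
    unfolding padic_abs_def nd by simp
  then show ?thesis by (simp add: q_def)
qed

lemma rat_as_fraction: obtains a b :: int where "(q::rat) = of_int a / of_int b" "b > 0"
  by (metis quotient_of_denom_pos quotient_of_div surj_pair)

lemma padic_abs_0 [simp]: "padic_abs p 0 = 0" by (simp add: padic_abs_def)

lemma padic_abs_nonneg [simp]: "padic_abs p q \<ge> 0"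
  by (simp add: padic_abs_def zero_le_power_int)

lemma padic_abs_value:
  assumes "q \<noteq> 0" shows "\<exists>k. padic_abs p q = real p powi k"
  using assms by (auto simp: padic_abs_def)

lemma padic_abs_mult:
  assumes p: "Factorial_Ring.prime p"
  shows "padic_abs p (x * y) = padic_abs p x * padic_abs p y"
proof (cases "x = 0 \<or> y = 0")
  case False
  obtain a b where x: "x = of_int a / of_int b" "b > 0" by (rule rat_as_fraction)
  obtain c d where y: "y = of_int c / of_int d" "d > 0" by (rule rat_as_fraction)
  have nz: "a \<noteq> 0" "c \<noteq> 0" "b \<noteq> 0" "d \<noteq> 0" using x y False by auto
  have "prime_elem (int p)" using p by (simp add: prime_imp_prime_elem)
  then have "padic_abs p (of_int (a * c) / of_int (b * d)) = real p powi
      ((int (multiplicity (int p) b) - int (multiplicity (int p) a)) + (int (multiplicity (int p) d) - int (multiplicity (int p) c)))"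
    using nz p padic_abs_fraction[of p "a * c" "b * d"]
    by (simp add: prime_elem_multiplicity_mult_distrib algebra_simps)
  also have "\<dots> = padic_abs p x * padic_abs p y"
    unfolding x y using nz p prime_gt_0_nat[OF p]
    by (subst power_int_add) (auto simp: padic_abs_fraction)
  finally show ?thesis by (simp add: x y)
qed auto

lemma padic_abs_int_le:
  assumes p: "Factorial_Ring.prime p" and "int p ^ k dvd a"
  shows "padic_abs p (of_int a) \<le> 1 / real p ^ k"
proof (cases "a = 0")
  case False
  have "k \<le> multiplicity (int p) a"
    using False assms prime_gt_1_nat[OF p] by (intro multiplicity_geI) auto
  moreover have "padic_abs p (of_int a) = real p powi (- int (multiplicity (int p) a))"
    using padic_abs_fraction[OF p False, of 1] by simp
  ultimately show ?thesis using prime_gt_1_nat[OF p]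
    by (simp add: power_int_minus divide_inverse[symmetric] inverse_eq_divide frac_le power_increasing)
qed (use prime_gt_0_nat[OF p] in auto)

lemma padic_abs_int: "Factorial_Ring.prime p \<Longrightarrow> padic_abs p (of_int a) \<le> 1"
  using padic_abs_int_le[of p 0 a] by simp

lemma padic_abs_1 [simp]: "Factorial_Ring.prime p \<Longrightarrow> padic_abs p 1 = 1"
  using padic_abs_fraction[of p 1 1] by simp

lemma padic_abs_add:
  assumes p: "Factorial_Ring.prime p" and x: "padic_abs p x \<le> B" and y: "padic_abs p y \<le> B"
  shows "padic_abs p (x + y) \<le> B"
proof (cases "x = 0 \<or> y = 0 \<or> x + y = 0")
  case True
  then show ?thesis using x y order_trans[OF padic_abs_nonneg x] by auto
next
  case False
  obtain a b where ab: "x = of_int a / of_int b" "b > 0" by (rule rat_as_fraction)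
  obtain c d where cd: "y = of_int c / of_int d" "d > 0" by (rule rat_as_fraction)
  define u v e where "u = a * d" and "v = c * b" and "e = b * d"
  have xe: "x = of_int u / of_int e" and ye: "y = of_int v / of_int e"
    using ab cd by (auto simp: u_def v_def e_def)
  then have se: "x + y = of_int (u + v) / of_int e" by (simp add: add_divide_distrib)
  have nz: "u \<noteq> 0" "v \<noteq> 0" "e \<noteq> 0" "u + v \<noteq> 0"
    using False xe ye se ab cd by (auto simp: e_def simp del: of_int_add)
  let ?m = "multiplicity (int p)"
  have "?m (u + v) \<ge> min (?m u) (?m v)"
    using nz prime_gt_1_nat[OF p]
    by (intro multiplicity_geI dvd_add) (auto intro: multiplicity_dvd')
  then consider "?m (u + v) \<ge> ?m u" | "?m (u + v) \<ge> ?m v" by linarith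
  then show ?thesis
  proof cases
    case 1
    then have "padic_abs p (x + y) \<le> padic_abs p x"
      unfolding se unfolding xe using nz p prime_gt_1_nat[OF p]
      by (subst (1 2) padic_abs_fraction) (auto intro!: power_int_increasing)
    then show ?thesis using x by linarith
  next
    case 2
    then have "padic_abs p (x + y) \<le> padic_abs p y"
      unfolding se unfolding ye using nz p prime_gt_1_nat[OF p]
      by (subst (1 2) padic_abs_fraction) (auto intro!: power_int_increasing)
    then show ?thesis using y by linarith
  qed
qed

lemma padic_abs_minus:
  assumes p: "Factorial_Ring.prime p" shows "padic_abs p (- x) = padic_abs p x"
proof -
  have "padic_abs p (-1) * padic_abs p (-1) = 1"
    using padic_abs_mult[OF p, of "-1" "-1"] p by simp
  then have "padic_abs p (-1) ^ 2 = 1 ^ 2" by (simp add: power2_eq_square)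
  then have "padic_abs p (-1) = 1" by (metis padic_abs_nonneg power2_eq_imp_eq zero_le_one)
  then show ?thesis using padic_abs_mult[OF p, of "-1" x] by simp
qed

lemma padic_abs_sum:
  assumes p: "Factorial_Ring.prime p" and "B \<ge> 0" "\<And>a. a \<in> A \<Longrightarrow> padic_abs p (f a) \<le> B"
  shows "padic_abs p (sum f A) \<le> B"
  using assms(3) by (induction A rule: infinite_finite_induct) (auto simp: \<open>B \<ge> 0\<close> padic_abs_add[OF p])

lemma integral_if_padic_integral:
  assumes "\<And>p. Factorial_Ring.prime p \<Longrightarrow> padic_abs p x \<le> 1"
  shows "x \<in> \<int>"
proof (cases "x = 0")
  case False
  obtain n d where nd: "quotient_of x = (n, d)" by (cases "quotient_of x")
  have d0: "d > 0" and cop: "coprime n d" and x: "x = of_int n / of_int d"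
    using quotient_of_denom_pos[OF nd] quotient_of_coprime[OF nd] quotient_of_div[OF nd] by auto
  have "d = 1"
  proof (rule ccontr)
    assume "d \<noteq> 1"
    then have "nat d \<noteq> 1" using d0 by auto
    then obtain p where p: "Factorial_Ring.prime p" "p dvd nat d" using prime_factor_nat by blast
    have pd: "int p dvd d" using p d0 by (metis int_dvd_int_iff int_nat_eq order_less_imp_le)
    have "\<not> int p dvd n" using cop pd p
      by (metis coprime_common_divisor not_prime_unit prime_nat_int_transfer)
    then have "multiplicity (int p) n = 0" by (rule not_dvd_imp_multiplicity_0)
    moreover have "multiplicity (int p) d \<ge> 1"
      using pd d0 prime_gt_1_nat[OF p(1)] by (intro multiplicity_geI) auto
    ultimately have "padic_abs p x > 1"
      unfolding padic_abs_def nd using False prime_gt_1_nat[OF p(1)] by (simp add: one_less_power)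
    then show False using assms[OF p(1)] by simp
  qed
  then show ?thesis using x by simp
qed simp

text \<open>
  A superadditive exponent survives convolution: passing to the j-th power of the series multiplies the
  constant K but leaves the rate of growth g unchanged.
\<close>

lemma padic_abs_power_coeff:
  assumes p: "Factorial_Ring.prime p" and K: "K \<ge> 1" and g: "\<And>m. g m \<ge> 1" "\<And>a b. g a * g b \<le> g (a + b)"
    and y: "\<And>m. padic_abs p (fps_nth y m) \<le> K * g m"
  shows "padic_abs p (fps_nth (y ^ j) m) \<le> K ^ j * g m"
proof (induction j arbitrary: m)
  case 0
  show ?case using g(1)[of m] p order_trans[OF zero_le_one g(1)] by auto
next
  case (Suc j)
  show ?case unfolding power_Suc fps_mult_nth
  proof (rule padic_abs_sum[OF p])
    fix i assume i: "i \<in> {0..m}"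
    have "padic_abs p (fps_nth y i * fps_nth (y ^ j) (m - i)) \<le> (K * g i) * (K ^ j * g (m - i))"
      unfolding padic_abs_mult[OF p] using K g(1)[of i] by (intro mult_mono y Suc) auto
    also have "\<dots> = K * K ^ j * (g i * g (m - i))" by simp
    also have "\<dots> \<le> K * K ^ j * g m" using g(2)[of i "m - i"] i K by (intro mult_left_mono) auto
    finally show "padic_abs p (fps_nth y i * fps_nth (y ^ j) (m - i)) \<le> K * K ^ j * g m" .
  qed (use K order_trans[OF zero_le_one g(1)[of m]] in auto)
qed

section \<open>Factorials\<close>

text \<open>
  Only the multiples of p up to n contribute, and they are p times the numbers up to \<open>n div p\<close>.
\<close>

lemma multiplicity_fact_step:
  assumes p: "Factorial_Ring.prime (p::nat)"
  shows "multiplicity p (fact n :: nat) = n div p + multiplicity p (fact (n div p) :: nat)"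
proof (induction n)
  case (Suc n)
  have pe: "prime_elem p" using p by (rule prime_imp_prime_elem)
  have 1: "multiplicity p (fact (Suc n) :: nat) = multiplicity p (Suc n) + multiplicity p (fact n :: nat)"
    unfolding fact_Suc using pe by (subst prime_elem_multiplicity_mult_distrib) auto
  show ?case
  proof (cases "p dvd Suc n")
    case True
    then obtain k where k: "Suc n = p * k" by auto
    then have "k \<noteq> 0" by (metis mult_0_right nat.distinct(1))
    then obtain k' where k': "k = Suc k'" using not0_implies_Suc by blast
    have "n = p * k' + (p - 1)" using k k' prime_gt_0_nat[OF p] by simp
    then have "n div p = k'" using prime_gt_0_nat[OF p] by (intro div_nat_eqI) auto
    moreover have "Suc n div p = k" using k prime_gt_0_nat[OF p] by simp
    moreover have "multiplicity p (Suc n) = 1 + multiplicity p k"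
      unfolding k using pe \<open>k \<noteq> 0\<close> prime_gt_0_nat[OF p] prime_gt_1_nat[OF p]
      by (subst prime_elem_multiplicity_mult_distrib) (auto simp: multiplicity_self)
    moreover have "multiplicity p (fact k :: nat) = multiplicity p k + multiplicity p (fact k' :: nat)"
      unfolding k' fact_Suc using pe by (subst prime_elem_multiplicity_mult_distrib) auto
    ultimately show ?thesis using 1 Suc k' by simp
  next
    case False
    then have "multiplicity p (Suc n) = 0" by (rule not_dvd_imp_multiplicity_0)
    moreover have "Suc n div p = n div p" using False by (simp add: div_Suc dvd_eq_mod_eq_0)
    ultimately show ?thesis using 1 Suc by simp
  qed
qed simp

text \<open>
  Legendre's bound.
\<close>

lemma multiplicity_fact_bound:
  assumes p: "Factorial_Ring.prime (p::nat)"
  shows "multiplicity p (fact n :: nat) * (p - 1) \<le> n"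
proof (induction n rule: less_induct)
  case (less n)
  show ?case
  proof (cases "n = 0")
    case False
    have "n div p < n" using False prime_gt_1_nat[OF p] by simp
    then have "multiplicity p (fact n :: nat) * (p - 1) \<le> (n div p) * (p - 1) + n div p"
      using less[of "n div p"] multiplicity_fact_step[OF p, of n] by (simp add: add_mult_distrib)
    also have "\<dots> = (n div p) * p" using prime_gt_0_nat[OF p] by (cases p) auto
    also have "\<dots> \<le> n" by simp
    finally show ?thesis .
  qed simp
qed

text \<open>
  By \<open>multiplicity_fact_step\<close> this is the multiplicity of p in \<open>m!\<close> minus \<open>m div p\<close>. It bounds the denominator
  of \<open>\<nabla>\<^sup>m / m!\<close> when \<open>\<nabla>\<^sup>p\<close> is divisible by p.
\<close>

definition good_exp :: "nat \<Rightarrow> nat \<Rightarrow> nat" where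
  "good_exp p m = multiplicity p (fact (m div p) :: nat)"

lemma good_exp_superadditive: "good_exp p a + good_exp p b \<le> good_exp p (a + b)"
  if p: "Factorial_Ring.prime p"
proof -
  have "(fact (a div p) * fact (b div p) :: nat) dvd fact (a div p + b div p)"
    by (rule fact_fact_dvd_fact)
  also have "\<dots> dvd fact ((a + b) div p)"
    by (intro fact_dvd) (simp add: div_add1_eq[of a b])
  finally have "multiplicity p (fact (a div p) * fact (b div p) :: nat) \<le> multiplicity p (fact ((a + b) div p) :: nat)"
    by (intro dvd_imp_multiplicity_le) auto
  then show ?thesis unfolding good_exp_def using prime_imp_prime_elem[OF p]
    by (subst (asm) prime_elem_multiplicity_mult_distrib) auto
qed

lemma good_exp_bound:
  assumes p: "Factorial_Ring.prime p"
  shows "real (good_exp p m) * ln (real p) \<le> real m * (ln (real p) / (real p * (real p - 1)))"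
proof -
  have "good_exp p m * (p - 1) \<le> m div p" unfolding good_exp_def by (rule multiplicity_fact_bound[OF p])
  then have "good_exp p m * (p - 1) * p \<le> m"
    using prime_gt_0_nat[OF p] by (metis less_eq_div_iff_mult_less_eq)
  then have "real (good_exp p m * (p - 1) * p) \<le> real m" by (simp only: of_nat_le_iff)
  then have "real (good_exp p m) * (real p * (real p - 1)) \<le> real m"
    using prime_gt_1_nat[OF p] by (simp add: of_nat_diff algebra_simps)
  then have "real (good_exp p m) \<le> real m / (real p * (real p - 1))"
    using prime_gt_1_nat[OF p] by (simp add: field_simps)
  then have "real (good_exp p m) * ln (real p) \<le> real m / (real p * (real p - 1)) * ln (real p)"
    using prime_gt_1_nat[OF p] by (intro mult_right_mono) auto
  then show ?thesis by simp
qed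

section \<open>The sum over primes\<close>

text \<open>
  The contribution of a prime to the growth rate of the denominators. For a prime with vanishing
  p-curvature it comes from \<open>good_exp\<close>, and for any other prime apart from 3 and 5 it is minus the logarithm of the
  radius of convergence.
\<close>

definition prime_weight :: "nat \<Rightarrow> real" where
  "prime_weight n = ln (real n) / (real n * (real n - 1))"

lemma prime_weight_nonneg: "prime_weight n \<ge> 0"
proof (cases "n \<le> 1")
  case True then have "n = 0 \<or> n = 1" by auto
  then show ?thesis by (auto simp: prime_weight_def)
qed (auto simp: prime_weight_def)

text \<open>
  Steps of 2 suffice because large primes are odd. The proof replaces \<open>n (n - 1)\<close> by
  \<open>(n - 3/2) (n + 1/2)\<close>, whose reciprocal telescopes; the summand 1 in h pays for the growth of the
  logarithm.
\<close>

lemma prime_weight_telescope: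
  assumes "n \<ge> 2"
  defines "h \<equiv> \<lambda>n. (ln (real n) + 1) / (2 * (real n - 3 / 2))"
  shows "prime_weight n \<le> h n - h (n + 2)"
proof -
  define x where "x = real n"
  have x: "x \<ge> 2" using assms by (simp add: x_def)
  have l: "ln (x + 2) \<le> ln x + 2 / x"
  proof -
    have "x + 2 = x * (1 + 2 / x)" using x by (simp add: field_simps)
    moreover have "1 + 2 / x > 0" using x by (intro add_pos_nonneg) auto
    ultimately have "ln (x + 2) = ln x + ln (1 + 2 / x)" using x by (simp only: ln_mult_pos)
    then show ?thesis using ln_add_one_self_le_self[of "2 / x"] x by simp
  qed
  have lx: "ln x \<ge> 0" using x by simp
  have "prime_weight n \<le> ln x / ((x - 3/2) * (x + 1/2))"
    unfolding prime_weight_def x_def[symmetric]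
  proof (intro divide_left_mono lx)
    show "(x - 3/2) * (x + 1/2) \<le> x * (x - 1)" by (simp add: algebra_simps)
    show "0 < x * (x - 1) * ((x - 3/2) * (x + 1/2))" using x by (intro mult_pos_pos) auto
  qed
  also have "ln x / ((x - 3/2) * (x + 1/2)) = (ln x + 1) / (2 * (x - 3/2)) - (ln x + 1) / (2 * (x + 1/2)) - 1 / ((x - 3/2) * (x + 1/2))"
    using x by (simp add: divide_simps) (simp add: algebra_simps)
  also have "\<dots> \<le> (ln x + 1) / (2 * (x - 3/2)) - (ln x + 1) / (2 * (x + 1/2)) - 1 / (x * (x + 1/2))"
    using x by (intro diff_left_mono divide_left_mono) (auto intro!: mult_right_mono)
  also have "\<dots> = (ln x + 1) / (2 * (x - 3/2)) - (ln x + 2 / x + 1) / (2 * (x + 1/2))"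
    using x by (simp add: divide_simps) (simp add: algebra_simps)
  also have "\<dots> \<le> (ln x + 1) / (2 * (x - 3/2)) - (ln (x + 2) + 1) / (2 * (x + 1/2))"
    using x l by (intro diff_left_mono divide_right_mono) auto
  also have "\<dots> = h n - h (n + 2)" by (simp add: h_def x_def algebra_simps)
  finally show ?thesis .
qed

text \<open>
  Rational upper bounds for logarithms, from \<open>ln 2 \<le> 25/36\<close>.
\<close>

lemma ln_from_power_of_2:
  assumes "(real n) ^ a \<le> 2 ^ b" "n > 0" "a > 0"
  shows "ln (real n) \<le> real b / real a * (25 / 36)"
proof -
  have "real a * ln (real n) = ln (real n ^ a)" using assms by (simp add: ln_realpow)
  also have "\<dots> \<le> ln (2 ^ b)" using assms by (subst ln_le_cancel_iff) auto
  also have "\<dots> = real b * ln 2" by (simp add: ln_realpow)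
  also have "\<dots> \<le> real b * (25 / 36)" using ln2_le_25_over_36 by (intro mult_left_mono) auto
  finally show ?thesis using assms by (simp add: field_simps)
qed

text \<open>
  The primes below 17 are estimated one by one. Primes from 17 on are majorised by all odd
  numbers from 17 on.
\<close>

lemma prime_weight_sum:
  assumes "finite F" "\<And>p. p \<in> F \<Longrightarrow> Factorial_Ring.prime p \<and> p \<noteq> 3 \<and> p \<noteq> 5"
  shows "(\<Sum>p\<in>F. prime_weight p) \<le> 56 / 100"
proof -
  define h where "h = (\<lambda>n. (ln (real n) + 1) / (2 * (real n - 3 / 2)))"
  have tele: "prime_weight (17 + 2 * k) \<le> h (17 + 2 * k) - h (17 + 2 * Suc k)" for k
  proof -
    have e: "17 + 2 * Suc k = 17 + 2 * k + 2" by simp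
    have "2 \<le> 17 + 2 * k" by simp
    then show ?thesis using prime_weight_telescope[of "17 + 2 * k"] unfolding h_def e by blast
  qed
  define K where "K = Max (insert 0 F)"
  define G where "G = (\<lambda>k. 17 + 2 * k) ` {..<K}"
  have "F \<subseteq> {2, 7, 11, 13} \<union> G"
  proof
    fix p assume pF: "p \<in> F"
    then have p: "Factorial_Ring.prime p" "p \<noteq> 3" "p \<noteq> 5" using assms by auto
    have pK: "p \<le> K" using pF assms(1) by (simp add: K_def)
    show "p \<in> {2, 7, 11, 13} \<union> G"
    proof (cases "p < 17")
      case True
      have np: "\<not> Factorial_Ring.prime (9::nat)" "\<not> Factorial_Ring.prime (15::nat)"
        using prime_product[of 3 3] prime_product[of 3 5] by auto
      have "odd p \<or> p = 2" using p(1) prime_odd_nat prime_ge_2_nat by (metis le_neq_implies_less)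
      moreover have "p \<ge> 2" using p(1) by (rule prime_ge_2_nat)
      ultimately have "p \<in> {2, 7, 9, 11, 13, 15}" using True p(2,3) by simp presburger
      then show ?thesis using p(1) np by auto
    next
      case False
      then have "odd p" using p(1) by (intro prime_odd_nat) auto
      then obtain k where "p = 2 * k + 1" by (auto elim: oddE)
      then have "p = 17 + 2 * (k - 8)" "k - 8 < K" using False pK by auto
      then show ?thesis unfolding G_def by blast
    qed
  qed
  moreover have fG: "finite G" by (simp add: G_def)
  ultimately have "(\<Sum>p\<in>F. prime_weight p) \<le> (\<Sum>p\<in>{2, 7, 11, 13} \<union> G. prime_weight p)"
    by (intro sum_mono2) (auto simp: prime_weight_nonneg)
  also have "\<dots> = (\<Sum>p\<in>{2, 7, 11, 13}. prime_weight p) + (\<Sum>p\<in>G. prime_weight p)"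
    by (rule sum.union_disjoint) (auto simp: G_def)
  also have "(\<Sum>p\<in>G. prime_weight p) = (\<Sum>k<K. prime_weight (17 + 2 * k))"
    unfolding G_def by (subst sum.reindex) (auto simp: inj_on_def)
  also have "\<dots> \<le> (\<Sum>k<K. h (17 + 2 * k) - h (17 + 2 * Suc k))"
    by (intro sum_mono tele)
  also have "\<dots> = h 17 - h (17 + 2 * K)"
    using sum_lessThan_telescope'[of "\<lambda>k. h (17 + 2 * k)" K] by simp
  also have "\<dots> \<le> h 17"
  proof -
    have "h (17 + 2 * K) \<ge> 0"
      unfolding h_def by (intro divide_nonneg_nonneg add_nonneg_nonneg ln_ge_zero) auto
    then show ?thesis by linarith
  qed
  also have "h 17 \<le> (41 / 10 * (25 / 36) + 1) / 31"
    using ln_from_power_of_2[of 17 10 41] by (simp add: h_def)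
  also have "(\<Sum>p\<in>{2, 7, 11, 13}. prime_weight p) = ln 2 / 2 + ln 7 / 42 + ln 11 / 110 + ln 13 / 156"
    by (simp add: prime_weight_def)
  also have "ln 2 / 2 + ln 7 / 42 + ln 11 / 110 + ln 13 / 156
     \<le> 25 / 36 / 2 + (3 * (25 / 36)) / 42 + (7 / 2 * (25 / 36)) / 110 + (15 / 4 * (25 / 36)) / (156::real)"
    using ln2_le_25_over_36 ln_from_power_of_2[of 7 5 15] ln_from_power_of_2[of 11 2 7] ln_from_power_of_2[of 13 4 15]
    by (intro add_mono divide_right_mono) auto
  also have "25 / 36 / 2 + (3 * (25 / 36)) / 42 + (7 / 2 * (25 / 36)) / 110 + (15 / 4 * (25 / 36)) / 156 + (41 / 10 * (25 / 36) + 1) / 31 \<le> (56 / 100 :: real)"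
    by simp
  finally show ?thesis by simp
qed

section \<open>Common denominators\<close>

text \<open>
  The radii of convergence granted by the hypotheses.
\<close>

definition disc_radius :: "nat \<Rightarrow> real" where
  "disc_radius p = (if p \<in> {3, 5} then 1 else real p powr (- 1 / (real p * (real p - 1))))"

text \<open>
  A prime outside S contributes its power of exponent \<open>good_exp\<close>, which is 0 for primes above T. A prime
  in S contributes according to the radius of convergence, and 3 and 5 only with the arbitrarily small
  rate that is lost because convergence on an open disc bounds the coefficients only on smaller discs.
\<close>

lemma common_denominators:
  assumes S: "finite S" "\<And>p. p \<in> S \<Longrightarrow> Factorial_Ring.prime p" "3 \<in> S" "5 \<in> S"
    and good: "\<And>p m. Factorial_Ring.prime p \<Longrightarrow> p \<notin> S \<Longrightarrow> padic_abs p (fps_nth y m) \<le> real p ^ good_exp p m"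
    and bad: "\<And>p. p \<in> S \<Longrightarrow> y \<in> convergent_fps p (disc_radius p)"
  shows "\<exists>\<Lambda> k. k \<ge> 0 \<and> (\<forall>J T. \<Lambda> J T > 0) \<and>
    (\<forall>J T. real (\<Lambda> J T) \<le> exp (k * real J + 564 / 1000 * real T)) \<and>
    (\<forall>J T j m. j \<le> J \<longrightarrow> m \<le> T \<longrightarrow> of_nat (\<Lambda> J T) * fps_nth (y ^ j) m \<in> \<int>)"
proof -
  \<comment> \<open>the margin between 0.564 and the bound 0.56 for the sum over primes, shared out among the primes in S\<close>
  define \<epsilon> where "\<epsilon> = 4 / 1000 / real (card S + 1)"
  have \<epsilon>: "\<epsilon> > 0" "real (card S) * \<epsilon> \<le> 4 / 1000" by (auto simp: \<epsilon>_def field_simps)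
  \<comment> \<open>the reciprocal of a radius slightly smaller than the radius of convergence\<close>
  define q where "q = (\<lambda>p. exp \<epsilon> / disc_radius p)"
  have rad: "disc_radius p > 0" "disc_radius p \<le> 1" if "p \<in> S" for p
  proof -
    have "p > 1" using S(2)[OF that] by (rule prime_gt_1_nat)
    then have "real p powr (- 1 / (real p * (real p - 1))) \<le> real p powr 0"
      by (intro powr_mono) auto
    then show "disc_radius p > 0" "disc_radius p \<le> 1" using \<open>p > 1\<close>
      by (auto simp: disc_radius_def)
  qed
  have q1: "q p \<ge> 1" if "p \<in> S" for p
    using rad[OF that] \<epsilon> by (simp add: q_def field_simps) (smt (verit) one_le_exp_iff)
  have "\<exists>K\<ge>1. \<forall>m. padic_abs p (fps_nth y m) \<le> K * q p ^ m" if p: "p \<in> S" for p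
  proof -
    have "1 / q p < disc_radius p" "0 < 1 / q p"
      using rad[OF p] \<epsilon> by (auto simp: q_def field_simps)
    then have "(\<lambda>n. padic_abs p (fps_nth y n) * (1 / q p) ^ n) \<longlonglongrightarrow> 0"
      using bad[OF p] unfolding convergent_fps_def by blast
    then have "bounded (range (\<lambda>n. padic_abs p (fps_nth y n) * (1 / q p) ^ n))"
      using convergent_imp_bounded convergentI by blast
    then obtain B where B: "\<And>n. norm (padic_abs p (fps_nth y n) * (1 / q p) ^ n) \<le> B" unfolding bounded_iff by auto
    have "padic_abs p (fps_nth y m) \<le> max 1 B * q p ^ m" for m
    proof -
      have "padic_abs p (fps_nth y m) * (1 / q p) ^ m \<le> max 1 B" using B[of m] by (auto simp: abs_le_iff)
      then show ?thesis using q1[OF p] by (simp add: field_simps)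
    qed
    then show ?thesis by (intro exI[of _ "max 1 B"]) auto
  qed
  then obtain K where K: "\<And>p. p \<in> S \<Longrightarrow> K p \<ge> 1" "\<And>p m. p \<in> S \<Longrightarrow> padic_abs p (fps_nth y m) \<le> K p * q p ^ m"
    by metis
  define U where "U = (\<lambda>J T p. K p ^ J * q p ^ T)"
  have U1: "U J T p \<ge> 1" if "p \<in> S" for J T p
    unfolding U_def using K(1)[OF that] q1[OF that]
    using mult_mono[of 1 "K p ^ J" 1 "q p ^ T"] by (simp add: one_le_power)
  define e where "e = (\<lambda>J T p. if p \<in> S then nat \<lfloor>log (real p) (U J T p)\<rfloor> else good_exp p T)"
  define P where "P = (\<lambda>T. S \<union> {p. Factorial_Ring.prime p \<and> p \<le> T})"
  have finP: "finite (P T)" for T using S(1) by (auto simp: P_def)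
  have primeP: "Factorial_Ring.prime p" if "p \<in> P T" for p T using that S(2) by (auto simp: P_def)
  define \<Lambda> where "\<Lambda> = (\<lambda>J T. \<Prod>p\<in>P T. p ^ e J T p)"
  define k where "k = (\<Sum>p\<in>S. ln (K p))"
  have k0: "k \<ge> 0" unfolding k_def using K(1) by (intro sum_nonneg) auto
  have pos: "\<Lambda> J T > 0" for J T
    unfolding \<Lambda>_def using primeP prime_gt_0_nat by (auto intro!: prod_pos)
  have eln: "real (e J T p) * ln (real p) \<le> (if p \<in> S then real J * ln (K p) + real T * \<epsilon> else 0)
      + (if p \<in> {3, 5} then 0 else real T * prime_weight p)"
    if "p \<in> P T" for J T p
  proof (cases "p \<in> S")
    case True
    have p1: "p > 1" using prime_gt_1_nat[OF S(2)[OF True]] .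
    have "real (e J T p) \<le> log (real p) (U J T p)"
    proof -
      have "log (real p) (U J T p) \<ge> 0" using U1[OF True, of J T] p1 by simp
      then show ?thesis using True unfolding e_def by (simp add: of_nat_nat)
    qed
    then have "real (e J T p) * ln (real p) \<le> log (real p) (U J T p) * ln (real p)"
      using p1 by (intro mult_right_mono) auto
    also have "\<dots> = ln (U J T p)" using p1 by (simp add: log_def)
    also have "\<dots> = real J * ln (K p) + real T * ln (q p)"
      using K(1)[OF True] q1[OF True] unfolding U_def by (simp add: ln_mult ln_realpow)
    also have "ln (q p) = \<epsilon> - ln (disc_radius p)" using rad[OF True] by (simp add: q_def ln_div)
    finally have "real (e J T p) * ln (real p) \<le> real J * ln (K p) + real T * (\<epsilon> - ln (disc_radius p))" .
    moreover have "- ln (disc_radius p) = (if p \<in> {3, 5} then 0 else prime_weight p)"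
      using p1 by (auto simp: disc_radius_def prime_weight_def ln_powr)
    then have "\<epsilon> - ln (disc_radius p) = \<epsilon> + (if p \<in> {3, 5} then 0 else prime_weight p)" by linarith
    ultimately show ?thesis using True by (auto simp: distrib_left)
  next
    case False
    then show ?thesis using good_exp_bound[OF primeP[OF that], of T] S(3,4)
      by (auto simp: e_def prime_weight_def)
  qed
  have size: "real (\<Lambda> J T) \<le> exp (k * real J + 564 / 1000 * real T)" for J T
  proof -
    have "ln (real (\<Lambda> J T)) = (\<Sum>p\<in>P T. real (e J T p) * ln (real p))"
      unfolding \<Lambda>_def of_nat_prod using finP primeP prime_gt_0_nat
      by (subst ln_prod) (auto simp: ln_realpow)
    also have "\<dots> \<le> (\<Sum>p\<in>P T. (if p \<in> S then real J * ln (K p) + real T * \<epsilon> else 0)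
      + (if p \<in> {3, 5} then 0 else real T * prime_weight p))" by (intro sum_mono eln)
    also have "\<dots> = (\<Sum>p\<in>P T \<inter> S. real J * ln (K p) + real T * \<epsilon>) + (\<Sum>p\<in>P T - {3, 5}. real T * prime_weight p)"
    proof -
      have "(\<Sum>p\<in>P T. if p \<in> S then real J * ln (K p) + real T * \<epsilon> else 0) = (\<Sum>p\<in>P T \<inter> S. real J * ln (K p) + real T * \<epsilon>)"
        by (rule sum.inter_restrict[OF finP, symmetric])
      moreover have "(\<Sum>p\<in>P T. if p \<in> {3, 5} then 0 else real T * prime_weight p) = (\<Sum>p\<in>P T - {3, 5}. real T * prime_weight p)"
        using finP by (intro sum.mono_neutral_cong_right) auto
      ultimately show ?thesis unfolding sum.distrib by (simp only:)
    qed
    also have "P T \<inter> S = S" by (auto simp: P_def)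
    also have "(\<Sum>p\<in>S. real J * ln (K p) + real T * \<epsilon>) = k * real J + real T * (real (card S) * \<epsilon>)"
      by (simp add: sum.distrib k_def sum_distrib_left mult_ac)
    also have "(\<Sum>p\<in>P T - {3, 5}. real T * prime_weight p) = real T * (\<Sum>p\<in>P T - {3, 5}. prime_weight p)"
      by (simp add: sum_distrib_left)
    also have "(\<Sum>p\<in>P T - {3, 5}. prime_weight p) \<le> 56 / 100"
      using finP primeP by (intro prime_weight_sum) auto
    also have "real (card S) * \<epsilon> \<le> 4 / 1000" by (rule \<epsilon>)
    finally have "ln (real (\<Lambda> J T)) \<le> k * real J + 564 / 1000 * real T" by (simp add: mult_left_mono)
    then have "exp (ln (real (\<Lambda> J T))) \<le> exp (k * real J + 564 / 1000 * real T)" by simp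
    then show ?thesis using pos[of J T] by simp
  qed
  have int: "of_nat (\<Lambda> J T) * fps_nth (y ^ j) m \<in> \<int>" if jm: "j \<le> J" "m \<le> T" for J T j m
  proof (rule integral_if_padic_integral)
    fix l :: nat assume l: "Factorial_Ring.prime l"
    define x where "x = fps_nth (y ^ j) m"
    have l1: "l > 1" using l by (rule prime_gt_1_nat)
    have bd: "padic_abs l x \<le> real l ^ e J T l"
    proof (cases "l \<in> S")
      case True
      have "padic_abs l x \<le> K l ^ j * q l ^ m" unfolding x_def
        using K(1)[OF True] K(2)[OF True] q1[OF True]
        by (intro padic_abs_power_coeff[OF l]) (auto simp: power_add)
      also have "\<dots> \<le> U J T l" unfolding U_def using K(1)[OF True] q1[OF True] jm
        by (intro mult_mono power_increasing) auto
      finally have le: "padic_abs l x \<le> U J T l" .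
      show ?thesis
      proof (cases "x = 0")
        case False
        then obtain n where n: "padic_abs l x = real l powi n" using padic_abs_value by blast
        have "real l powr real_of_int n \<le> U J T l" using le n l1 by (simp add: powr_real_of_int')
        then have "real_of_int n \<le> log (real l) (U J T l)"
          using l1 U1[OF True, of J T] by (simp add: le_log_iff)
        then have "n \<le> \<lfloor>log (real l) (U J T l)\<rfloor>" by (simp add: le_floor_iff)
        also have "\<dots> = int (e J T l)" using True l1 U1[OF True, of J T] by (simp add: e_def)
        finally have "real l powi n \<le> real l powi int (e J T l)"
          using l1 by (intro power_int_increasing) auto
        then show ?thesis using n by simp
      qed simp
    next
      case False
      have "padic_abs l x \<le> 1 ^ j * real l ^ good_exp l m" unfolding x_def
        using good[OF l False] l1 good_exp_superadditive[OF l]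
        by (intro padic_abs_power_coeff[OF l]) (auto simp flip: power_add intro: power_increasing)
      also have "\<dots> \<le> real l ^ good_exp l T"
        using l1 jm good_exp_superadditive[OF l, of m "T - m"] by (auto intro!: power_increasing)
      finally show ?thesis using False by (simp add: e_def)
    qed
    have "l ^ e J T l dvd \<Lambda> J T"
    proof (cases "l \<in> P T")
      case True
      then show ?thesis unfolding \<Lambda>_def using finP by (intro dvd_prodI) auto
    next
      case False
      then have "l \<notin> S" "T < l" using l by (auto simp: P_def)
      then have "e J T l = 0" by (simp add: e_def good_exp_def)
      then show ?thesis by simp
    qed
    then have "int l ^ e J T l dvd int (\<Lambda> J T)" by (metis of_nat_dvd_iff of_nat_power)
    then have "padic_abs l (of_int (int (\<Lambda> J T))) \<le> 1 / real l ^ e J T l" by (rule padic_abs_int_le[OF l])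
    then have "padic_abs l (of_nat (\<Lambda> J T) * x) \<le> 1 / real l ^ e J T l * real l ^ e J T l"
      unfolding padic_abs_mult[OF l] using bd by (intro mult_mono) auto
    then show "padic_abs l (of_nat (\<Lambda> J T) * fps_nth (y ^ j) m) \<le> 1" using l1 by (simp add: x_def)
  qed
  show ?thesis
    by (rule exI[of _ \<Lambda>], rule exI[of _ k]) (use k0 pos size int in auto)
qed

text \<open>
  The inequality on which everything depends: the conformal radius \<open>\<surd>\<pi>\<close> of the map from the disc
  exceeds the growth rate of the denominators.
\<close>

lemma ln_sqrt_pi: "564 / 1000 < ln (sqrt pi)"
proof -
  have "exp (113/100 :: real) = exp 1 * exp (13/100)" by (simp flip: exp_add)
  also have "\<dots> \<le> 2.72 * (1 + 13/100 + (13/100)^2)"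
    using e_less_272 exp_bound[of "13/100"] by (intro mult_mono) auto
  also have "\<dots> < 3.14" by (simp add: power2_eq_square)
  also have "\<dots> < pi" using pi_approx by simp
  finally have "ln (exp (113/100)) < ln pi" using pi_gt_zero by (subst ln_less_cancel_iff) auto
  then show ?thesis using pi_gt_zero by (simp add: ln_sqrt)
qed

section \<open>Linear differential equations on the disc\<close>

text \<open>
  With u the sum of the weighted sizes of the coefficients of order n of all \<open>W i\<close> and S its partial
  sums, the equation gives \<open>(n + 1) u(n + 1) \<le> c S(n)\<close>. So S grows at most polynomially, which is
  harmless after passing to a smaller radius.
\<close>

lemma linear_ode_on_disc:
  fixes W :: "nat \<Rightarrow> complex fps" and H :: "nat \<Rightarrow> nat \<Rightarrow> complex fps"
  assumes ode: "\<And>i. i < r \<Longrightarrow> fps_deriv (W i) = (\<Sum>j<r. H i j * W j)"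
    and H: "\<And>i j. i < r \<Longrightarrow> j < r \<Longrightarrow> on_disc (H i j)" and i: "i < r"
  shows "on_disc (W i)"
proof (rule on_disc_iff_geometric)
  fix \<rho> :: real assume \<rho>: "0 < \<rho>" "\<rho> < 1"
  obtain \<sigma> where \<sigma>: "\<rho> < \<sigma>" "\<sigma> < 1" using \<rho> dense by blast
  then have \<sigma>0: "\<sigma> > 0" using \<rho> by simp
  have "\<forall>i\<in>{..<r}. \<forall>j\<in>{..<r}. \<exists>B. bnd \<sigma> (H i j) B"
    using H \<sigma> \<sigma>0 unfolding on_disc_def by simp
  then obtain B where B: "\<And>i j. i < r \<Longrightarrow> j < r \<Longrightarrow> bnd \<sigma> (H i j) (B i j)"
    unfolding Ball_def lessThan_iff by metis
  define C where "C = (\<Sum>i<r. \<Sum>j<r. B i j)"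
  have B0: "B i j \<ge> 0" if "i < r" "j < r" for i j using bnd_nonneg[OF B[OF that] \<sigma>0] .
  have BC: "B i j \<le> C" if "i < r" "j < r" for i j
  proof -
    have "B i j \<le> (\<Sum>j<r. B i j)" using that B0 by (intro member_le_sum) auto
    also have "\<dots> \<le> C" unfolding C_def using that B0 by (intro member_le_sum) (auto intro!: sum_nonneg)
    finally show ?thesis .
  qed
  obtain c :: nat where c: "real r * C < real c" using reals_Archimedean2 by blast
  define u where "u = (\<lambda>n. \<Sum>i<r. norm (fps_nth (W i) n) * \<sigma> ^ n)"
  define S where "S = (\<lambda>n. \<Sum>k\<le>n. u k)"
  have u0: "u n \<ge> 0" for n unfolding u_def using \<sigma>0 by (intro sum_nonneg) auto
  have C0: "C \<ge> 0" unfolding C_def using B0 by (auto intro!: sum_nonneg)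
  have step: "real (n + 1) * u (n + 1) \<le> real c * S n" for n
  proof -
    have "real (n + 1) * (norm (fps_nth (W i) (n + 1)) * \<sigma> ^ (n + 1)) \<le> C * S n" if i: "i < r" for i
    proof -
      have "real (n + 1) * norm (fps_nth (W i) (n + 1)) = norm (fps_nth (fps_deriv (W i)) n)"
        by (simp add: norm_mult flip: of_nat_Suc)
      also have "fps_nth (fps_deriv (W i)) n = (\<Sum>j<r. \<Sum>k\<le>n. fps_nth (H i j) (n - k) * fps_nth (W j) k)"
        unfolding ode[OF i] fps_sum_nth fps_mult_nth atLeast0AtMost
        by (intro sum.cong refl sum.reindex_bij_witness[of _ "\<lambda>k. n - k" "\<lambda>k. n - k"]) auto
      finally have e: "real (n + 1) * norm (fps_nth (W i) (n + 1)) = norm (\<Sum>j<r. \<Sum>k\<le>n. fps_nth (H i j) (n - k) * fps_nth (W j) k)" .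
      have "real (n + 1) * (norm (fps_nth (W i) (n + 1)) * \<sigma> ^ (n + 1))
          = real (n + 1) * norm (fps_nth (W i) (n + 1)) * \<sigma> ^ (n + 1)" by simp
      also have "\<dots> \<le> real (n + 1) * norm (fps_nth (W i) (n + 1)) * \<sigma> ^ n"
        using \<sigma> \<sigma>0 by (intro mult_left_mono power_decreasing) auto
      also have "\<dots> \<le> (\<Sum>j<r. \<Sum>k\<le>n. norm (fps_nth (H i j) (n - k)) * norm (fps_nth (W j) k)) * \<sigma> ^ n"
        unfolding e using \<sigma>0
        by (intro mult_right_mono order_trans[OF norm_sum] sum_mono) (auto simp: norm_mult)
      also have "\<dots> = (\<Sum>j<r. \<Sum>k\<le>n. (norm (fps_nth (H i j) (n - k)) * \<sigma> ^ (n - k)) * (norm (fps_nth (W j) k) * \<sigma> ^ k))"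
        unfolding sum_distrib_right
      proof (intro sum.cong refl)
        fix j k assume "k \<in> {..n}"
        then have "\<sigma> ^ n = \<sigma> ^ (n - k) * \<sigma> ^ k" by (simp flip: power_add)
        then show "norm (fps_nth (H i j) (n - k)) * norm (fps_nth (W j) k) * \<sigma> ^ n
          = (norm (fps_nth (H i j) (n - k)) * \<sigma> ^ (n - k)) * (norm (fps_nth (W j) k) * \<sigma> ^ k)" by simp
      qed
      also have "\<dots> \<le> (\<Sum>j<r. \<Sum>k\<le>n. C * (norm (fps_nth (W j) k) * \<sigma> ^ k))"
      proof (intro sum_mono mult_right_mono)
        fix j k assume j: "j \<in> {..<r}"
        show "norm (fps_nth (H i j) (n - k)) * \<sigma> ^ (n - k) \<le> C"
          using bnd_nth[OF B[of i j] \<sigma>0, of "n - k"] BC[of i j] i j by auto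
      qed (use \<sigma>0 in auto)
      also have "\<dots> = C * S n"
        unfolding S_def u_def sum_distrib_left by (subst sum.swap) simp
      finally show ?thesis .
    qed
    then have "real (n + 1) * u (n + 1) \<le> (\<Sum>i<r. C * S n)"
      unfolding u_def sum_distrib_left by (intro sum_mono) auto
    also have "\<dots> = (real r * C) * S n" by simp
    also have "\<dots> \<le> real c * S n"
      using c u0 by (intro mult_right_mono) (auto simp: S_def intro!: sum_nonneg)
    finally show ?thesis .
  qed
  have Sbd: "S n \<le> S 0 * real (n + 1) ^ c" for n
  proof (induction n)
    case (Suc n)
    have S0: "S n \<ge> 0" unfolding S_def using u0 by (auto intro!: sum_nonneg)
    have "S (Suc n) = S n + u (n + 1)" by (simp add: S_def)
    also have "\<dots> \<le> S n + real c * S n / real (n + 1)"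
      using step[of n] by (simp add: field_simps del: of_nat_Suc of_nat_add)
    also have "\<dots> = S n * (1 + real c * (1 / real (n + 1)))" by (simp add: field_simps)
    also have "\<dots> \<le> S n * (1 + 1 / real (n + 1)) ^ c"
    proof -
      have "0 \<le> 1 / real (n + 1)" by simp
      then have "-1 \<le> 1 / real (n + 1)" by linarith
      then show ?thesis using S0 by (intro mult_left_mono Bernoulli_inequality)
    qed
    also have "\<dots> \<le> S 0 * real (n + 1) ^ c * (1 + 1 / real (n + 1)) ^ c"
      using Suc by (intro mult_right_mono) auto
    also have "\<dots> = S 0 * (real (n + 1) * (1 + 1 / real (n + 1))) ^ c" by (simp add: power_mult_distrib)
    also have "real (n + 1) * (1 + 1 / real (n + 1)) = real (Suc n + 1)" by (simp add: field_simps)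
    finally show ?case .
  qed simp
  define q where "q = \<rho> / \<sigma>"
  have q: "0 < q" "q < 1" using \<rho> \<sigma> by (auto simp: q_def)
  have "(\<lambda>n. real (n + 1) ^ c * q ^ n) \<longlonglongrightarrow> 0"
    using q by real_asymp
  then have "bounded (range (\<lambda>n. real (n + 1) ^ c * q ^ n))"
    using convergent_imp_bounded convergentI by blast
  then obtain K where K: "\<And>n. norm (real (n + 1) ^ c * q ^ n) \<le> K"
    unfolding bounded_iff by auto
  have "norm (fps_nth (W i) n) * \<rho> ^ n \<le> S 0 * K" for n
  proof -
    have "norm (fps_nth (W i) n) * \<sigma> ^ n \<le> u n"
      unfolding u_def using i \<sigma>0 by (intro member_le_sum) auto
    also have "\<dots> \<le> S n" unfolding S_def using u0 by (intro member_le_sum) auto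
    finally have 1: "norm (fps_nth (W i) n) * \<sigma> ^ n \<le> S 0 * real (n + 1) ^ c" using Sbd[of n] by linarith
    have "norm (fps_nth (W i) n) * \<rho> ^ n = norm (fps_nth (W i) n) * \<sigma> ^ n * q ^ n"
      using \<sigma>0 by (simp add: q_def power_divide)
    also have "\<dots> \<le> S 0 * real (n + 1) ^ c * q ^ n" using 1 q by (intro mult_right_mono) auto
    also have "\<dots> = S 0 * (real (n + 1) ^ c * q ^ n)" by simp
    also have "\<dots> \<le> S 0 * K"
      using K[of n] q u0[of 0] by (intro mult_left_mono) (auto simp: S_def)
    finally show ?thesis .
  qed
  then show "\<exists>B. \<forall>n. norm (fps_nth (W i) n) * \<rho> ^ n \<le> B" by blast
qed

lemma on_disc_if_radius:
  assumes "fps_conv_radius f \<ge> 1"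
  shows "on_disc f"
proof (rule on_disc_iff_geometric)
  fix \<rho> :: real assume \<rho>: "0 < \<rho>" "\<rho> < 1"
  have "summable (\<lambda>n. fps_nth f n * of_real \<rho> ^ n)"
    using assms \<rho> by (intro summable_fps) (auto intro: less_le_trans[of _ 1])
  then have "(\<lambda>n. fps_nth f n * of_real \<rho> ^ n) \<longlonglongrightarrow> 0" by (rule summable_LIMSEQ_zero)
  then have "bounded (range (\<lambda>n. fps_nth f n * of_real \<rho> ^ n))"
    using convergent_imp_bounded convergentI by blast
  then obtain B where "\<And>n. norm (fps_nth f n * of_real \<rho> ^ n) \<le> B" unfolding bounded_iff by auto
  then show "\<exists>B. \<forall>n. norm (fps_nth f n) * \<rho> ^ n \<le> B"
    using \<rho> by (auto simp: norm_mult norm_power)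
qed

lemma on_disc_expansion:
  assumes "f holomorphic_on ball 0 1" "f has_fps_expansion F"
  shows "on_disc F"
proof -
  have "fps_conv_radius F \<ge> 1"
    using holomorphic_on_imp_fps_conv_radius_ge[OF assms(2), of 1] assms(1) by (simp add: one_ereal_def)
  then show ?thesis by (rule on_disc_if_radius)
qed

section \<open>A map from the disc avoiding the fourth roots of unity\<close>

text \<open>
  The map is \<open>\<Phi> = \<surd>(tanh u)\<close> with \<open>u = \<pi> z\<^sup>2 / (1 - z\<^sup>4)\<close>. Since tanh omits the values 1 and -1, the
  function \<open>\<Phi>\<^sup>4 - 1 = - 1 / cosh\<^sup>2 u\<close> has no zero. The function \<open>z / (1 - z\<^sup>2)\<close> maps the disc to the plane
  without two half-lines on the imaginary axis; scaled by \<open>\<pi>\<close> and applied to \<open>z\<^sup>2\<close> it omits the poles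
  and the nonzero zeros of tanh, so that \<open>tanh u\<close> is holomorphic with a double zero at the origin as its
  only zero and has a square root. Its leading term is \<open>\<pi> z\<^sup>2\<close>, whence \<open>\<bar>\<Phi>'(0)\<bar> = \<surd>\<pi>\<close>.
\<close>

lemma disc_avoids_fourth_roots:
  obtains \<Phi> :: "complex fps" where
    "fps_nth \<Phi> 0 = 0" "norm (fps_nth \<Phi> 1) = sqrt pi" "on_disc \<Phi>"
    "\<exists>I. on_disc I \<and> I * (\<Phi> ^ 4 - 1) = 1"
proof -
  define D :: "complex set" where "D = ball 0 1"
  have z4: "1 - z ^ 4 \<noteq> 0" if "z \<in> D" for z
  proof
    assume "1 - z ^ 4 = 0"
    then have "norm (z ^ 4) = 1" by (metis norm_one right_minus_eq)
    then have "norm z ^ 4 = 1" by (simp add: norm_power)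
    moreover have "norm z ^ 4 < 1" using that by (simp add: D_def power_less_one_iff)
    ultimately show False by simp
  qed
  define u where "u = (\<lambda>z::complex. of_real pi * z ^ 2 / (1 - z ^ 4))"
  \<comment> \<open>the poles and the nonzero zeros of tanh lie on these two half-lines of the imaginary axis\<close>
  have u_avoid: "Re (u z) \<noteq> 0 \<or> \<bar>Im (u z)\<bar> < pi / 2" if z: "z \<in> D" for z
  proof (rule ccontr)
    assume a: "\<not> (Re (u z) \<noteq> 0 \<or> \<bar>Im (u z)\<bar> < pi / 2)"
    define t where "t = z ^ 2"
    have nt: "norm t < 1"
      using z by (simp add: t_def D_def norm_power power_less_one_iff)
    obtain y where y: "u z = \<i> * of_real y" "\<bar>y\<bar> \<ge> pi / 2"
      using a by (intro that[of "Im (u z)"]) (auto simp: complex_eq_iff)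
    have z4t: "z ^ 4 = t ^ 2" by (simp add: t_def flip: power_mult)
    have y0: "y \<noteq> 0" using y(2) pi_gt_zero by force
    have "of_real pi * t = \<i> * of_real y * (1 - t ^ 2)"
      using y(1) z4[OF z] unfolding u_def z4t t_def[symmetric] by (simp add: field_simps)
    then have eq: "t ^ 2 + (- \<i> * of_real (pi / y)) * t - 1 = 0"
    proof -
      have "- \<i> * (of_real pi * t) = of_real y * (1 - t ^ 2)"
        unfolding \<open>of_real pi * t = \<i> * of_real y * (1 - t ^ 2)\<close> by (simp flip: mult.assoc)
      then have "of_real y * (t ^ 2 + (- \<i> * of_real (pi / y)) * t - 1) = 0"
        using y0 by (simp add: algebra_simps)
      then show ?thesis using y0 by (simp del: of_real_divide)
    qed
    \<comment> \<open>with \<open>t = \<i> s\<close> the equation has the real middle coefficient \<open>- \<pi> / y\<close>, of absolute value at most 2, so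
       that its roots lie on the unit circle\<close>
    define s where "s = - \<i> * t"
    have "s ^ 2 - of_real (pi / y) * s + 1 = 0"
      using eq unfolding s_def by (simp add: power_mult_distrib algebra_simps)
    define p where "p = pi / y"
    have p2: "\<bar>p\<bar> \<le> 2" using y(2) y0 unfolding p_def by (simp add: abs_divide divide_le_eq field_simps)
    have sq: "s ^ 2 - of_real p * s + 1 = 0" using \<open>s ^ 2 - of_real (pi / y) * s + 1 = 0\<close> by (simp add: p_def)
    have re: "Re s ^ 2 - Im s ^ 2 - p * Re s + 1 = 0" and im: "2 * Re s * Im s - p * Im s = 0"
      using arg_cong[OF sq, of Re] arg_cong[OF sq, of Im] by (auto simp: power2_eq_square)
    have "norm s = norm t" by (simp add: s_def norm_mult)
    then have ns: "(Re s)\<^sup>2 + (Im s)\<^sup>2 < 1"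
      using nt by (metis cmod_power2 norm_ge_zero power_less_one_iff zero_less_numeral)
    show False
    proof (cases "Im s = 0")
      case True
      have "p * Re s \<le> 2 * \<bar>Re s\<bar>" using p2 by (metis abs_ge_self abs_mult mult_right_mono abs_ge_zero order_trans)
      then have "(1 - \<bar>Re s\<bar>)\<^sup>2 \<le> 0" using re True by (simp add: power2_eq_square algebra_simps)
      then have "\<bar>Re s\<bar> = 1" by simp
      then show False using ns True by (metis add.right_neutral less_irrefl power2_abs power_one zero_power2)
    next
      case False
      then have "p = 2 * Re s" using im by (simp add: algebra_simps)
      then show False using re ns by (simp add: power2_eq_square)
    qed
  qed
  have cosh_ne: "cosh (u z) \<noteq> 0" if z: "z \<in> D" for z
  proof
    assume "cosh (u z) = 0"
    then have "cos (\<i> * u z) = 0" by (simp add: cosh_conv_cos)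
    then obtain n where n: "\<i> * u z = of_real (real_of_int n * pi) + of_real pi / 2"
      unfolding cos_eq_0 by auto
    then have "u z = - \<i> * of_real (real_of_int n * pi + pi / 2)"
      by (simp add: complex_eq_iff)
    then have "Re (u z) = 0" "Im (u z) = - (real_of_int n * pi + pi / 2)" by auto
    then have "\<bar>- (real_of_int n * pi + pi / 2)\<bar> < pi / 2" using u_avoid[OF z] by metis
    then have "\<bar>real_of_int n * pi + pi / 2\<bar> < pi / 2" by linarith
    moreover have "real_of_int n * pi + pi / 2 = (pi / 2) * (2 * real_of_int n + 1)"
      by (simp add: algebra_simps)
    ultimately have "(pi / 2) * \<bar>2 * real_of_int n + 1\<bar> < (pi / 2) * 1" by (simp add: abs_mult)
    then have "\<bar>2 * real_of_int n + 1\<bar> < 1" using pi_gt_zero mult_less_cancel_left_pos by fastforce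
    then have "\<bar>2 * n + 1\<bar> < 1" by linarith
    then show False by presburger
  qed
  have sinh_ne: "u z = 0" if z: "z \<in> D" and s0: "sinh (u z) = 0" for z
  proof -
    have "sin (\<i> * u z) = 0" using s0 by (simp add: sinh_conv_sin)
    then obtain n where n: "\<i> * u z = of_real (real_of_int n * pi)"
      unfolding sin_eq_0 by auto
    then have e: "u z = - \<i> * of_real (real_of_int n * pi)"
      by (simp add: complex_eq_iff)
    then have "Re (u z) = 0" "Im (u z) = - (real_of_int n * pi)" by auto
    then have "\<bar>real_of_int n * pi\<bar> < pi / 2" using u_avoid[OF z] by auto
    then have "\<bar>real_of_int n\<bar> * pi < 1 * pi" by (simp add: abs_mult)
    then have "\<bar>real_of_int n\<bar> < 1" by simp
    then have "n = 0" by linarith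
    then show ?thesis using e by simp
  qed
  have u_holo: "u holomorphic_on D"
    unfolding u_def using z4 by (intro holomorphic_intros) auto
  \<comment> \<open>g is \<open>tanh u / z\<^sup>2\<close>, made to have no singularity at the origin\<close>
  define S where "S = (\<lambda>v::complex. if v = 0 then 1 else sinh v / v)"
  have S_holo: "S holomorphic_on UNIV"
  proof -
    have "sinh holomorphic_on (UNIV :: complex set)"
      unfolding holomorphic_on_def field_differentiable_def
      by (auto intro!: exI derivative_eq_intros)
    then have "(\<lambda>w. if w = 0 then deriv sinh 0 else (sinh w - sinh 0) / (w - 0)) holomorphic_on (UNIV :: complex set)"
      by (rule pole_lemma_open) simp
    moreover have "deriv sinh (0::complex) = 1"
      by (rule DERIV_imp_deriv) (auto intro!: derivative_eq_intros)
    ultimately show ?thesis unfolding S_def by (simp only: sinh_0 diff_zero)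
  qed
  have S_sinh: "S v * v = sinh v" for v by (auto simp: S_def)
  define g where "g = (\<lambda>z. S (u z) / cosh (u z) * (of_real pi / (1 - z ^ 4)))"
  have g_holo: "g holomorphic_on D"
  proof -
    have "(S \<circ> u) holomorphic_on D"
      by (rule holomorphic_on_compose_gen[OF u_holo S_holo]) auto
    moreover have "(\<lambda>z. cosh (u z)) holomorphic_on D"
      unfolding cosh_conv_cos using u_holo by (intro holomorphic_intros)
    ultimately show ?thesis
      unfolding g_def using cosh_ne z4 by (intro holomorphic_intros) (auto simp: o_def)
  qed
  have g_ne: "g z \<noteq> 0" if z: "z \<in> D" for z
  proof -
    have "S (u z) \<noteq> 0" using sinh_ne[OF z] by (auto simp: S_def)
    then show ?thesis using cosh_ne[OF z] z4[OF z] by (simp add: g_def)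
  qed
  have g_tanh: "z ^ 2 * g z = sinh (u z) / cosh (u z)" for z
    by (simp add: g_def u_def mult_ac flip: S_sinh)
  have "simply_connected D" unfolding D_def by (simp add: convex_imp_simply_connected)
  then obtain h where h: "h holomorphic_on D" "\<And>z. z \<in> D \<Longrightarrow> g z = h z ^ 2"
    using simply_connected_eq_holomorphic_sqrt[of D] g_holo g_ne unfolding D_def by blast
  define \<phi> where "\<phi> = (\<lambda>z. z * h z)"
  have \<phi>_holo: "\<phi> holomorphic_on D" unfolding \<phi>_def using h by (intro holomorphic_intros)
  define F where "F = fps_expansion h 0"
  have hF: "h has_fps_expansion F"
    unfolding F_def using h(1)
    by (intro has_fps_expansion_fps_expansion[of D]) (auto simp: D_def)
  have \<phi>F: "\<phi> has_fps_expansion (fps_X * F)"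
    unfolding \<phi>_def by (intro fps_expansion_intros hF)
  define I where "I = (\<lambda>z. - (cosh (u z) ^ 2))"
  have I_holo: "I holomorphic_on D" unfolding I_def cosh_conv_cos using u_holo by (intro holomorphic_intros)
  define G where "G = fps_expansion I 0"
  have IG: "I has_fps_expansion G"
    unfolding G_def using I_holo
    by (intro has_fps_expansion_fps_expansion[of D]) (auto simp: D_def)
  have one: "I z * (\<phi> z ^ 4 - 1) = 1" if z: "z \<in> D" for z
  proof -
    have "\<phi> z ^ 4 = (z ^ 2 * h z ^ 2) ^ 2" by (simp add: \<phi>_def power_mult_distrib flip: power_mult)
    also have "\<dots> = (sinh (u z) / cosh (u z)) ^ 2" using g_tanh[of z] h(2)[OF z] by simp
    finally have "I z * (\<phi> z ^ 4 - 1) = cosh (u z) ^ 2 - sinh (u z) ^ 2"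
      using cosh_ne[OF z] by (simp add: I_def power_divide field_simps)
    then show ?thesis by (simp add: cosh_square_eq)
  qed
  have "(\<lambda>z. I z * (\<phi> z ^ 4 - 1)) has_fps_expansion (G * ((fps_X * F) ^ 4 - 1))"
    by (intro fps_expansion_intros IG \<phi>F)
  moreover have "(\<lambda>z. I z * (\<phi> z ^ 4 - 1)) has_fps_expansion 1 \<longleftrightarrow> (\<lambda>z::complex. 1::complex) has_fps_expansion 1"
  proof (rule has_fps_expansion_cong)
    have "eventually (\<lambda>z. z \<in> D) (nhds (0::complex))"
      by (intro eventually_nhds_in_open) (auto simp: D_def)
    then show "eventually (\<lambda>z. I z * (\<phi> z ^ 4 - 1) = 1) (nhds 0)"
      by eventually_elim (rule one)
  qed simp
  ultimately have inv1: "G * ((fps_X * F) ^ 4 - 1) = 1"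
    using fps_expansion_unique_complex by auto
  have F0: "fps_nth F 0 = h 0" using hF by (simp add: has_fps_expansion_imp_0_eq_fps_nth_0)
  have "h 0 ^ 2 = g 0" using h(2)[of 0] by (simp add: D_def)
  also have "g 0 = of_real pi" by (simp add: g_def u_def S_def)
  finally have "norm (h 0) ^ 2 = pi" by (metis norm_of_real norm_power abs_of_pos pi_gt_zero)
  then have "norm (h 0) = sqrt pi" by (metis norm_ge_zero real_sqrt_unique)
  then show ?thesis
    using that[of "fps_X * F"] F0 on_disc_expansion[OF _ \<phi>F] \<phi>_holo on_disc_expansion[OF _ IG] I_holo inv1
    by (auto simp: D_def)
qed

section \<open>The coordinate ring of the curve\<close>

definition q4 :: "rat fps" where "q4 = fps_X ^ 4 - 1"

lemma fps_of_poly_q4: "fps_of_poly [:-1, 0, 0, 0, 1:] = q4"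
  by (rule fps_ext) (simp add: q4_def fps_X_power_nth coeff_pCons split: nat.split)

lemma q4_unit: "inverse (q4 ^ k) * q4 ^ k = 1" "q4 ^ k * inverse (q4 ^ k) = 1"
proof -
  have "fps_nth (q4 ^ k) 0 \<noteq> 0" by (simp add: q4_def fps_X_power_nth)
  then show "inverse (q4 ^ k) * q4 ^ k = 1" "q4 ^ k * inverse (q4 ^ k) = 1"
    by (simp_all add: inverse_mult_eq_1 inverse_mult_eq_1')
qed

lemma q4_nonzero [simp]: "q4 \<noteq> 0"
  using q4_unit(1)[of 1] by auto

lemma carrier_curve_ring:
  "f \<in> carrier (curve_ring C) \<longleftrightarrow> (\<exists>a k. (\<forall>i. poly.coeff a i \<in> C) \<and> f * q4 ^ k = fps_of_poly a)"
proof -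
  have "f = fps_of_poly a * inverse (q4 ^ k) \<longleftrightarrow> f * q4 ^ k = fps_of_poly a" for a k
  proof
    assume "f = fps_of_poly a * inverse (q4 ^ k)"
    then show "f * q4 ^ k = fps_of_poly a" using q4_unit(1)[of k] by (simp add: mult.assoc)
  next
    assume "f * q4 ^ k = fps_of_poly a"
    then have "fps_of_poly a * inverse (q4 ^ k) = f * (q4 ^ k * inverse (q4 ^ k))" by (simp add: mult.assoc)
    then show "f = fps_of_poly a * inverse (q4 ^ k)" by (simp add: q4_unit)
  qed
  then show ?thesis
    unfolding curve_ring_def fps_subring_def by (auto simp: fps_of_poly_power fps_of_poly_q4)
qed

lemma curve_ring_simps [simp]:
  "a \<otimes>\<^bsub>curve_ring C\<^esub> b = a * b" "a \<oplus>\<^bsub>curve_ring C\<^esub> b = a + b"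
  "\<one>\<^bsub>curve_ring C\<^esub> = 1" "\<zero>\<^bsub>curve_ring C\<^esub> = 0"
  by (simp_all add: curve_ring_def fps_subring_def)

lemma curve_ring_pow [simp]: "a [^]\<^bsub>curve_ring C\<^esub> (k::nat) = a ^ k"
  by (induction k) (simp_all add: mult.commute)

lemma O_X_simps [simp]:
  "a \<otimes>\<^bsub>O_X\<^esub> b = a * b" "a \<oplus>\<^bsub>O_X\<^esub> b = a + b"
  "\<one>\<^bsub>O_X\<^esub> = 1" "\<zero>\<^bsub>O_X\<^esub> = 0"
  "a [^]\<^bsub>O_X\<^esub> (k::nat) = a ^ k"
  by (simp_all add: O_X_def)

abbreviation OX :: "rat fps set" where "OX \<equiv> carrier O_X"

lemma OX_iff: "f \<in> OX \<longleftrightarrow> (\<exists>a k. f * q4 ^ k = fps_of_poly a)"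
  by (simp add: O_X_def carrier_curve_ring)

lemma OX_poly [simp]: "fps_of_poly a \<in> OX"
  unfolding OX_iff by (rule exI[of _ a], rule exI[of _ 0]) simp

lemma OX_const [simp]: "fps_const c \<in> OX" using OX_poly[of "[:c:]"] by (simp add: fps_of_poly_const)
lemma OX_0 [simp]: "0 \<in> OX" using OX_poly[of 0] by simp
lemma OX_1 [simp]: "1 \<in> OX" using OX_poly[of 1] by simp
lemma OX_q4 [simp]: "q4 \<in> OX" using OX_poly fps_of_poly_q4 by metis

lemma OX_add [simp]: assumes "f \<in> OX" "g \<in> OX" shows "f + g \<in> OX"
proof -
  obtain a k where a: "f * q4 ^ k = fps_of_poly a" using assms OX_iff by blast
  obtain b l where b: "g * q4 ^ l = fps_of_poly b" using assms OX_iff by blast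
  have "(f + g) * q4 ^ (k + l) = (f * q4 ^ k) * q4 ^ l + (g * q4 ^ l) * q4 ^ k"
    by (simp add: power_add algebra_simps)
  also have "\<dots> = fps_of_poly (a * [:-1,0,0,0,1:] ^ l + b * [:-1,0,0,0,1:] ^ k)"
    unfolding a b by (simp add: fps_of_poly_add fps_of_poly_mult fps_of_poly_power fps_of_poly_q4)
  finally show ?thesis unfolding OX_iff by blast
qed

lemma OX_mult [simp]: assumes "f \<in> OX" "g \<in> OX" shows "f * g \<in> OX"
proof -
  obtain a k where a: "f * q4 ^ k = fps_of_poly a" using assms OX_iff by blast
  obtain b l where b: "g * q4 ^ l = fps_of_poly b" using assms OX_iff by blast
  have "(f * g) * q4 ^ (k + l) = (f * q4 ^ k) * (g * q4 ^ l)"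
    by (simp add: power_add algebra_simps)
  also have "\<dots> = fps_of_poly (a * b)"
    unfolding a b by (simp add: fps_of_poly_mult)
  finally show ?thesis unfolding OX_iff by blast
qed

lemma OX_uminus [simp]: assumes "f \<in> OX" shows "- f \<in> OX"
proof -
  have "- f = fps_const (-1) * f" by (rule fps_ext) simp
  then show ?thesis using assms by (metis OX_const OX_mult)
qed

lemma OX_diff [simp]: "f \<in> OX \<Longrightarrow> g \<in> OX \<Longrightarrow> f - g \<in> OX"
  using OX_add[of f "- g"] by simp

lemma OX_power [simp]: "f \<in> OX \<Longrightarrow> f ^ n \<in> OX" by (induction n) auto

lemma OX_sum: "(\<And>a. a \<in> A \<Longrightarrow> f a \<in> OX) \<Longrightarrow> sum f A \<in> OX"
  by (induction A rule: infinite_finite_induct) auto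

lemma OX_prod: "(\<And>a. a \<in> A \<Longrightarrow> f a \<in> OX) \<Longrightarrow> prod f A \<in> OX"
  by (induction A rule: infinite_finite_induct) auto

lemma OX_inverse_q4 [simp]: "inverse (q4 ^ k) \<in> OX"
  unfolding OX_iff by (rule exI[of _ 1], rule exI[of _ k]) (simp add: q4_unit)

lemma OX_deriv [simp]: assumes "f \<in> OX" shows "fps_deriv f \<in> OX"
proof -
  obtain a k where a: "f * q4 ^ k = fps_of_poly a" using assms OX_iff by blast
  have "fps_deriv (f * q4 ^ k) = fps_deriv f * q4 ^ k + f * fps_deriv (q4 ^ k)" by simp
  moreover have "fps_deriv (q4 ^ k) = fps_of_poly (pderiv ([:-1,0,0,0,1:] ^ k))"
    by (simp add: fps_of_poly_pderiv fps_of_poly_power fps_of_poly_q4)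
  ultimately have "fps_deriv f * q4 ^ k = fps_of_poly (pderiv a) - f * fps_of_poly (pderiv ([:-1,0,0,0,1:] ^ k))"
    unfolding a by (simp add: fps_of_poly_pderiv)
  also have "\<dots> \<in> OX" using assms by (intro OX_diff OX_mult) auto
  finally have "fps_deriv f * q4 ^ k * inverse (q4 ^ k) \<in> OX" by (rule OX_mult) simp
  then show ?thesis by (simp add: mult.assoc q4_unit)
qed

lemma cring_O_X: "cring O_X"
proof (rule cringI)
  show "abelian_group O_X"
  proof (rule abelian_groupI)
    fix x assume "x \<in> OX"
    then show "\<exists>y\<in>OX. y \<oplus>\<^bsub>O_X\<^esub> x = \<zero>\<^bsub>O_X\<^esub>" by (intro bexI[of _ "- x"]) auto
  qed (auto simp: algebra_simps)
  show "Group.comm_monoid O_X" by (rule comm_monoidI) (auto simp: algebra_simps)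
qed (auto simp: algebra_simps)

text \<open>
  A nonzero polynomial in the ideal, differentiated as often as its degree, becomes a nonzero constant.
  This is the device by which statements over the function field, which hold up to a denominator, are
  turned into statements over the whole curve: the admissible denominators form an ideal that is stable
  under differentiation.
\<close>

lemma derivation_stable_ideal_unit:
  assumes I: "\<And>f g. f \<in> I \<Longrightarrow> g \<in> OX \<Longrightarrow> g * f \<in> I" "\<And>f. f \<in> I \<Longrightarrow> fps_deriv f \<in> I"
    and f: "f \<in> I" "f \<in> OX" "f \<noteq> 0"
  shows "1 \<in> I"
proof -
  have *: "1 \<in> I" if "fps_of_poly a \<in> I" "a \<noteq> 0" for a :: "rat poly"
    using that
  proof (induction "Polynomial.degree a" arbitrary: a)
    case 0
    then obtain c where c: "a = [:c:]" "c \<noteq> 0" by (metis degree_eq_zeroE pCons_eq_0_iff)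
    then have "fps_const (inverse c) * fps_of_poly a \<in> I" using I(1)[OF 0(2)] by simp
    then show ?case using c by (simp add: fps_of_poly_const)
  next
    case (Suc n)
    have "Polynomial.degree (pderiv a) = n" using Suc(2) by (simp add: degree_pderiv)
    moreover have "pderiv a \<noteq> 0" using Suc(2) by (simp add: pderiv_eq_0_iff)
    moreover have "fps_of_poly (pderiv a) \<in> I" using I(2)[OF Suc(3)] by (simp add: fps_of_poly_pderiv)
    ultimately show ?case using Suc(1)[of "pderiv a"] by blast
  qed
  obtain a k where a: "f * q4 ^ k = fps_of_poly a" using f(2) OX_iff by blast
  then have "fps_of_poly a \<in> I" using I(1)[OF f(1), of "q4 ^ k"] by (simp add: mult.commute)
  moreover have "a \<noteq> 0" using a f(3) by auto
  ultimately show ?thesis by (rule *)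
qed

section \<open>Algebraicity of solutions of linear systems\<close>

lemma on_disc_deriv:
  assumes "on_disc f" shows "on_disc (fps_deriv f)"
proof (rule on_disc_iff_geometric)
  fix \<rho> :: real assume \<rho>: "0 < \<rho>" "\<rho> < 1"
  obtain \<sigma> where \<sigma>: "\<rho> < \<sigma>" "\<sigma> < 1" using \<rho> dense by blast
  obtain B where B: "bnd \<sigma> f B" using assms \<rho> \<sigma> unfolding on_disc_def by (meson order_less_trans)
  define q where "q = \<rho> / \<sigma>"
  have q: "0 < q" "q < 1" using \<rho> \<sigma> by (auto simp: q_def)
  have "(\<lambda>n. real (n + 1) * q ^ n) \<longlonglongrightarrow> 0" using q by real_asymp
  then have "bounded (range (\<lambda>n. real (n + 1) * q ^ n))"
    using convergent_imp_bounded convergentI by blast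
  then obtain K where K: "\<And>n. norm (real (n + 1) * q ^ n) \<le> K" unfolding bounded_iff by auto
  have "norm (fps_nth (fps_deriv f) n) * \<rho> ^ n \<le> B / \<sigma> * K" for n
  proof -
    have \<sigma>0: "\<sigma> > 0" using \<rho> \<sigma> by simp
    have "norm (fps_nth (fps_deriv f) n) * \<rho> ^ n = (norm (fps_nth f (n + 1)) * \<sigma> ^ (n + 1)) / \<sigma> * (real (n + 1) * q ^ n)"
      using \<sigma>0 by (simp add: q_def power_divide norm_mult flip: of_nat_Suc)
    also have "\<dots> \<le> B / \<sigma> * K"
      using bnd_nth[OF B \<sigma>0, of "n + 1"] bnd_nonneg[OF B \<sigma>0] K[of n] \<sigma>0 q
      by (intro mult_mono divide_right_mono) auto
    finally show ?thesis .
  qed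
  then show "\<exists>B. \<forall>n. norm (fps_nth (fps_deriv f) n) * \<rho> ^ n \<le> B" by blast
qed

text \<open>
  Elements of the coordinate ring have poles only at the points that \<open>\<Phi>\<close> avoids.
\<close>

lemma on_disc_OX_compose:
  assumes f: "f \<in> OX" and \<Phi>: "fps_nth \<Phi> 0 = 0" "on_disc \<Phi>" "on_disc I" "I * (\<Phi> ^ 4 - 1) = 1"
  shows "on_disc (fps_compose (cfps f) \<Phi>)"
proof -
  obtain a k where a: "f * q4 ^ k = fps_of_poly a" using f OX_iff by blast
  have "cfps f * cfps q4 ^ k = cfps (fps_of_poly a)" using a by (metis cfps_mult cfps_power)
  then have "fps_compose (cfps f) \<Phi> * fps_compose (cfps q4) \<Phi> ^ k = fps_compose (cfps (fps_of_poly a)) \<Phi>"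
    by (metis \<Phi>(1) fps_compose_mult_distrib fps_compose_power)
  moreover have "fps_compose (cfps q4) \<Phi> = \<Phi> ^ 4 - 1"
  proof -
    have "cfps q4 = fps_X ^ 4 - 1"
      using cfps_add[of "fps_X ^ 4" "- 1"] by (simp add: q4_def cfps_minus cfps_power)
    then show ?thesis
      using \<Phi>(1) by (simp add: fps_compose_sub_distrib fps_compose_power[symmetric] fps_X_fps_compose_startby0)
  qed
  ultimately have "fps_compose (cfps f) \<Phi> * ((\<Phi> ^ 4 - 1) ^ k * I ^ k) = fps_compose (cfps (fps_of_poly a)) \<Phi> * I ^ k"
    by (simp add: mult.assoc)
  then have e: "fps_compose (cfps f) \<Phi> = fps_compose (cfps (fps_of_poly a)) \<Phi> * I ^ k"
    using \<Phi>(4) by (simp flip: power_mult_distrib) (simp add: mult.commute)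
  have "on_disc (fps_compose (cfps (fps_of_poly a)) \<Phi>)"
  proof (induction a)
    case 0 show ?case using on_disc_const[of 0] by simp
  next
    case (pCons c a)
    have "fps_compose (cfps (fps_of_poly (pCons c a))) \<Phi> = fps_const (of_rat c) + \<Phi> * fps_compose (cfps (fps_of_poly a)) \<Phi>"
      using \<Phi>(1) by (simp add: fps_of_poly_pCons cfps_add cfps_mult cfps_const fps_compose_add_distrib
          fps_compose_mult_distrib fps_X_fps_compose_startby0 mult.commute)
    then show ?case using pCons \<Phi>(2) by (simp add: on_disc_add on_disc_mult on_disc_const)
  qed
  then show ?thesis unfolding e using \<Phi>(3) by (intro on_disc_mult on_disc_power)
qed

text \<open>
  By the chain rule the pulled back series solve a linear system that is holomorphic on the disc.
\<close>

lemma on_disc_ode_compose: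
  fixes G :: "nat \<Rightarrow> nat \<Rightarrow> rat fps" and v :: "nat \<Rightarrow> rat fps" and r :: nat
  assumes G: "\<And>i j. i < r \<Longrightarrow> j < r \<Longrightarrow> G i j \<in> OX"
    and v: "\<And>i. i < r \<Longrightarrow> fps_deriv (v i) = - (\<Sum>j<r. G i j * v j)"
    and \<Phi>: "fps_nth \<Phi> 0 = 0" "on_disc \<Phi>" "on_disc I" "I * (\<Phi> ^ 4 - 1) = 1" and i: "i < r"
  shows "on_disc (fps_compose (cfps (v i)) \<Phi>)"
proof (rule linear_ode_on_disc[where r = r and H = "\<lambda>i j. fps_const (-1) * fps_compose (cfps (G i j)) \<Phi> * fps_deriv \<Phi>"
      and W = "\<lambda>i. fps_compose (cfps (v i)) \<Phi>"])
  fix i assume i: "i < r"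
  have "fps_deriv (fps_compose (cfps (v i)) \<Phi>) = fps_compose (cfps (fps_deriv (v i))) \<Phi> * fps_deriv \<Phi>"
    using \<Phi>(1) by (simp add: fps_compose_deriv cfps_deriv)
  also have "\<dots> = (\<Sum>j<r. fps_const (- 1) * fps_compose (cfps (G i j)) \<Phi> * fps_deriv \<Phi> * fps_compose (cfps (v j)) \<Phi>)"
    unfolding v[OF i] using \<Phi>(1)
    by (simp add: cfps_minus cfps_sum cfps_mult fps_compose_uminus fps_compose_sum_distrib
        fps_compose_mult_distrib sum_distrib_right sum_distrib_left mult_ac sum_negf flip: fps_const_neg)
  finally show "fps_deriv (fps_compose (cfps (v i)) \<Phi>) = (\<Sum>j<r. fps_const (- 1) * fps_compose (cfps (G i j)) \<Phi> * fps_deriv \<Phi> * fps_compose (cfps (v j)) \<Phi>)" .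
next
  fix i j assume "i < r" "j < r"
  then show "on_disc (fps_const (- 1) * fps_compose (cfps (G i j)) \<Phi> * fps_deriv \<Phi>)"
    using G \<Phi> by (intro on_disc_mult on_disc_const on_disc_deriv on_disc_OX_compose[of _ _ I])
qed (rule i)

lemma horizontal_section_algebraic:
  fixes G :: "nat \<Rightarrow> nat \<Rightarrow> rat fps" and v :: "nat \<Rightarrow> rat fps" and r :: nat
  assumes G: "\<And>i j. i < r \<Longrightarrow> j < r \<Longrightarrow> G i j \<in> OX"
    and v: "\<And>i. i < r \<Longrightarrow> fps_deriv (v i) = - (\<Sum>j<r. G i j * v j)"
    and i: "i < r"
    and S: "finite S" "\<And>p. p \<in> S \<Longrightarrow> Factorial_Ring.prime p" "3 \<in> S" "5 \<in> S"
    and good: "\<And>p m. Factorial_Ring.prime p \<Longrightarrow> p \<notin> S \<Longrightarrow> padic_abs p (fps_nth (v i) m) \<le> real p ^ good_exp p m"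
    and bad: "\<And>p. p \<in> S \<Longrightarrow> v i \<in> convergent_fps p (disc_radius p)"
  shows "alg_fps (v i)"
proof -
  obtain \<Lambda> k where L: "k \<ge> 0" "\<And>J T. \<Lambda> J T > 0"
    "\<And>J T. real (\<Lambda> J T) \<le> exp (k * real J + 564 / 1000 * real T)"
    "\<And>J T j m. j \<le> J \<Longrightarrow> m \<le> T \<Longrightarrow> of_nat (\<Lambda> J T) * fps_nth (v i ^ j) m \<in> \<int>"
    using common_denominators[OF S good bad] by blast
  obtain \<Phi> I where \<Phi>: "fps_nth \<Phi> 0 = 0" "norm (fps_nth \<Phi> 1) = sqrt pi" "on_disc \<Phi>"
    "on_disc I" "I * (\<Phi> ^ 4 - 1) = 1"
    using disc_avoids_fourth_roots by metis
  have w: "on_disc (fps_compose (cfps (v i)) \<Phi>)"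
    by (rule on_disc_ode_compose[OF G v \<Phi>(1,3-5) i])
  \<comment> \<open>the identity map of the disc avoids the four points too, so the series itself converges on the disc\<close>
  have geo: "on_disc (Abs_fps (\<lambda>n. if 4 dvd n then - 1 else 0))" (is "on_disc ?I")
  proof (rule on_disc_iff_geometric)
    fix \<rho> :: real assume "0 < \<rho>" "\<rho> < 1"
    then show "\<exists>B. \<forall>n. norm (fps_nth ?I n) * \<rho> ^ n \<le> B"
      by (intro exI[of _ 1]) (auto simp: power_le_one)
  qed
  have "?I * (fps_X ^ 4 - 1) = 1"
  proof (rule fps_ext)
    fix n :: nat
    have d: "4 dvd n - 4 \<longleftrightarrow> 4 dvd n" if "n \<ge> 4" for n :: nat using that by (simp add: dvd_minus_self)
    have "n < 4 \<Longrightarrow> 4 dvd n \<Longrightarrow> n = 0" by (auto dest: dvd_imp_le)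
    then show "fps_nth (?I * (fps_X ^ 4 - 1)) n = fps_nth 1 n"
      by (auto simp: right_diff_distrib fps_X_power_mult_right_nth d)
  qed
  moreover have "on_disc fps_X"
  proof (rule on_disc_iff_geometric)
    fix \<rho> :: real assume "0 < \<rho>" "\<rho> < 1"
    then show "\<exists>B. \<forall>n. norm (fps_nth (fps_X :: complex fps) n) * \<rho> ^ n \<le> B"
      by (intro exI[of _ 1]) (auto simp: fps_X_nth power_le_one)
  qed
  ultimately have "on_disc (fps_compose (cfps (v i)) fps_X)"
    by (intro on_disc_ode_compose[OF G v _ _ geo _ i]) auto
  then have y: "on_disc (cfps (v i))" by simp
  show ?thesis
    by (rule algebraicity_criterion[OF \<Phi>(1,3) w y L(4,2,3,1)]) (use \<Phi>(2) ln_sqrt_pi in auto)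
qed

section \<open>Prime ideals and local properties\<close>

text \<open>
  A maximal element among the ideals containing I that are disjoint from T is prime.
\<close>

lemma prime_ideal_avoiding:
  fixes R (structure)
  assumes R: "cring R" and I: "ideal I R" and T: "T \<subseteq> carrier R" "\<one> \<in> T" "\<And>a b. a \<in> T \<Longrightarrow> b \<in> T \<Longrightarrow> a \<otimes> b \<in> T"
    and IT: "I \<inter> T = {}"
  obtains P where "primeideal P R" "I \<subseteq> P" "P \<inter> T = {}"
proof -
  interpret cring R by fact
  define \<A> where "\<A> = {J. ideal J R \<and> I \<subseteq> J \<and> J \<inter> T = {}}"
  have "\<exists>P\<in>\<A>. \<forall>J\<in>\<A>. P \<subseteq> J \<longrightarrow> J = P"
  proof (rule subset_Zorn_nonempty)
    show "\<A> \<noteq> {}" using I IT by (auto simp: \<A>_def)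
    fix \<C> assume C: "\<C> \<noteq> {}" "subset.chain \<A> \<C>"
    then have "subset.chain {J. ideal J R} \<C>" unfolding pred_on.chain_def \<A>_def by auto
    from chain_Union_is_ideal[OF this] C(1) have "ideal (\<Union>\<C>) R" by simp
    moreover have "\<C> \<subseteq> \<A>" using C(2) by (simp add: pred_on.chain_def)
    then have "I \<subseteq> \<Union>\<C>" "\<Union>\<C> \<inter> T = {}" using C(1) unfolding \<A>_def by blast+
    ultimately show "\<Union>\<C> \<in> \<A>" by (simp add: \<A>_def)
  qed
  then obtain P where P: "P \<in> \<A>" and max: "\<And>J. J \<in> \<A> \<Longrightarrow> P \<subseteq> J \<Longrightarrow> J = P" by blast
  have Pi: "ideal P R" and IP: "I \<subseteq> P" and PT: "P \<inter> T = {}" using P by (auto simp: \<A>_def)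
  interpret P: ideal P R by fact
  have meets: "\<exists>u\<in>P. \<exists>s\<in>carrier R. u \<oplus> s \<otimes> a \<in> T" if a: "a \<in> carrier R" "a \<notin> P" for a
  proof -
    let ?J = "set_add R P (PIdl a)"
    have mem: "x \<in> ?J \<longleftrightarrow> (\<exists>u\<in>P. \<exists>s\<in>carrier R. x = u \<oplus> s \<otimes> a)" for x
      unfolding set_add_def' cgenideal_def by auto
    have J: "ideal ?J R" by (rule add_ideals[OF Pi cgenideal_ideal[OF a(1)]])
    have PJ: "P \<subseteq> ?J"
    proof
      fix u assume "u \<in> P"
      moreover from this have "u \<in> carrier R" using P.a_subset by blast
      then have "u = u \<oplus> \<zero> \<otimes> a" using a by simp
      ultimately show "u \<in> ?J" unfolding mem by blast
    qed
    have "a = \<zero> \<oplus> \<one> \<otimes> a" using a by simp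
    then have "a \<in> ?J" unfolding mem using P.zero_closed by blast
    then have "?J \<noteq> P" using a by blast
    then have "?J \<notin> \<A>" using max PJ by blast
    then have "?J \<inter> T \<noteq> {}" using J PJ IP unfolding \<A>_def by blast
    then obtain x where "x \<in> ?J" "x \<in> T" by blast
    then show ?thesis using mem by auto
  qed
  have "primeideal P R"
  proof (rule primeidealI[OF Pi R])
    show "carrier R \<noteq> P" using T PT by blast
    fix a b assume ab: "a \<in> carrier R" "b \<in> carrier R" "a \<otimes> b \<in> P"
    show "a \<in> P \<or> b \<in> P"
    proof (rule ccontr)
      assume "\<not> (a \<in> P \<or> b \<in> P)"
      then have "a \<notin> P" "b \<notin> P" by auto
      then obtain u s v t where uv: "u \<in> P" "s \<in> carrier R" "u \<oplus> s \<otimes> a \<in> T"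
        "v \<in> P" "t \<in> carrier R" "v \<oplus> t \<otimes> b \<in> T"
        using meets[OF ab(1)] meets[OF ab(2)] by blast
      have c: "u \<in> carrier R" "v \<in> carrier R" using uv P.a_subset by blast+
      have "(u \<oplus> s \<otimes> a) \<otimes> (v \<oplus> t \<otimes> b) = u \<otimes> (v \<oplus> t \<otimes> b) \<oplus> (s \<otimes> a \<otimes> v \<oplus> s \<otimes> t \<otimes> (a \<otimes> b))"
        using ab uv c by (simp add: l_distr r_distr m_ac a_ac)
      also have "\<dots> \<in> P"
      proof (intro P.a_closed)
        show "u \<otimes> (v \<oplus> t \<otimes> b) \<in> P" using ab uv c by (auto intro: P.I_r_closed)
        show "s \<otimes> a \<otimes> v \<in> P" by (rule P.I_l_closed) (use ab uv c in auto)
        show "s \<otimes> t \<otimes> (a \<otimes> b) \<in> P" by (rule P.I_l_closed) (use ab uv c in auto)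
      qed
      finally show False using T(3)[OF uv(3,6)] PT by blast
    qed
  qed
  then show thesis using IP PT by (rule that)
qed

text \<open>
  An ideal not contained in any prime is the unit ideal. In this form, local properties of a vector bundle
  become global ones.
\<close>

lemma OX_ideal_whole:
  assumes I: "I \<subseteq> OX" "0 \<in> I" "\<And>a b. a \<in> I \<Longrightarrow> b \<in> I \<Longrightarrow> a + b \<in> I" "\<And>a b. a \<in> I \<Longrightarrow> b \<in> OX \<Longrightarrow> b * a \<in> I"
    and P: "\<And>P. primeideal P O_X \<Longrightarrow> \<exists>g\<in>I. g \<notin> P"
  shows "1 \<in> I"
proof (rule ccontr)
  assume n: "1 \<notin> I"
  interpret cring O_X by (rule cring_O_X)
  have "subgroup I (add_monoid O_X)"
  proof (rule add.subgroupI)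
    fix a assume a: "a \<in> I"
    then have "\<ominus>\<^bsub>O_X\<^esub> a = - a"
      using I(1) by (intro minus_equality) auto
    moreover have "fps_const (-1) * a = - a" by (rule fps_ext) simp
    then have "- a \<in> I" using I(4)[OF a, of "fps_const (-1)"] by simp
    ultimately show "\<ominus>\<^bsub>O_X\<^esub> a \<in> I" by simp
  qed (use I in auto)
  then have "ideal I O_X"
    using I by (intro idealI) (auto simp: ring_axioms mult.commute)
  then obtain P where "primeideal P O_X" "I \<subseteq> P"
    using prime_ideal_avoiding[OF cring_O_X, of I "{1}"] n by auto
  then show False using P by blast
qed

lemma primeideal_power_O_X: 
  assumes "primeideal P O_X" "g ^ k \<in> P" "g \<in> OX" shows "g \<in> P"
  using assms(2)
proof (induction k)
  case 0
  then have "1 \<in> P" by simp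
  then have "P = OX" using ideal.one_imp_carrier[of P O_X] assms(1) primeideal.axioms(1) by force
  then show ?case using assms by simp
next
  case (Suc k)
  then have "g \<in> P \<or> g ^ k \<in> P" using primeideal.I_prime[OF assms(1), of g "g ^ k"] assms by simp
  then show ?case using Suc by blast
qed

lemma primeideal_not_1: "primeideal P O_X \<Longrightarrow> 1 \<notin> P"
  using ideal.one_imp_carrier[of P O_X] primeideal.I_notcarr[of P O_X] primeideal.axioms(1) by force

lemma primeideal_origin: "primeideal {f \<in> OX. fps_nth f 0 = 0} O_X" (is "primeideal ?P _")
proof (rule primeidealI[OF _ cring_O_X])
  interpret cring O_X by (rule cring_O_X)
  have "subgroup ?P (add_monoid O_X)"
  proof (rule add.subgroupI)
    fix a assume a: "a \<in> ?P"
    then have "\<ominus>\<^bsub>O_X\<^esub> a = - a" by (intro minus_equality) auto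
    then show "\<ominus>\<^bsub>O_X\<^esub> a \<in> ?P" using a by simp
  qed auto
  then show "ideal ?P O_X" by (intro idealI) (auto simp: ring_axioms)
  have "1 \<in> OX" "1 \<notin> ?P" by auto
  then show "OX \<noteq> ?P" by blast
qed auto

lemma finsum_linear_functional:
  fixes h :: "'m \<Rightarrow> rat fps"
  assumes N: "module (curve_ring C) N" and h: "\<And>m n. m \<in> carrier N \<Longrightarrow> n \<in> carrier N \<Longrightarrow> h (m \<oplus>\<^bsub>N\<^esub> n) = h m + h n"
     "\<And>f m. f \<in> carrier (curve_ring C) \<Longrightarrow> m \<in> carrier N \<Longrightarrow> h (f \<odot>\<^bsub>N\<^esub> m) = f * h m"
    and A: "finite A" "a \<in> A \<rightarrow> carrier (curve_ring C)" "e \<in> A \<rightarrow> carrier N"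
  shows "h (\<Oplus>\<^bsub>N\<^esub>i\<in>A. a i \<odot>\<^bsub>N\<^esub> e i) = (\<Sum>i\<in>A. a i * h (e i))"
proof -
  interpret module "curve_ring C" N by fact
  have h0: "h \<zero>\<^bsub>N\<^esub> = 0" using h(1)[of "\<zero>\<^bsub>N\<^esub>" "\<zero>\<^bsub>N\<^esub>"] by simp
  show ?thesis using A
  proof (induction A rule: finite_induct)
    case empty
    then show ?case by (simp add: h0)
  next
    case (insert x F)
    have 1: "(\<lambda>i. a i \<odot>\<^bsub>N\<^esub> e i) \<in> F \<rightarrow> carrier N" "a x \<odot>\<^bsub>N\<^esub> e x \<in> carrier N"
      using insert by (auto intro!: smult_closed)
    then have "(\<Oplus>\<^bsub>N\<^esub>i\<in>insert x F. a i \<odot>\<^bsub>N\<^esub> e i) = a x \<odot>\<^bsub>N\<^esub> e x \<oplus>\<^bsub>N\<^esub> (\<Oplus>\<^bsub>N\<^esub>i\<in>F. a i \<odot>\<^bsub>N\<^esub> e i)"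
      using insert by (intro finsum_insert) auto
    then show ?case using insert 1 by (simp add: h finsum_closed Pi_iff)
  qed
qed

section \<open>Finitely generated torsion-free modules are free\<close>

definition span_OX :: "'j set \<Rightarrow> ('j \<Rightarrow> nat \<Rightarrow> rat fps) \<Rightarrow> (nat \<Rightarrow> rat fps) set" where
  "span_OX J b = {w. \<exists>a. (\<forall>j\<in>J. a j \<in> OX) \<and> (\<forall>i. w i = (\<Sum>j\<in>J. a j * b j i))}"

definition indep_OX :: "'j set \<Rightarrow> ('j \<Rightarrow> nat \<Rightarrow> rat fps) \<Rightarrow> bool" where
  "indep_OX J b \<longleftrightarrow> (\<forall>a. (\<forall>j\<in>J. a j \<in> OX) \<and> (\<forall>i. (\<Sum>j\<in>J. a j * b j i) = 0) \<longrightarrow> (\<forall>j\<in>J. a j = 0))"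

lemma span_OX_elementary:
  fixes b :: "'j \<Rightarrow> nat \<Rightarrow> rat fps"
  assumes "finite J" "k \<in> J" "l \<in> J" "k \<noteq> l" "q \<in> OX"
  shows "span_OX J b \<subseteq> span_OX J (b(l := \<lambda>i. b l i + q * b k i))" (is "_ \<subseteq> span_OX J ?b'")
proof
  fix w assume "w \<in> span_OX J b"
  then obtain a where a: "\<forall>j\<in>J. a j \<in> OX" "\<And>i. w i = (\<Sum>j\<in>J. a j * b j i)"
    unfolding span_OX_def by blast
  have split: "(\<Sum>j\<in>J. f j) = f k + (f l + (\<Sum>j\<in>J - {k} - {l}. f j))" for f :: "'j \<Rightarrow> rat fps"
    using assms by (simp add: sum.remove[of J k] sum.remove[of "J - {k}" l])
  define a' where "a' = a(k := a k - a l * q)"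
  have "w i = (\<Sum>j\<in>J. a' j * ?b' j i)" for i
  proof -
    have "(\<Sum>j\<in>J - {k} - {l}. a' j * ?b' j i) = (\<Sum>j\<in>J - {k} - {l}. a j * b j i)"
      by (rule sum.cong) (auto simp: a'_def)
    then show ?thesis unfolding a(2) split using assms by (simp add: a'_def algebra_simps)
  qed
  moreover have "\<forall>j\<in>J. a' j \<in> OX" using a assms by (auto simp: a'_def)
  ultimately show "w \<in> span_OX J ?b'" unfolding span_OX_def by blast
qed

lemma span_OX_elementary_eq:
  fixes b :: "'j \<Rightarrow> nat \<Rightarrow> rat fps"
  assumes "finite J" "k \<in> J" "l \<in> J" "k \<noteq> l" "q \<in> OX"
  shows "span_OX J (b(l := \<lambda>i. b l i + q * b k i)) = span_OX J b" (is "span_OX J ?b' = _")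
proof
  have "span_OX J ?b' \<subseteq> span_OX J (?b'(l := \<lambda>i. ?b' l i + (- q) * ?b' k i))"
    using assms by (intro span_OX_elementary) auto
  also have "?b'(l := \<lambda>i. ?b' l i + (- q) * ?b' k i) = b"
    using assms by (auto simp: fun_eq_iff)
  finally show "span_OX J ?b' \<subseteq> span_OX J b" .
qed (use span_OX_elementary[OF assms] in blast)

text \<open>
  Euclid's algorithm on the coefficients of a relation between generators: dividing one coefficient by
  another, and changing the generators accordingly, lowers the total degree, until a single coefficient
  is left. Then the corresponding generator is zero and can be dropped, against minimality.
\<close>

lemma minimal_generators_indep:
  fixes b :: "nat \<Rightarrow> nat \<Rightarrow> rat fps"
  assumes "finite J" "W = span_OX J b"
    and min: "\<And>J' b'. finite J' \<Longrightarrow> W = span_OX (J' :: nat set) b' \<Longrightarrow> card J \<le> card J'"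
    and "\<And>i. (\<Sum>j\<in>J. fps_of_poly (p j) * b j i) = 0" "j \<in> J"
  shows "p j = 0"
  using assms(2,4,5)
proof (induction "\<Sum>j\<in>J. if p j = 0 then 0 else Suc (Polynomial.degree (p j))" arbitrary: p b j rule: less_induct)
  case less
  note gen = less(2) and rel = less(3)
  show ?case
  proof (cases "\<exists>k\<in>J. \<exists>l\<in>J. k \<noteq> l \<and> p k \<noteq> 0 \<and> p l \<noteq> 0")
    case True
    then obtain k l where kl: "k \<in> J" "l \<in> J" "k \<noteq> l" "p k \<noteq> 0" "p l \<noteq> 0"
      "Polynomial.degree (p l) \<le> Polynomial.degree (p k)" by (metis linear)
    define q where "q = p k div p l"
    define p' where "p' = p(k := p k mod p l)"
    define b' where "b' = b(l := \<lambda>i. b l i + fps_of_poly q * b k i)"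
    have split: "(\<Sum>j\<in>J. f j) = f k + (f l + (\<Sum>j\<in>J - {k} - {l}. f j))" for f :: "nat \<Rightarrow> rat fps"
      using kl assms(1) by (simp add: sum.remove[of J k] sum.remove[of "J - {k}" l])
    have gen': "W = span_OX J b'"
      unfolding b'_def gen using kl assms(1) by (intro span_OX_elementary_eq[symmetric]) auto
    have rel': "(\<Sum>j\<in>J. fps_of_poly (p' j) * b' j i) = 0" for i
    proof -
      have "(\<Sum>j\<in>J - {k} - {l}. fps_of_poly (p' j) * b' j i) = (\<Sum>j\<in>J - {k} - {l}. fps_of_poly (p j) * b j i)"
        by (rule sum.cong) (auto simp: p'_def b'_def)
      moreover define m where "m = p k mod p l"
      have pk: "fps_of_poly (p k) = fps_of_poly q * fps_of_poly (p l) + fps_of_poly m"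
        unfolding q_def m_def by (simp flip: fps_of_poly_mult fps_of_poly_add)
      ultimately have "(\<Sum>j\<in>J. fps_of_poly (p' j) * b' j i) = (\<Sum>j\<in>J. fps_of_poly (p j) * b j i)"
        unfolding split using kl by (simp add: p'_def b'_def pk algebra_simps flip: m_def)
      then show ?thesis using rel by simp
    qed
    have "(if p' k = 0 then 0 else Suc (Polynomial.degree (p' k))) < (if p k = 0 then 0 else Suc (Polynomial.degree (p k)))"
      using kl degree_mod_less[of "p l" "p k"] by (auto simp: p'_def)
    then have "(\<Sum>j\<in>J. if p' j = 0 then 0 else Suc (Polynomial.degree (p' j))) < (\<Sum>j\<in>J. if p j = 0 then 0 else Suc (Polynomial.degree (p j)))"
      using kl assms(1) by (intro sum_strict_mono_ex1) (auto simp: p'_def)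
    from less(1)[OF this gen' rel' kl(2)] have "p' l = 0" .
    then have False using kl by (simp add: p'_def)
    then show ?thesis ..
  next
    case False
    show ?thesis
    proof (rule ccontr)
      assume nz: "p j \<noteq> 0"
      have others: "p l = 0" if "l \<in> J - {j}" for l using False nz less(4) that by blast
      have "b j i = 0" for i
      proof -
        have "(\<Sum>j\<in>J. fps_of_poly (p j) * b j i) = fps_of_poly (p j) * b j i + (\<Sum>l\<in>J - {j}. fps_of_poly (p l) * b l i)"
          using assms(1) less(4) by (rule sum.remove)
        also have "(\<Sum>l\<in>J - {j}. fps_of_poly (p l) * b l i) = 0"
          using others by (intro sum.neutral) auto
        finally show ?thesis using rel[of i] nz by simp
      qed
      then have "(\<Sum>l\<in>J. a l * b l i) = (\<Sum>l\<in>J - {j}. a l * b l i)" for a i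
        using assms(1) less(4) by (simp add: sum.remove[of J j])
      then have "span_OX J b = span_OX (J - {j}) b"
      proof (intro subset_antisym subsetI)
        fix w assume "w \<in> span_OX (J - {j}) b"
        then obtain a where a: "\<forall>l\<in>J - {j}. a l \<in> OX" "\<forall>i. w i = (\<Sum>l\<in>J - {j}. a l * b l i)"
          unfolding span_OX_def by blast
        have "(\<Sum>l\<in>J - {j}. a l * b l i) = (\<Sum>l\<in>J - {j}. (a(j := 0)) l * b l i)" for i
          by (rule sum.cong) auto
        then have "\<forall>i. w i = (\<Sum>l\<in>J. (a(j := 0)) l * b l i)"
          using a(2) \<open>\<And>i a. (\<Sum>l\<in>J. a l * b l i) = (\<Sum>l\<in>J - {j}. a l * b l i)\<close>[of "a(j := 0)"] by simp
        moreover have "\<forall>l\<in>J. (a(j := 0)) l \<in> OX" using a(1) by auto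
        ultimately show "w \<in> span_OX J b" unfolding span_OX_def by blast
      qed (auto simp: span_OX_def)
      then have "card J \<le> card (J - {j})" using min[of "J - {j}" b] gen assms(1) by auto
      then show False using assms(1) less(4) by (metis card_Diff1_less leD)
    qed
  qed
qed

lemma OX_common_denominator:
  assumes "finite J" "\<And>j. j \<in> J \<Longrightarrow> a j \<in> OX"
  shows "\<exists>k p. \<forall>j\<in>J. a j * q4 ^ k = fps_of_poly (p j)"
proof -
  have "\<exists>k. \<forall>j\<in>J. \<exists>p. a j * q4 ^ k = fps_of_poly p"
    using assms
  proof (induction J rule: finite_induct)
    case (insert x F)
    then obtain k where k: "\<forall>j\<in>F. \<exists>p. a j * q4 ^ k = fps_of_poly p" by auto
    obtain p l where p: "a x * q4 ^ l = fps_of_poly p" using insert(4)[of x] OX_iff by auto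
    have q: "fps_of_poly c * q4 ^ n = fps_of_poly (c * [:-1,0,0,0,1:] ^ n)" for c n
      by (simp add: fps_of_poly_mult fps_of_poly_power fps_of_poly_q4)
    have "\<exists>p. a j * q4 ^ (k + l) = fps_of_poly p" if "j \<in> insert x F" for j
    proof (cases "j = x")
      case True
      then have "a j * q4 ^ (k + l) = fps_of_poly p * q4 ^ k" using p by (simp add: power_add mult_ac flip: p)
      then show ?thesis using q by metis
    next
      case False
      then have "j \<in> F" using that by simp
      then obtain p' where p': "a j * q4 ^ k = fps_of_poly p'" using k by blast
      then have "a j * q4 ^ (k + l) = fps_of_poly p' * q4 ^ l" by (simp add: power_add mult_ac flip: p')
      then show ?thesis using q by metis
    qed
    then show ?case by blast
  qed simp
  then obtain k where "\<forall>j\<in>J. \<exists>p. a j * q4 ^ k = fps_of_poly p" by blast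
  from bchoice[OF this] show ?thesis by blast
qed

lemma finitely_generated_free:
  assumes E: "finite E" "W = span_OX E c" 
  obtains n and b :: "nat \<Rightarrow> nat \<Rightarrow> rat fps" where "W = span_OX {..<n} b" "indep_OX {..<n} b"
proof -
  define Q where "Q = (\<lambda>n. \<exists>J (b :: nat \<Rightarrow> nat \<Rightarrow> rat fps). finite J \<and> card J = n \<and> W = span_OX J b)"
  have bij: "\<exists>b'. W = span_OX {..<card J} b' \<and> (indep_OX J b \<longrightarrow> indep_OX {..<card J} b')" if J: "finite J" "W = span_OX J b" for J and b :: "'j \<Rightarrow> nat \<Rightarrow> rat fps"
  proof -
    obtain f where f: "bij_betw f {..<card J} J" using ex_bij_betw_nat_finite[OF J(1)] by (auto simp: atLeast0LessThan)
    let ?g = "inv_into {..<card J} f"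
    have g: "\<And>j. j \<in> J \<Longrightarrow> ?g j < card J" "\<And>j. j \<in> J \<Longrightarrow> f (?g j) = j" "\<And>k. k < card J \<Longrightarrow> ?g (f k) = k" "\<And>k. k < card J \<Longrightarrow> f k \<in> J"
      using f by (auto simp: bij_betw_def f_inv_into_f inv_into_into inv_into_f_f intro: inv_into_into[of _ f "{..<card J}", simplified lessThan_iff])
    have s: "(\<Sum>j\<in>J. a j * b j i) = (\<Sum>k<card J. a (f k) * b (f k) i)" for a i
      using sum.reindex_bij_betw[OF f, of "\<lambda>j. a j * b j i"] by simp
    have "span_OX J b = span_OX {..<card J} (b \<circ> f)"
    proof (rule subset_antisym; rule subsetI)
      fix w assume "w \<in> span_OX J b"
      then obtain a where "\<forall>j\<in>J. a j \<in> OX" "\<forall>i. w i = (\<Sum>j\<in>J. a j * b j i)" unfolding span_OX_def by blast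
      then show "w \<in> span_OX {..<card J} (b \<circ> f)" unfolding span_OX_def s using g by (auto intro!: exI[of _ "a \<circ> f"])
    next
      fix w assume "w \<in> span_OX {..<card J} (b \<circ> f)"
      then obtain a where a: "\<forall>j<card J. a j \<in> OX" "\<forall>i. w i = (\<Sum>j<card J. a j * b (f j) i)" unfolding span_OX_def by auto
      have "(\<Sum>k<card J. a (?g (f k)) * b (f k) i) = w i" for i
        using a g by simp
      then show "w \<in> span_OX J b" unfolding span_OX_def s using a g by (auto intro!: exI[of _ "\<lambda>j. a (?g j)"])
    qed
    then have "W = span_OX {..<card J} (b \<circ> f)" using J by simp
    moreover have "indep_OX {..<card J} (b \<circ> f)" if i: "indep_OX J b"
      unfolding indep_OX_def
    proof (intro allI impI ballI, elim conjE)
      fix a k assume a: "\<forall>j\<in>{..<card J}. a j \<in> OX" "\<forall>i. (\<Sum>j<card J. a j * (b \<circ> f) j i) = 0" and k: "k \<in> {..<card J}"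
      have "\<forall>i. (\<Sum>j\<in>J. a (?g j) * b j i) = 0"
      proof
        fix i
        have "(\<Sum>j\<in>J. a (?g j) * b j i) = (\<Sum>k<card J. a (?g (f k)) * b (f k) i)" by (rule s)
        also have "\<dots> = (\<Sum>j<card J. a j * (b \<circ> f) j i)" by (rule sum.cong) (auto simp: g)
        finally show "(\<Sum>j\<in>J. a (?g j) * b j i) = 0" using a by simp
      qed
      moreover have "\<forall>j\<in>J. a (?g j) \<in> OX" using a g by auto
      ultimately have "\<forall>j\<in>J. a (?g j) = 0" using i[unfolded indep_OX_def, THEN spec, of "\<lambda>j. a (?g j)"] by (elim mp) (intro conjI)
      then have "a (?g (f k)) = 0" using g(4)[of k] k by blast
      then show "a k = 0" using g(3)[of k] k by simp
    qed
    ultimately show ?thesis by blast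
  qed
  have "Q (card E)" using bij[OF E] unfolding Q_def by (metis card_lessThan finite_lessThan)
  then have "Q (LEAST n. Q n)" by (rule LeastI)
  then obtain J and b :: "nat \<Rightarrow> nat \<Rightarrow> rat fps" where J: "finite J" "card J = (LEAST n. Q n)" "W = span_OX J b"
    unfolding Q_def by blast
  have min: "card J \<le> card J'" if "finite J'" "W = span_OX J' b'" for J' :: "nat set" and b'
    unfolding J(2) using that by (intro Least_le) (auto simp: Q_def)
  have "indep_OX J b"
    unfolding indep_OX_def
  proof (intro allI impI ballI, elim conjE)
    fix a j assume a: "\<forall>j\<in>J. a j \<in> OX" "\<forall>i. (\<Sum>j\<in>J. a j * b j i) = 0" and j: "j \<in> J"
    have "\<exists>k p. \<forall>j\<in>J. a j * q4 ^ k = fps_of_poly (p j)"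
      using a by (intro OX_common_denominator J(1)) simp
    then obtain k p where p: "\<forall>j\<in>J. a j * q4 ^ k = fps_of_poly (p j)" by blast
    have "(\<Sum>j\<in>J. fps_of_poly (p j) * b j i) = 0" for i
    proof -
      have "(\<Sum>j\<in>J. fps_of_poly (p j) * b j i) = q4 ^ k * (\<Sum>j\<in>J. a j * b j i)"
        unfolding sum_distrib_left by (rule sum.cong) (use p in \<open>auto simp: mult_ac\<close>)
      then show ?thesis using a by simp
    qed
    note rel = this
    have "p j = 0"
    proof (rule minimal_generators_indep[OF J(1,3) _ _ j])
      fix J' and b' :: "nat \<Rightarrow> nat \<Rightarrow> rat fps"
      assume "finite J'" "W = span_OX J' b'"
      then show "card J \<le> card J'" by (rule min)
    qed (rule rel)
    moreover have "a j * q4 ^ k = fps_of_poly (p j)" using p j by blast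
    ultimately have "a j * q4 ^ k = 0" by simp
    then show "a j = 0" by simp
  qed
  moreover obtain b' where "W = span_OX {..<card J} b'" "indep_OX J b \<longrightarrow> indep_OX {..<card J} b'"
    using bij[OF J(1,3)] by (elim exE conjE)
  ultimately show ?thesis by (intro that) simp_all
qed

section \<open>Global coordinates on a vector bundle\<close>

text \<open>
  An isomorphism of M with the free module of rank r, given by its components. Values of \<open>\<kappa> m\<close> at
  indices from r on carry no information.
\<close>

definition coordinates :: "(rat fps, 'm) module \<Rightarrow> nat \<Rightarrow> ('m \<Rightarrow> nat \<Rightarrow> rat fps) \<Rightarrow> bool" where
  "coordinates M r \<kappa> \<longleftrightarrow> module O_X M \<and>
    (\<forall>m\<in>carrier M. \<forall>i<r. \<kappa> m i \<in> OX) \<and>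
    (\<forall>m\<in>carrier M. \<forall>n\<in>carrier M. \<forall>i<r. \<kappa> (m \<oplus>\<^bsub>M\<^esub> n) i = \<kappa> m i + \<kappa> n i) \<and>
    (\<forall>f\<in>OX. \<forall>m\<in>carrier M. \<forall>i<r. \<kappa> (f \<odot>\<^bsub>M\<^esub> m) i = f * \<kappa> m i) \<and>
    (\<forall>m\<in>carrier M. \<forall>n\<in>carrier M. (\<forall>i<r. \<kappa> m i = \<kappa> n i) \<longrightarrow> m = n) \<and>
    (\<forall>a. (\<forall>i<r. a i \<in> OX) \<longrightarrow> (\<exists>m\<in>carrier M. \<forall>i<r. \<kappa> m i = a i))"

lemma local_basis_indep:
  "local_basis A M g r e \<Longrightarrow> a \<in> {..<r} \<rightarrow> carrier A \<Longrightarrow> (\<Oplus>\<^bsub>M\<^esub>i\<in>{..<r}. a i \<odot>\<^bsub>M\<^esub> e i) = \<zero>\<^bsub>M\<^esub> \<Longrightarrow>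
   i < r \<Longrightarrow> \<exists>k::nat. (g [^]\<^bsub>A\<^esub> k) \<otimes>\<^bsub>A\<^esub> a i = \<zero>\<^bsub>A\<^esub>"
  unfolding local_basis_def by blast

lemma (in module) lincomb_smult:
  assumes "finite A" "f \<in> carrier R" "a \<in> A \<rightarrow> carrier R" "e \<in> A \<rightarrow> carrier M"
  shows "f \<odot>\<^bsub>M\<^esub> (\<Oplus>\<^bsub>M\<^esub>i\<in>A. a i \<odot>\<^bsub>M\<^esub> e i) = (\<Oplus>\<^bsub>M\<^esub>i\<in>A. (f \<otimes> a i) \<odot>\<^bsub>M\<^esub> e i)"
proof -
  have "f \<odot>\<^bsub>M\<^esub> (\<Oplus>\<^bsub>M\<^esub>i\<in>A. a i \<odot>\<^bsub>M\<^esub> e i) = (\<Oplus>\<^bsub>M\<^esub>i\<in>A. f \<odot>\<^bsub>M\<^esub> (a i \<odot>\<^bsub>M\<^esub> e i))"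
    using assms by (intro finsum_smult_ldistr) auto
  also have "\<dots> = (\<Oplus>\<^bsub>M\<^esub>i\<in>A. (f \<otimes> a i) \<odot>\<^bsub>M\<^esub> e i)"
    using assms by (intro finsum_cong') (auto simp: smult_assoc1 Pi_iff)
  finally show ?thesis .
qed

lemma (in module) lincomb_add:
  assumes "a \<in> A \<rightarrow> carrier R" "b \<in> A \<rightarrow> carrier R" "e \<in> A \<rightarrow> carrier M"
  shows "(\<Oplus>\<^bsub>M\<^esub>i\<in>A. a i \<odot>\<^bsub>M\<^esub> e i) \<oplus>\<^bsub>M\<^esub> (\<Oplus>\<^bsub>M\<^esub>i\<in>A. b i \<odot>\<^bsub>M\<^esub> e i) = (\<Oplus>\<^bsub>M\<^esub>i\<in>A. (a i \<oplus> b i) \<odot>\<^bsub>M\<^esub> e i)"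
proof -
  have "(\<Oplus>\<^bsub>M\<^esub>i\<in>A. (a i \<oplus> b i) \<odot>\<^bsub>M\<^esub> e i) = (\<Oplus>\<^bsub>M\<^esub>i\<in>A. a i \<odot>\<^bsub>M\<^esub> e i \<oplus>\<^bsub>M\<^esub> b i \<odot>\<^bsub>M\<^esub> e i)"
    using assms by (intro finsum_cong') (auto simp: smult_l_distr Pi_iff)
  also have "\<dots> = (\<Oplus>\<^bsub>M\<^esub>i\<in>A. a i \<odot>\<^bsub>M\<^esub> e i) \<oplus>\<^bsub>M\<^esub> (\<Oplus>\<^bsub>M\<^esub>i\<in>A. b i \<odot>\<^bsub>M\<^esub> e i)"
    using assms by (intro finsum_addf) auto
  finally show ?thesis ..
qed

lemma (in module) lincomb_eq_imp_diff:
  assumes "a \<in> A \<rightarrow> carrier R" "b \<in> A \<rightarrow> carrier R" "c \<in> A \<rightarrow> carrier R" "e \<in> A \<rightarrow> carrier M"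
    and "\<And>i. i \<in> A \<Longrightarrow> c i \<oplus> b i = a i"
    and "(\<Oplus>\<^bsub>M\<^esub>i\<in>A. a i \<odot>\<^bsub>M\<^esub> e i) = (\<Oplus>\<^bsub>M\<^esub>i\<in>A. b i \<odot>\<^bsub>M\<^esub> e i)"
  shows "(\<Oplus>\<^bsub>M\<^esub>i\<in>A. c i \<odot>\<^bsub>M\<^esub> e i) = \<zero>\<^bsub>M\<^esub>"
proof -
  have "(\<Oplus>\<^bsub>M\<^esub>i\<in>A. c i \<odot>\<^bsub>M\<^esub> e i) \<oplus>\<^bsub>M\<^esub> (\<Oplus>\<^bsub>M\<^esub>i\<in>A. b i \<odot>\<^bsub>M\<^esub> e i) = (\<Oplus>\<^bsub>M\<^esub>i\<in>A. (c i \<oplus> b i) \<odot>\<^bsub>M\<^esub> e i)"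
    using assms by (intro lincomb_add)
  also have "\<dots> = (\<Oplus>\<^bsub>M\<^esub>i\<in>A. a i \<odot>\<^bsub>M\<^esub> e i)"
    using assms by (intro finsum_cong') (auto simp: Pi_iff)
  finally show ?thesis unfolding assms(6)
    using assms by (intro M.add.l_cancel_one[THEN iffD1, rotated 2]) (auto simp: Pi_iff M.add.m_comm intro!: M.finsum_closed)
qed

text \<open>
  In a chart around the origin the function g is invertible as a power series, so the powers of g in
  the defining property of a local basis can be divided out.
\<close>

lemma chart_coordinates:
  fixes M :: "(rat fps, 'm) module"
  assumes M: "module O_X M" and lb: "local_basis O_X M g r e" and g: "g \<in> OX" "fps_nth g 0 \<noteq> 0"
  obtains c :: "'m \<Rightarrow> nat \<Rightarrow> rat fps" where
    "\<And>m i. i \<ge> r \<Longrightarrow> c m i = 0"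
    "\<And>m n i. m \<in> carrier M \<Longrightarrow> n \<in> carrier M \<Longrightarrow> c (m \<oplus>\<^bsub>M\<^esub> n) i = c m i + c n i"
    "\<And>f m i. f \<in> OX \<Longrightarrow> m \<in> carrier M \<Longrightarrow> c (f \<odot>\<^bsub>M\<^esub> m) i = f * c m i"
    "\<And>m. m \<in> carrier M \<Longrightarrow> \<exists>k. (\<forall>i<r. c m i * g ^ k \<in> OX) \<and> g ^ k \<odot>\<^bsub>M\<^esub> m = (\<Oplus>\<^bsub>M\<^esub>i\<in>{..<r}. (c m i * g ^ k) \<odot>\<^bsub>M\<^esub> e i)"
    "\<And>i j. i < r \<Longrightarrow> c (e i) j = (if i = j then 1 else 0)"
proof -
  interpret module O_X M by fact
  define L where "L = (\<lambda>a. \<Oplus>\<^bsub>M\<^esub>i\<in>{..<r}. a i \<odot>\<^bsub>M\<^esub> e i)"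
  have e: "e \<in> {..<r} \<rightarrow> carrier M" using lb by (simp add: local_basis_def)
  have gk: "g ^ k \<in> OX" "g ^ k \<noteq> 0" for k using g by auto
  have Lc: "L a \<in> carrier M" if "a \<in> {..<r} \<rightarrow> OX" for a
    unfolding L_def using e that by (intro finsum_closed) (auto simp: Pi_iff)
  have L_smult: "f \<odot>\<^bsub>M\<^esub> L a = L (\<lambda>i. f * a i)" if "f \<in> OX" "a \<in> {..<r} \<rightarrow> OX" for f a
    unfolding L_def using lincomb_smult[of "{..<r}" f a e] that e by simp
  have L_add: "L a \<oplus>\<^bsub>M\<^esub> L b = L (\<lambda>i. a i + b i)" if "a \<in> {..<r} \<rightarrow> OX" "b \<in> {..<r} \<rightarrow> OX" for a b
    unfolding L_def using lincomb_add[of a "{..<r}" b e] that e by simp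
  have g_cancel: "u = v" if "u * g ^ k = v * g ^ k" for u v k using that gk(2)[of k] mult_right_cancel by blast
  have L_inj: "a i = b i" if "L a = L b" "a \<in> {..<r} \<rightarrow> OX" "b \<in> {..<r} \<rightarrow> OX" "i < r" for a b i
  proof -
    have d: "(\<lambda>i. a i - b i) \<in> {..<r} \<rightarrow> OX" using that by (simp add: Pi_iff)
    have "L (\<lambda>i. a i - b i) = \<zero>\<^bsub>M\<^esub>"
      unfolding L_def using that e d
      by (intro lincomb_eq_imp_diff[of a "{..<r}" b _ e]) (auto simp: L_def)
    then obtain k where "g ^ k * (a i - b i) = 0"
      using local_basis_indep[OF lb d _ \<open>i < r\<close>] unfolding L_def by auto
    then have "a i * g ^ k = b i * g ^ k" by (simp add: algebra_simps)
    then show ?thesis by (rule g_cancel)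
  qed
  have "\<exists>k a. a \<in> {..<r} \<rightarrow> OX \<and> g ^ k \<odot>\<^bsub>M\<^esub> m = L a" if "m \<in> carrier M" for m
    using lb that unfolding local_basis_def L_def by (auto simp: Bex_def)
  then obtain K A where KA: "\<And>m. m \<in> carrier M \<Longrightarrow> A m \<in> {..<r} \<rightarrow> OX \<and> g ^ K m \<odot>\<^bsub>M\<^esub> m = L (A m)"
    by metis
  define c where "c = (\<lambda>m i. if i < r then A m i * inverse (g ^ K m) else 0)"
  have cA: "c m i * g ^ K m = A m i" if "i < r" for m i
  proof -
    have "inverse (g ^ K m) * g ^ K m = 1" using g by (intro inverse_mult_eq_1) (simp add: fps_power_zeroth)
    then show ?thesis using that by (simp add: c_def mult.assoc)
  qed
  have char: "c m i * g ^ k = a i" if "m \<in> carrier M" "a \<in> {..<r} \<rightarrow> OX" "g ^ k \<odot>\<^bsub>M\<^esub> m = L a" "i < r" for m k a i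
  proof -
    note K = KA[OF that(1)]
    have "L (\<lambda>i. g ^ k * A m i) = g ^ k \<odot>\<^bsub>M\<^esub> (g ^ K m \<odot>\<^bsub>M\<^esub> m)" using L_smult[of "g ^ k" "A m"] K gk by simp
    also have "\<dots> = g ^ K m \<odot>\<^bsub>M\<^esub> (g ^ k \<odot>\<^bsub>M\<^esub> m)"
      using smult_assoc1[of "g ^ k" "g ^ K m" m] smult_assoc1[of "g ^ K m" "g ^ k" m] gk that(1) by (simp add: mult.commute)
    also have "\<dots> = L (\<lambda>i. g ^ K m * a i)" using L_smult[of "g ^ K m" a] that gk by simp
    finally have "g ^ k * A m i = g ^ K m * a i"
      using L_inj[of "\<lambda>i. g ^ k * A m i" "\<lambda>i. g ^ K m * a i" i] K gk(1) that by (simp add: Pi_iff)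
    then have "(c m i * g ^ k) * g ^ K m = a i * g ^ K m" unfolding cA[OF that(4), of m, symmetric] by (simp add: mult_ac)
    then show ?thesis by (rule g_cancel)
  qed
  have char': "g ^ K m \<odot>\<^bsub>M\<^esub> m = L (\<lambda>i. c m i * g ^ K m)" if "m \<in> carrier M" for m
  proof -
    have "L (A m) = L (\<lambda>i. c m i * g ^ K m)"
      unfolding L_def using e KA[OF that] cA by (intro finsum_cong') (auto simp: Pi_iff)
    then show ?thesis using KA[OF that] by simp
  qed
  have cO: "c m i * g ^ K m \<in> OX" if "m \<in> carrier M" "i < r" for m i
    using cA that KA[OF that(1)] by auto
  show thesis
  proof (rule that[of c])
    fix m i assume "r \<le> i" then show "c m i = 0" by (simp add: c_def)
  next
    fix m n i assume mn: "m \<in> carrier M" "n \<in> carrier M"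
    show "c (m \<oplus>\<^bsub>M\<^esub> n) i = c m i + c n i"
    proof (cases "i < r")
      case True
      define a where "a = (\<lambda>i. g ^ K n * (c m i * g ^ K m) + g ^ K m * (c n i * g ^ K n))"
      have 1: "(\<lambda>i. c m i * g ^ K m) \<in> {..<r} \<rightarrow> OX" "(\<lambda>i. c n i * g ^ K n) \<in> {..<r} \<rightarrow> OX" using cO mn by auto
      have "g ^ (K m + K n) \<odot>\<^bsub>M\<^esub> (m \<oplus>\<^bsub>M\<^esub> n) = g ^ K n \<odot>\<^bsub>M\<^esub> (g ^ K m \<odot>\<^bsub>M\<^esub> m) \<oplus>\<^bsub>M\<^esub> g ^ K m \<odot>\<^bsub>M\<^esub> (g ^ K n \<odot>\<^bsub>M\<^esub> n)"
        using mn gk smult_assoc1[of "g ^ K n" "g ^ K m" m] smult_assoc1[of "g ^ K m" "g ^ K n" n]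
        by (simp add: smult_r_distr power_add mult.commute)
      also have "\<dots> = L (\<lambda>i. g ^ K n * (c m i * g ^ K m)) \<oplus>\<^bsub>M\<^esub> L (\<lambda>i. g ^ K m * (c n i * g ^ K n))"
        using mn L_smult 1 gk by (simp add: char')
      also have "\<dots> = L a" unfolding a_def using 1 gk(1) by (intro L_add) (auto simp: Pi_iff)
      finally have "c (m \<oplus>\<^bsub>M\<^esub> n) i * g ^ (K m + K n) = a i"
        using 1 gk(1) mn True by (intro char) (auto simp: a_def Pi_iff)
      also have "\<dots> = (c m i + c n i) * g ^ (K m + K n)" by (simp add: a_def algebra_simps power_add)
      finally show ?thesis by (rule g_cancel)
    qed (simp add: c_def)
  next
    fix f m i assume fm: "f \<in> OX" "m \<in> carrier M"
    show "c (f \<odot>\<^bsub>M\<^esub> m) i = f * c m i"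
    proof (cases "i < r")
      case True
      have 1: "(\<lambda>i. c m i * g ^ K m) \<in> {..<r} \<rightarrow> OX" using cO fm by auto
      have "g ^ K m \<odot>\<^bsub>M\<^esub> (f \<odot>\<^bsub>M\<^esub> m) = f \<odot>\<^bsub>M\<^esub> (g ^ K m \<odot>\<^bsub>M\<^esub> m)"
        using smult_assoc1[of "g ^ K m" f m] smult_assoc1[of f "g ^ K m" m] gk fm by (simp add: mult.commute)
      also have "\<dots> = L (\<lambda>i. f * (c m i * g ^ K m))" using fm L_smult 1 by (simp add: char')
      finally have "c (f \<odot>\<^bsub>M\<^esub> m) i * g ^ K m = f * (c m i * g ^ K m)"
        using 1 fm True by (intro char) (auto simp: Pi_iff)
      then have "c (f \<odot>\<^bsub>M\<^esub> m) i * g ^ K m = (f * c m i) * g ^ K m" by simp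
      then show ?thesis by (rule g_cancel)
    qed (simp add: c_def)
  next
    fix m assume m: "m \<in> carrier M"
    show "\<exists>k. (\<forall>i<r. c m i * g ^ k \<in> OX) \<and> g ^ k \<odot>\<^bsub>M\<^esub> m = (\<Oplus>\<^bsub>M\<^esub>i\<in>{..<r}. (c m i * g ^ k) \<odot>\<^bsub>M\<^esub> e i)"
      using char'[OF m] cO[OF m] unfolding L_def by blast
  next
    fix i j assume i: "i < r"
    show "c (e i) j = (if i = j then 1 else 0)"
    proof (cases "j < r")
      case True
      let ?d = "\<lambda>j. if i = j then 1 else 0 :: rat fps"
      have ei: "e i \<in> carrier M" using e i by auto
      have "L ?d = (\<Oplus>\<^bsub>M\<^esub>j\<in>{..<r}. if i = j then e j else \<zero>\<^bsub>M\<^esub>)"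
        unfolding L_def using e smult_one smult_l_null by (intro finsum_cong') (auto simp: Pi_iff)
      also have "\<dots> = e i" using i e by (intro finsum_singleton) auto
      finally have "g ^ 0 \<odot>\<^bsub>M\<^esub> e i = L ?d" using ei smult_one[OF ei] by simp
      from char[OF ei _ this True] show ?thesis by auto
    qed (use i in \<open>auto simp: c_def\<close>)
  qed
qed

text \<open>
  The annihilator of m is not contained in any prime, because every chart at the prime is free.
\<close>

lemma vector_bundle_torsion_free:
  fixes M :: "(rat fps, 'm) module"
  assumes vb: "vector_bundle O_X M r" and a: "a \<in> OX" "a \<noteq> 0" and m: "m \<in> carrier M" "a \<odot>\<^bsub>M\<^esub> m = \<zero>\<^bsub>M\<^esub>"
  shows "m = \<zero>\<^bsub>M\<^esub>"
proof -
  interpret module O_X M using vb by (simp add: vector_bundle_def)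
  define I where "I = {f \<in> OX. f \<odot>\<^bsub>M\<^esub> m = \<zero>\<^bsub>M\<^esub>}"
  have "1 \<in> I"
  proof (rule OX_ideal_whole)
    show "I \<subseteq> OX" "0 \<in> I" using smult_l_null[OF m(1)] by (auto simp: I_def)
    show "f + g \<in> I" if "f \<in> I" "g \<in> I" for f g
      using that smult_l_distr[of f g m] m(1) by (simp add: I_def)
    show "g * f \<in> I" if "f \<in> I" "g \<in> OX" for f g
      using that smult_assoc1[of g f m] m(1) by (simp add: I_def)
    fix P assume P: "primeideal P O_X"
    then obtain g e where ge: "g \<in> OX" "g \<notin> P" "local_basis O_X M g r e"
      using vb unfolding vector_bundle_def by blast
    have "0 \<in> P" using P by (metis O_X_simps(4) additive_subgroup.zero_closed ideal_def primeideal.axioms(1))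
    then have g0: "g \<noteq> 0" using ge by auto
    have e: "e \<in> {..<r} \<rightarrow> carrier M" using ge by (simp add: local_basis_def)
    obtain k b where kb: "b \<in> {..<r} \<rightarrow> OX" "g ^ k \<odot>\<^bsub>M\<^esub> m = (\<Oplus>\<^bsub>M\<^esub>i\<in>{..<r}. b i \<odot>\<^bsub>M\<^esub> e i)"
      using ge(3) m(1) unfolding local_basis_def by (auto simp: Bex_def)
    have "(\<Oplus>\<^bsub>M\<^esub>i\<in>{..<r}. (a * b i) \<odot>\<^bsub>M\<^esub> e i) = a \<odot>\<^bsub>M\<^esub> (g ^ k \<odot>\<^bsub>M\<^esub> m)"
      using lincomb_smult[of "{..<r}" a b e] kb e a by simp
    also have "\<dots> = g ^ k \<odot>\<^bsub>M\<^esub> (a \<odot>\<^bsub>M\<^esub> m)"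
      using smult_assoc1[of a "g ^ k" m] smult_assoc1[of "g ^ k" a m] ge a m(1) by (simp add: mult.commute)
    also have "\<dots> = \<zero>\<^bsub>M\<^esub>" using m ge by simp
    finally have z: "(\<Oplus>\<^bsub>M\<^esub>i\<in>{..<r}. (a * b i) \<odot>\<^bsub>M\<^esub> e i) = \<zero>\<^bsub>M\<^esub>" .
    have "(\<lambda>i. a * b i) \<in> {..<r} \<rightarrow> OX" using a kb by (auto simp: Pi_iff)
    then have b0: "b i = 0" if "i < r" for i using local_basis_indep[OF ge(3) _ z that] a g0 by auto
    have "g ^ k \<odot>\<^bsub>M\<^esub> m = (\<Oplus>\<^bsub>M\<^esub>i\<in>{..<r}. \<zero>\<^bsub>M\<^esub>)"
      unfolding kb(2) using e b0 smult_l_null by (intro finsum_cong') (auto simp: Pi_iff)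
    then have "g ^ k \<in> I" using ge by (simp add: I_def)
    moreover have "g ^ k \<notin> P" using primeideal_power_O_X[OF P] ge by blast
    ultimately show "\<exists>g\<in>I. g \<notin> P" by blast
  qed
  then show ?thesis using m(1) smult_one[OF m(1)] by (simp add: I_def)
qed


lemma indep_OXD:
  assumes "indep_OX J b" "\<And>j. j \<in> J \<Longrightarrow> a j \<in> OX" "\<And>i. (\<Sum>j\<in>J. a j * b j i) = 0" "j \<in> J"
  shows "a j = 0"
  using assms(1)[unfolded indep_OX_def, THEN spec, of a] assms(2-4) by blast

lemma primeideal_sum_O_X:
  assumes "primeideal P O_X" "\<And>g. g \<in> H \<Longrightarrow> f g \<in> P"
  shows "sum f H \<in> P"
proof -
  interpret primeideal P O_X by fact
  have "0 \<in> P" "\<And>a b. a \<in> P \<Longrightarrow> b \<in> P \<Longrightarrow> a + b \<in> P"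
    using additive_subgroup.zero_closed[OF is_additive_subgroup] additive_subgroup.a_closed[OF is_additive_subgroup] by simp_all
  then show ?thesis using assms(2)
    by (induction H rule: infinite_finite_induct) auto
qed

lemmas finsum_functional_O_X = finsum_linear_functional[of UNIV, folded O_X_def]

text \<open>
  The functions g of the charts generate the unit ideal, so finitely many of them do; the basis elements
  of those charts generate M, since the functions that multiply a given element into their span are not
  all contained in any one prime.
\<close>

lemma vector_bundle_finitely_generated:
  fixes M :: "(rat fps, 'm) module"
  assumes vb: "vector_bundle O_X M r"
    and c: "\<And>m n i. m \<in> carrier M \<Longrightarrow> n \<in> carrier M \<Longrightarrow> c (m \<oplus>\<^bsub>M\<^esub> n) i = c m i + c n i"
    "\<And>f m i. f \<in> OX \<Longrightarrow> m \<in> carrier M \<Longrightarrow> c (f \<odot>\<^bsub>M\<^esub> m) i = f * c m i"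
  obtains J :: "(rat fps \<times> nat) set" and b where "finite J" "c ` carrier M = span_OX J b"
proof -
  interpret module O_X M using vb by (simp add: vector_bundle_def)
  have M: "module O_X M" using vb by (simp add: vector_bundle_def)
  define Gs where "Gs = {g \<in> OX. \<exists>e. local_basis O_X M g r e}"
  have chart: "\<exists>g\<in>Gs. g \<notin> P" if "primeideal P O_X" for P
    using vb that unfolding vector_bundle_def Gs_def by blast
  define AA where "AA = {f \<in> OX. \<exists>H h. finite H \<and> H \<subseteq> Gs \<and> (\<forall>g\<in>H. h g \<in> OX) \<and> f = (\<Sum>g\<in>H. h g * g)}"
  have "1 \<in> AA"
  proof (rule OX_ideal_whole)
    show "AA \<subseteq> OX" by (auto simp: AA_def)
    show "0 \<in> AA" by (auto simp: AA_def intro!: exI[of _ "{}"])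
  next
    fix f1 f2 assume f: "f1 \<in> AA" "f2 \<in> AA"
    obtain H1 h1 where h1: "finite H1" "H1 \<subseteq> Gs" "\<forall>g\<in>H1. h1 g \<in> OX" "f1 = (\<Sum>g\<in>H1. h1 g * g)"
      using f unfolding AA_def by blast
    obtain H2 h2 where h2: "finite H2" "H2 \<subseteq> Gs" "\<forall>g\<in>H2. h2 g \<in> OX" "f2 = (\<Sum>g\<in>H2. h2 g * g)"
      using f unfolding AA_def by blast
    define h where "h = (\<lambda>g. (if g \<in> H1 then h1 g else 0) + (if g \<in> H2 then h2 g else 0))"
    have "f1 = (\<Sum>g\<in>H1 \<union> H2. (if g \<in> H1 then h1 g else 0) * g)"
      unfolding h1(4) using h1 h2 by (intro sum.mono_neutral_cong_left) auto
    moreover have "f2 = (\<Sum>g\<in>H1 \<union> H2. (if g \<in> H2 then h2 g else 0) * g)"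
      unfolding h2(4) using h1 h2 by (intro sum.mono_neutral_cong_left) auto
    ultimately have "f1 + f2 = (\<Sum>g\<in>H1 \<union> H2. h g * g)"
      by (simp add: h_def distrib_right sum.distrib)
    moreover have "\<forall>g\<in>H1 \<union> H2. h g \<in> OX" using h1 h2 by (auto simp: h_def)
    moreover have "f1 + f2 \<in> OX" using f by (auto simp: AA_def)
    ultimately show "f1 + f2 \<in> AA" unfolding AA_def using h1 h2
      by (auto intro!: exI[of _ "H1 \<union> H2"])
  next
    fix f q assume f: "f \<in> AA" "q \<in> OX"
    then obtain H h where h: "finite H" "H \<subseteq> Gs" "\<forall>g\<in>H. h g \<in> OX" "f = (\<Sum>g\<in>H. h g * g)"
      unfolding AA_def by blast
    then have "q * f = (\<Sum>g\<in>H. (q * h g) * g)" by (simp add: sum_distrib_left mult.assoc)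
    moreover have "\<forall>g\<in>H. q * h g \<in> OX" using h f by auto
    moreover have "q * f \<in> OX" using f by (auto simp: AA_def)
    ultimately show "q * f \<in> AA" unfolding AA_def using h(1,2)
      by (intro CollectI conjI exI[of _ H] exI[of _ "\<lambda>g. q * h g"])
  next
    fix P assume "primeideal P O_X"
    then obtain g where g: "g \<in> Gs" "g \<notin> P" using chart by blast
    then have "g \<in> AA" unfolding AA_def by (auto simp: Gs_def intro!: exI[of _ "{g}"] exI[of _ "\<lambda>_. 1"])
    then show "\<exists>g\<in>AA. g \<notin> P" using g by blast
  qed
  then obtain H h where H: "finite H" "H \<subseteq> Gs" "\<forall>g\<in>H. h g \<in> OX" "1 = (\<Sum>g\<in>H. h g * g)"
    unfolding AA_def by blast
  have "\<forall>g\<in>H. \<exists>e. local_basis O_X M g r e" using H(2) by (auto simp: Gs_def)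
  from bchoice[OF this] obtain e where e: "\<And>g. g \<in> H \<Longrightarrow> local_basis O_X M g r (e g)" by blast
  have ec: "e g i \<in> carrier M" if "g \<in> H" "i < r" for g i
    using e[OF that(1)] that(2) by (auto simp: local_basis_def)
  define J where "J = H \<times> {..<r}"
  define b where "b = (\<lambda>(g, j). c (e g j))"
  have fJ: "finite J" using H by (simp add: J_def)
  have "c ` carrier M \<subseteq> span_OX J b"
  proof
    fix w assume "w \<in> c ` carrier M"
    then obtain m where m: "m \<in> carrier M" "w = c m" by blast
    define I where "I = {f \<in> OX. \<exists>a. (\<forall>j\<in>J. a j \<in> OX) \<and> (\<forall>i. f * w i = (\<Sum>j\<in>J. a j * b j i))}"
    have "1 \<in> I"
    proof (rule OX_ideal_whole)
      show "I \<subseteq> OX" by (auto simp: I_def)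
      show "0 \<in> I" by (auto simp: I_def intro!: exI[of _ "\<lambda>_. 0"])
    next
      fix f1 f2 assume f: "f1 \<in> I" "f2 \<in> I"
      then obtain a1 a2 where "\<forall>j\<in>J. a1 j \<in> OX" "\<forall>i. f1 * w i = (\<Sum>j\<in>J. a1 j * b j i)"
         "\<forall>j\<in>J. a2 j \<in> OX" "\<forall>i. f2 * w i = (\<Sum>j\<in>J. a2 j * b j i)" unfolding I_def by blast
      then show "f1 + f2 \<in> I" using f unfolding I_def
        by (auto intro!: exI[of _ "\<lambda>j. a1 j + a2 j"] simp: distrib_right sum.distrib)
    next
      fix f q assume f: "f \<in> I" "q \<in> OX"
      then obtain a where a: "\<forall>j\<in>J. a j \<in> OX" "\<forall>i. f * w i = (\<Sum>j\<in>J. a j * b j i)" unfolding I_def by blast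
      have "\<forall>i. (q * f) * w i = (\<Sum>j\<in>J. (q * a j) * b j i)"
        using a(2) by (simp add: mult.assoc sum_distrib_left[symmetric])
      moreover have "\<forall>j\<in>J. q * a j \<in> OX" "q * f \<in> OX" using a f by (auto simp: I_def)
      ultimately show "q * f \<in> I" unfolding I_def by (intro CollectI conjI exI[of _ "\<lambda>j. q * a j"])
    next
      fix P assume P: "primeideal P O_X"
      have "\<exists>g\<in>H. g \<notin> P"
      proof (rule ccontr)
        assume "\<not> (\<exists>g\<in>H. g \<notin> P)"
        then have "h g * g \<in> P" if "g \<in> H" for g
          using ideal.I_l_closed[OF primeideal.axioms(1)[OF P], of g "h g"] that H(3) by auto
        then have "(1::rat fps) \<in> P" unfolding H(4) by (intro primeideal_sum_O_X[OF P]) auto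
        then show False using primeideal_not_1[OF P] by blast
      qed
      then obtain g where g: "g \<in> H" "g \<notin> P" by blast
      have gO: "g \<in> OX" using g H by (auto simp: Gs_def)
      obtain k a where a: "a \<in> {..<r} \<rightarrow> OX" "g ^ k \<odot>\<^bsub>M\<^esub> m = (\<Oplus>\<^bsub>M\<^esub>j\<in>{..<r}. a j \<odot>\<^bsub>M\<^esub> e g j)"
        using e[OF g(1)] m(1) unfolding local_basis_def by (auto simp: Bex_def)
      define a' where "a' = (\<lambda>(g', j). if g' = g then a j else 0)"
      have "g ^ k * w i = (\<Sum>j\<in>J. a' j * b j i)" for i
      proof -
        have "g ^ k * w i = c (g ^ k \<odot>\<^bsub>M\<^esub> m) i" using c(2) m gO by simp
        also have "\<dots> = (\<Sum>j<r. a j * c (e g j) i)"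
          unfolding a(2) using a(1) ec[OF g(1)] c by (intro finsum_functional_O_X[OF M]) auto
        also have "\<dots> = (\<Sum>g'\<in>H. if g' = g then (\<Sum>j<r. a j * c (e g j) i) else 0)"
          using H(1) g(1) by simp
        also have "\<dots> = (\<Sum>g'\<in>H. \<Sum>j<r. a' (g', j) * b (g', j) i)"
          by (intro sum.cong) (auto simp: a'_def b_def)
        also have "\<dots> = (\<Sum>j\<in>J. a' j * b j i)" unfolding J_def by (simp add: sum.cartesian_product case_prod_unfold)
        finally show ?thesis .
      qed
      moreover have "\<forall>j\<in>J. a' j \<in> OX" using a(1) by (auto simp: a'_def J_def)
      moreover have "g ^ k \<in> OX" using gO by simp
      ultimately have "g ^ k \<in> I" unfolding I_def by blast
      moreover have "g ^ k \<notin> P" using primeideal_power_O_X[OF P] g gO by blast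
      ultimately show "\<exists>g\<in>I. g \<notin> P" by blast
    qed
    then show "w \<in> span_OX J b" unfolding I_def span_OX_def by simp
  qed
  moreover have "span_OX J b \<subseteq> c ` carrier M"
  proof
    fix w assume "w \<in> span_OX J b"
    then obtain a where a: "\<forall>j\<in>J. a j \<in> OX" "\<And>i. w i = (\<Sum>j\<in>J. a j * b j i)" unfolding span_OX_def by blast
    define m where "m = (\<Oplus>\<^bsub>M\<^esub>j\<in>J. a j \<odot>\<^bsub>M\<^esub> e (fst j) (snd j))"
    have ec': "(\<lambda>j. e (fst j) (snd j)) \<in> J \<rightarrow> carrier M" using ec by (auto simp: J_def)
    have "c m i = (\<Sum>j\<in>J. a j * c (e (fst j) (snd j)) i)" for i
      unfolding m_def using a(1) ec' c fJ by (intro finsum_functional_O_X[OF M]) auto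
    then have "c m = w" by (auto simp: fun_eq_iff a(2) b_def case_prod_unfold)
    moreover have "m \<in> carrier M" unfolding m_def using a(1) ec' by (intro finsum_closed) (auto simp: Pi_iff)
    ultimately show "w \<in> c ` carrier M" by blast
  qed
  ultimately show thesis using fJ by (intro that[of J b]) auto
qed

text \<open>
  The chart at the origin embeds the torsion-free module M into vectors of power series, where its image
  is finitely generated, hence free.
\<close>

theorem vector_bundle_coordinates:
  fixes M :: "(rat fps, 'm) module"
  assumes vb: "vector_bundle O_X M r"
  obtains \<kappa> where "coordinates M r \<kappa>"
proof -
  interpret module O_X M using vb by (simp add: vector_bundle_def)
  have M: "module O_X M" using vb by (simp add: vector_bundle_def)
  obtain g e where g: "g \<in> OX" "fps_nth g 0 \<noteq> 0" and lb: "local_basis O_X M g r e"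
    using vb primeideal_origin unfolding vector_bundle_def by blast
  have e: "e i \<in> carrier M" if "i < r" for i using lb that by (auto simp: local_basis_def)
  obtain c :: "'m \<Rightarrow> nat \<Rightarrow> rat fps" where c:
    "\<And>m i. i \<ge> r \<Longrightarrow> c m i = 0"
    "\<And>m n i. m \<in> carrier M \<Longrightarrow> n \<in> carrier M \<Longrightarrow> c (m \<oplus>\<^bsub>M\<^esub> n) i = c m i + c n i"
    "\<And>f m i. f \<in> OX \<Longrightarrow> m \<in> carrier M \<Longrightarrow> c (f \<odot>\<^bsub>M\<^esub> m) i = f * c m i"
    "\<And>m. m \<in> carrier M \<Longrightarrow> \<exists>k. (\<forall>i<r. c m i * g ^ k \<in> OX) \<and> g ^ k \<odot>\<^bsub>M\<^esub> m = (\<Oplus>\<^bsub>M\<^esub>i\<in>{..<r}. (c m i * g ^ k) \<odot>\<^bsub>M\<^esub> e i)"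
    "\<And>i j. i < r \<Longrightarrow> c (e i) j = (if i = j then 1 else 0)"
    by (rule chart_coordinates[OF M lb g]) (rule that)
  have g0: "g \<noteq> 0" using g by auto
  have inj0: "m = \<zero>\<^bsub>M\<^esub>" if m: "m \<in> carrier M" "\<And>i. i < r \<Longrightarrow> c m i = 0" for m
  proof -
    obtain k where k: "g ^ k \<odot>\<^bsub>M\<^esub> m = (\<Oplus>\<^bsub>M\<^esub>i\<in>{..<r}. (c m i * g ^ k) \<odot>\<^bsub>M\<^esub> e i)" using c(4)[OF m(1)] by blast
    also have "\<dots> = (\<Oplus>\<^bsub>M\<^esub>i\<in>{..<r}. \<zero>\<^bsub>M\<^esub>)"
      using m e smult_l_null by (intro finsum_cong') (auto simp: Pi_iff)
    finally have "g ^ k \<odot>\<^bsub>M\<^esub> m = \<zero>\<^bsub>M\<^esub>" by simp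
    then show ?thesis using vector_bundle_torsion_free[OF vb, of "g ^ k" m] g g0 m by simp
  qed
  have inj: "m = n" if mn: "m \<in> carrier M" "n \<in> carrier M" "\<And>i. i < r \<Longrightarrow> c m i = c n i" for m n
  proof -
    have 1: "fps_const (-1) \<odot>\<^bsub>M\<^esub> n \<in> carrier M" using mn by (intro smult_closed) auto
    have "m \<oplus>\<^bsub>M\<^esub> (fps_const (-1) \<odot>\<^bsub>M\<^esub> n) = \<zero>\<^bsub>M\<^esub>"
      using mn 1 c by (intro inj0) (auto simp flip: fps_const_neg)
    moreover have "n \<oplus>\<^bsub>M\<^esub> (fps_const (-1) \<odot>\<^bsub>M\<^esub> n) = \<zero>\<^bsub>M\<^esub>"
      using mn 1 c by (intro inj0) (auto simp flip: fps_const_neg)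
    ultimately have "m \<oplus>\<^bsub>M\<^esub> (fps_const (-1) \<odot>\<^bsub>M\<^esub> n) = n \<oplus>\<^bsub>M\<^esub> (fps_const (-1) \<odot>\<^bsub>M\<^esub> n)" by simp
    then show ?thesis using mn 1 M.add.r_cancel[of "fps_const (-1) \<odot>\<^bsub>M\<^esub> n" m n] by simp
  qed
  obtain J :: "(rat fps \<times> nat) set" and b0 where J: "finite J" "c ` carrier M = span_OX J b0"
    by (rule vector_bundle_finitely_generated[OF vb c(2,3)])
  obtain n and b :: "nat \<Rightarrow> nat \<Rightarrow> rat fps" where b: "c ` carrier M = span_OX {..<n} b" "indep_OX {..<n} b"
    by (rule finitely_generated_free[OF J])
  have delta: "(\<Sum>l<n. (if l = j then x else 0) * y l) = x * y j" if "j < n" for j and x :: "rat fps" and y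
  proof -
    have "(\<Sum>l<n. (if l = j then x else 0) * y l) = (\<Sum>l<n. if l = j then x * y l else 0)" by (intro sum.cong) auto
    then show ?thesis using that by simp
  qed
  have bW: "\<exists>m\<in>carrier M. c m = b j" if "j < n" for j
  proof -
    have "b j \<in> span_OX {..<n} b" unfolding span_OX_def
      using delta[OF that, of 1] by (intro CollectI exI[of _ "\<lambda>l. if l = j then 1 else 0"]) auto
    then show ?thesis using b(1) by (metis imageE)
  qed
  then obtain \<beta> where \<beta>: "\<And>j. j < n \<Longrightarrow> \<beta> j \<in> carrier M \<and> c (\<beta> j) = b j" by metis
  \<comment> \<open>the two base change matrices between the global basis b and the local basis e are inverse to each other,
     so that n and r are the traces of their products in either order\<close>
  have "n = r"
  proof -
    have "\<exists>p. (\<forall>j<n. p j \<in> OX) \<and> (\<forall>l. c (e i) l = (\<Sum>j<n. p j * b j l))" if "i < r" for i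
    proof -
      have "c (e i) \<in> span_OX {..<n} b" using b(1) e[OF that] by blast
      then show ?thesis unfolding span_OX_def by auto
    qed
    then obtain P where P: "\<And>i j. i < r \<Longrightarrow> j < n \<Longrightarrow> P i j \<in> OX" "\<And>i l. i < r \<Longrightarrow> c (e i) l = (\<Sum>j<n. P i j * b j l)"
      by metis
    have "\<exists>k. \<forall>i<r. b j i * g ^ k \<in> OX" if "j < n" for j using c(4)[of "\<beta> j"] \<beta>[OF that] by auto
    then obtain K where K: "\<And>j i. j < n \<Longrightarrow> i < r \<Longrightarrow> b j i * g ^ K j \<in> OX" by metis
    have bP: "(\<Sum>i<r. b j i * P i l) = (if l = j then 1 else 0)" if jl: "j < n" "l < n" for j l
    proof -
      define a where "a = (\<lambda>l. g ^ K j * (\<Sum>i<r. b j i * P i l) - (if l = j then g ^ K j else 0))"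
      have z: "(\<Sum>l<n. a l * b l x) = 0" for x
      proof -
        have "(\<Sum>l<n. g ^ K j * (\<Sum>i<r. b j i * P i l) * b l x) = g ^ K j * (\<Sum>l<n. \<Sum>i<r. b j i * P i l * b l x)"
          by (simp add: sum_distrib_left sum_distrib_right mult_ac)
        also have "(\<Sum>l<n. \<Sum>i<r. b j i * P i l * b l x) = (\<Sum>i<r. b j i * c (e i) x)"
          by (subst sum.swap) (simp add: P(2) sum_distrib_left mult_ac)
        also have "\<dots> = (\<Sum>i<r. if i = x then b j i else 0)" by (intro sum.cong) (auto simp: c(5))
        also have "\<dots> = b j x" using c(1)[of x "\<beta> j"] \<beta>[OF jl(1)] by auto
        finally have "(\<Sum>l<n. g ^ K j * (\<Sum>i<r. b j i * P i l) * b l x) = g ^ K j * b j x" .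
        then show ?thesis using delta[OF jl(1), of "g ^ K j" "\<lambda>l. b l x"]
          by (simp add: a_def left_diff_distrib sum_subtractf)
      qed
      have o: "a l \<in> OX" if "l \<in> {..<n}" for l
      proof -
        have "g ^ K j * (\<Sum>i<r. b j i * P i l) = (\<Sum>i<r. (b j i * g ^ K j) * P i l)" by (simp add: sum_distrib_left mult_ac)
        also have "\<dots> \<in> OX"
        proof (rule OX_sum)
          fix i assume "i \<in> {..<r}"
          then show "(b j i * g ^ K j) * P i l \<in> OX" using K[OF jl(1), of i] P(1)[of i l] that by (simp only: lessThan_iff OX_mult)
        qed
        finally show ?thesis using g by (auto simp: a_def)
      qed
      have "a l = 0" using indep_OXD[OF b(2) o z] jl by blast
      then have "g ^ K j * (\<Sum>i<r. b j i * P i l) = g ^ K j * (if l = j then 1 else 0)" by (auto simp: a_def)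
      then show ?thesis using g0 mult_left_cancel[of "g ^ K j"] by simp
    qed
    have "(of_nat n :: rat fps) = (\<Sum>j<n. \<Sum>i<r. b j i * P i j)" by (simp add: bP)
    also have "\<dots> = (\<Sum>i<r. \<Sum>j<n. P i j * b j i)" by (subst sum.swap) (simp add: mult.commute)
    also have "\<dots> = (\<Sum>i<r. c (e i) i)" using P(2) by simp
    also have "\<dots> = of_nat r" by (simp add: c(5))
    finally show ?thesis by simp
  qed
  note [simp] = this
  have "\<exists>a. (\<forall>j<r. a j \<in> OX) \<and> (\<forall>i. c m i = (\<Sum>j<r. a j * b j i))" if "m \<in> carrier M" for m
  proof -
    have "c m \<in> span_OX {..<r} b" using b(1) that by auto
    then show ?thesis unfolding span_OX_def by auto
  qed
  then obtain \<kappa> where \<kappa>: "\<And>m j. m \<in> carrier M \<Longrightarrow> j < r \<Longrightarrow> \<kappa> m j \<in> OX"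
     "\<And>m i. m \<in> carrier M \<Longrightarrow> c m i = (\<Sum>j<r. \<kappa> m j * b j i)" by metis
  have uniq: "\<kappa> m j = a j" if m: "m \<in> carrier M" and a: "\<And>j. j < r \<Longrightarrow> a j \<in> OX" "\<And>i. c m i = (\<Sum>j<r. a j * b j i)" and j: "j < r" for m a j
  proof -
    have z: "(\<Sum>j<r. (\<kappa> m j - a j) * b j i) = 0" for i
      using \<kappa>(2)[OF m, of i] a(2)[of i] by (simp add: left_diff_distrib sum_subtractf)
    have o: "\<kappa> m j - a j \<in> OX" if "j \<in> {..<r}" for j using \<kappa>(1)[OF m] a(1) that by simp
    have "indep_OX {..<r} b" using b(2) by simp
    from indep_OXD[OF this o z] have "\<kappa> m j - a j = 0" using j by blast
    then show ?thesis by simp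
  qed
  have "coordinates M r \<kappa>"
    unfolding coordinates_def
  proof (intro conjI ballI allI impI M)
    fix m i assume "m \<in> carrier M" "i < r" then show "\<kappa> m i \<in> OX" by (rule \<kappa>)
  next
    fix m n i assume mn: "m \<in> carrier M" "n \<in> carrier M" "i < r"
    then show "\<kappa> (m \<oplus>\<^bsub>M\<^esub> n) i = \<kappa> m i + \<kappa> n i"
      by (intro uniq) (simp_all only: M.a_closed OX_add \<kappa>(1) c(2), simp_all only: \<kappa>(2) distrib_right sum.distrib)
  next
    fix f m i assume mn: "f \<in> OX" "m \<in> carrier M" "i < r"
    then show "\<kappa> (f \<odot>\<^bsub>M\<^esub> m) i = f * \<kappa> m i"
      by (intro uniq) (simp_all only: smult_closed OX_mult \<kappa>(1) c(3), simp_all only: \<kappa>(2) sum_distrib_left mult.assoc)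
  next
    fix m n assume "m \<in> carrier M" "n \<in> carrier M" "\<forall>i<r. \<kappa> m i = \<kappa> n i"
    then show "m = n" by (intro inj) (auto simp: \<kappa>)
  next
    fix a assume a: "\<forall>i<r. a i \<in> OX"
    then have "(\<lambda>i. \<Sum>j<r. a j * b j i) \<in> span_OX {..<r} b" unfolding span_OX_def by auto
    then have "(\<lambda>i. \<Sum>j<r. a j * b j i) \<in> c ` carrier M" using b(1) by simp
    then obtain m where m: "(\<lambda>i. \<Sum>j<r. a j * b j i) = c m" "m \<in> carrier M" by (rule imageE)
    have cm: "c m i = (\<Sum>j<r. a j * b j i)" for i using fun_cong[OF m(1), of i] by simp
    have "\<kappa> m i = a i" if "i < r" for i using a m(2) that cm by (intro uniq) simp_all
    then show "\<exists>m\<in>carrier M. \<forall>i<r. \<kappa> m i = a i" using m(2) by blast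
  qed
  then show thesis by (rule that)
qed

section \<open>Pullbacks in coordinates\<close>

definition ev :: "('k \<Rightarrow> rat fps) \<Rightarrow> ('k \<Rightarrow>\<^sub>0 int) \<Rightarrow> rat fps" where
  "ev h x = (\<Sum>k\<in>Poly_Mapping.keys x. of_int (Poly_Mapping.lookup x k) * h k)"

lemma ev_superset:
  assumes "finite S" "Poly_Mapping.keys x \<subseteq> S"
  shows "ev h x = (\<Sum>k\<in>S. of_int (Poly_Mapping.lookup x k) * h k)"
  unfolding ev_def using assms by (intro sum.mono_neutral_left) (auto simp: in_keys_iff)

lemma ev_0 [simp]: "ev h 0 = 0" by (simp add: ev_def)

lemma ev_add: "ev h (x + y) = ev h x + ev h y"
proof -
  let ?S = "Poly_Mapping.keys x \<union> Poly_Mapping.keys y"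
  have "ev h (x + y) = (\<Sum>k\<in>?S. of_int (Poly_Mapping.lookup (x + y) k) * h k)"
    using keys_add[of x y] by (intro ev_superset) auto
  moreover have "ev h x = (\<Sum>k\<in>?S. of_int (Poly_Mapping.lookup x k) * h k)" by (intro ev_superset) auto
  moreover have "ev h y = (\<Sum>k\<in>?S. of_int (Poly_Mapping.lookup y k) * h k)" by (intro ev_superset) auto
  ultimately show ?thesis by (simp add: lookup_add distrib_right sum.distrib)
qed

lemma ev_minus: "ev h (- x) = - ev h x"
  using ev_add[of h x "- x"] by (simp add: minus_unique)

lemma ev_diff: "ev h (x - y) = ev h x - ev h y"
  using ev_add[of h x "- y"] by (simp add: ev_minus)

lemma ev_frag_of [simp]: "ev h (frag_of k) = h k"
  by (simp add: ev_def)

lemma ev_sum: "ev h (sum f A) = (\<Sum>a\<in>A. ev h (f a))"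
  by (induction A rule: infinite_finite_induct) (simp_all add: ev_add)

lemma coordinates_basis:
  assumes "coordinates M r \<kappa>"
  obtains \<beta> where "\<And>i. i < r \<Longrightarrow> \<beta> i \<in> carrier M" "\<And>i j. i < r \<Longrightarrow> j < r \<Longrightarrow> \<kappa> (\<beta> i) j = (if i = j then 1 else 0)"
    "\<And>m. m \<in> carrier M \<Longrightarrow> m = (\<Oplus>\<^bsub>M\<^esub>i\<in>{..<r}. \<kappa> m i \<odot>\<^bsub>M\<^esub> \<beta> i)"
proof -
  have M: "module O_X M" and k0: "\<And>m i. m \<in> carrier M \<Longrightarrow> i < r \<Longrightarrow> \<kappa> m i \<in> OX"
    and ka: "\<And>m n i. m \<in> carrier M \<Longrightarrow> n \<in> carrier M \<Longrightarrow> i < r \<Longrightarrow> \<kappa> (m \<oplus>\<^bsub>M\<^esub> n) i = \<kappa> m i + \<kappa> n i"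
    and ks: "\<And>f m i. f \<in> OX \<Longrightarrow> m \<in> carrier M \<Longrightarrow> i < r \<Longrightarrow> \<kappa> (f \<odot>\<^bsub>M\<^esub> m) i = f * \<kappa> m i"
    and ki: "\<And>m n. m \<in> carrier M \<Longrightarrow> n \<in> carrier M \<Longrightarrow> (\<And>i. i < r \<Longrightarrow> \<kappa> m i = \<kappa> n i) \<Longrightarrow> m = n"
    and ks: "\<And>a. (\<And>i. i < r \<Longrightarrow> a i \<in> OX) \<Longrightarrow> \<exists>m\<in>carrier M. \<forall>i<r. \<kappa> m i = a i"
    using assms unfolding coordinates_def by auto
  interpret module O_X M by fact
  have "\<exists>b\<in>carrier M. \<forall>j<r. \<kappa> b j = (if i = j then 1 else 0)" for i by (rule ks) auto
  then obtain \<beta> where \<beta>: "\<And>i. \<beta> i \<in> carrier M" "\<And>i j. j < r \<Longrightarrow> \<kappa> (\<beta> i) j = (if i = j then 1 else 0)" by metis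
  have "m = (\<Oplus>\<^bsub>M\<^esub>i\<in>{..<r}. \<kappa> m i \<odot>\<^bsub>M\<^esub> \<beta> i)" if m: "m \<in> carrier M" for m
  proof (rule ki[OF m])
    show "(\<Oplus>\<^bsub>M\<^esub>i\<in>{..<r}. \<kappa> m i \<odot>\<^bsub>M\<^esub> \<beta> i) \<in> carrier M"
      using \<beta>(1) k0[OF m] by (intro finsum_closed) auto
    fix j assume j: "j < r"
    have "\<kappa> (\<Oplus>\<^bsub>M\<^esub>i\<in>{..<r}. \<kappa> m i \<odot>\<^bsub>M\<^esub> \<beta> i) j = (\<Sum>i<r. \<kappa> m i * \<kappa> (\<beta> i) j)"
      using \<beta>(1) k0[OF m] ka assms j unfolding coordinates_def
      by (intro finsum_functional_O_X[OF M, of "\<lambda>m. \<kappa> m j"]) auto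
    also have "\<dots> = (\<Sum>i<r. if i = j then \<kappa> m i else 0)" using j by (intro sum.cong) (auto simp: \<beta>)
    finally show "\<kappa> m j = \<kappa> (\<Oplus>\<^bsub>M\<^esub>i\<in>{..<r}. \<kappa> m i \<odot>\<^bsub>M\<^esub> \<beta> i) j" using j by simp
  qed
  then show thesis using \<beta> by (intro that[of \<beta>]) auto
qed

lemma connection_matrix:
  assumes co: "coordinates M r \<kappa>" and con: "is_connection O_X fps_deriv M nabla"
  obtains G where "\<And>i j. i < r \<Longrightarrow> j < r \<Longrightarrow> G i j \<in> OX"
    "\<And>m i. m \<in> carrier M \<Longrightarrow> i < r \<Longrightarrow> \<kappa> (nabla m) i = fps_deriv (\<kappa> m i) + (\<Sum>j<r. G i j * \<kappa> m j)"
proof -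
  have M: "module O_X M" and k0: "\<And>m i. m \<in> carrier M \<Longrightarrow> i < r \<Longrightarrow> \<kappa> m i \<in> OX"
    and ka: "\<And>m n i. m \<in> carrier M \<Longrightarrow> n \<in> carrier M \<Longrightarrow> i < r \<Longrightarrow> \<kappa> (m \<oplus>\<^bsub>M\<^esub> n) i = \<kappa> m i + \<kappa> n i"
    and ks: "\<And>f m i. f \<in> OX \<Longrightarrow> m \<in> carrier M \<Longrightarrow> i < r \<Longrightarrow> \<kappa> (f \<odot>\<^bsub>M\<^esub> m) i = f * \<kappa> m i"
    using co unfolding coordinates_def by auto
  have n: "\<And>m. m \<in> carrier M \<Longrightarrow> nabla m \<in> carrier M"
    "\<And>m n. m \<in> carrier M \<Longrightarrow> n \<in> carrier M \<Longrightarrow> nabla (m \<oplus>\<^bsub>M\<^esub> n) = nabla m \<oplus>\<^bsub>M\<^esub> nabla n"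
    "\<And>a m. a \<in> OX \<Longrightarrow> m \<in> carrier M \<Longrightarrow> nabla (a \<odot>\<^bsub>M\<^esub> m) = (fps_deriv a \<odot>\<^bsub>M\<^esub> m) \<oplus>\<^bsub>M\<^esub> (a \<odot>\<^bsub>M\<^esub> nabla m)"
    using con unfolding is_connection_def by auto
  interpret module O_X M by fact
  obtain \<beta> where \<beta>: "\<And>i. i < r \<Longrightarrow> \<beta> i \<in> carrier M" "\<And>i j. i < r \<Longrightarrow> j < r \<Longrightarrow> \<kappa> (\<beta> i) j = (if i = j then 1 else 0)"
    "\<And>m. m \<in> carrier M \<Longrightarrow> m = (\<Oplus>\<^bsub>M\<^esub>i\<in>{..<r}. \<kappa> m i \<odot>\<^bsub>M\<^esub> \<beta> i)"
    by (rule coordinates_basis[OF co]) (rule that)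
  define h where "h = (\<lambda>i m. \<kappa> (nabla m) i - fps_deriv (\<kappa> m i))"
  show thesis
  proof (rule that[of "\<lambda>i j. h i (\<beta> j)"])
    fix i j assume "i < r" "j < r"
    then show "h i (\<beta> j) \<in> OX" using \<beta> n k0 by (simp add: h_def)
  next
    fix m i assume m: "m \<in> carrier M" and i: "i < r"
    have "h i (\<Oplus>\<^bsub>M\<^esub>j\<in>{..<r}. \<kappa> m j \<odot>\<^bsub>M\<^esub> \<beta> j) = (\<Sum>j<r. \<kappa> m j * h i (\<beta> j))"
    proof (rule finsum_functional_O_X[OF M])
      fix m n' assume "m \<in> carrier M" "n' \<in> carrier M"
      then show "h i (m \<oplus>\<^bsub>M\<^esub> n') = h i m + h i n'" using i n(1) by (simp add: h_def n(2) ka)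
    next
      fix f m assume "f \<in> OX" "m \<in> carrier M"
      then show "h i (f \<odot>\<^bsub>M\<^esub> m) = f * h i m"
        using i n(1) by (simp add: h_def n(3) ka ks algebra_simps)
    qed (use \<beta> k0 m in auto)
    then have "h i m = (\<Sum>j<r. \<kappa> m j * h i (\<beta> j))" using \<beta>(3)[OF m] by simp
    then show "\<kappa> (nabla m) i = fps_deriv (\<kappa> m i) + (\<Sum>j<r. h i (\<beta> j) * \<kappa> m j)"
      by (simp add: h_def[of ] mult.commute algebra_simps)
  qed
qed

text \<open>
  Coordinates on the pullback of M along \<open>\<phi>\<close>. The injection \<open>\<iota>\<close> realises C as a ring of power series.
  The locale serves twice: for the completed local ring at the origin and for the finite etale cover.
\<close>

locale base_change =
  fixes M :: "(rat fps, 'm) module" and r :: nat and \<kappa> :: "'m \<Rightarrow> nat \<Rightarrow> rat fps"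
    and C :: "('c, 'x) ring_scheme" and \<phi> :: "rat fps \<Rightarrow> 'c" and \<iota> :: "'c \<Rightarrow> rat fps"
  assumes co: "coordinates M r \<kappa>" and C: "cring C"
    and iota_inj: "\<And>a b. a \<in> carrier C \<Longrightarrow> b \<in> carrier C \<Longrightarrow> \<iota> a = \<iota> b \<Longrightarrow> a = b"
    and iota_add: "\<And>a b. a \<in> carrier C \<Longrightarrow> b \<in> carrier C \<Longrightarrow> \<iota> (a \<oplus>\<^bsub>C\<^esub> b) = \<iota> a + \<iota> b"
    and iota_mult: "\<And>a b. a \<in> carrier C \<Longrightarrow> b \<in> carrier C \<Longrightarrow> \<iota> (a \<otimes>\<^bsub>C\<^esub> b) = \<iota> a * \<iota> b"
    and phi_closed: "\<And>a. a \<in> OX \<Longrightarrow> \<phi> a \<in> carrier C"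
    and iota_phi: "\<And>a. a \<in> OX \<Longrightarrow> \<iota> (\<phi> a) = a"
begin

sublocale C: cring C by (rule C)

lemma M: "module O_X M" and k_closed: "\<And>m i. m \<in> carrier M \<Longrightarrow> i < r \<Longrightarrow> \<kappa> m i \<in> OX"
    and k_add: "\<And>m n i. m \<in> carrier M \<Longrightarrow> n \<in> carrier M \<Longrightarrow> i < r \<Longrightarrow> \<kappa> (m \<oplus>\<^bsub>M\<^esub> n) i = \<kappa> m i + \<kappa> n i"
    and k_smult: "\<And>f m i. f \<in> OX \<Longrightarrow> m \<in> carrier M \<Longrightarrow> i < r \<Longrightarrow> \<kappa> (f \<odot>\<^bsub>M\<^esub> m) i = f * \<kappa> m i"
  using co unfolding coordinates_def by auto

sublocale M: module O_X M by (rule M)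

lemma iota_zero [simp]: "\<iota> \<zero>\<^bsub>C\<^esub> = 0"
  using iota_add[of "\<zero>\<^bsub>C\<^esub>" "\<zero>\<^bsub>C\<^esub>"] by simp

lemma iota_minus: "a \<in> carrier C \<Longrightarrow> b \<in> carrier C \<Longrightarrow> \<iota> (a \<ominus>\<^bsub>C\<^esub> b) = \<iota> a - \<iota> b"
proof -
  assume ab: "a \<in> carrier C" "b \<in> carrier C"
  have "(a \<ominus>\<^bsub>C\<^esub> b) \<oplus>\<^bsub>C\<^esub> b = a" using ab by (simp add: C.minus_eq C.a_assoc C.l_neg)
  then show ?thesis using iota_add[of "a \<ominus>\<^bsub>C\<^esub> b" b] ab by (simp add: eq_diff_eq)
qed

abbreviation "gens \<equiv> {x. Poly_Mapping.keys x \<subseteq> carrier C \<times> carrier M}"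
abbreviation "rels \<equiv> tensor_rels O_X C \<phi> M"
abbreviation "PB \<equiv> pullback O_X C \<phi> M"

definition \<theta> :: "('c \<times> 'm \<Rightarrow>\<^sub>0 int) \<Rightarrow> nat \<Rightarrow> rat fps" where
  "\<theta> x i = ev (\<lambda>(c, m). \<iota> c * \<kappa> m i) x"

lemma theta_simps [simp]:
  "\<theta> 0 i = 0" "\<theta> (x + y) i = \<theta> x i + \<theta> y i" "\<theta> (x - y) i = \<theta> x i - \<theta> y i"
  "\<theta> (- x) i = - \<theta> x i" "\<theta> (frag_of (c, m)) i = \<iota> c * \<kappa> m i"
  by (simp_all add: \<theta>_def ev_add ev_diff ev_minus)

lemma gens_closed: "x \<in> gens \<Longrightarrow> y \<in> gens \<Longrightarrow> x + y \<in> gens" "x \<in> gens \<Longrightarrow> y \<in> gens \<Longrightarrow> x - y \<in> gens"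
  "0 \<in> gens" "x \<in> gens \<Longrightarrow> - x \<in> gens" "c \<in> carrier C \<Longrightarrow> m \<in> carrier M \<Longrightarrow> frag_of (c, m) \<in> gens"
  using keys_add[of x y] keys_diff[of x y] by (auto simp: keys_minus)

lemma gens_induct [consumes 1, case_names zero one diff]:
  assumes "x \<in> gens" "P 0" "\<And>c m. c \<in> carrier C \<Longrightarrow> m \<in> carrier M \<Longrightarrow> P (frag_of (c, m))"
    "\<And>x y. x \<in> gens \<Longrightarrow> y \<in> gens \<Longrightarrow> P x \<Longrightarrow> P y \<Longrightarrow> P (x - y)"
  shows "P x"
  using assms by (intro free_Abelian_group_induct[of x "carrier C \<times> carrier M" P]) auto

lemma carrier_tensor_gens: "carrier (tensor_gens C M) = gens"
  by (auto simp: tensor_gens_def)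

definition tensor_gen_rels where "tensor_gen_rels =
     {frag_of (b \<oplus>\<^bsub>C\<^esub> b', m) - frag_of (b, m) - frag_of (b', m) | b b' m.
         b \<in> carrier C \<and> b' \<in> carrier C \<and> m \<in> carrier M} \<union>
      {frag_of (b, m \<oplus>\<^bsub>M\<^esub> m') - frag_of (b, m) - frag_of (b, m') | b m m'.
         b \<in> carrier C \<and> m \<in> carrier M \<and> m' \<in> carrier M} \<union>
      {frag_of (b \<otimes>\<^bsub>C\<^esub> \<phi> a, m) - frag_of (b, a \<odot>\<^bsub>M\<^esub> m) | a b m.
         a \<in> OX \<and> b \<in> carrier C \<and> m \<in> carrier M}"

lemma rels_eq: "rels = generate (tensor_gens C M) tensor_gen_rels"
  by (simp add: tensor_rels_def tensor_gen_rels_def)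

lemma tensor_gen_rels_gens: "tensor_gen_rels \<subseteq> gens"
  unfolding tensor_gen_rels_def
  by (intro Un_least subsetI; elim CollectE exE conjE; simp only:; intro gens_closed; (simp add: phi_closed M.smult_closed)?)

lemma rels_subgroup: "subgroup rels (tensor_gens C M)"
  unfolding rels_eq using tensor_gen_rels_gens
  by (intro group.generate_is_subgroup) (auto simp: tensor_gens_def)

lemma rels_gens: "rels \<subseteq> gens"
  using subgroup.subset[OF rels_subgroup] by (simp add: carrier_tensor_gens)

lemma rels_closed: "0 \<in> rels" "x \<in> rels \<Longrightarrow> y \<in> rels \<Longrightarrow> x + y \<in> rels" "x \<in> rels \<Longrightarrow> - x \<in> rels"
  "x \<in> rels \<Longrightarrow> y \<in> rels \<Longrightarrow> x - y \<in> rels"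
proof -
  show z: "0 \<in> rels" using subgroup.one_closed[OF rels_subgroup] by (simp add: tensor_gens_def)
  show a: "x + y \<in> rels" if "x \<in> rels" "y \<in> rels" for x y
    using subgroup.m_closed[OF rels_subgroup that] by (simp add: tensor_gens_def)
  show m: "- x \<in> rels" if "x \<in> rels" for x
    using subgroup.m_inv_closed[OF rels_subgroup that] rels_gens that by (auto simp: tensor_gens_def)
  show "x - y \<in> rels" if "x \<in> rels" "y \<in> rels" for x y
    using a[OF that(1) m[OF that(2)]] by simp
qed

lemma theta_gen_rels: "h \<in> tensor_gen_rels \<Longrightarrow> i < r \<Longrightarrow> \<theta> h i = 0"
  unfolding tensor_gen_rels_def
  by (elim UnE CollectE exE conjE; hypsubst; simp add: iota_add iota_mult phi_closed iota_phi k_add k_smult algebra_simps)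

lemma theta_rels: "x \<in> rels \<Longrightarrow> i < r \<Longrightarrow> \<theta> x i = 0"
  unfolding rels_eq
proof (induction x rule: generate.induct)
  case (incl h)
  then show ?case by (intro theta_gen_rels)
next
  case (inv h)
  then have "h \<in> gens" using tensor_gen_rels_gens by blast
  moreover from inv have "\<theta> h i = 0" by (intro theta_gen_rels)
  ultimately show ?case by (simp add: tensor_gens_def)
qed (auto simp: tensor_gens_def)

lemma theta_range: "x \<in> gens \<Longrightarrow> i < r \<Longrightarrow> \<theta> x i \<in> \<iota> ` carrier C"
proof (induction x rule: gens_induct)
  case zero
  show ?case using iota_zero C.zero_closed by (metis imageI theta_simps(1))
next
  case (one c m)
  have "\<iota> (c \<otimes>\<^bsub>C\<^esub> \<phi> (\<kappa> m i)) = \<theta> (frag_of (c, m)) i"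
    using one by (simp add: iota_mult phi_closed iota_phi k_closed)
  then show ?case using one by (metis C.m_closed imageI k_closed phi_closed)
next
  case (diff x y)
  then obtain a b where "a \<in> carrier C" "b \<in> carrier C" "\<theta> x i = \<iota> a" "\<theta> y i = \<iota> b" by blast
  then have "\<theta> (x - y) i = \<iota> (a \<ominus>\<^bsub>C\<^esub> b)" "a \<ominus>\<^bsub>C\<^esub> b \<in> carrier C" by (simp_all add: iota_minus)
  then show ?case by blast
qed

lemma rel_add_left: "b \<in> carrier C \<Longrightarrow> b' \<in> carrier C \<Longrightarrow> m \<in> carrier M \<Longrightarrow>
    frag_of (b \<oplus>\<^bsub>C\<^esub> b', m) - frag_of (b, m) - frag_of (b', m) \<in> rels"
  unfolding rels_eq tensor_gen_rels_def by (rule generate.incl) blast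

lemma rel_add_right: "b \<in> carrier C \<Longrightarrow> m \<in> carrier M \<Longrightarrow> m' \<in> carrier M \<Longrightarrow>
    frag_of (b, m \<oplus>\<^bsub>M\<^esub> m') - frag_of (b, m) - frag_of (b, m') \<in> rels"
  unfolding rels_eq tensor_gen_rels_def by (rule generate.incl) blast

lemma rel_smult: "a \<in> OX \<Longrightarrow> b \<in> carrier C \<Longrightarrow> m \<in> carrier M \<Longrightarrow>
    frag_of (b \<otimes>\<^bsub>C\<^esub> \<phi> a, m) - frag_of (b, a \<odot>\<^bsub>M\<^esub> m) \<in> rels"
  unfolding rels_eq tensor_gen_rels_def by (rule generate.incl) blast

lemma rel_zero_left: "m \<in> carrier M \<Longrightarrow> frag_of (\<zero>\<^bsub>C\<^esub>, m) \<in> rels"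
  using rels_closed(3)[OF rel_add_left[of "\<zero>\<^bsub>C\<^esub>" "\<zero>\<^bsub>C\<^esub>" m]] by simp

lemma rel_zero_right: "b \<in> carrier C \<Longrightarrow> frag_of (b, \<zero>\<^bsub>M\<^esub>) \<in> rels"
  using rels_closed(3)[OF rel_add_right[of b "\<zero>\<^bsub>M\<^esub>" "\<zero>\<^bsub>M\<^esub>"]] by simp

lemma rel_finsum:
  assumes "finite A" "f \<in> A \<rightarrow> carrier M" "b \<in> carrier C"
  shows "frag_of (b, \<Oplus>\<^bsub>M\<^esub>i\<in>A. f i) - (\<Sum>i\<in>A. frag_of (b, f i)) \<in> rels"
  using assms(1,2)
proof (induction A rule: finite_induct)
  case empty
  then show ?case using rel_zero_right[OF assms(3)] by simp
next
  case (insert a A)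
  then have 1: "f a \<in> carrier M" "(\<Oplus>\<^bsub>M\<^esub>i\<in>A. f i) \<in> carrier M" by (auto intro!: M.finsum_closed)
  have 2: "(\<Oplus>\<^bsub>M\<^esub>i\<in>insert a A. f i) = f a \<oplus>\<^bsub>M\<^esub> (\<Oplus>\<^bsub>M\<^esub>i\<in>A. f i)" using insert by (intro M.finsum_insert) auto
  have "frag_of (b, \<Oplus>\<^bsub>M\<^esub>i\<in>insert a A. f i) - (\<Sum>i\<in>insert a A. frag_of (b, f i))
    = (frag_of (b, f a \<oplus>\<^bsub>M\<^esub> (\<Oplus>\<^bsub>M\<^esub>i\<in>A. f i)) - frag_of (b, f a) - frag_of (b, \<Oplus>\<^bsub>M\<^esub>i\<in>A. f i))
     + (frag_of (b, \<Oplus>\<^bsub>M\<^esub>i\<in>A. f i) - (\<Sum>i\<in>A. frag_of (b, f i)))"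
    unfolding 2 using insert by simp
  also have "\<dots> \<in> rels" using insert 1 assms(3) by (intro rels_closed(2) rel_add_right) auto
  finally show ?case .
qed

lemma rels_sum: "(\<And>a. a \<in> A \<Longrightarrow> f a \<in> rels) \<Longrightarrow> sum f A \<in> rels"
  by (induction A rule: infinite_finite_induct) (auto intro: rels_closed)

text \<open>
  Modulo the tensor relations every element is \<open>\<Sum> c\<^sub>i \<otimes> \<beta>\<^sub>i\<close> with coefficients read off by \<open>\<theta>\<close>.
\<close>

lemma normal_form:
  assumes x: "x \<in> gens" and \<beta>: "\<And>i. i < r \<Longrightarrow> \<beta> i \<in> carrier M"
    "\<And>m. m \<in> carrier M \<Longrightarrow> m = (\<Oplus>\<^bsub>M\<^esub>i\<in>{..<r}. \<kappa> m i \<odot>\<^bsub>M\<^esub> \<beta> i)"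
  shows "\<exists>c. (\<forall>i<r. c i \<in> carrier C \<and> \<iota> (c i) = \<theta> x i) \<and> x - (\<Sum>i<r. frag_of (c i, \<beta> i)) \<in> rels"
  using x
proof (induction x rule: gens_induct)
  case zero
  have "0 - (\<Sum>i<r. frag_of (\<zero>\<^bsub>C\<^esub>, \<beta> i)) \<in> rels"
    using \<beta> by (intro rels_closed(4) rels_closed(1) rels_sum rel_zero_left) auto
  then show ?case by (intro exI[of _ "\<lambda>_. \<zero>\<^bsub>C\<^esub>"]) auto
next
  case (one b m)
  define c where "c = (\<lambda>i. b \<otimes>\<^bsub>C\<^esub> \<phi> (\<kappa> m i))"
  have c: "\<forall>i<r. c i \<in> carrier C \<and> \<iota> (c i) = \<theta> (frag_of (b, m)) i"
    using one by (simp add: c_def iota_mult phi_closed iota_phi k_closed)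
  have km: "(\<lambda>i. \<kappa> m i \<odot>\<^bsub>M\<^esub> \<beta> i) \<in> {..<r} \<rightarrow> carrier M"
    using one \<beta>(1) k_closed by (auto intro!: M.smult_closed)
  have "frag_of (b, m) - (\<Sum>i<r. frag_of (c i, \<beta> i)) =
    (frag_of (b, \<Oplus>\<^bsub>M\<^esub>i\<in>{..<r}. \<kappa> m i \<odot>\<^bsub>M\<^esub> \<beta> i) - (\<Sum>i<r. frag_of (b, \<kappa> m i \<odot>\<^bsub>M\<^esub> \<beta> i)))
    - (\<Sum>i<r. frag_of (c i, \<beta> i) - frag_of (b, \<kappa> m i \<odot>\<^bsub>M\<^esub> \<beta> i))"
    using \<beta>(2)[OF one(2)] by (simp add: sum_subtractf)
  also have "\<dots> \<in> rels"
  proof (rule rels_closed(4))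
    show "frag_of (b, \<Oplus>\<^bsub>M\<^esub>i\<in>{..<r}. \<kappa> m i \<odot>\<^bsub>M\<^esub> \<beta> i) - (\<Sum>i<r. frag_of (b, \<kappa> m i \<odot>\<^bsub>M\<^esub> \<beta> i)) \<in> rels"
      using one km by (intro rel_finsum) auto
    show "(\<Sum>i<r. frag_of (c i, \<beta> i) - frag_of (b, \<kappa> m i \<odot>\<^bsub>M\<^esub> \<beta> i)) \<in> rels"
      unfolding c_def using one \<beta>(1) k_closed by (intro rels_sum rel_smult) auto
  qed
  finally show ?case using c by blast
next
  case (diff x y)
  obtain c where c: "\<And>i. i < r \<Longrightarrow> c i \<in> carrier C" "\<And>i. i < r \<Longrightarrow> \<iota> (c i) = \<theta> x i" "x - (\<Sum>i<r. frag_of (c i, \<beta> i)) \<in> rels"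
    using diff(3) by blast
  obtain d where d: "\<And>i. i < r \<Longrightarrow> d i \<in> carrier C" "\<And>i. i < r \<Longrightarrow> \<iota> (d i) = \<theta> y i" "y - (\<Sum>i<r. frag_of (d i, \<beta> i)) \<in> rels"
    using diff(4) by blast
  let ?e = "\<lambda>i. c i \<ominus>\<^bsub>C\<^esub> d i"
  have ec: "?e i \<oplus>\<^bsub>C\<^esub> d i = c i" if "i < r" for i
    using c(1)[OF that] d(1)[OF that] by (simp add: C.minus_eq C.a_assoc C.l_neg)
  have s: "(\<Sum>i<r. frag_of (c i, \<beta> i) - frag_of (?e i, \<beta> i) - frag_of (d i, \<beta> i)) \<in> rels"
  proof (rule rels_sum)
    fix i assume "i \<in> {..<r}"
    then show "frag_of (c i, \<beta> i) - frag_of (?e i, \<beta> i) - frag_of (d i, \<beta> i) \<in> rels"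
      using rel_add_left[of "?e i" "d i" "\<beta> i"] ec[of i] c(1)[of i] d(1)[of i] \<beta>(1)[of i] by simp
  qed
  have "(x - (\<Sum>i<r. frag_of (c i, \<beta> i))) - (y - (\<Sum>i<r. frag_of (d i, \<beta> i)))
     + (\<Sum>i<r. frag_of (c i, \<beta> i) - frag_of (?e i, \<beta> i) - frag_of (d i, \<beta> i)) \<in> rels"
    by (rule rels_closed(2)[OF rels_closed(4)[OF c(3) d(3)] s])
  moreover have "(x - (\<Sum>i<r. frag_of (c i, \<beta> i))) - (y - (\<Sum>i<r. frag_of (d i, \<beta> i)))
     + (\<Sum>i<r. frag_of (c i, \<beta> i) - frag_of (?e i, \<beta> i) - frag_of (d i, \<beta> i)) = (x - y) - (\<Sum>i<r. frag_of (?e i, \<beta> i))"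
    by (simp add: sum_subtractf)
  moreover have "\<forall>i<r. ?e i \<in> carrier C \<and> \<iota> (?e i) = \<theta> (x - y) i" using c d by (simp add: iota_minus)
  ultimately show ?case by (intro exI[of _ ?e]) simp
qed

text \<open>
  The coordinates \<open>\<theta>\<close> are well defined and injective on \<open>C \<otimes> M\<close>.
\<close>

lemma rels_iff: "x \<in> rels \<longleftrightarrow> x \<in> gens \<and> (\<forall>i<r. \<theta> x i = 0)"
proof
  assume "x \<in> rels" then show "x \<in> gens \<and> (\<forall>i<r. \<theta> x i = 0)" using theta_rels rels_gens by blast
next
  assume x: "x \<in> gens \<and> (\<forall>i<r. \<theta> x i = 0)"
  obtain \<beta> where \<beta>: "\<And>i. i < r \<Longrightarrow> \<beta> i \<in> carrier M" "\<And>i j. i < r \<Longrightarrow> j < r \<Longrightarrow> \<kappa> (\<beta> i) j = (if i = j then 1 else 0)"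
    "\<And>m. m \<in> carrier M \<Longrightarrow> m = (\<Oplus>\<^bsub>M\<^esub>i\<in>{..<r}. \<kappa> m i \<odot>\<^bsub>M\<^esub> \<beta> i)"
    by (rule coordinates_basis[OF co]) (rule that)
  have xg: "x \<in> gens" using x by blast
  have "\<exists>c. (\<forall>i<r. c i \<in> carrier C \<and> \<iota> (c i) = \<theta> x i) \<and> x - (\<Sum>i<r. frag_of (c i, \<beta> i)) \<in> rels"
    by (rule normal_form[OF xg \<beta>(1,3)])
  then obtain c where c: "\<And>i. i < r \<Longrightarrow> c i \<in> carrier C" "\<And>i. i < r \<Longrightarrow> \<iota> (c i) = \<theta> x i" "x - (\<Sum>i<r. frag_of (c i, \<beta> i)) \<in> rels"
    by blast
  have "c i = \<zero>\<^bsub>C\<^esub>" if "i < r" for i using c(1,2)[OF that] x that by (intro iota_inj) auto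
  then have "(\<Sum>i<r. frag_of (c i, \<beta> i)) \<in> rels" using \<beta>(1) by (intro rels_sum) (auto intro: rel_zero_left)
  from rels_closed(2)[OF c(3) this] show "x \<in> rels" by simp
qed

definition cl :: "('c \<times> 'm \<Rightarrow>\<^sub>0 int) \<Rightarrow> ('c \<times> 'm \<Rightarrow>\<^sub>0 int) set" where
  "cl x = {h + x | h. h \<in> rels}"

lemma cl_mem: "y \<in> cl x \<longleftrightarrow> y - x \<in> rels"
  unfolding cl_def by (auto intro!: exI[of _ "y - x"])

lemma cl_self: "x \<in> cl x" by (simp add: cl_mem rels_closed)

lemma cl_theta: "x \<in> gens \<Longrightarrow> y \<in> cl x \<Longrightarrow> i < r \<Longrightarrow> \<theta> y i = \<theta> x i"
  using theta_rels[of "y - x" i] unfolding cl_mem by simp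

lemma cl_eq_iff: "x \<in> gens \<Longrightarrow> y \<in> gens \<Longrightarrow> cl x = cl y \<longleftrightarrow> (\<forall>i<r. \<theta> x i = \<theta> y i)"
proof
  assume xy: "x \<in> gens" "y \<in> gens" and "cl x = cl y"
  then have "x \<in> cl y" using cl_self by blast
  then show "\<forall>i<r. \<theta> x i = \<theta> y i" using cl_theta xy by blast
next
  assume xy: "x \<in> gens" "y \<in> gens" and e: "\<forall>i<r. \<theta> x i = \<theta> y i"
  have d: "x - y \<in> rels" unfolding rels_iff using e gens_closed(2)[OF xy] by simp
  show "cl x = cl y"
  proof (intro subset_antisym subsetI)
    fix z assume "z \<in> cl x"
    then have "(z - x) + (x - y) \<in> rels" using d unfolding cl_mem by (rule rels_closed(2))
    then show "z \<in> cl y" unfolding cl_mem by simp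
  next
    fix z assume "z \<in> cl y"
    then have "(z - y) - (x - y) \<in> rels" using d unfolding cl_mem by (rule rels_closed(4))
    then show "z \<in> cl x" unfolding cl_mem by simp
  qed
qed

lemma carrier_PB: "U \<in> carrier PB \<longleftrightarrow> (\<exists>x\<in>gens. U = cl x)"
proof -
  have "rels #>\<^bsub>tensor_gens C M\<^esub> x = cl x" for x
    unfolding r_coset_def cl_def by (auto simp: tensor_gens_def)
  then show ?thesis
    unfolding pullback_def by (simp add: FactGroup_def RCOSETS_def carrier_tensor_gens Bex_def)
qed

lemma zero_PB: "\<zero>\<^bsub>PB\<^esub> = cl 0"
  unfolding pullback_def cl_def by simp

lemma add_PB: "x \<in> gens \<Longrightarrow> y \<in> gens \<Longrightarrow> cl x \<oplus>\<^bsub>PB\<^esub> cl y = cl (x + y)"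
proof -
  have "cl x \<oplus>\<^bsub>PB\<^esub> cl y = {u + v | u v. u \<in> cl x \<and> v \<in> cl y}"
    unfolding pullback_def by (auto simp: set_mult_def tensor_gens_def)
  also have "\<dots> = cl (x + y)"
  proof (intro subset_antisym subsetI)
    fix z assume "z \<in> {u + v | u v. u \<in> cl x \<and> v \<in> cl y}"
    then obtain u v where "z = u + v" "u - x \<in> rels" "v - y \<in> rels" by (auto simp: cl_mem)
    then show "z \<in> cl (x + y)" unfolding cl_mem using rels_closed(2)[of "u - x" "v - y"] by (simp add: algebra_simps)
  next
    fix z assume "z \<in> cl (x + y)"
    then have "z - y \<in> cl x" "y \<in> cl y" using cl_self by (auto simp: cl_mem algebra_simps)
    moreover have "z = (z - y) + y" by simp
    ultimately show "z \<in> {u + v | u v. u \<in> cl x \<and> v \<in> cl y}" by blast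
  qed
  finally show ?thesis .
qed

text \<open>
  This computes scalar multiplication and the connection of the pullback on representatives.
\<close>

lemma cl_endo:
  assumes F: "\<And>x y. F (x + y) = F x + F y" "\<And>h. h \<in> rels \<Longrightarrow> F h \<in> rels"
  shows "rels <#>\<^bsub>tensor_gens C M\<^esub> (F ` cl x) = cl (F x)"
proof -
  have "rels <#>\<^bsub>tensor_gens C M\<^esub> (F ` cl x) = {h + F y | h y. h \<in> rels \<and> y \<in> cl x}"
    by (auto simp: set_mult_def tensor_gens_def)
  also have "\<dots> = cl (F x)"
  proof (intro subset_antisym subsetI)
    fix z assume "z \<in> {h + F y | h y. h \<in> rels \<and> y \<in> cl x}"
    then obtain h y where z: "z = h + F y" "h \<in> rels" "y - x \<in> rels" by (auto simp: cl_mem)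
    have "F y = F (y - x) + F x" using F(1)[of "y - x" x] by simp
    then have "z - F x = h + F (y - x)" using z by simp
    also have "\<dots> \<in> rels" using z F(2) by (intro rels_closed(2)) auto
    finally show "z \<in> cl (F x)" by (simp add: cl_mem)
  next
    fix z assume "z \<in> cl (F x)"
    then have "z - F x \<in> rels" by (simp add: cl_mem)
    moreover have "z = (z - F x) + F x" by simp
    ultimately show "z \<in> {h + F y | h y. h \<in> rels \<and> y \<in> cl x}" using cl_self by blast
  qed
  finally show ?thesis .
qed

lemma frag_extend_gens:
  assumes "\<And>c m. c \<in> carrier C \<Longrightarrow> m \<in> carrier M \<Longrightarrow> f (c, m) \<in> gens" and "x \<in> gens"
  shows "frag_extend f x \<in> gens"
  using assms(2)
proof (induction x rule: gens_induct)
  case (one c m) then show ?case using assms(1)[of c m] by simp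
next
  case (diff x y) then show ?case using gens_closed(2)[of "frag_extend f x" "frag_extend f y"] by (simp add: frag_extend_diff)
qed simp

lemma smult_PB:
  assumes b: "b \<in> carrier C" and x: "x \<in> gens"
  obtains y where "y \<in> gens" "b \<odot>\<^bsub>PB\<^esub> cl x = cl y" "\<And>i. i < r \<Longrightarrow> \<theta> y i = \<iota> b * \<theta> x i"
proof -
  define f :: "'c \<times> 'm \<Rightarrow> ('c \<times> 'm \<Rightarrow>\<^sub>0 int)" where "f = (\<lambda>(b', m). frag_of (b \<otimes>\<^bsub>C\<^esub> b', m))"
  have fg: "f (c, m) \<in> gens" if "c \<in> carrier C" "m \<in> carrier M" for c m
    using that b unfolding f_def by (simp add: gens_closed(5))
  have g: "frag_extend f y \<in> gens" if "y \<in> gens" for y using frag_extend_gens[of f y] fg that by blast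
  have t: "\<theta> (frag_extend f y) i = \<iota> b * \<theta> y i" if "y \<in> gens" "i < r" for y i
    using that(1)
  proof (induction y rule: gens_induct)
    case (one c m) then show ?case using b by (simp add: f_def iota_mult)
  next
    case (diff x y) then show ?case by (simp add: frag_extend_diff right_diff_distrib)
  qed simp
  have "b \<odot>\<^bsub>PB\<^esub> cl x = rels <#>\<^bsub>tensor_gens C M\<^esub> (frag_extend f ` cl x)"
    unfolding pullback_def f_def by simp
  also have "\<dots> = cl (frag_extend f x)"
    by (rule cl_endo) (use g t in \<open>auto simp: frag_extend_add rels_iff\<close>)
  finally show thesis using g[OF x] t[OF x] by (intro that[of "frag_extend f x"])
qed

lemma connection_PB:
  assumes d: "\<And>c. c \<in> carrier C \<Longrightarrow> \<delta> c \<in> carrier C" "\<And>c. c \<in> carrier C \<Longrightarrow> \<iota> (\<delta> c) = fps_deriv (\<iota> c)"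
    and n: "\<And>m. m \<in> carrier M \<Longrightarrow> nabla m \<in> carrier M"
    "\<And>m i. m \<in> carrier M \<Longrightarrow> i < r \<Longrightarrow> \<kappa> (nabla m) i = fps_deriv (\<kappa> m i) + (\<Sum>j<r. G i j * \<kappa> m j)"
    and x: "x \<in> gens"
  obtains y where "y \<in> gens" "pullback_connection O_X C \<phi> M \<delta> nabla (cl x) = cl y"
    "\<And>i. i < r \<Longrightarrow> \<theta> y i = fps_deriv (\<theta> x i) + (\<Sum>j<r. G i j * \<theta> x j)"
proof -
  define f :: "'c \<times> 'm \<Rightarrow> ('c \<times> 'm \<Rightarrow>\<^sub>0 int)" where "f = (\<lambda>(b, m). frag_of (\<delta> b, m) + frag_of (b, nabla m))"
  have fg: "f (c, m) \<in> gens" if "c \<in> carrier C" "m \<in> carrier M" for c m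
  proof -
    have "frag_of (\<delta> c, m) + frag_of (c, nabla m) \<in> gens"
      by (rule gens_closed(1)) (use that d n in \<open>auto\<close>)
    then show ?thesis by (simp add: f_def)
  qed
  have g: "frag_extend f y \<in> gens" if "y \<in> gens" for y using frag_extend_gens[of f y] fg that by blast
  have t: "\<theta> (frag_extend f y) i = fps_deriv (\<theta> y i) + (\<Sum>j<r. G i j * \<theta> y j)" if "y \<in> gens" "i < r" for y i
    using that(1)
  proof (induction y rule: gens_induct)
    case (one c m)
    have "\<theta> (frag_extend f (frag_of (c, m))) i = fps_deriv (\<iota> c) * \<kappa> m i + \<iota> c * (fps_deriv (\<kappa> m i) + (\<Sum>j<r. G i j * \<kappa> m j))"
      using one \<open>i < r\<close> d n by (simp add: f_def)
    also have "\<dots> = fps_deriv (\<theta> (frag_of (c, m)) i) + (\<Sum>j<r. G i j * \<theta> (frag_of (c, m)) j)"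
      by (simp add: distrib_left sum_distrib_left mult_ac)
    finally show ?case .
  next
    case (diff x y) then show ?case by (simp add: frag_extend_diff right_diff_distrib sum_subtractf)
  qed simp
  have "pullback_connection O_X C \<phi> M \<delta> nabla (cl x) = rels <#>\<^bsub>tensor_gens C M\<^esub> (frag_extend f ` cl x)"
    unfolding pullback_connection_def f_def by simp
  also have "\<dots> = cl (frag_extend f x)"
  proof (rule cl_endo)
    fix h assume h: "h \<in> rels"
    then have "h \<in> gens" "\<And>i. i < r \<Longrightarrow> \<theta> h i = 0" by (auto simp: rels_iff)
    then show "frag_extend f h \<in> rels" unfolding rels_iff using g t by simp
  qed (simp add: frag_extend_add)
  finally show thesis using g[OF x] t[OF x] by (intro that[of "frag_extend f x"])
qed

lemma theta_surj:
  assumes v: "\<And>i. i < r \<Longrightarrow> v i \<in> \<iota> ` carrier C"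
  shows "\<exists>x\<in>gens. \<forall>i<r. \<theta> x i = v i"
proof -
  obtain \<beta> where \<beta>: "\<And>i. i < r \<Longrightarrow> \<beta> i \<in> carrier M" "\<And>i j. i < r \<Longrightarrow> j < r \<Longrightarrow> \<kappa> (\<beta> i) j = (if i = j then 1 else 0)"
    "\<And>m. m \<in> carrier M \<Longrightarrow> m = (\<Oplus>\<^bsub>M\<^esub>i\<in>{..<r}. \<kappa> m i \<odot>\<^bsub>M\<^esub> \<beta> i)"
    by (rule coordinates_basis[OF co]) (rule that)
  have "\<forall>i\<in>{..<r}. \<exists>c\<in>carrier C. v i = \<iota> c" using v by blast
  then have "\<exists>c. \<forall>i\<in>{..<r}. c i \<in> carrier C \<and> v i = \<iota> (c i)" by (intro bchoice) blast
  then obtain c where c: "\<And>i. i < r \<Longrightarrow> c i \<in> carrier C" "\<And>i. i < r \<Longrightarrow> v i = \<iota> (c i)"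
    by auto
  define x where "x = (\<Sum>i<r. frag_of (c i, \<beta> i))"
  have "(\<Sum>i\<in>A. frag_of (c i, \<beta> i)) \<in> gens" if "A \<subseteq> {..<r}" for A
    using finite_subset[OF that finite_lessThan] that
  proof (induction A rule: finite_induct)
    case (insert a A)
    have "frag_of (c a, \<beta> a) \<in> gens" using insert c \<beta> by (intro gens_closed(5)) auto
    moreover have "(\<Sum>i\<in>A. frag_of (c i, \<beta> i)) \<in> gens" using insert by simp
    ultimately have "frag_of (c a, \<beta> a) + (\<Sum>i\<in>A. frag_of (c i, \<beta> i)) \<in> gens" by (rule gens_closed(1))
    then show ?case using insert by simp
  qed simp
  then have "x \<in> gens" unfolding x_def by blast
  moreover have "\<theta> x j = v j" if "j < r" for j
  proof -
    have "\<theta> x j = (\<Sum>i<r. \<iota> (c i) * \<kappa> (\<beta> i) j)" by (simp add: x_def \<theta>_def ev_sum)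
    also have "\<dots> = (\<Sum>i<r. if i = j then v i else 0)" using that \<beta>(2) c(2) by (intro sum.cong) auto
    finally show ?thesis using that by simp
  qed
  ultimately show ?thesis by blast
qed

end

section \<open>Formal horizontal sections\<close>

primrec iterated_connection :: "(nat \<Rightarrow> nat \<Rightarrow> rat fps) \<Rightarrow> nat \<Rightarrow> (nat \<Rightarrow> rat fps) \<Rightarrow> nat \<Rightarrow> nat \<Rightarrow> rat fps" where
  "iterated_connection G r u 0 = u"
| "iterated_connection G r u (Suc n) =
     (\<lambda>i. fps_deriv (iterated_connection G r u n i) + (\<Sum>j<r. G i j * iterated_connection G r u n j))"

text \<open>
  The i-th coordinate of \<open>\<Sum> (-x)\<^sup>n / n! \<nabla>\<^sup>n u\<close>, the horizontal section with value u at the origin. Only the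
  terms with \<open>n \<le> m\<close> contribute to the coefficient of order m. The connection is \<open>d/dx + G\<close>.
\<close>

definition taylor_section :: "(nat \<Rightarrow> nat \<Rightarrow> rat fps) \<Rightarrow> nat \<Rightarrow> (nat \<Rightarrow> rat fps) \<Rightarrow> nat \<Rightarrow> rat fps" where
  "taylor_section G r u i =
     Abs_fps (\<lambda>m. \<Sum>n\<le>m. ((-1) ^ n / fact n) * fps_nth (iterated_connection G r u n i) (m - n))"

lemma taylor_section_0: "fps_nth (taylor_section G r u i) 0 = fps_nth (u i) 0"
  by (simp add: taylor_section_def)

lemma fps_mult_nth_cong:
  assumes "\<And>k. k \<le> m \<Longrightarrow> fps_nth f k = fps_nth g k"
  shows "fps_nth (h * f) m = fps_nth (h * g) m"
  unfolding fps_mult_nth using assms by (intro sum.cong) auto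

text \<open>
  The sum telescopes when the connection is applied to it.
\<close>

lemma taylor_section_deriv:
  "fps_deriv (taylor_section G r u i) = - (\<Sum>j<r. G i j * taylor_section G r u j)"
proof -
  define D where "D = iterated_connection G r u"
  define c :: "nat \<Rightarrow> rat" where "c = (\<lambda>n. (-1) ^ n / fact n)"
  define S where "S = (\<lambda>N i. \<Sum>n\<le>N. fps_const (c n) * (fps_X ^ n * D n i))"
  have nth: "fps_nth (taylor_section G r u i) m = fps_nth (S N i) m" if "m \<le> N" for i m N
  proof -
    have "fps_nth (S N i) m = (\<Sum>n\<le>N. c n * (if m < n then 0 else fps_nth (D n i) (m - n)))"
      by (simp add: S_def fps_sum_nth fps_X_power_mult_nth)
    also have "\<dots> = (\<Sum>n\<le>m. c n * (if m < n then 0 else fps_nth (D n i) (m - n)))"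
      using that by (intro sum.mono_neutral_right) auto
    also have "\<dots> = (\<Sum>n\<le>m. c n * fps_nth (D n i) (m - n))" by (intro sum.cong) auto
    finally show ?thesis by (simp add: taylor_section_def c_def D_def)
  qed
  have cS: "of_nat (Suc n) * c (Suc n) = - c n" for n
    by (simp add: c_def field_simps del: of_nat_Suc)
  have tele: "fps_deriv (S N i) + (\<Sum>j<r. G i j * S N j) = fps_const (c N) * (fps_X ^ N * D (Suc N) i)" for N
  proof (induction N)
    case 0
    show ?case by (simp add: S_def c_def D_def)
  next
    case (Suc N)
    define x where "x = (\<lambda>i. fps_const (c (Suc N)) * (fps_X ^ Suc N * D (Suc N) i))"
    have Sx: "S (Suc N) i = S N i + x i" for i by (simp add: S_def x_def)
    have dX: "fps_deriv (fps_X ^ Suc N :: rat fps) = fps_const (of_nat (Suc N)) * fps_X ^ N"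
      by (simp add: fps_deriv_power fps_of_nat del: of_nat_Suc power_Suc)
    have dx: "fps_deriv (x i) = fps_const (of_nat (Suc N) * c (Suc N)) * (fps_X ^ N * D (Suc N) i)
         + fps_const (c (Suc N)) * (fps_X ^ Suc N * fps_deriv (D (Suc N) i))"
      unfolding x_def fps_deriv_mult dX by (simp add: algebra_simps del: power_Suc of_nat_Suc flip: fps_const_mult)
    have Gx: "(\<Sum>j<r. G i j * x j) = fps_const (c (Suc N)) * (fps_X ^ Suc N * (\<Sum>j<r. G i j * D (Suc N) j))"
      unfolding x_def sum_distrib_left by (intro sum.cong) (simp_all add: mult_ac)
    have "fps_deriv (S (Suc N) i) + (\<Sum>j<r. G i j * S (Suc N) j)
      = (fps_deriv (S N i) + (\<Sum>j<r. G i j * S N j)) + (fps_deriv (x i) + (\<Sum>j<r. G i j * x j))"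
      unfolding Sx by (simp add: distrib_left sum.distrib)
    also have "\<dots> = (fps_deriv (S N i) + (\<Sum>j<r. G i j * S N j))
       + (fps_const (of_nat (Suc N) * c (Suc N)) * (fps_X ^ N * D (Suc N) i)
         + fps_const (c (Suc N)) * (fps_X ^ Suc N * (fps_deriv (D (Suc N) i) + (\<Sum>j<r. G i j * D (Suc N) j))))"
      unfolding dx Gx by (simp add: distrib_left add.assoc)
    also have "\<dots> = fps_const (c (Suc N)) * (fps_X ^ Suc N * D (Suc (Suc N)) i)"
      unfolding Suc cS by (simp add: D_def flip: fps_const_neg)
    finally show ?case .
  qed
  show ?thesis
  proof (rule fps_ext)
    fix m
    have "fps_nth (fps_deriv (taylor_section G r u i)) m = fps_nth (fps_deriv (S (Suc m) i)) m"
      using nth[of "m + 1" "Suc m" i] by simp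
    moreover have "fps_nth (\<Sum>j<r. G i j * taylor_section G r u j) m = fps_nth (\<Sum>j<r. G i j * S (Suc m) j) m"
      unfolding fps_sum_nth by (intro sum.cong fps_mult_nth_cong nth) auto
    moreover have "fps_nth (fps_deriv (S (Suc m) i) + (\<Sum>j<r. G i j * S (Suc m) j)) m = 0"
      unfolding tele by (simp only: fps_mult_left_const_nth fps_X_power_mult_nth) simp
    ultimately show "fps_nth (fps_deriv (taylor_section G r u i)) m = fps_nth (- (\<Sum>j<r. G i j * taylor_section G r u j)) m"
      by simp
  qed
qed

section \<open>Convergent and integral power series\<close>

text \<open>
  Boundedness at every radius below \<open>\<rho>\<close> gives convergence at every smaller radius.
\<close>

lemma convergent_fps_iff:
  "f \<in> convergent_fps p \<rho> \<longleftrightarrow> (\<forall>s. 0 < s \<and> s < \<rho> \<longrightarrow> (\<exists>B. \<forall>n. padic_abs p (fps_nth f n) * s ^ n \<le> B))"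
proof
  assume f: "f \<in> convergent_fps p \<rho>"
  show "\<forall>s. 0 < s \<and> s < \<rho> \<longrightarrow> (\<exists>B. \<forall>n. padic_abs p (fps_nth f n) * s ^ n \<le> B)"
  proof (intro allI impI)
    fix s assume "0 < s \<and> s < \<rho>"
    then have "(\<lambda>n. padic_abs p (fps_nth f n) * s ^ n) \<longlonglongrightarrow> 0" using f by (simp add: convergent_fps_def)
    then have "bounded (range (\<lambda>n. padic_abs p (fps_nth f n) * s ^ n))"
      using convergent_imp_bounded convergentI by blast
    then obtain B where B: "\<And>n. norm (padic_abs p (fps_nth f n) * s ^ n) \<le> B" unfolding bounded_iff by auto
    have "padic_abs p (fps_nth f n) * s ^ n \<le> B" for n using B[of n] by (simp add: abs_le_iff)
    then show "\<exists>B. \<forall>n. padic_abs p (fps_nth f n) * s ^ n \<le> B" by blast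
  qed
next
  assume f: "\<forall>s. 0 < s \<and> s < \<rho> \<longrightarrow> (\<exists>B. \<forall>n. padic_abs p (fps_nth f n) * s ^ n \<le> B)"
  have "(\<lambda>n. padic_abs p (fps_nth f n) * s ^ n) \<longlonglongrightarrow> 0" if s: "0 < s" "s < \<rho>" for s
  proof -
    obtain t where t: "s < t" "t < \<rho>" using s dense by blast
    then obtain B where B: "\<And>n. padic_abs p (fps_nth f n) * t ^ n \<le> B" using f s by (meson order_less_trans)
    have lim: "(\<lambda>n. B * (s / t) ^ n) \<longlonglongrightarrow> 0"
      using s t by (intro tendsto_mult_right_zero LIMSEQ_realpow_zero) auto
    show ?thesis
    proof (rule tendsto_sandwich[OF _ _ tendsto_const lim])
      show "\<forall>\<^sub>F n in sequentially. 0 \<le> padic_abs p (fps_nth f n) * s ^ n" using s by (intro always_eventually) auto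
      have "padic_abs p (fps_nth f n) * s ^ n \<le> B * (s / t) ^ n" for n
      proof -
        have "padic_abs p (fps_nth f n) * s ^ n = padic_abs p (fps_nth f n) * t ^ n * (s / t) ^ n"
          using s t by (simp add: power_divide)
        also have "\<dots> \<le> B * (s / t) ^ n" using s t B[of n] by (intro mult_right_mono) auto
        finally show ?thesis .
      qed
      then show "\<forall>\<^sub>F n in sequentially. padic_abs p (fps_nth f n) * s ^ n \<le> B * (s / t) ^ n" by simp
    qed
  qed
  then show "f \<in> convergent_fps p \<rho>" by (simp add: convergent_fps_def)
qed

lemma convergent_fps_0 [simp]: "0 \<in> convergent_fps p \<rho>" by (simp add: convergent_fps_def)

lemma convergent_fps_add:
  assumes p: "Factorial_Ring.prime p" and f: "f \<in> convergent_fps p \<rho>" "g \<in> convergent_fps p \<rho>"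
  shows "f + g \<in> convergent_fps p \<rho>"
  unfolding convergent_fps_iff
proof (intro allI impI)
  fix s assume s: "0 < s \<and> s < \<rho>"
  obtain B where B: "\<And>n. padic_abs p (fps_nth f n) * s ^ n \<le> B" using f s convergent_fps_iff by blast
  obtain B' where B': "\<And>n. padic_abs p (fps_nth g n) * s ^ n \<le> B'" using f s convergent_fps_iff by blast
  have "padic_abs p (fps_nth (f + g) n) * s ^ n \<le> max B B'" for n
  proof -
    have "padic_abs p (fps_nth f n + fps_nth g n) \<le> max B B' / s ^ n"
      using s B[of n] B'[of n] by (intro padic_abs_add[OF p]) (auto simp: field_simps)
    then show ?thesis using s by (simp add: field_simps)
  qed
  then show "\<exists>B. \<forall>n. padic_abs p (fps_nth (f + g) n) * s ^ n \<le> B" by blast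
qed

lemma convergent_fps_mult:
  assumes p: "Factorial_Ring.prime p" and f: "f \<in> convergent_fps p \<rho>" "g \<in> convergent_fps p \<rho>"
  shows "f * g \<in> convergent_fps p \<rho>"
  unfolding convergent_fps_iff
proof (intro allI impI)
  fix s assume s: "0 < s \<and> s < \<rho>"
  obtain B where B: "\<And>n. padic_abs p (fps_nth f n) * s ^ n \<le> B" using f s convergent_fps_iff by blast
  obtain B' where B': "\<And>n. padic_abs p (fps_nth g n) * s ^ n \<le> B'" using f s convergent_fps_iff by blast
  have B0: "B \<ge> 0" "B' \<ge> 0" using B[of 0] B'[of 0] padic_abs_nonneg[of p "fps_nth f 0"] padic_abs_nonneg[of p "fps_nth g 0"]
    by (simp_all del: padic_abs_nonneg)
  have "padic_abs p (fps_nth (f * g) n) * s ^ n \<le> B * B'" for n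
  proof -
    have "padic_abs p (fps_nth (f * g) n) \<le> B * B' / s ^ n" unfolding fps_mult_nth
    proof (rule padic_abs_sum[OF p])
      fix i assume i: "i \<in> {0..n}"
      have "padic_abs p (fps_nth f i * fps_nth g (n - i)) * s ^ n = (padic_abs p (fps_nth f i) * s ^ i) * (padic_abs p (fps_nth g (n - i)) * s ^ (n - i))"
        using i by (simp add: padic_abs_mult[OF p] mult_ac flip: power_add)
      also have "\<dots> \<le> B * B'" using B B' B0 s by (intro mult_mono) auto
      finally show "padic_abs p (fps_nth f i * fps_nth g (n - i)) \<le> B * B' / s ^ n" using s by (simp add: field_simps)
    qed (use B0 s in auto)
    then show ?thesis using s by (simp add: field_simps)
  qed
  then show "\<exists>B. \<forall>n. padic_abs p (fps_nth (f * g) n) * s ^ n \<le> B" by blast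
qed

definition padic_integral :: "nat \<Rightarrow> rat fps \<Rightarrow> bool" where
  "padic_integral p f \<longleftrightarrow> (\<forall>n. padic_abs p (fps_nth f n) \<le> 1)"

lemma padic_integral_mult:
  assumes p: "Factorial_Ring.prime p" and "padic_integral p f" "padic_integral p g"
  shows "padic_integral p (f * g)"
  unfolding padic_integral_def fps_mult_nth
proof (intro allI padic_abs_sum[OF p])
  fix n i
  show "padic_abs p (fps_nth f i * fps_nth g (n - i)) \<le> 1"
    unfolding padic_abs_mult[OF p] using assms by (intro mult_le_one) (auto simp: padic_integral_def)
qed simp

lemma padic_integral_sum:
  assumes p: "Factorial_Ring.prime p" and "\<And>a. a \<in> A \<Longrightarrow> padic_integral p (f a)"
  shows "padic_integral p (sum f A)"
  unfolding padic_integral_def fps_sum_nth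
  using assms(2) by (intro allI padic_abs_sum[OF p]) (auto simp: padic_integral_def)

lemma padic_integral_power: "Factorial_Ring.prime p \<Longrightarrow> padic_integral p f \<Longrightarrow> padic_integral p (f ^ k)"
  by (induction k) (auto simp: padic_integral_mult, auto simp: padic_integral_def fps_one_nth)

lemma padic_integral_inverse:
  assumes p: "Factorial_Ring.prime p" and f: "padic_integral p f" "padic_abs p (fps_nth f 0) = 1"
  shows "padic_integral p (inverse f)"
proof -
  have f0: "fps_nth f 0 \<noteq> 0" using f(2) by auto
  have inv: "padic_abs p (inverse (fps_nth f 0)) = 1"
    using padic_abs_mult[OF p, of "fps_nth f 0" "inverse (fps_nth f 0)"] f0 f(2) p by simp
  have "padic_abs p (fps_nth (inverse f) n) \<le> 1" for n
  proof (induction n rule: less_induct)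
    case (less n)
    show ?case
    proof (cases "n = 0")
      case True then show ?thesis using inv by simp
    next
      case False
      have "fps_nth (f * inverse f) n = 0" using f0 False by (simp add: inverse_mult_eq_1')
      then have "fps_nth f 0 * fps_nth (inverse f) n + (\<Sum>i=1..n. fps_nth f i * fps_nth (inverse f) (n - i)) = 0"
        unfolding fps_mult_nth by (subst (asm) sum.atLeast_Suc_atMost) auto
      then have e: "fps_nth (inverse f) n = - (inverse (fps_nth f 0) * (\<Sum>i=1..n. fps_nth f i * fps_nth (inverse f) (n - i)))"
        using f0 by (simp add: field_simps eq_neg_iff_add_eq_0)
      have "padic_abs p (\<Sum>i=1..n. fps_nth f i * fps_nth (inverse f) (n - i)) \<le> 1"
      proof (rule padic_abs_sum[OF p])
        fix i assume i: "i \<in> {1..n}"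
        then have "padic_abs p (fps_nth (inverse f) (n - i)) \<le> 1" using False by (intro less) auto
        then show "padic_abs p (fps_nth f i * fps_nth (inverse f) (n - i)) \<le> 1"
          unfolding padic_abs_mult[OF p] using f(1) by (intro mult_le_one) (auto simp: padic_integral_def)
      qed simp
      then show ?thesis unfolding e padic_abs_minus[OF p] padic_abs_mult[OF p] inv by simp
    qed
  qed
  then show ?thesis by (simp add: padic_integral_def)
qed

lemma q4_integral: "Factorial_Ring.prime p \<Longrightarrow> padic_integral p q4"
  "Factorial_Ring.prime p \<Longrightarrow> padic_integral p (inverse (q4 ^ k))"
proof -
  assume p: "Factorial_Ring.prime p"
  have "padic_abs p (fps_nth q4 n) \<le> 1" for n
    using padic_abs_minus[OF p, of 1] p by (auto simp: q4_def fps_X_power_nth fps_one_nth)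
  then show q: "padic_integral p q4" by (simp add: padic_integral_def)
  have "padic_abs p (fps_nth q4 0) = 1" using padic_abs_minus[OF p, of 1] p by (simp add: q4_def fps_X_power_nth)
  then have "padic_integral p (inverse q4)" by (rule padic_integral_inverse[OF p q])
  from padic_integral_power[OF p this, of k] show "padic_integral p (inverse (q4 ^ k))" by (simp add: fps_inverse_power)
qed

lemma OX_as_quotient: "f \<in> OX \<Longrightarrow> \<exists>a k. f = fps_of_poly a * inverse (q4 ^ k)"
proof -
  assume "f \<in> OX"
  then obtain a k where "f * q4 ^ k = fps_of_poly a" using OX_iff by blast
  then have "fps_of_poly a * inverse (q4 ^ k) = f * (q4 ^ k * inverse (q4 ^ k))" by (simp add: mult.assoc)
  then show ?thesis by (metis q4_unit(2) mult.right_neutral)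
qed

text \<open>
  The denominators are powers of \<open>x\<^sup>4 - 1\<close>, which is a unit with integral inverse.
\<close>

lemma OX_convergent:
  assumes p: "Factorial_Ring.prime p" and f: "f \<in> OX" and \<rho>: "\<rho> \<le> 1"
  shows "f \<in> convergent_fps p \<rho>"
proof -
  obtain a k where f: "f = fps_of_poly a * inverse (q4 ^ k)" using OX_as_quotient[OF f] by blast
  have "inverse (q4 ^ k) \<in> convergent_fps p \<rho>"
    unfolding convergent_fps_iff
  proof (intro allI impI exI[of _ 1])
    fix s n assume s: "0 < s \<and> s < \<rho>"
    show "padic_abs p (fps_nth (inverse (q4 ^ k)) n) * s ^ n \<le> 1"
      using q4_integral(2)[OF p, of k] s \<rho> by (intro mult_le_one) (auto simp: padic_integral_def power_le_one)
  qed
  moreover have "fps_of_poly a \<in> convergent_fps p \<rho>"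
    unfolding convergent_fps_iff
  proof (intro allI impI exI[of _ "\<Sum>i\<le>Polynomial.degree a. padic_abs p (poly.coeff a i)"])
    fix s n assume s: "0 < s \<and> s < \<rho>"
    have "padic_abs p (fps_nth (fps_of_poly a) n) * s ^ n \<le> padic_abs p (poly.coeff a n)"
      using s \<rho> by (simp add: mult_left_le power_le_one)
    also have "\<dots> \<le> (\<Sum>i\<le>Polynomial.degree a. padic_abs p (poly.coeff a i))"
    proof (cases "n \<le> Polynomial.degree a")
      case True then show ?thesis by (intro member_le_sum) auto
    next
      case False then show ?thesis by (simp add: Polynomial.coeff_eq_0 sum_nonneg)
    qed
    finally show "padic_abs p (fps_nth (fps_of_poly a) n) * s ^ n \<le> (\<Sum>i\<le>Polynomial.degree a. padic_abs p (poly.coeff a i))" .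
  qed
  ultimately show ?thesis unfolding f using convergent_fps_mult[OF p] by blast
qed

lemma padic_abs_nat:
  assumes p: "Factorial_Ring.prime p" and n: "n > 0"
  shows "padic_abs p (of_nat n) = 1 / real p ^ multiplicity p n"
proof -
  have p1: "p > 1" using p by (rule prime_gt_1_nat)
  obtain c where c: "n = p ^ multiplicity p n * c" "\<not> p dvd c"
    by (rule multiplicity_decompose'[of n p]) (use n p1 in auto)
  have c0: "int c \<noteq> 0" using c(2) by (metis dvd_0_right of_nat_eq_0_iff)
  have "multiplicity (int p) (int c) = 0"
    using c(2) by (intro not_dvd_imp_multiplicity_0) simp
  then have ac: "padic_abs p (of_nat c) = 1" using padic_abs_fraction[OF p c0, of 1] by simp
  have "multiplicity (int p) (int p) = 1" using p1 by (intro multiplicity_self) auto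
  then have ap: "padic_abs p (of_nat p) = 1 / real p"
    using padic_abs_fraction[OF p, of "int p" 1] p1 by (simp add: power_int_minus divide_inverse)
  have app: "padic_abs p (of_nat p ^ k) = 1 / real p ^ k" for k
    using p by (induction k) (simp_all add: padic_abs_mult[OF p] ap)
  have "padic_abs p (of_nat n) = padic_abs p (of_nat p ^ multiplicity p n * of_nat c)"
    using arg_cong[OF c(1), of "of_nat :: nat \<Rightarrow> rat"] by simp
  then show ?thesis by (simp add: padic_abs_mult[OF p] ac app)
qed

lemma padic_abs_inverse_nat:
  assumes p: "Factorial_Ring.prime p" and n: "n > 0"
  shows "padic_abs p (1 / of_nat n) = real p ^ multiplicity p n"
proof -
  have "padic_abs p (1 / of_nat n) * padic_abs p (of_nat n) = 1"
    unfolding padic_abs_mult[OF p, symmetric] using n p by simp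
  then show ?thesis unfolding padic_abs_nat[OF assms] using prime_gt_0_nat[OF p] by (simp add: field_simps)
qed

lemma finite_bad_primes_rat: "finite {p. Factorial_Ring.prime p \<and> padic_abs p q > 1}"
proof -
  obtain a b where q: "q = of_int a / of_int b" "b > 0" by (rule rat_as_fraction)
  have "{p. Factorial_Ring.prime p \<and> padic_abs p q > 1} \<subseteq> {p. p dvd nat b}"
  proof
    fix p assume "p \<in> {p. Factorial_Ring.prime p \<and> padic_abs p q > 1}"
    then have p: "Factorial_Ring.prime p" "padic_abs p q > 1" by auto
    have "p dvd nat b"
    proof (rule ccontr)
      assume "\<not> p dvd nat b"
      then have "multiplicity p (nat b) = 0" by (rule not_dvd_imp_multiplicity_0)
      then have "padic_abs p (1 / of_nat (nat b)) = 1" using padic_abs_inverse_nat[OF p(1), of "nat b"] q(2) by simp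
      then have "padic_abs p q = padic_abs p (of_int a)"
        using padic_abs_mult[OF p(1), of "of_int a" "1 / of_nat (nat b)"] q by (simp add: of_nat_nat)
      then show False using padic_abs_int[OF p(1), of a] p(2) by simp
    qed
    then show "p \<in> {p. p dvd nat b}" by simp
  qed
  moreover have "finite {p. p dvd nat b}" using q(2) by (intro finite_divisors_nat) simp
  ultimately show ?thesis by (rule finite_subset)
qed

text \<open>
  Polynomials have finitely many coefficients, and the inverse of \<open>x\<^sup>4 - 1\<close> is integral.
\<close>

lemma finite_bad_primes_OX: "f \<in> OX \<Longrightarrow> finite {p. Factorial_Ring.prime p \<and> \<not> padic_integral p f}"
proof -
  assume "f \<in> OX"
  then obtain a k where f: "f = fps_of_poly a * inverse (q4 ^ k)" using OX_as_quotient by blast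
  have "{p. Factorial_Ring.prime p \<and> \<not> padic_integral p f} \<subseteq> (\<Union>i\<le>Polynomial.degree a. {p. Factorial_Ring.prime p \<and> padic_abs p (poly.coeff a i) > 1})"
  proof
    fix p assume "p \<in> {p. Factorial_Ring.prime p \<and> \<not> padic_integral p f}"
    then have p: "Factorial_Ring.prime p" "\<not> padic_integral p f" by auto
    then have "\<not> padic_integral p (fps_of_poly a)" using padic_integral_mult[OF p(1) _ q4_integral(2)[OF p(1)]] f by blast
    then obtain i where i: "padic_abs p (poly.coeff a i) > 1" by (auto simp: padic_integral_def not_le)
    then have "i \<le> Polynomial.degree a" using Polynomial.coeff_eq_0[of a i] by (cases "i \<le> Polynomial.degree a") auto
    then show "p \<in> (\<Union>i\<le>Polynomial.degree a. {p. Factorial_Ring.prime p \<and> padic_abs p (poly.coeff a i) > 1})" using p i by blast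
  qed
  from finite_subset[OF this] show ?thesis by (simp add: finite_bad_primes_rat)
qed

lemma curve_ring_subset: "carrier (curve_ring C) \<subseteq> OX"
  unfolding carrier_curve_ring OX_iff subset_iff by blast

lemma primeideal_origin_curve_ring:
  assumes "cring (curve_ring C)" "1 \<in> carrier (curve_ring C)"
  shows "primeideal {f \<in> carrier (curve_ring C). fps_nth f 0 = 0} (curve_ring C)" (is "primeideal ?P _")
proof (rule primeidealI[OF _ assms(1)])
  interpret cring "curve_ring C" by (rule assms)
  have "subgroup ?P (add_monoid (curve_ring C))"
  proof (rule add.subgroupI)
    show "?P \<noteq> {}" using zero_closed by auto
    fix a assume a: "a \<in> ?P"
    then have ac: "a \<in> carrier (curve_ring C)" by simp
    have "\<ominus>\<^bsub>curve_ring C\<^esub> a + a = 0" using l_neg[OF ac] by simp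
    then have "\<ominus>\<^bsub>curve_ring C\<^esub> a = - a" by (simp add: eq_neg_iff_add_eq_0)
    then show "\<ominus>\<^bsub>curve_ring C\<^esub> a \<in> ?P" using a a_inv_closed[OF ac] by simp
  next
    fix a b assume "a \<in> ?P" "b \<in> ?P"
    then show "a \<oplus>\<^bsub>curve_ring C\<^esub> b \<in> ?P" using a_closed[of a b] by simp
  qed auto
  then show "ideal ?P (curve_ring C)"
  proof (intro idealI ring_axioms)
    fix a x assume "a \<in> ?P" "x \<in> carrier (curve_ring C)"
    then show "x \<otimes>\<^bsub>curve_ring C\<^esub> a \<in> ?P" "a \<otimes>\<^bsub>curve_ring C\<^esub> x \<in> ?P"
      using m_closed[of a x] m_closed[of x a] by simp_all
  qed
  have "1 \<notin> ?P" by auto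
  then show "carrier (curve_ring C) \<noteq> ?P" using assms(2) by blast
qed auto

lemma inverted_1: "1 \<in> carrier (curve_ring (inverted N))" "- 1 \<in> carrier (curve_ring (inverted N))"
proof -
  have i: "of_int a \<in> inverted N" for a unfolding inverted_def by (intro CollectI exI[of _ a] exI[of _ 0]) simp
  have z: "(0::rat) \<in> inverted N" "1 \<in> inverted N" "-1 \<in> inverted N" using i[of 0] i[of 1] i[of "-1"] by auto
  have "\<forall>i. poly.coeff [:1:] i \<in> inverted N" "\<forall>i. poly.coeff [:-1:] i \<in> inverted N"
    using z by (auto simp: coeff_pCons split: nat.split)
  moreover have "(1::rat fps) * q4 ^ 0 = fps_of_poly [:1:]" "(-1::rat fps) * q4 ^ 0 = fps_of_poly [:-1:]"
    by (simp_all add: fps_of_poly_const flip: fps_const_neg)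
  ultimately show "1 \<in> carrier (curve_ring (inverted N))" "- 1 \<in> carrier (curve_ring (inverted N))"
    unfolding carrier_curve_ring by blast+
qed

lemma inverted_integral:
  assumes p: "Factorial_Ring.prime p" "\<not> p dvd N" and f: "f \<in> carrier (curve_ring (inverted N))"
  shows "padic_integral p f"
proof -
  have N: "N > 0" using p(2) by (cases N) auto
  obtain a k where a: "\<forall>i. poly.coeff a i \<in> inverted N" "f * q4 ^ k = fps_of_poly a"
    using f carrier_curve_ring by blast
  have N1: "padic_abs p (1 / of_nat N) = 1"
    using padic_abs_inverse_nat[OF p(1) N] not_dvd_imp_multiplicity_0[OF p(2)] by simp
  have N1k: "padic_abs p ((1 / of_nat N) ^ k) = 1" for k
  proof (induction k)
    case (Suc k)
    then show ?case unfolding power_Suc padic_abs_mult[OF p(1)] N1 by simp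
  qed (use p in simp)
  have "padic_abs p c \<le> 1" if c: "c \<in> inverted N" for c
  proof -
    obtain b l where "c = of_int b * (1 / of_nat N) ^ l" using c by (auto simp: inverted_def power_one_over)
    then show ?thesis using padic_abs_int[OF p(1), of b] by (simp add: padic_abs_mult[OF p(1)] N1k)
  qed
  then have "padic_integral p (fps_of_poly a)" using a(1) by (simp add: padic_integral_def)
  then have "padic_integral p (f * q4 ^ k * inverse (q4 ^ k))"
    unfolding a(2) using q4_integral[OF p(1)] by (intro padic_integral_mult[OF p(1)])
  then show ?thesis by (simp add: mult.assoc q4_unit)
qed

lemma good_exp_mono: "Factorial_Ring.prime p \<Longrightarrow> n \<le> m \<Longrightarrow> good_exp p n \<le> good_exp p m"
  using good_exp_superadditive[of p n "m - n"] by simp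

section \<open>Algebraicity of horizontal sections\<close>

text \<open>
  For \<open>D = d/dx\<close> the derivation \<open>D\<^sup>p\<close> is zero, so the p-curvature is \<open>- \<nabla>\<^sup>p\<close>.
\<close>

lemma funpow_deriv_X: "p \<ge> 2 \<Longrightarrow> ((\<lambda>f. 1 * fps_deriv f) ^^ p) (fps_X :: rat fps) = 0"
proof -
  assume "p \<ge> 2"
  then obtain q where q: "p = q + 2" by (metis add.commute le_Suc_ex)
  have "((\<lambda>f. 1 * fps_deriv f) ^^ 2) (fps_X :: rat fps) = 0" by (simp add: numeral_2_eq_2)
  moreover have "((\<lambda>f. 1 * fps_deriv f) ^^ q) (0 :: rat fps) = 0" by (induction q) auto
  ultimately show ?thesis unfolding q funpow_add by simp
qed

text \<open>
  Vanishing of the p-curvature along \<open>d/dx\<close> says \<open>\<nabla>\<^sup>p L \<subseteq> p L\<close>, so that \<open>\<nabla>\<^sup>n\<close> is divisible by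
  p to the power \<open>n div p\<close> on the lattice, and dividing by \<open>n!\<close> leaves a denominator of exponent \<open>good_exp p n\<close>. For
  almost all p the coordinates of elements of L are p-integral; a single chart of the model, around the
  origin, shows this, because its function g is invertible as a power series.
\<close>

lemma almost_all_primes_bound:
  fixes M :: "(rat fps, 'm) module"
  assumes co: "coordinates M r \<kappa>" and con: "is_connection O_X fps_deriv M nabla"
    and G: "\<And>m i. m \<in> carrier M \<Longrightarrow> i < r \<Longrightarrow> \<kappa> (nabla m) i = fps_deriv (\<kappa> m i) + (\<Sum>j<r. G i j * \<kappa> m j)"
    and N: "N > 0" and mo: "model M nabla r N L"
    and fin: "finite {p. Factorial_Ring.prime p \<and> \<not> p dvd N \<and> \<not> p_curvature_vanishes M nabla N L p}"
  shows "\<exists>S. finite S \<and> (\<forall>p. Factorial_Ring.prime p \<and> p \<notin> S \<longrightarrow> (\<forall>k<r. \<forall>i<r. \<forall>m.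
     padic_abs p (fps_nth (taylor_section G r (\<lambda>i. if i = k then 1 else 0) i) m) \<le> real p ^ good_exp p m))"
proof -
  define A where "A = carrier (curve_ring (inverted N))"
  have AO: "A \<subseteq> OX" unfolding A_def by (rule curve_ring_subset)
  have A1: "1 \<in> A" "- 1 \<in> A" unfolding A_def by (rule inverted_1)+
  have M: "module O_X M" and k0: "\<And>m i. m \<in> carrier M \<Longrightarrow> i < r \<Longrightarrow> \<kappa> m i \<in> OX"
    and ka: "\<And>m n i. m \<in> carrier M \<Longrightarrow> n \<in> carrier M \<Longrightarrow> i < r \<Longrightarrow> \<kappa> (m \<oplus>\<^bsub>M\<^esub> n) i = \<kappa> m i + \<kappa> n i"
    and ks: "\<And>f m i. f \<in> OX \<Longrightarrow> m \<in> carrier M \<Longrightarrow> i < r \<Longrightarrow> \<kappa> (f \<odot>\<^bsub>M\<^esub> m) i = f * \<kappa> m i"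
    and ki: "\<And>m n. m \<in> carrier M \<Longrightarrow> n \<in> carrier M \<Longrightarrow> (\<And>i. i < r \<Longrightarrow> \<kappa> m i = \<kappa> n i) \<Longrightarrow> m = n"
    using co unfolding coordinates_def by auto
  interpret M: module O_X M by (rule M)
  have n1: "\<And>m. m \<in> carrier M \<Longrightarrow> nabla m \<in> carrier M"
    and n3: "\<And>a m. a \<in> OX \<Longrightarrow> m \<in> carrier M \<Longrightarrow> nabla (a \<odot>\<^bsub>M\<^esub> m) = (fps_deriv a \<odot>\<^bsub>M\<^esub> m) \<oplus>\<^bsub>M\<^esub> (a \<odot>\<^bsub>M\<^esub> nabla m)"
    using con unfolding is_connection_def by auto
  have LM: "L \<subseteq> carrier M" and vbL: "vector_bundle (curve_ring (inverted N)) (M\<lparr>carrier := L\<rparr>) r"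
    and nL: "\<And>m. m \<in> L \<Longrightarrow> nabla m \<in> L" and nz: "\<And>m. m \<in> carrier M \<Longrightarrow> \<exists>n::nat. n > 0 \<and> of_nat n \<odot>\<^bsub>M\<^esub> m \<in> L"
    using mo unfolding model_def is_connection_def by auto
  have modL: "module (curve_ring (inverted N)) (M\<lparr>carrier := L\<rparr>)" using vbL by (simp add: vector_bundle_def)
  interpret L: module "curve_ring (inverted N)" "M\<lparr>carrier := L\<rparr>" by (rule modL)
  have smL: "f \<odot>\<^bsub>M\<^esub> l \<in> L" if "f \<in> A" "l \<in> L" for f l
    using L.smult_closed[of f l] that by (simp add: A_def)
  have ofnat: "(of_nat n :: rat fps) \<in> OX" for n using OX_const[of "of_nat n"] by (simp only: fps_of_nat)
  have "primeideal {f \<in> A. fps_nth f 0 = 0} (curve_ring (inverted N))"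
    unfolding A_def by (rule primeideal_origin_curve_ring[OF L.R.is_cring inverted_1(1)])
  then obtain g e where g: "g \<in> A" "fps_nth g 0 \<noteq> 0" and lb: "local_basis (curve_ring (inverted N)) (M\<lparr>carrier := L\<rparr>) g r e"
    using vbL unfolding vector_bundle_def A_def by blast
  have eL: "e i \<in> L" if "i < r" for i using lb that by (auto simp: local_basis_def)
  have Lk: "\<exists>k a. (\<forall>i<r. a i \<in> A) \<and> (\<forall>x<r. g ^ k * \<kappa> l x = (\<Sum>i<r. a i * \<kappa> (e i) x))" if l: "l \<in> L" for l
  proof -
    obtain k a where a: "a \<in> {..<r} \<rightarrow> A"
      "g ^ k \<odot>\<^bsub>M\<^esub> l = (\<Oplus>\<^bsub>M\<lparr>carrier := L\<rparr>\<^esub>i\<in>{..<r}. a i \<odot>\<^bsub>M\<^esub> e i)"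
      using lb l unfolding local_basis_def A_def by (auto simp: Bex_def)
    have "g ^ k * \<kappa> l x = (\<Sum>i<r. a i * \<kappa> (e i) x)" if x: "x < r" for x
    proof -
      have "\<kappa> (\<Oplus>\<^bsub>M\<lparr>carrier := L\<rparr>\<^esub>i\<in>{..<r}. a i \<odot>\<^bsub>M\<lparr>carrier := L\<rparr>\<^esub> e i) x = (\<Sum>i<r. a i * \<kappa> (e i) x)"
      proof (rule finsum_linear_functional[OF modL, of "\<lambda>m. \<kappa> m x"])
        fix m n assume "m \<in> carrier (M\<lparr>carrier := L\<rparr>)" "n \<in> carrier (M\<lparr>carrier := L\<rparr>)"
        then have "m \<in> carrier M" "n \<in> carrier M" using LM by auto
        then show "\<kappa> (m \<oplus>\<^bsub>M\<lparr>carrier := L\<rparr>\<^esub> n) x = \<kappa> m x + \<kappa> n x" using ka x by simp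
      next
        fix f m assume "f \<in> carrier (curve_ring (inverted N))" "m \<in> carrier (M\<lparr>carrier := L\<rparr>)"
        then have "f \<in> OX" "m \<in> carrier M" using LM AO by (auto simp: A_def)
        then show "\<kappa> (f \<odot>\<^bsub>M\<lparr>carrier := L\<rparr>\<^esub> m) x = f * \<kappa> m x" using ks x by simp
      qed (use a(1) eL in \<open>auto simp: A_def\<close>)
      moreover have "\<kappa> (g ^ k \<odot>\<^bsub>M\<^esub> l) x = g ^ k * \<kappa> l x"
        using g(1) AO l LM x by (intro ks) auto
      ultimately show ?thesis using a(2) by simp
    qed
    then show ?thesis using a(1) by blast
  qed
  obtain \<beta> where \<beta>: "\<And>i. i < r \<Longrightarrow> \<beta> i \<in> carrier M" "\<And>i j. i < r \<Longrightarrow> j < r \<Longrightarrow> \<kappa> (\<beta> i) j = (if i = j then 1 else 0)"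
    "\<And>m. m \<in> carrier M \<Longrightarrow> m = (\<Oplus>\<^bsub>M\<^esub>i\<in>{..<r}. \<kappa> m i \<odot>\<^bsub>M\<^esub> \<beta> i)"
    by (rule coordinates_basis[OF co]) (rule that)
  have "\<forall>k\<in>{..<r}. \<exists>n::nat. n > 0 \<and> of_nat n \<odot>\<^bsub>M\<^esub> \<beta> k \<in> L" using nz \<beta>(1) by blast
  from bchoice[OF this] obtain \<nu> :: "nat \<Rightarrow> nat" where \<nu>: "\<And>k. k < r \<Longrightarrow> \<nu> k > 0" "\<And>k. k < r \<Longrightarrow> of_nat (\<nu> k) \<odot>\<^bsub>M\<^esub> \<beta> k \<in> L"
    by auto
  \<comment> \<open>primes of bad reduction of the model, of the chart, of its basis or of the global basis, and the primes with
     nonvanishing p-curvature\<close>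
  define S where "S = {p. p dvd N} \<union> {p. Factorial_Ring.prime p \<and> padic_abs p (fps_nth g 0) > 1}
     \<union> {p. Factorial_Ring.prime p \<and> padic_abs p (inverse (fps_nth g 0)) > 1}
     \<union> (\<Union>i<r. \<Union>x<r. {p. Factorial_Ring.prime p \<and> \<not> padic_integral p (\<kappa> (e i) x)})
     \<union> (\<Union>k<r. {p. p dvd \<nu> k})
     \<union> {p. Factorial_Ring.prime p \<and> \<not> p dvd N \<and> \<not> p_curvature_vanishes M nabla N L p}"
  have "finite S"
  proof -
    have "finite {p. p dvd \<nu> k}" if "k < r" for k using \<nu>(1)[OF that] by (intro finite_divisors_nat)
    moreover have "\<kappa> (e i) x \<in> OX" if "i < r" "x < r" for i x using eL that LM by (intro k0) auto
    ultimately show ?thesis unfolding S_def using N fin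
      by (intro finite_UnI finite_UN_I finite_bad_primes_rat finite_bad_primes_OX) auto
  qed
  moreover have "padic_abs p (fps_nth (taylor_section G r (\<lambda>i. if i = k then 1 else 0) x) m) \<le> real p ^ good_exp p m"
    if p: "Factorial_Ring.prime p" "p \<notin> S" and k: "k < r" and x: "x < r" for p k x m
  proof -
    have p2: "p \<ge> 2" using p(1) by (rule prime_ge_2_nat)
    have pN: "\<not> p dvd N" and pc: "p_curvature_vanishes M nabla N L p" using p by (auto simp: S_def)
    have int: "padic_integral p (\<kappa> l x)" if l: "l \<in> L" "x < r" for l x
    proof -
      obtain n a where a: "\<forall>i<r. a i \<in> A" "g ^ n * \<kappa> l x = (\<Sum>i<r. a i * \<kappa> (e i) x)" using Lk[OF l(1)] l(2) by blast
      have "padic_integral p (\<Sum>i<r. a i * \<kappa> (e i) x)"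
      proof (intro padic_integral_sum[OF p(1)] padic_integral_mult[OF p(1)])
        fix i assume i: "i \<in> {..<r}"
        show "padic_integral p (a i)" using a(1) i inverted_integral[OF p(1) pN] by (auto simp: A_def)
        show "padic_integral p (\<kappa> (e i) x)" using p i l(2) by (auto simp: S_def)
      qed
      moreover have "padic_integral p (inverse (g ^ n))"
      proof -
        have "padic_abs p (fps_nth g 0) \<le> 1" "padic_abs p (inverse (fps_nth g 0)) \<le> 1"
          using p by (auto simp: S_def not_less)
        moreover have "padic_abs p (fps_nth g 0) * padic_abs p (inverse (fps_nth g 0)) = 1"
          unfolding padic_abs_mult[OF p(1), symmetric] using g(2) p by simp
        ultimately have "padic_abs p (fps_nth g 0) = 1"
          by (smt (verit) mult_left_le padic_abs_nonneg)
        then have "padic_integral p (inverse g)"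
          using inverted_integral[OF p(1) pN] g(1) by (intro padic_integral_inverse[OF p(1)]) (auto simp: A_def)
        from padic_integral_power[OF p(1) this, of n] show ?thesis by (simp add: fps_inverse_power)
      qed
      ultimately have "padic_integral p (inverse (g ^ n) * (g ^ n * \<kappa> l x))"
        unfolding a(2) by (intro padic_integral_mult[OF p(1)])
      moreover have "inverse (g ^ n) * g ^ n = 1" using g(2) by (intro inverse_mult_eq_1) (simp add: fps_power_zeroth)
      ultimately show ?thesis by (simp flip: mult.assoc)
    qed
    have nLk: "(nabla ^^ n) l \<in> L" if "l \<in> L" for n l using that nL by (induction n) auto
    have nconst: "(nabla ^^ n) (of_nat c \<odot>\<^bsub>M\<^esub> m) = of_nat c \<odot>\<^bsub>M\<^esub> (nabla ^^ n) m \<and> (nabla ^^ n) m \<in> carrier M" if m: "m \<in> carrier M" for n c m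
    proof (induction n)
      case (Suc n)
      have d: "fps_deriv (of_nat c :: rat fps) = 0" by (metis fps_deriv_const fps_of_nat)
      show ?case using Suc n1 n3[OF ofnat, of "(nabla ^^ n) m" c] M.smult_l_null[of "(nabla ^^ n) m"] M.smult_closed[OF ofnat n1] d by simp
    qed (use m in simp)
    have step: "\<exists>l\<in>L. (nabla ^^ p) m = of_nat p \<odot>\<^bsub>M\<^esub> l" if m: "m \<in> L" for m
    proof -
      have mM: "m \<in> carrier M" using m LM by blast
      have "((\<lambda>n. 1 \<odot>\<^bsub>M\<^esub> nabla n) ^^ n) m = (nabla ^^ n) m" for n
      proof (induction n)
        case (Suc n)
        have "nabla ((nabla ^^ n) m) \<in> carrier M" using nLk[OF m, of "Suc n"] LM by auto
        then show ?case using Suc M.smult_one by simp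
      qed simp
      then have "p_curvature M nabla p 1 m = (0 \<odot>\<^bsub>M\<^esub> nabla m) \<ominus>\<^bsub>M\<^esub> (nabla ^^ p) m"
        unfolding p_curvature_def funpow_deriv_X[OF p2] by simp
      moreover have "p_curvature M nabla p 1 m \<in> (\<lambda>n. of_nat p \<odot>\<^bsub>M\<^esub> n) ` L"
        using pc m A1(1) unfolding p_curvature_vanishes_def A_def by blast
      ultimately obtain l where l: "l \<in> L" "(0 \<odot>\<^bsub>M\<^esub> nabla m) \<ominus>\<^bsub>M\<^esub> (nabla ^^ p) m = of_nat p \<odot>\<^bsub>M\<^esub> l" by auto
      have cM: "(nabla ^^ p) m \<in> carrier M" "l \<in> carrier M" using nLk[OF m] l(1) LM by auto
      have "\<ominus>\<^bsub>M\<^esub> (nabla ^^ p) m = of_nat p \<odot>\<^bsub>M\<^esub> l"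
        using l(2) M.smult_l_null[OF n1[OF mM]] cM by (simp add: M.M.minus_eq)
      then have "(nabla ^^ p) m \<oplus>\<^bsub>M\<^esub> of_nat p \<odot>\<^bsub>M\<^esub> l = \<zero>\<^bsub>M\<^esub>" using M.M.r_neg[OF cM(1)] by simp
      moreover have k00: "\<kappa> \<zero>\<^bsub>M\<^esub> x = 0" if "x < r" for x using ka[OF M.M.zero_closed M.M.zero_closed that] by simp
      moreover have oc: "of_nat p \<odot>\<^bsub>M\<^esub> l \<in> carrier M" using M.smult_closed[OF ofnat cM(2)] .
      ultimately have kk: "\<kappa> ((nabla ^^ p) m) x = - of_nat p * \<kappa> l x" if "x < r" for x
        using ka[OF cM(1) oc that] ks[OF ofnat cM(2) that] that by (simp add: eq_neg_iff_add_eq_0)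
      define l' where "l' = (- 1) \<odot>\<^bsub>M\<^esub> l"
      have l': "l' \<in> L" unfolding l'_def using smL[OF A1(2) l(1)] .
      have l'M: "l' \<in> carrier M" using l' LM by blast
      have "(nabla ^^ p) m = of_nat p \<odot>\<^bsub>M\<^esub> l'"
      proof (rule ki[OF cM(1) M.smult_closed[OF ofnat l'M]])
        fix i assume i: "i < r"
        have "- 1 \<in> OX" using A1(2) AO by blast
        then have "\<kappa> l' i = - \<kappa> l i" unfolding l'_def using ks[of "-1" l i] cM(2) i by simp
        then show "\<kappa> ((nabla ^^ p) m) i = \<kappa> (of_nat p \<odot>\<^bsub>M\<^esub> l') i"
          using kk[OF i] ks[OF ofnat l'M i] by simp
      qed
      then show ?thesis using l' by blast
    qed
    have main: "\<exists>l\<in>L. \<forall>x<r. \<kappa> ((nabla ^^ n) m) x = of_nat p ^ (n div p) * \<kappa> l x" if m: "m \<in> L" for n m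
      using m
    proof (induction n arbitrary: m rule: less_induct)
      case (less n)
      show ?case
      proof (cases "n < p")
        case True then show ?thesis using nLk[OF less(2), of n] by (intro bexI[of _ "(nabla ^^ n) m"]) auto
      next
        case False
        obtain l where l: "l \<in> L" "(nabla ^^ p) m = of_nat p \<odot>\<^bsub>M\<^esub> l" using step[OF less(2)] by blast
        have lM: "l \<in> carrier M" using l LM by blast
        have "n - p < n" using False p2 by linarith
        then obtain l2 where l2: "l2 \<in> L" "\<forall>x<r. \<kappa> ((nabla ^^ (n - p)) l) x = of_nat p ^ ((n - p) div p) * \<kappa> l2 x"
          using less(1) l(1) by blast
        have "(nabla ^^ n) m = (nabla ^^ (n - p)) ((nabla ^^ p) m)"
          using False funpow_add[of "n - p" p nabla] by simp
        also have "\<dots> = of_nat p \<odot>\<^bsub>M\<^esub> (nabla ^^ (n - p)) l" unfolding l(2) using nconst[OF lM] by blast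
        finally have e: "(nabla ^^ n) m = of_nat p \<odot>\<^bsub>M\<^esub> (nabla ^^ (n - p)) l" .
        have "n div p = Suc ((n - p) div p)" using False p2 by (simp add: le_div_geq)
        then have "\<kappa> ((nabla ^^ n) m) x = of_nat p ^ (n div p) * \<kappa> l2 x" if "x < r" for x
          unfolding e using ks[OF ofnat _ that, of "(nabla ^^ (n - p)) l" p] nconst[OF lM] l2(2) that by simp
        then show ?thesis using l2(1) by blast
      qed
    qed
    have ic: "\<kappa> ((nabla ^^ n) (\<beta> k)) x = iterated_connection G r (\<lambda>i. if i = k then 1 else 0) n x" if "x < r" for n x
      using that
    proof (induction n arbitrary: x)
      case 0 then show ?case using \<beta>(2)[OF k] by auto
    next
      case (Suc n)
      have "(nabla ^^ n) (\<beta> k) \<in> carrier M" using nconst[OF \<beta>(1)[OF k]] by blast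
      then show ?case using Suc G by simp
    qed
    have icb: "padic_abs p (fps_nth (iterated_connection G r (\<lambda>i. if i = k then 1 else 0) n x) t) \<le> 1 / real p ^ (n div p)" for n t
    proof -
      let ?f = "\<kappa> ((nabla ^^ n) (\<beta> k)) x"
      obtain l where l: "l \<in> L" "\<forall>x<r. \<kappa> ((nabla ^^ n) (of_nat (\<nu> k) \<odot>\<^bsub>M\<^esub> \<beta> k)) x = of_nat p ^ (n div p) * \<kappa> l x"
        using main[OF \<nu>(2)[OF k]] by blast
      have "\<kappa> ((nabla ^^ n) (of_nat (\<nu> k) \<odot>\<^bsub>M\<^esub> \<beta> k)) x = of_nat (\<nu> k) * ?f"
        using nconst[OF \<beta>(1)[OF k], of n "\<nu> k"] ks[OF ofnat _ x, of "(nabla ^^ n) (\<beta> k)" "\<nu> k"] by simp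
      then have "of_nat (\<nu> k) * ?f = of_nat p ^ (n div p) * \<kappa> l x" using l(2) x by simp
      moreover have "(of_nat p ^ (n div p) :: rat fps) = fps_const (of_nat (p ^ (n div p)))"
        by (metis fps_of_nat of_nat_power)
      ultimately have "fps_const (of_nat (\<nu> k)) * ?f = fps_const (of_nat (p ^ (n div p))) * \<kappa> l x"
        by (simp only: fps_of_nat)
      then have "fps_nth (fps_const (of_nat (\<nu> k)) * ?f) t = fps_nth (fps_const (of_nat (p ^ (n div p))) * \<kappa> l x) t"
        by (simp only:)
      then have e: "of_nat (\<nu> k) * fps_nth ?f t = of_nat (p ^ (n div p)) * fps_nth (\<kappa> l x) t"
        by (simp only: fps_mult_left_const_nth)
      have "\<not> p dvd \<nu> k" using p k by (auto simp: S_def)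
      then have h1: "padic_abs p (of_nat (\<nu> k)) = 1"
        using padic_abs_nat[OF p(1) \<nu>(1)[OF k]] not_dvd_imp_multiplicity_0[of p "\<nu> k"] by simp
      have h2: "padic_abs p (of_nat (p ^ (n div p))) \<le> 1 / real p ^ (n div p)"
        using padic_abs_int_le[OF p(1), of "n div p" "int (p ^ (n div p))"] by simp
      have h3: "padic_abs p (fps_nth (\<kappa> l x) t) \<le> 1" using int[OF l(1) x] by (simp add: padic_integral_def)
      have "padic_abs p (of_nat (\<nu> k)) * padic_abs p (fps_nth ?f t) = padic_abs p (of_nat (p ^ (n div p))) * padic_abs p (fps_nth (\<kappa> l x) t)"
        using arg_cong[OF e, of "padic_abs p"] by (simp only: padic_abs_mult[OF p(1)])
      then have "padic_abs p (fps_nth ?f t) = padic_abs p (of_nat (p ^ (n div p))) * padic_abs p (fps_nth (\<kappa> l x) t)"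
        unfolding h1 by simp
      also have "\<dots> \<le> 1 / real p ^ (n div p) * 1" using h2 h3 by (intro mult_mono) auto
      finally have "padic_abs p (fps_nth ?f t) \<le> 1 / real p ^ (n div p)" by simp
      then show ?thesis using ic[OF x] by simp
    qed
    show ?thesis
      unfolding taylor_section_def fps_nth_Abs_fps
    proof (rule padic_abs_sum[OF p(1)])
      fix n assume n: "n \<in> {..m}"
      have s1: "padic_abs p ((- 1) ^ n) = 1"
        using padic_abs_minus[OF p(1), of 1] p(1) by (cases "even n") auto
      have sf: "padic_abs p (1 / fact n) = real p ^ multiplicity p (fact n :: nat)"
        using padic_abs_inverse_nat[OF p(1), of "fact n"] by simp
      have "padic_abs p ((- 1) ^ n / fact n) = real p ^ multiplicity p (fact n :: nat)"
        using padic_abs_mult[OF p(1), of "(-1) ^ n" "1 / fact n"] s1 sf by simp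
      then have "padic_abs p ((- 1) ^ n / fact n * fps_nth (iterated_connection G r (\<lambda>i. if i = k then 1 else 0) n x) (m - n))
          \<le> real p ^ multiplicity p (fact n :: nat) * (1 / real p ^ (n div p))"
        unfolding padic_abs_mult[OF p(1), of "(- 1) ^ n / fact n"] by (simp only:) (intro mult_left_mono icb zero_le_power of_nat_0_le_iff)
      also have "\<dots> = real p ^ good_exp p n"
        unfolding multiplicity_fact_step[OF p(1), of n] good_exp_def power_add using p2 by simp
      also have "\<dots> \<le> real p ^ good_exp p m"
        using good_exp_mono[OF p(1), of n m] n p2 by (intro power_increasing) auto
      finally show "padic_abs p ((- 1) ^ n / fact n * fps_nth (iterated_connection G r (\<lambda>i. if i = k then 1 else 0) n x) (m - n)) \<le> real p ^ good_exp p m" .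
    qed simp
  qed
  ultimately show ?thesis by blast
qed

lemma cring_O_formal: "cring O_formal"
proof (rule cringI)
  show "abelian_group O_formal"
  proof (rule abelian_groupI)
    fix x assume "x \<in> carrier O_formal"
    then show "\<exists>y\<in>carrier O_formal. y \<oplus>\<^bsub>O_formal\<^esub> x = \<zero>\<^bsub>O_formal\<^esub>"
      by (intro bexI[of _ "- x"]) (auto simp: O_formal_def fps_subring_def)
  qed (auto simp: O_formal_def fps_subring_def algebra_simps)
  show "Group.comm_monoid O_formal" by (rule comm_monoidI) (auto simp: O_formal_def fps_subring_def algebra_simps)
qed (auto simp: O_formal_def fps_subring_def algebra_simps)

text \<open>
  The vector v defines a horizontal section of the pullback to the completed local ring. A representative
  with convergent coefficients has convergent coordinates, since the elements of the coordinate ring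
  converge on the disc.
\<close>

lemma horizontal_sections_convergent:
  fixes M :: "(rat fps, 'm) module"
  assumes co: "coordinates M r \<kappa>" and con: "is_connection O_X fps_deriv M nabla"
    and G: "\<And>m i. m \<in> carrier M \<Longrightarrow> i < r \<Longrightarrow> \<kappa> (nabla m) i = fps_deriv (\<kappa> m i) + (\<Sum>j<r. G i j * \<kappa> m j)"
    and p: "Factorial_Ring.prime p" and \<rho>: "\<rho> \<le> 1" and conv: "horizontal_sections_converge M nabla p \<rho>"
    and v: "\<And>i. i < r \<Longrightarrow> fps_deriv (v i) = - (\<Sum>j<r. G i j * v j)" and i: "i < r"
  shows "v i \<in> convergent_fps p \<rho>"
proof -
  interpret base_change M r \<kappa> O_formal "\<lambda>f. f" "\<lambda>f. f"
    by (rule base_change.intro[OF co cring_O_formal]) (auto simp: O_formal_def fps_subring_def)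
  have n: "\<And>m. m \<in> carrier M \<Longrightarrow> nabla m \<in> carrier M" using con unfolding is_connection_def by auto
  have cU: "carrier O_formal = UNIV" by (simp add: O_formal_def fps_subring_def)
  have "\<exists>x\<in>gens. \<forall>i<r. \<theta> x i = v i" by (rule theta_surj) (simp add: cU)
  then obtain x where x: "x \<in> gens" "\<And>i. i < r \<Longrightarrow> \<theta> x i = v i" by blast
  obtain y where y: "y \<in> gens" "pullback_connection O_X O_formal (\<lambda>f. f) M fps_deriv nabla (cl x) = cl y"
    "\<And>i. i < r \<Longrightarrow> \<theta> y i = fps_deriv (\<theta> x i) + (\<Sum>j<r. G i j * \<theta> x j)"
    by (rule connection_PB[of fps_deriv nabla G x]) (use n G x cU that in auto)
  have "\<theta> y i = 0" if "i < r" for i using y(3)[OF that] x(2) v[OF that] that by simp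
  then have "cl y = cl 0" using cl_eq_iff[OF y(1) gens_closed(3)] by simp
  then have "cl x \<in> formal_horizontal_sections M nabla"
    unfolding formal_horizontal_sections_def using x(1) y(2) carrier_PB zero_PB by auto
  then obtain c where c: "c \<in> cl x" "Poly_Mapping.keys c \<subseteq> convergent_fps p \<rho> \<times> carrier M"
    using conv unfolding horizontal_sections_converge_def by blast
  have "v i = \<theta> c i" using cl_theta[OF x(1) c(1) i] x(2)[OF i] by simp
  also have "\<theta> c i \<in> convergent_fps p \<rho>"
    unfolding \<theta>_def ev_def
  proof -
    have s: "sum f A \<in> convergent_fps p \<rho>" if "\<And>a. a \<in> A \<Longrightarrow> f a \<in> convergent_fps p \<rho>" for f and A :: "(rat fps \<times> 'm) set"
      using that by (induction A rule: infinite_finite_induct) (auto simp: convergent_fps_add[OF p])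
    show "(\<Sum>k\<in>Poly_Mapping.keys c. of_int (Poly_Mapping.lookup c k) * (case k of (c, m) \<Rightarrow> c * \<kappa> m i)) \<in> convergent_fps p \<rho>"
    proof (rule s)
      fix k assume k: "k \<in> Poly_Mapping.keys c"
      obtain f m where fm: "k = (f, m)" by (cases k)
      have "f \<in> convergent_fps p \<rho>" "m \<in> carrier M" using c(2) k fm by auto
      moreover have "(of_int (Poly_Mapping.lookup c k) :: rat fps) \<in> OX" using OX_const fps_of_int by metis
      ultimately show "of_int (Poly_Mapping.lookup c k) * (case k of (c, m) \<Rightarrow> c * \<kappa> m i) \<in> convergent_fps p \<rho>"
        unfolding fm prod.case using k_closed i
        by (intro convergent_fps_mult[OF p OX_convergent[OF p _ \<rho>] convergent_fps_mult[OF p _ OX_convergent[OF p _ \<rho>]]]) auto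
    qed
  qed
  finally show ?thesis .
qed

theorem horizontal_sections_algebraic:
  fixes M :: "(rat fps, 'm) module"
  assumes co: "coordinates M r \<kappa>" and con: "is_connection O_X fps_deriv M nabla"
    and G: "\<And>i j. i < r \<Longrightarrow> j < r \<Longrightarrow> G i j \<in> OX"
      "\<And>m i. m \<in> carrier M \<Longrightarrow> i < r \<Longrightarrow> \<kappa> (nabla m) i = fps_deriv (\<kappa> m i) + (\<Sum>j<r. G i j * \<kappa> m j)"
    and pc: "p_curvatures_vanish M nabla r"
    and conv: "\<forall>p\<in>{3, 5}. horizontal_sections_converge M nabla p 1"
    and k: "k < r" and i: "i < r"
  shows "alg_fps (taylor_section G r (\<lambda>i. if i = k then 1 else 0) i)"
proof -
  obtain N L where NL: "N > 0" "model M nabla r N L"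
    "finite {p. Factorial_Ring.prime p \<and> \<not> p dvd N \<and> \<not> p_curvature_vanishes M nabla N L p}"
    using pc unfolding p_curvatures_vanish_def by blast
  let ?v = "taylor_section G r (\<lambda>i. if i = k then 1 else 0)"
  have "\<exists>S. finite S \<and> (\<forall>p. Factorial_Ring.prime p \<and> p \<notin> S \<longrightarrow> (\<forall>k<r. \<forall>i<r. \<forall>m.
     padic_abs p (fps_nth (taylor_section G r (\<lambda>i. if i = k then 1 else 0) i) m) \<le> real p ^ good_exp p m))"
    by (rule almost_all_primes_bound[where G = G and \<kappa> = \<kappa>, OF co con _ NL]) (rule G(2))
  then obtain S where S1: "finite S" and S2: "\<forall>p. Factorial_Ring.prime p \<and> p \<notin> S \<longrightarrow> (\<forall>k<r. \<forall>i<r. \<forall>m.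
     padic_abs p (fps_nth (taylor_section G r (\<lambda>i. if i = k then 1 else 0) i) m) \<le> real p ^ good_exp p m)"
    by (elim exE conjE)
  have S: "padic_abs p (fps_nth (?v i) m) \<le> real p ^ good_exp p m" if "Factorial_Ring.prime p" "p \<notin> S" for p m
    using S2 that k i by simp
  define S' where "S' = {p \<in> S. Factorial_Ring.prime p} \<union> {3, 5}"
  show ?thesis
  proof (rule horizontal_section_algebraic[where r = r and G = G and S = S' and v = "taylor_section G r (\<lambda>i. if i = k then 1 else 0)"])
    fix p assume "p \<in> S'"
    then have p: "Factorial_Ring.prime p" by (auto simp: S'_def)
    have c1: "horizontal_sections_converge M nabla p (disc_radius p)"
      using conv pc p unfolding p_curvatures_vanish_def disc_radius_def by auto
    have c2: "disc_radius p \<le> 1"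
    proof -
      have "real p powr (- 1 / (real p * (real p - 1))) \<le> real p powr 0"
        using prime_gt_1_nat[OF p] by (intro powr_mono) auto
      then show ?thesis using prime_gt_1_nat[OF p] by (auto simp: disc_radius_def)
    qed
    show "taylor_section G r (\<lambda>i. if i = k then 1 else 0) i \<in> convergent_fps p (disc_radius p)"
      by (rule horizontal_sections_convergent[where v = ?v and G = G and \<kappa> = \<kappa>, OF co con _ p c2 c1 taylor_section_deriv i]) (rule G(2))
  next
    fix p m assume "Factorial_Ring.prime p" "p \<notin> S'"
    then show "padic_abs p (fps_nth (?v i) m) \<le> real p ^ good_exp p m" by (intro S) (auto simp: S'_def)
  next
    show "fps_deriv (?v i) = - (\<Sum>j<r. G i j * ?v j)" if "i < r" for i by (rule taylor_section_deriv)
  qed (use S1 i G(1) in \<open>auto simp: S'_def\<close>)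
qed

section \<open>Linear algebra over subrings of a domain\<close>

text \<open>
  Elimination without division: one unknown more than equations, by induction on the number of equations.
\<close>

lemma homogeneous_system:
  fixes v :: "nat \<Rightarrow> nat \<Rightarrow> rat fps"
  assumes S: "0 \<in> S" "1 \<in> S" "\<And>a b. a \<in> S \<Longrightarrow> b \<in> S \<Longrightarrow> a - b \<in> S" "\<And>a b. a \<in> S \<Longrightarrow> b \<in> S \<Longrightarrow> a * b \<in> S"
    and v: "\<And>i j. i \<le> n \<Longrightarrow> j < n \<Longrightarrow> v i j \<in> S"
  shows "\<exists>c. (\<forall>i\<le>n. c i \<in> S) \<and> (\<exists>i\<le>n. c i \<noteq> 0) \<and> (\<forall>j<n. (\<Sum>i\<le>n. c i * v i j) = 0)"
  using v
proof (induction n arbitrary: v)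
  case 0
  show ?case using S by (intro exI[of _ "\<lambda>_. 1"]) auto
next
  case (Suc n)
  show ?case
  proof (cases "\<exists>k\<le>Suc n. v k n \<noteq> 0")
    case False
    then have z: "v i n = 0" if "i \<le> Suc n" for i using that by blast
    have "\<exists>c. (\<forall>i\<le>n. c i \<in> S) \<and> (\<exists>i\<le>n. c i \<noteq> 0) \<and> (\<forall>j<n. (\<Sum>i\<le>n. c i * v i j) = 0)"
      by (rule Suc(1)) (simp add: Suc(2))
    then obtain c where c: "\<forall>i\<le>n. c i \<in> S" "\<exists>i\<le>n. c i \<noteq> 0" "\<forall>j<n. (\<Sum>i\<le>n. c i * v i j) = 0"
      by blast
    define c' where "c' = c(Suc n := 0)"
    have "(\<Sum>i\<le>Suc n. c' i * v i j) = (\<Sum>i\<le>n. c i * v i j)" for j by (simp add: c'_def)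
    moreover have "(\<Sum>i\<le>Suc n. c' i * v i n) = 0" using z by (intro sum.neutral) auto
    ultimately have "\<forall>j<Suc n. (\<Sum>i\<le>Suc n. c' i * v i j) = 0" using c(3) by (metis less_Suc_eq)
    moreover have "\<forall>i\<le>Suc n. c' i \<in> S" using c(1) S(1) by (auto simp: c'_def le_Suc_eq)
    moreover have "\<exists>i\<le>Suc n. c' i \<noteq> 0"
    proof -
      obtain i where "i \<le> n" "c i \<noteq> 0" using c(2) by blast
      then show ?thesis by (intro exI[of _ i]) (auto simp: c'_def)
    qed
    ultimately show ?thesis by blast
  next
    case True
    then obtain k where k: "k \<le> Suc n" "v k n \<noteq> 0" by blast
    define s where "s = (\<lambda>i. if i < k then i else Suc i)"
    have s: "s i \<le> Suc n" "s i \<noteq> k" if "i \<le> n" for i using that k by (auto simp: s_def)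
    have split: "(\<Sum>i\<le>Suc n. f i) = f k + (\<Sum>i\<le>n. f (s i))" for f :: "nat \<Rightarrow> rat fps"
    proof -
      have "(\<Sum>i\<in>{..Suc n} - {k}. f i) = (\<Sum>i\<le>n. f (s i))"
        using k by (intro sum.reindex_bij_witness[of _ s "\<lambda>i. if i < k then i else i - 1"]) (auto simp: s_def)
      moreover have "(\<Sum>i\<le>Suc n. f i) = f k + (\<Sum>i\<in>{..Suc n} - {k}. f i)"
        using k by (intro sum.remove) auto
      ultimately show ?thesis by (simp only:)
    qed
    define u where "u = (\<lambda>i j. v k n * v (s i) j - v (s i) n * v k j)"
    have "\<exists>c. (\<forall>i\<le>n. c i \<in> S) \<and> (\<exists>i\<le>n. c i \<noteq> 0) \<and> (\<forall>j<n. (\<Sum>i\<le>n. c i * u i j) = 0)"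
    proof (rule Suc(1))
      fix i j assume "i \<le> n" "j < n"
      then show "u i j \<in> S" unfolding u_def using s[of i] k Suc(2) by (intro S) auto
    qed
    then obtain c where c: "\<forall>i\<le>n. c i \<in> S" "\<exists>i\<le>n. c i \<noteq> 0" "\<forall>j<n. (\<Sum>i\<le>n. c i * u i j) = 0" by blast
    define t where "t = (\<lambda>i. if i < k then i else i - 1)"
    have ts: "t (s i) = i" if "i \<le> n" for i by (auto simp: t_def s_def)
    define d where "d = (\<lambda>i. if i = k then 0 - (\<Sum>l\<le>n. c l * v (s l) n) else v k n * c (t i))"
    have ds: "d (s i) = v k n * c i" if "i \<le> n" for i using s[OF that] ts[OF that] by (simp add: d_def)
    have Ssum: "(\<Sum>l\<in>A. f l) \<in> S" if "\<And>l. l \<in> A \<Longrightarrow> f l \<in> S" for f and A :: "nat set"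
      using that
    proof (induction A rule: infinite_finite_induct)
      case (insert x F)
      have "f x - (0 - sum f F) \<in> S" using insert S by (intro S(3)) auto
      then show ?case using insert by simp
    qed (use S in auto)
    have eq: "(\<Sum>i\<le>Suc n. d i * v i j) = (\<Sum>l\<le>n. c l * u l j)" for j
    proof -
      have "(\<Sum>i\<le>n. d (s i) * v (s i) j) = (\<Sum>i\<le>n. v k n * c i * v (s i) j)" using ds by (intro sum.cong) auto
      then have "(\<Sum>i\<le>Suc n. d i * v i j) = d k * v k j + (\<Sum>i\<le>n. v k n * c i * v (s i) j)" by (simp only: split)
      also have "\<dots> = (\<Sum>l\<le>n. c l * u l j)"
        by (simp add: d_def u_def sum_distrib_right sum_distrib_left sum_subtractf right_diff_distrib mult_ac)
      finally show ?thesis .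
    qed
    have "(\<Sum>l\<le>n. c l * u l n) = 0" by (intro sum.neutral) (auto simp: u_def)
    then have "\<forall>j<Suc n. (\<Sum>i\<le>Suc n. d i * v i j) = 0" unfolding eq using c(3) by (metis less_Suc_eq)
    moreover have "\<forall>i\<le>Suc n. d i \<in> S"
    proof (intro allI impI)
      fix i assume i: "i \<le> Suc n"
      show "d i \<in> S"
      proof (cases "i = k")
        case True
        have "(\<Sum>l\<le>n. c l * v (s l) n) \<in> S" using c(1) s Suc(2) by (intro Ssum S(4)) auto
        then show ?thesis using True S(1,3) by (simp add: d_def del: diff_0)
      next
        case False
        then have "t i \<le> n" using i k by (auto simp: t_def)
        then show ?thesis using False c(1) Suc(2)[of k n] k by (simp add: d_def S(4))
      qed
    qed
    moreover have "\<exists>i\<le>Suc n. d i \<noteq> 0"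
    proof -
      obtain i where "i \<le> n" "c i \<noteq> 0" using c(2) by blast
      then show ?thesis using s[of i] ds[of i] k by (intro exI[of _ "s i"]) auto
    qed
    ultimately show ?thesis by blast
  qed
qed

text \<open>
  The lowest order coefficients of a nonzero vector v would have to vanish, as Z is the identity at the origin.
\<close>

lemma unipotent_injective:
  fixes Z :: "nat \<Rightarrow> nat \<Rightarrow> rat fps"
  assumes Z: "\<And>k j. k < r \<Longrightarrow> j < r \<Longrightarrow> fps_nth (Z k j) 0 = (if k = j then 1 else 0)"
    and v: "\<And>k. k < r \<Longrightarrow> (\<Sum>j<r. Z k j * v j) = 0" and j: "j < r"
  shows "v j = 0"
proof -
  have "\<forall>k<r. fps_nth (v k) n = 0" for n
  proof (induction n rule: less_induct)
    case (less n)
    show ?case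
    proof (intro allI impI)
      fix k assume k: "k < r"
      have t: "fps_nth (Z k j * v j) n = fps_nth (Z k j) 0 * fps_nth (v j) n" if "j < r" for j
      proof -
        have "fps_nth (Z k j * v j) n = (\<Sum>i=0..n. fps_nth (Z k j) i * fps_nth (v j) (n - i))" by (simp add: fps_mult_nth)
        also have "\<dots> = (\<Sum>i\<in>{0}. fps_nth (Z k j) i * fps_nth (v j) (n - i))"
          using less that by (intro sum.mono_neutral_right) auto
        finally show ?thesis by simp
      qed
      have "0 = fps_nth (\<Sum>j<r. Z k j * v j) n" using v[OF k] by simp
      also have "\<dots> = (\<Sum>j<r. fps_nth (Z k j) 0 * fps_nth (v j) n)" using t by (simp add: fps_sum_nth)
      also have "\<dots> = (\<Sum>j<r. if j = k then fps_nth (v j) n else 0)" using Z[OF k] by (intro sum.cong) auto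
      finally show "fps_nth (v k) n = 0" using k by simp
    qed
  qed
  then show ?thesis using j by (intro fps_ext) simp
qed

text \<open>
  The product ZY has derivative 0 and is the identity at the origin.
\<close>

lemma inverse_system:
  fixes Y Z G :: "nat \<Rightarrow> nat \<Rightarrow> rat fps" and r :: nat
  assumes "\<And>i k. i < r \<Longrightarrow> k < r \<Longrightarrow> fps_deriv (Y i k) = - (\<Sum>j<r. G i j * Y j k)"
    and "\<And>k j. k < r \<Longrightarrow> j < r \<Longrightarrow> fps_deriv (Z k j) = (\<Sum>i<r. Z k i * G i j)"
    and "\<And>i k. i < r \<Longrightarrow> k < r \<Longrightarrow> fps_nth (Y i k) 0 = (if i = k then 1 else 0)"
    and "\<And>i k. i < r \<Longrightarrow> k < r \<Longrightarrow> fps_nth (Z i k) 0 = (if i = k then 1 else 0)"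
    and kl: "k < r" "l < r"
  shows "(\<Sum>j<r. Z k j * Y j l) = (if k = l then 1 else (0 :: rat fps))"
proof -
  let ?w = "\<Sum>j<r. Z k j * Y j l"
  have "fps_deriv ?w = (\<Sum>j<r. fps_deriv (Z k j) * Y j l + Z k j * fps_deriv (Y j l))" by (simp add: fps_deriv_sum add.commute)
  also have "\<dots> = (\<Sum>j<r. \<Sum>i<r. Z k i * G i j * Y j l) - (\<Sum>j<r. \<Sum>i<r. Z k j * G j i * Y i l)"
    using assms(1,2) kl by (simp add: sum.distrib sum_negf sum_subtractf sum_distrib_left sum_distrib_right mult.assoc)
  also have "(\<Sum>j<r. \<Sum>i<r. Z k j * G j i * Y i l) = (\<Sum>j<r. \<Sum>i<r. Z k i * G i j * Y j l)"
    by (subst sum.swap) simp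
  finally have "fps_deriv ?w = 0" by simp
  then have "?w = fps_const (fps_nth ?w 0)" by (simp add: fps_deriv_eq_0_iff)
  also have "fps_nth ?w 0 = (\<Sum>j<r. (if k = j then 1 else 0) * (if j = l then 1 else 0))"
    using assms(3,4) kl by (simp add: fps_sum_nth)
  also have "\<dots> = (\<Sum>j<r. if j = k then (if k = l then 1 else 0) else 0)" by (intro sum.cong) auto
  also have "\<dots> = (if k = l then 1 else 0)" 
  proof -
    have "(\<Sum>j<r. if j = k then c else 0) = c" for c :: rat using kl(1) by simp
    then show ?thesis .
  qed
  finally show ?thesis by simp
qed

section \<open>Differential algebras generated by algebraic elements\<close>

inductive_set OXspan :: "rat fps set \<Rightarrow> rat fps set" for T where
  zero: "0 \<in> OXspan T"
| step: "s \<in> OXspan T \<Longrightarrow> a \<in> OX \<Longrightarrow> t \<in> T \<Longrightarrow> a * t + s \<in> OXspan T"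

lemma OXspan_base: "t \<in> T \<Longrightarrow> t \<in> OXspan T"
  using OXspan.step[OF OXspan.zero, of 1 t T] by simp

lemma OXspan_add: "x \<in> OXspan T \<Longrightarrow> y \<in> OXspan T \<Longrightarrow> x + y \<in> OXspan T"
  by (induction rule: OXspan.induct) (auto simp: add.assoc intro: OXspan.step)

lemma OXspan_smult: "x \<in> OXspan T \<Longrightarrow> a \<in> OX \<Longrightarrow> a * x \<in> OXspan T"
  by (induction rule: OXspan.induct) (auto simp: distrib_left mult.assoc[symmetric] intro: OXspan.intros)

lemma OXspan_sum: "(\<And>i. i \<in> A \<Longrightarrow> f i \<in> OXspan T) \<Longrightarrow> sum f A \<in> OXspan T"
  by (induction A rule: infinite_finite_induct) (auto intro: OXspan_add OXspan.zero)

lemma OXspan_least: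
  assumes "x \<in> OXspan T" "\<And>t. t \<in> T \<Longrightarrow> t \<in> OXspan U" shows "x \<in> OXspan U"
  using assms(1) by (induction rule: OXspan.induct) (auto intro: OXspan_add OXspan_smult assms(2) OXspan.zero)

lemma OXspan_deriv:
  assumes "x \<in> OXspan T" "\<And>t. t \<in> T \<Longrightarrow> fps_deriv t \<in> OXspan T" shows "fps_deriv x \<in> OXspan T"
  using assms(1)
proof (induction rule: OXspan.induct)
  case (step s a t)
  have "fps_deriv (a * t + s) = (a * fps_deriv t + fps_deriv a * t) + fps_deriv s" by simp
  also have "\<dots> \<in> OXspan T" using step assms(2)[of t] by (intro OXspan_add OXspan_smult) (auto intro: OXspan_base)
  finally show ?case .
qed (auto intro: OXspan.zero)

lemma OXspan_mult:
  assumes "x \<in> OXspan T" "y \<in> OXspan U" "\<And>t u. t \<in> T \<Longrightarrow> u \<in> U \<Longrightarrow> t * u \<in> OXspan V"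
  shows "x * y \<in> OXspan V"
  using assms(1)
proof (induction rule: OXspan.induct)
  case (step s a t)
  have "t * y \<in> OXspan V" using assms(2)
  proof (induction rule: OXspan.induct)
    case (step s' b u)
    have e: "t * (b * u + s') = b * (t * u) + t * s'" by (simp add: algebra_simps)
    show ?case unfolding e
      by (rule OXspan_add[OF OXspan_smult[OF assms(3)]]) (use step \<open>t \<in> T\<close> in auto)
  qed (auto intro: OXspan.zero)
  moreover have e: "(a * t + s) * y = a * (t * y) + s * y" by (simp add: algebra_simps)
  ultimately show ?case unfolding e using step by (blast intro: OXspan_add OXspan_smult)
qed (auto intro: OXspan.zero)

lemma OXspan_finite: 
  assumes "finite T" "x \<in> OXspan T"
  shows "\<exists>a. (\<forall>t\<in>T. a t \<in> OX) \<and> x = (\<Sum>t\<in>T. a t * t)"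
  using assms(2)
proof (induction rule: OXspan.induct)
  case zero
  show ?case by (intro exI[of _ "\<lambda>_. 0"]) auto
next
  case (step s c t)
  then obtain a where a: "\<forall>t\<in>T. a t \<in> OX" "s = (\<Sum>t\<in>T. a t * t)" by blast
  have "(\<Sum>u\<in>T. (if u = t then c else 0) * u) = (\<Sum>u\<in>T. if u = t then c * u else 0)" by (intro sum.cong) auto
  also have "\<dots> = c * t" using step assms(1) by simp
  finally have "c * t + s = (\<Sum>u\<in>T. (a u + (if u = t then c else 0)) * u)"
    unfolding a(2) by (simp add: distrib_right sum.distrib)
  then show ?case using a(1) step by (intro exI[of _ "\<lambda>u. a u + (if u = t then c else 0)"]) auto
qed

definition monomials :: "rat fps set \<Rightarrow> nat \<Rightarrow> rat fps set" where
  "monomials Y d = {prod_list xs | xs. set xs \<subseteq> Y \<and> length xs \<le> d}"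

lemma finite_monomials: "finite Y \<Longrightarrow> finite (monomials Y d)"
proof -
  assume "finite Y"
  then have "finite (prod_list ` {xs. set xs \<subseteq> Y \<and> length xs \<le> d})" by (intro finite_imageI finite_lists_length_le)
  then show ?thesis by (rule finite_subset[rotated]) (auto simp: monomials_def)
qed

lemma monomialsI: "set xs \<subseteq> Y \<Longrightarrow> length xs \<le> d \<Longrightarrow> prod_list xs \<in> monomials Y d"
  by (auto simp: monomials_def)

lemma monomials_mono: "d \<le> e \<Longrightarrow> monomials Y d \<subseteq> monomials Y e"
  by (auto simp: monomials_def)

lemma monomials_deriv:
  assumes Y: "\<And>y. y \<in> Y \<Longrightarrow> fps_deriv y \<in> OXspan Y" and xs: "set xs \<subseteq> Y"
  shows "fps_deriv (prod_list xs) \<in> OXspan (monomials Y (length xs))"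
  using xs
proof (induction xs)
  case Nil show ?case by (auto intro: OXspan.zero)
next
  case (Cons y xs)
  have m: "u * t \<in> OXspan (monomials Y (length (y # xs)))" if "u \<in> Y" "t \<in> monomials Y (length xs)" for u t
  proof -
    obtain zs where zs: "t = prod_list zs" "set zs \<subseteq> Y" "length zs \<le> length xs"
      using \<open>t \<in> monomials Y (length xs)\<close> by (auto simp: monomials_def)
    then have "prod_list (u # zs) \<in> monomials Y (length (y # xs))" using that by (intro monomialsI) auto
    then show ?thesis using zs by (auto intro: OXspan_base)
  qed
  have "fps_deriv (prod_list (y # xs)) = y * fps_deriv (prod_list xs) + fps_deriv y * prod_list xs" by simp
  also have "\<dots> \<in> OXspan (monomials Y (length (y # xs)))"
  proof (rule OXspan_add)
    show "y * fps_deriv (prod_list xs) \<in> OXspan (monomials Y (length (y # xs)))"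
      using Cons by (intro OXspan_mult[OF OXspan_base[of y Y] _ m]) auto
    show "fps_deriv y * prod_list xs \<in> OXspan (monomials Y (length (y # xs)))"
      using Cons Y[of y] by (intro OXspan_mult[OF _ OXspan_base m]) (auto intro: monomialsI)
  qed
  finally show ?case .
qed

lemma OXspan_monomials_deriv:
  assumes Y: "\<And>y. y \<in> Y \<Longrightarrow> fps_deriv y \<in> OXspan Y" and x: "x \<in> OXspan (monomials Y d)"
  shows "fps_deriv x \<in> OXspan (monomials Y d)"
proof (rule OXspan_deriv[OF x])
  fix t assume "t \<in> monomials Y d"
  then obtain xs where xs: "t = prod_list xs" "set xs \<subseteq> Y" "length xs \<le> d" by (auto simp: monomials_def)
  have 1: "fps_deriv (prod_list xs) \<in> OXspan (monomials Y (length xs))"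
    by (rule monomials_deriv) (use Y xs(2) in auto)
  show "fps_deriv t \<in> OXspan (monomials Y d)"
    unfolding xs(1) by (rule OXspan_least[OF 1], rule OXspan_base, rule subsetD[OF monomials_mono[OF xs(3)]])
qed

lemma extract_power:
  assumes "count_list xs y \<ge> e"
  shows "\<exists>zs. prod_list xs = y ^ e * prod_list zs \<and> set zs \<subseteq> set xs \<and> length zs + e = length (xs :: rat fps list)"
  using assms
proof (induction e arbitrary: xs)
  case 0 then show ?case by (intro exI[of _ xs]) auto
next
  case (Suc e)
  then have "y \<in> set xs" using count_notin by fastforce
  then obtain us vs where xs: "xs = us @ y # vs" by (meson split_list)
  then have "count_list (us @ vs) y \<ge> e" using Suc by simp
  then obtain zs where zs: "prod_list (us @ vs) = y ^ e * prod_list zs" "set zs \<subseteq> set (us @ vs)" "length zs + e = length (us @ vs)"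
    using Suc(1) by blast
  have "prod_list xs = y * prod_list (us @ vs)" unfolding xs by (simp add: mult_ac)
  then show ?case using zs unfolding xs by (intro exI[of _ zs]) auto
qed

lemma alg_fps_relation:
  assumes "alg_fps y"
  shows "\<exists>e a c. a \<in> OX \<and> a \<noteq> 0 \<and> (\<forall>j<e. c j \<in> OX) \<and> a * y ^ e = (\<Sum>j<e. c j * y ^ j)"
proof -
  obtain J P where P: "\<exists>j<J. P j \<noteq> 0" "(\<Sum>j<J. fps_of_poly (P j) * y ^ j) = 0" using assms unfolding alg_fps_def by blast
  define e where "e = Max {j. j < J \<and> P j \<noteq> 0}"
  have fin: "finite {j. j < J \<and> P j \<noteq> 0}" by simp
  have ne: "{j. j < J \<and> P j \<noteq> 0} \<noteq> {}" using P(1) by blast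
  have e: "e < J" "P e \<noteq> 0" using Max_in[OF fin ne] by (auto simp: e_def)
  have gt: "P j = 0" if "e < j" "j < J" for j
  proof (rule ccontr)
    assume "P j \<noteq> 0"
    then have "j \<le> e" unfolding e_def using that by (intro Max_ge fin) simp
    then show False using that by simp
  qed
  have "0 = (\<Sum>j<J. fps_of_poly (P j) * y ^ j)" using P(2) by simp
  also have "\<dots> = (\<Sum>j<Suc e. fps_of_poly (P j) * y ^ j)"
    using e gt by (intro sum.mono_neutral_right) (auto simp: not_less)
  finally have "fps_of_poly (P e) * y ^ e = - (\<Sum>j<e. fps_of_poly (P j) * y ^ j)" by (simp add: eq_neg_iff_add_eq_0 add.commute)
  also have "\<dots> = (\<Sum>j<e. fps_of_poly (- P j) * y ^ j)" by (simp add: sum_negf fps_of_poly_uminus)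
  finally show ?thesis using e by (intro exI[of _ e] exI[of _ "fps_of_poly (P e)"] exI[of _ "\<lambda>j. fps_of_poly (- P j)"]) auto
qed

text \<open>
  Among sufficiently many factors some y occurs as often as the degree of its equation. The
  equation then replaces this power of y by lower ones, at the cost of a factor \<open>\<alpha>\<close>, the product of all leading
  coefficients.
\<close>

lemma monomials_bounded_up_to_denominator:
  assumes Y: "finite Y" "\<And>y. y \<in> Y \<Longrightarrow> alg_fps y"
  shows "\<exists>d \<alpha>. \<alpha> \<in> OX \<and> \<alpha> \<noteq> 0 \<and> (\<forall>xs. set xs \<subseteq> Y \<longrightarrow> (\<exists>k. \<alpha> ^ k * prod_list xs \<in> OXspan (monomials Y d)))"
proof -
  define R where "R = (\<lambda>y (x :: nat \<times> rat fps \<times> (nat \<Rightarrow> rat fps)). fst (snd x) \<in> OX \<and> fst (snd x) \<noteq> 0 \<and>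
    (\<forall>j<fst x. snd (snd x) j \<in> OX) \<and> fst (snd x) * y ^ fst x = (\<Sum>j<fst x. snd (snd x) j * y ^ j))"
  have "\<forall>y\<in>Y. \<exists>x. R y x"
  proof
    fix y assume "y \<in> Y"
    then obtain e a c where "a \<in> OX \<and> a \<noteq> 0 \<and> (\<forall>j<e. c j \<in> OX) \<and> a * y ^ e = (\<Sum>j<e. c j * y ^ j)"
      using alg_fps_relation[OF Y(2)] by blast
    then have "R y (e, a, c)" by (simp add: R_def)
    then show "\<exists>x. R y x" by blast
  qed
  from bchoice[OF this] obtain \<xi> where \<xi>: "\<And>y. y \<in> Y \<Longrightarrow> R y (\<xi> y)" by blast
  define e a c where "e = (\<lambda>y. fst (\<xi> y))" and "a = (\<lambda>y. fst (snd (\<xi> y)))" and "c = (\<lambda>y. snd (snd (\<xi> y)))"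
  have r: "a y \<in> OX" "a y \<noteq> 0" "j < e y \<Longrightarrow> c y j \<in> OX" "a y * y ^ e y = (\<Sum>j<e y. c y j * y ^ j)"
    if "y \<in> Y" for y j using \<xi>[OF that] by (simp_all add: R_def e_def a_def c_def)
  define d where "d = (\<Sum>y\<in>Y. e y)"
  define \<alpha> where "\<alpha> = (\<Prod>y\<in>Y. a y)"
  have \<alpha>: "\<alpha> \<in> OX" "\<alpha> \<noteq> 0" using r Y(1) by (auto simp: \<alpha>_def intro!: OX_prod)
  have "\<exists>k. \<alpha> ^ k * prod_list xs \<in> OXspan (monomials Y d)" if "set xs \<subseteq> Y" for xs
    using that
  proof (induction "length xs" arbitrary: xs rule: less_induct)
    case less
    show ?case
    proof (cases "length xs \<le> d")
      case True
      then show ?thesis using less(2) by (intro exI[of _ 0]) (auto intro!: OXspan_base monomialsI)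
    next
      case False
      have "\<exists>y\<in>Y. count_list xs y \<ge> e y"
      proof (rule ccontr)
        assume "\<not> (\<exists>y\<in>Y. count_list xs y \<ge> e y)"
        then have "(\<Sum>y\<in>Y. count_list xs y) \<le> d" unfolding d_def by (intro sum_mono) auto
        then show False using sum_count_set[OF less(2) Y(1)] False by simp
      qed
      then obtain y where y: "y \<in> Y" "count_list xs y \<ge> e y" by blast
      obtain zs where zs: "prod_list xs = y ^ e y * prod_list zs" "set zs \<subseteq> set xs" "length zs + e y = length xs"
        using extract_power[OF y(2)] by blast
      have "\<exists>k. \<alpha> ^ k * (y ^ j * prod_list zs) \<in> OXspan (monomials Y d)" if "j < e y" for j
      proof -
        have "length (replicate j y @ zs) < length xs" using that zs by simp
        moreover have "set (replicate j y @ zs) \<subseteq> Y" using y zs less(2) by (auto simp: set_replicate_conv_if)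
        ultimately have "\<exists>k. \<alpha> ^ k * prod_list (replicate j y @ zs) \<in> OXspan (monomials Y d)" by (rule less(1))
        then show ?thesis by simp
      qed
      then have "\<forall>j\<in>{..<e y}. \<exists>k. \<alpha> ^ k * (y ^ j * prod_list zs) \<in> OXspan (monomials Y d)" by simp
      from bchoice[OF this] obtain k where k: "\<And>j. j < e y \<Longrightarrow> \<alpha> ^ k j * (y ^ j * prod_list zs) \<in> OXspan (monomials Y d)" by auto
      define K where "K = (\<Sum>j<e y. k j)"
      have kK: "k j \<le> K" if "j < e y" for j unfolding K_def using that by (intro member_le_sum) auto
      have K: "\<alpha> ^ K * (y ^ j * prod_list zs) \<in> OXspan (monomials Y d)" if "j < e y" for j
      proof -
        have "\<alpha> ^ K = \<alpha> ^ (K - k j) * \<alpha> ^ k j" using kK[OF that] by (simp flip: power_add)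
        then have e: "\<alpha> ^ K * (y ^ j * prod_list zs) = \<alpha> ^ (K - k j) * (\<alpha> ^ k j * (y ^ j * prod_list zs))" by (simp only: mult.assoc)
        show ?thesis unfolding e by (rule OXspan_smult[OF k[OF that]]) (simp add: \<alpha>(1))
      qed
      have "\<alpha> = a y * (\<Prod>x\<in>Y - {y}. a x)" unfolding \<alpha>_def using Y(1) y(1) by (rule prod.remove)
      then have "\<alpha> ^ Suc K * prod_list xs = (\<Prod>x\<in>Y - {y}. a x) * (\<alpha> ^ K * ((a y * y ^ e y) * prod_list zs))"
        unfolding zs(1) by (simp add: mult_ac)
      also have "\<dots> = (\<Prod>x\<in>Y - {y}. a x) * (\<Sum>j<e y. c y j * (\<alpha> ^ K * (y ^ j * prod_list zs)))"
        unfolding r(4)[OF y(1)] by (simp add: sum_distrib_left sum_distrib_right mult_ac)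
      also have "\<dots> \<in> OXspan (monomials Y d)"
      proof (rule OXspan_smult[OF OXspan_sum])
        show "(\<Prod>x\<in>Y - {y}. a x) \<in> OX" using r(1) by (intro OX_prod) auto
        fix j assume "j \<in> {..<e y}"
        then show "c y j * (\<alpha> ^ K * (y ^ j * prod_list zs)) \<in> OXspan (monomials Y d)"
          using K[of j] r(3)[OF y(1), of j] by (intro OXspan_smult[of "\<alpha> ^ K * (y ^ j * prod_list zs)"]) simp_all
      qed
      finally show ?thesis by blast
    qed
  qed
  then show ?thesis using \<alpha> by blast
qed

text \<open>
  The span of the monomials of bounded degree is stable under differentiation, because the derivatives of
  the generators are linear in the generators. Hence the functions that multiply the monomials of degree at
  most e into the span of those of degree at most d form an ideal stable under differentiation. It contains a power of
  \<open>\<alpha>\<close>, so it contains 1.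
\<close>

lemma differential_algebra_finite:
  assumes Y: "finite Y" "\<And>y. y \<in> Y \<Longrightarrow> alg_fps y" "\<And>y. y \<in> Y \<Longrightarrow> fps_deriv y \<in> OXspan Y"
  obtains d where "\<And>e x. x \<in> OXspan (monomials Y e) \<Longrightarrow> x \<in> OXspan (monomials Y d)"
proof -
  have "\<exists>d \<alpha>. \<alpha> \<in> OX \<and> \<alpha> \<noteq> 0 \<and> (\<forall>xs. set xs \<subseteq> Y \<longrightarrow> (\<exists>k. \<alpha> ^ k * prod_list xs \<in> OXspan (monomials Y d)))"
    by (rule monomials_bounded_up_to_denominator[OF Y(1)]) (rule Y(2))
  then obtain d \<alpha> where d0: "\<alpha> \<in> OX \<and> \<alpha> \<noteq> 0 \<and> (\<forall>xs. set xs \<subseteq> Y \<longrightarrow> (\<exists>k. \<alpha> ^ k * prod_list xs \<in> OXspan (monomials Y d)))"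
    by (elim exE)
  then have d: "\<alpha> \<in> OX" "\<alpha> \<noteq> 0" "\<And>xs. set xs \<subseteq> Y \<Longrightarrow> \<exists>k. \<alpha> ^ k * prod_list xs \<in> OXspan (monomials Y d)"
    by blast+
  show thesis
  proof (rule that[of d])
    fix e x assume x: "x \<in> OXspan (monomials Y e)"
    define I where "I = {f \<in> OX. \<forall>b\<in>OXspan (monomials Y e). f * b \<in> OXspan (monomials Y d)}"
    have "\<forall>t\<in>monomials Y e. \<exists>k. \<alpha> ^ k * t \<in> OXspan (monomials Y d)"
      using d(3) by (auto simp: monomials_def)
    from bchoice[OF this] obtain k where k: "\<And>t. t \<in> monomials Y e \<Longrightarrow> \<alpha> ^ k t * t \<in> OXspan (monomials Y d)" by blast
    define K where "K = (\<Sum>t\<in>monomials Y e. k t)"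
    have aKt: "\<alpha> ^ K * t \<in> OXspan (monomials Y d)" if t: "t \<in> monomials Y e" for t
    proof -
      have "k t \<le> K" unfolding K_def using t finite_monomials[OF Y(1)] by (intro member_le_sum) auto
      then have "\<alpha> ^ K = \<alpha> ^ (K - k t) * \<alpha> ^ k t" by (simp flip: power_add)
      then have e: "\<alpha> ^ K * t = \<alpha> ^ (K - k t) * (\<alpha> ^ k t * t)" by (simp only: mult.assoc)
      show ?thesis unfolding e by (rule OXspan_smult[OF k[OF t]]) (simp add: d(1))
    qed
    have "\<alpha> ^ K * b \<in> OXspan (monomials Y d)" if b: "b \<in> OXspan (monomials Y e)" for b
      using b
    proof (induction rule: OXspan.induct)
      case (step s a t)
      have e: "\<alpha> ^ K * (a * t + s) = a * (\<alpha> ^ K * t) + \<alpha> ^ K * s" by (simp add: algebra_simps)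
      show ?case unfolding e by (rule OXspan_add[OF OXspan_smult]) (use step aKt in auto)
    qed (auto intro: OXspan.zero)
    then have aI: "\<alpha> ^ K \<in> I" using d(1) by (simp add: I_def)
    have "1 \<in> I"
    proof (rule derivation_stable_ideal_unit[OF _ _ aI])
      fix f g assume "f \<in> I" "g \<in> OX"
      then show "g * f \<in> I" by (auto simp: I_def mult.assoc intro: OXspan_smult)
    next
      fix f assume f: "f \<in> I"
      show "fps_deriv f \<in> I" unfolding I_def
      proof (intro CollectI conjI ballI)
        show "fps_deriv f \<in> OX" using f by (simp add: I_def)
        fix b assume b: "b \<in> OXspan (monomials Y e)"
        have 1: "fps_deriv (f * b) \<in> OXspan (monomials Y d)"
          by (rule OXspan_monomials_deriv) (use Y(3) f b in \<open>auto simp: I_def\<close>)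
        have 2: "f * fps_deriv b \<in> OXspan (monomials Y d)"
          using f OXspan_monomials_deriv[OF Y(3) b] by (simp add: I_def)
        have 3: "fps_deriv f * b = fps_deriv (f * b) + (- 1) * (f * fps_deriv b)" by simp
        show "fps_deriv f * b \<in> OXspan (monomials Y d)"
          unfolding 3 by (rule OXspan_add[OF 1 OXspan_smult[OF 2 OX_uminus[OF OX_1]]])
      qed
    qed (use d in auto)
    then show "x \<in> OXspan (monomials Y d)" using x by (auto simp: I_def)
  qed
qed

section \<open>The finite cover\<close>

text \<open>
  A ring of power series that is closed under differentiation and free of finite rank over the coordinate
  ring. Its spectrum is a finite etale cover of the curve.
\<close>

locale finite_differential_algebra =
  fixes A :: "rat fps set" and n :: nat and w :: "nat \<Rightarrow> rat fps"
  assumes OX_A: "OX \<subseteq> A"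
    and A_add: "\<And>x y. x \<in> A \<Longrightarrow> y \<in> A \<Longrightarrow> x + y \<in> A"
    and A_mult: "\<And>x y. x \<in> A \<Longrightarrow> y \<in> A \<Longrightarrow> x * y \<in> A"
    and A_deriv: "\<And>x. x \<in> A \<Longrightarrow> fps_deriv x \<in> A"
    and w_A: "\<And>j. j < n \<Longrightarrow> w j \<in> A"
    and w_span: "\<And>x. x \<in> A \<Longrightarrow> \<exists>a. (\<forall>j<n. a j \<in> OX) \<and> x = (\<Sum>j<n. a j * w j)"
    and w_indep: "\<And>a j. (\<And>j. j < n \<Longrightarrow> a j \<in> OX) \<Longrightarrow> (\<Sum>j<n. a j * w j) = 0 \<Longrightarrow> j < n \<Longrightarrow> a j = 0"
begin

lemma A_OX: "a \<in> OX \<Longrightarrow> a \<in> A" using OX_A by blast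

lemma A_uminus: "x \<in> A \<Longrightarrow> - x \<in> A"
  using A_mult[OF A_OX[OF OX_uminus[OF OX_1]], of x] by simp

lemma A_diff: "x \<in> A \<Longrightarrow> y \<in> A \<Longrightarrow> x - y \<in> A"
  using A_add[OF _ A_uminus, of x y] by simp

lemma A_sum: "(\<And>i. i \<in> S \<Longrightarrow> f i \<in> A) \<Longrightarrow> sum f S \<in> A"
  by (induction S rule: infinite_finite_induct) (auto intro: A_add A_OX)

lemma A_power: "x \<in> A \<Longrightarrow> x ^ k \<in> A"
  by (induction k) (auto intro: A_mult A_OX)

lemma w_unique:
  assumes "\<And>j. j < n \<Longrightarrow> a j \<in> OX" "\<And>j. j < n \<Longrightarrow> b j \<in> OX" "(\<Sum>j<n. a j * w j) = (\<Sum>j<n. b j * w j)" "j < n"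
  shows "a j = b j"
  using w_indep[of "\<lambda>j. a j - b j" j] assms by (simp add: left_diff_distrib sum_subtractf)

lemma n_pos: "n > 0"
proof (rule ccontr)
  assume "\<not> n > 0"
  then have "(1 :: rat fps) = 0" using w_span[OF A_OX[OF OX_1]] by auto
  then show False by simp
qed

definition relation :: "rat fps \<Rightarrow> nat \<Rightarrow> (nat \<Rightarrow> rat fps) \<Rightarrow> bool" where
  "relation t d c \<longleftrightarrow> (\<forall>i\<le>d. c i \<in> OX) \<and> c d \<noteq> 0 \<and> (\<Sum>i\<le>d. c i * t ^ i) = 0"

lemma relation_exists:
  assumes t: "t \<in> A" shows "\<exists>d c. relation t d c"
proof -
  have "\<forall>i. \<exists>a. (\<forall>j<n. a j \<in> OX) \<and> t ^ i = (\<Sum>j<n. a j * w j)" using w_span[OF A_power[OF t]] by blast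
  from choice[OF this] obtain v where v: "\<And>i j. j < n \<Longrightarrow> v i j \<in> OX" "\<And>i. t ^ i = (\<Sum>j<n. v i j * w j)" by blast
  have "\<exists>c. (\<forall>i\<le>n. c i \<in> OX) \<and> (\<exists>i\<le>n. c i \<noteq> 0) \<and> (\<forall>j<n. (\<Sum>i\<le>n. c i * v i j) = 0)"
    by (rule homogeneous_system) (use v(1) in auto)
  then obtain c where c: "\<forall>i\<le>n. c i \<in> OX" "\<exists>i\<le>n. c i \<noteq> 0" "\<forall>j<n. (\<Sum>i\<le>n. c i * v i j) = 0" by blast
  have "(\<Sum>i\<le>n. c i * t ^ i) = (\<Sum>j<n. (\<Sum>i\<le>n. c i * v i j) * w j)"
    unfolding v(2) sum_distrib_left sum_distrib_right by (subst sum.swap) (simp add: mult.assoc)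
  also have "\<dots> = 0" using c(3) by simp
  finally have z: "(\<Sum>i\<le>n. c i * t ^ i) = 0" .
  define d where "d = Max {i. i \<le> n \<and> c i \<noteq> 0}"
  have fin: "finite {i. i \<le> n \<and> c i \<noteq> 0}" by simp
  have d: "d \<le> n" "c d \<noteq> 0" using Max_in[OF fin] c(2) unfolding d_def by blast+
  have gt: "c i = 0" if "d < i" "i \<le> n" for i
  proof (rule ccontr)
    assume "c i \<noteq> 0"
    then have "i \<le> d" unfolding d_def using that by (intro Max_ge fin) simp
    then show False using that by simp
  qed
  have "(\<Sum>i\<le>n. c i * t ^ i) = (\<Sum>i\<le>d. c i * t ^ i)"
    using d gt by (intro sum.mono_neutral_right) (auto simp: not_le)
  then have "relation t d c" unfolding relation_def using c(1) d z by auto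
  then show ?thesis by blast
qed

text \<open>
  A relation of degree 0 would say that its leading coefficient is zero.
\<close>

lemma minimal_relation:
  assumes t: "t \<in> A"
  shows "\<exists>d c. relation t (Suc d) c \<and> (\<forall>e b. relation t e b \<longrightarrow> Suc d \<le> e)"
proof -
  define m where "m = (LEAST d. \<exists>c. relation t d c)"
  have "\<exists>c. relation t m c" unfolding m_def by (rule LeastI_ex) (rule relation_exists[OF t])
  then obtain c where c: "relation t m c" by blast
  have least: "m \<le> e" if "relation t e b" for e b unfolding m_def by (rule Least_le) (use that in blast)
  have "m \<noteq> 0"
  proof
    assume "m = 0"
    then show False using c by (simp add: relation_def)
  qed
  then obtain d where "m = Suc d" using not0_implies_Suc by blast
  then show ?thesis using c least by (intro exI[of _ d] exI[of _ c]) simp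
qed

text \<open>
  The constant coefficient of a minimal relation is a nonzero multiple of t.
\<close>

lemma nonzero_divides_OX:
  assumes t: "t \<in> A" "t \<noteq> 0"
  shows "\<exists>u\<in>A. t * u \<in> OX \<and> t * u \<noteq> 0"
proof -
  obtain d c where c: "relation t (Suc d) c" "\<forall>e b. relation t e b \<longrightarrow> Suc d \<le> e"
    using minimal_relation[OF t(1)] by (elim exE conjE)
  define u where "u = - (\<Sum>i\<le>d. c (Suc i) * t ^ i)"
  have cO: "c i \<in> OX" if "i \<le> Suc d" for i using c(1) that by (simp add: relation_def)
  have "0 = (\<Sum>i\<le>Suc d. c i * t ^ i)" using c(1) by (simp add: relation_def)
  also have "\<dots> = c 0 + (\<Sum>i\<le>d. c (Suc i) * t ^ Suc i)" by (subst sum.atMost_Suc_shift) simp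
  also have "(\<Sum>i\<le>d. c (Suc i) * t ^ Suc i) = t * (\<Sum>i\<le>d. c (Suc i) * t ^ i)" by (simp add: sum_distrib_left mult_ac)
  finally have "t * (\<Sum>i\<le>d. c (Suc i) * t ^ i) + c 0 = 0" by (simp only: add.commute)
  then have tu: "t * u = c 0" unfolding u_def by (simp only: minus_unique mult_minus_right)
  have "c 0 \<noteq> 0"
  proof
    assume "c 0 = 0"
    then have "t * (\<Sum>i\<le>d. c (Suc i) * t ^ i) = 0" using tu by (simp add: u_def)
    then have "(\<Sum>i\<le>d. c (Suc i) * t ^ i) = 0" using t(2) by simp
    then have "relation t d (\<lambda>i. c (Suc i))" using c(1) by (simp add: relation_def)
    then have "Suc d \<le> d" using c(2) by blast
    then show False by simp
  qed
  moreover have "u \<in> A" unfolding u_def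
    by (intro A_uminus A_sum, rule A_mult[OF A_OX A_power[OF t(1)]]) (use cO in auto)
  ultimately show ?thesis using cO[of 0] by (intro bexI[of _ u]) (auto simp only: tu)
qed

text \<open>
  Over the function field Z is obtained from Y by linear algebra, so every column of Z lies in A up to a
  denominator. Since \<open>Z' = Z G\<close>, the denominators common to all entries form an ideal stable under
  differentiation.
\<close>

lemma inverse_matrix_entries:
  assumes Y: "\<And>i k. i < r \<Longrightarrow> k < r \<Longrightarrow> Y i k \<in> A"
    and G: "\<And>i j. i < r \<Longrightarrow> j < r \<Longrightarrow> G i j \<in> OX"
    and Z: "\<And>k j. k < r \<Longrightarrow> j < r \<Longrightarrow> fps_deriv (Z k j) = (\<Sum>i<r. Z k i * G i j)"
    and ZY: "\<And>k l. k < r \<Longrightarrow> l < r \<Longrightarrow> (\<Sum>j<r. Z k j * Y j l) = (if k = l then 1 else 0)"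
    and kl: "k < r" "l < (r :: nat)"
  shows "Z k l \<in> A"
proof -
  have "\<exists>a\<in>OX. a \<noteq> 0 \<and> (\<forall>k<r. a * Z k l \<in> A)" if l: "l < r" for l
  proof -
    define v where "v = (\<lambda>i j. if i < r then Y j i else if j = l then 1 else 0)"
    have "\<exists>c. (\<forall>i\<le>r. c i \<in> A) \<and> (\<exists>i\<le>r. c i \<noteq> 0) \<and> (\<forall>j<r. (\<Sum>i\<le>r. c i * v i j) = 0)"
      by (rule homogeneous_system) (use Y in \<open>auto simp: v_def intro: A_OX A_diff A_mult\<close>)
    then obtain c where c: "\<forall>i\<le>r. c i \<in> A" "\<exists>i\<le>r. c i \<noteq> 0" "\<forall>j<r. (\<Sum>i\<le>r. c i * v i j) = 0" by blast
    have eq: "c k + c r * Z k l = 0" if k: "k < r" for k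
    proof -
      have "(\<Sum>i\<le>r. c i * v i j) = (\<Sum>i<r. c i * Y j i) + c r * (if j = l then 1 else 0)" for j
        unfolding v_def lessThan_Suc_atMost[symmetric] by simp
      then have "0 = (\<Sum>j<r. Z k j * ((\<Sum>i<r. c i * Y j i) + c r * (if j = l then 1 else 0)))" using c(3) by simp
      also have "\<dots> = (\<Sum>j<r. \<Sum>i<r. c i * (Z k j * Y j i)) + (\<Sum>j<r. if j = l then c r * Z k j else 0)"
        unfolding distrib_left sum.distrib sum_distrib_left
        by (intro arg_cong2[where f = "(+)"] sum.cong) (auto simp: mult_ac)
      also have "(\<Sum>j<r. \<Sum>i<r. c i * (Z k j * Y j i)) = (\<Sum>i<r. c i * (\<Sum>j<r. Z k j * Y j i))"
        unfolding sum_distrib_left by (rule sum.swap)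
      also have "\<dots> = (\<Sum>i<r. if i = k then c i else 0)" using ZY[OF k] by (intro sum.cong) auto
      finally show ?thesis using k l by simp
    qed
    have "c r \<noteq> 0"
    proof
      assume z: "c r = 0"
      have "c i = 0" if "i \<le> r" for i using eq[of i] z that by (cases "i = r") auto
      then show False using c(2) by blast
    qed
    then obtain u where u: "u \<in> A" "c r * u \<in> OX" "c r * u \<noteq> 0" using nonzero_divides_OX c(1) by blast
    have "c r * u * Z k l \<in> A" if k: "k < r" for k
    proof -
      have "c r * Z k l = - c k" using eq[OF k] by (simp add: eq_neg_iff_add_eq_0 add.commute)
      then have e: "c r * u * Z k l = u * (- c k)" by (metis mult.assoc mult.commute)
      show ?thesis unfolding e using u(1) c(1) k by (intro A_mult A_uminus) auto
    qed
    then show ?thesis using u by blast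
  qed
  then have "\<forall>l\<in>{..<r}. \<exists>a. a \<in> OX \<and> a \<noteq> 0 \<and> (\<forall>k<r. a * Z k l \<in> A)" by blast
  from bchoice[OF this] obtain a where a: "\<And>l. l < r \<Longrightarrow> a l \<in> OX" "\<And>l. l < r \<Longrightarrow> a l \<noteq> 0" "\<And>k l. k < r \<Longrightarrow> l < r \<Longrightarrow> a l * Z k l \<in> A" by auto
  define I where "I = {f \<in> OX. \<forall>k<r. \<forall>l<r. f * Z k l \<in> A}"
  have aI: "(\<Prod>l<r. a l) \<in> I" unfolding I_def
  proof (intro CollectI conjI allI impI)
    show "(\<Prod>l<r. a l) \<in> OX" using a by (intro OX_prod) auto
    fix k l assume kl: "k < r" "l < r"
    have e: "(\<Prod>l<r. a l) * Z k l = (\<Prod>l\<in>{..<r} - {l}. a l) * (a l * Z k l)"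
      using prod.remove[of "{..<r}" l a] kl by (simp add: mult_ac)
    show "(\<Prod>l<r. a l) * Z k l \<in> A" unfolding e by (rule A_mult[OF A_OX[OF OX_prod]]) (use a kl in auto)
  qed
  have "1 \<in> I"
  proof (rule derivation_stable_ideal_unit[OF _ _ aI])
    fix f g assume "f \<in> I" "g \<in> OX"
    then show "g * f \<in> I" by (auto simp: I_def mult.assoc intro: A_mult A_OX)
  next
    fix f assume f: "f \<in> I"
    show "fps_deriv f \<in> I" unfolding I_def
    proof (intro CollectI conjI allI impI)
      show "fps_deriv f \<in> OX" using f by (simp add: I_def)
      fix k l assume kl: "k < r" "l < r"
      have "f * fps_deriv (Z k l) = (\<Sum>i<r. (f * Z k i) * G i l)" unfolding Z[OF kl] by (simp add: sum_distrib_left mult.assoc)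
      also have "\<dots> \<in> A"
      proof (rule A_sum)
        fix i assume i: "i \<in> {..<r}"
        have "f * Z k i \<in> A" using f kl i by (simp add: I_def)
        then show "(f * Z k i) * G i l \<in> A" by (rule A_mult[OF _ A_OX]) (use G i kl in auto)
      qed
      finally have "fps_deriv (f * Z k l) - f * fps_deriv (Z k l) \<in> A"
        using f kl by (intro A_diff A_deriv) (auto simp: I_def)
      then show "fps_deriv f * Z k l \<in> A" by simp
    qed
  next
    show "(\<Prod>l<r. a l) \<in> OX" using aI by (simp add: I_def)
    show "(\<Prod>l<r. a l) \<noteq> 0" using a(2) by simp
  qed
  then show ?thesis using kl by (simp add: I_def)
qed

lemma A_countable: "countable A"
proof -
  define h where "h = (\<lambda>(l :: rat list, k :: nat). fps_of_poly (Poly l) * inverse (q4 ^ k))"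
  have "\<exists>x. f = h x" if "f \<in> OX" for f
  proof -
    obtain a k where "f = fps_of_poly a * inverse (q4 ^ k)" using OX_as_quotient[OF \<open>f \<in> OX\<close>] by blast
    then show ?thesis by (intro exI[of _ "(coeffs a, k)"]) (simp add: h_def)
  qed
  then obtain h' where h': "\<And>f. f \<in> OX \<Longrightarrow> f = h (h' f)" by metis
  have "A \<subseteq> range (\<lambda>xs. \<Sum>j<n. h (xs ! j) * w j)"
  proof
    fix x assume "x \<in> A"
    then obtain a where a: "\<forall>j<n. a j \<in> OX" "x = (\<Sum>j<n. a j * w j)" using w_span by blast
    have "x = (\<Sum>j<n. h (map (\<lambda>j. h' (a j)) [0..<n] ! j) * w j)"
      unfolding a(2) using a(1) h' by (intro sum.cong) auto
    then show "x \<in> range (\<lambda>xs. \<Sum>j<n. h (xs ! j) * w j)" by (rule range_eqI)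
  qed
  then show ?thesis by (rule countable_subset) simp
qed

text \<open>
  A is countable, which allows its ring structure to be carried over to the natural numbers.
\<close>

definition enc :: "rat fps \<Rightarrow> nat" where "enc = to_nat_on A"
definition dec :: "nat \<Rightarrow> rat fps" where "dec = from_nat_into A"

lemma dec_enc [simp]: "x \<in> A \<Longrightarrow> dec (enc x) = x"
  unfolding enc_def dec_def by (rule from_nat_into_to_nat_on[OF A_countable])

definition cover_ring :: "nat ring" where
  "cover_ring = \<lparr>carrier = enc ` A, monoid.mult = (\<lambda>x y. enc (dec x * dec y)), monoid.one = enc 1,
     ring.zero = enc 0, ring.add = (\<lambda>x y. enc (dec x + dec y))\<rparr>"

lemma cover_ring_simps [simp]:
  "carrier cover_ring = enc ` A" "x \<otimes>\<^bsub>cover_ring\<^esub> y = enc (dec x * dec y)" "\<one>\<^bsub>cover_ring\<^esub> = enc 1"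
  "\<zero>\<^bsub>cover_ring\<^esub> = enc 0" "x \<oplus>\<^bsub>cover_ring\<^esub> y = enc (dec x + dec y)"
  by (simp_all add: cover_ring_def)

lemma A_01 [simp]: "0 \<in> A" "1 \<in> A" by (auto intro: A_OX)

lemma cring_cover: "cring cover_ring"
proof (rule cringI)
  show "abelian_group cover_ring"
  proof (rule abelian_groupI)
    fix x assume "x \<in> carrier cover_ring"
    then show "\<exists>y\<in>carrier cover_ring. y \<oplus>\<^bsub>cover_ring\<^esub> x = \<zero>\<^bsub>cover_ring\<^esub>"
      by (auto simp: A_uminus intro!: bexI[of _ "- dec x"])
  qed (auto simp: A_add algebra_simps)
  show "Group.comm_monoid cover_ring" by (rule comm_monoidI) (auto simp: A_mult algebra_simps)
qed (auto simp: A_mult A_add algebra_simps)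

lemma enc_inj: "x \<in> A \<Longrightarrow> y \<in> A \<Longrightarrow> enc x = enc y \<Longrightarrow> x = y" by (metis dec_enc)

lemma restrict_simps [simp]:
  "carrier (restrict_scalars cover_ring enc) = enc ` A" "a \<odot>\<^bsub>restrict_scalars cover_ring enc\<^esub> x = enc (dec (enc a) * dec x)"
  "x \<oplus>\<^bsub>restrict_scalars cover_ring enc\<^esub> y = enc (dec x + dec y)" "\<zero>\<^bsub>restrict_scalars cover_ring enc\<^esub> = enc 0"
  by (simp_all add: restrict_scalars_def)

lemma module_restrict: "module O_X (restrict_scalars cover_ring enc)"
proof (rule moduleI[OF cring_O_X])
  show "abelian_group (restrict_scalars cover_ring enc)"
  proof (rule abelian_groupI)
    fix x assume "x \<in> carrier (restrict_scalars cover_ring enc)"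
    then show "\<exists>y\<in>carrier (restrict_scalars cover_ring enc). y \<oplus>\<^bsub>restrict_scalars cover_ring enc\<^esub> x = \<zero>\<^bsub>restrict_scalars cover_ring enc\<^esub>"
      by (auto simp: A_uminus intro!: bexI[of _ "- dec x"])
  qed (auto simp: A_add algebra_simps)
qed (auto simp: A_OX A_mult A_add algebra_simps)

lemma vector_bundle_cover: "vector_bundle O_X (restrict_scalars cover_ring enc) n"
  unfolding vector_bundle_def
proof (intro conjI allI impI module_restrict)
  interpret N: module O_X "restrict_scalars cover_ring enc" by (rule module_restrict)
  fix P assume P: "primeideal P O_X"
  have fs: "dec (\<Oplus>\<^bsub>restrict_scalars cover_ring enc\<^esub>i\<in>{..<n}. a i \<odot>\<^bsub>restrict_scalars cover_ring enc\<^esub> enc (w i)) = (\<Sum>i<n. a i * w i)"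
    if a: "a \<in> {..<n} \<rightarrow> OX" for a
  proof -
    have "dec (\<Oplus>\<^bsub>restrict_scalars cover_ring enc\<^esub>i\<in>{..<n}. a i \<odot>\<^bsub>restrict_scalars cover_ring enc\<^esub> enc (w i)) = (\<Sum>i<n. a i * dec (enc (w i)))"
      by (rule finsum_functional_O_X[OF module_restrict]) (use a w_A in \<open>auto simp: A_add A_mult A_OX\<close>)
    then show ?thesis using w_A by simp
  qed
  have fc: "(\<Oplus>\<^bsub>restrict_scalars cover_ring enc\<^esub>i\<in>{..<n}. a i \<odot>\<^bsub>restrict_scalars cover_ring enc\<^esub> enc (w i)) \<in> enc ` A"
    if a: "a \<in> {..<n} \<rightarrow> OX" for a
  proof -
    have "(\<Oplus>\<^bsub>restrict_scalars cover_ring enc\<^esub>i\<in>{..<n}. a i \<odot>\<^bsub>restrict_scalars cover_ring enc\<^esub> enc (w i)) \<in> carrier (restrict_scalars cover_ring enc)"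
      by (rule N.finsum_closed) (use a w_A in \<open>auto simp: A_mult A_OX Pi_iff\<close>)
    then show ?thesis by simp
  qed
  have "local_basis O_X (restrict_scalars cover_ring enc) 1 n (\<lambda>i. enc (w i))"
    unfolding local_basis_def
  proof (intro conjI ballI impI allI)
    show "(\<lambda>i. enc (w i)) \<in> {..<n} \<rightarrow> carrier (restrict_scalars cover_ring enc)" using w_A by auto
  next
    fix m assume "m \<in> carrier (restrict_scalars cover_ring enc)"
    then obtain x where x: "m = enc x" "x \<in> A" by auto
    obtain a where a: "\<forall>j<n. a j \<in> OX" "x = (\<Sum>j<n. a j * w j)" using w_span[OF x(2)] by blast
    then have aP: "a \<in> {..<n} \<rightarrow> OX" by auto
    obtain y where y: "y \<in> A" "(\<Oplus>\<^bsub>restrict_scalars cover_ring enc\<^esub>i\<in>{..<n}. a i \<odot>\<^bsub>restrict_scalars cover_ring enc\<^esub> enc (w i)) = enc y"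
      using fc[OF aP] by blast
    then have "y = x" using fs[OF aP] a(2) by simp
    then have "1 [^]\<^bsub>O_X\<^esub> (0::nat) \<odot>\<^bsub>restrict_scalars cover_ring enc\<^esub> m = (\<Oplus>\<^bsub>restrict_scalars cover_ring enc\<^esub>i\<in>{..<n}. a i \<odot>\<^bsub>restrict_scalars cover_ring enc\<^esub> enc (w i))"
      unfolding y(2) using x by simp
    then show "\<exists>k::nat. \<exists>a\<in>{..<n} \<rightarrow> OX. 1 [^]\<^bsub>O_X\<^esub> k \<odot>\<^bsub>restrict_scalars cover_ring enc\<^esub> m = (\<Oplus>\<^bsub>restrict_scalars cover_ring enc\<^esub>i\<in>{..<n}. a i \<odot>\<^bsub>restrict_scalars cover_ring enc\<^esub> enc (w i))"
      using aP by blast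
  next
    fix a i assume a: "a \<in> {..<n} \<rightarrow> OX" and i: "i < n"
      "(\<Oplus>\<^bsub>restrict_scalars cover_ring enc\<^esub>i\<in>{..<n}. a i \<odot>\<^bsub>restrict_scalars cover_ring enc\<^esub> enc (w i)) = \<zero>\<^bsub>restrict_scalars cover_ring enc\<^esub>"
    then have "(\<Sum>i<n. a i * w i) = 0" using fs[OF a] by simp
    then have "a i = 0" using w_indep[of a i] a i by auto
    then show "\<exists>k::nat. 1 [^]\<^bsub>O_X\<^esub> k \<otimes>\<^bsub>O_X\<^esub> a i = \<zero>\<^bsub>O_X\<^esub>" by simp
  qed
  then show "\<exists>g\<in>OX - P. \<exists>e. local_basis O_X (restrict_scalars cover_ring enc) g n e"
    using primeideal_not_1[OF P] by (intro bexI[of _ 1]) auto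
qed

lemma enc_ring_hom: "enc \<in> ring_hom O_X cover_ring"
  by (rule ring_hom_memI) (auto simp: A_OX)

text \<open>
  Since A is free, the extension of P to A meets the coordinate ring only in P, and a prime of A that
  contains the extension and avoids the complement of P lies over P.
\<close>

lemma lying_over:
  assumes P: "primeideal P O_X"
  shows "\<exists>Q. primeideal Q cover_ring \<and> {a \<in> OX. enc a \<in> Q} = P"
proof -
  have Pi: "ideal P O_X" using P by (rule primeideal.axioms(1))
  have PO: "P \<subseteq> OX" using ideal.Icarr[OF Pi] by auto
  have P0: "0 \<in> P" using additive_subgroup.zero_closed[OF ideal.axioms(1)[OF Pi]] by simp
  have Pa: "x + y \<in> P" if "x \<in> P" "y \<in> P" for x y
    using additive_subgroup.a_closed[OF ideal.axioms(1)[OF Pi] that] by simp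
  have Pm: "a * x \<in> P" if "x \<in> P" "a \<in> OX" for a x using ideal.I_l_closed[OF Pi that] by simp
  define PA where "PA = {x. \<exists>a. (\<forall>j<n. a j \<in> P) \<and> x = (\<Sum>j<n. a j * w j)}"
  have PA_A: "PA \<subseteq> A" 
  proof
    fix x assume "x \<in> PA"
    then obtain a where a: "\<forall>j<n. a j \<in> P" "x = (\<Sum>j<n. a j * w j)" unfolding PA_def by blast
    have "a j * w j \<in> A" if "j < n" for j by (rule A_mult[OF A_OX w_A]) (use a(1) PO that in auto)
    then show "x \<in> A" unfolding a(2) by (intro A_sum) simp
  qed
  have PA_add: "x + y \<in> PA" if xy: "x \<in> PA" "y \<in> PA" for x y
  proof -
    obtain a b where "\<forall>j<n. a j \<in> P" "x = (\<Sum>j<n. a j * w j)" "\<forall>j<n. b j \<in> P" "y = (\<Sum>j<n. b j * w j)"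
      using xy unfolding PA_def by blast
    then show ?thesis unfolding PA_def
      by (intro CollectI exI[of _ "\<lambda>j. a j + b j"]) (simp add: Pa distrib_right sum.distrib)
  qed
  have PA_0: "0 \<in> PA" unfolding PA_def using P0 by (intro CollectI exI[of _ "\<lambda>_. 0"]) simp
  have PA_sum: "(\<Sum>i\<in>S. f i) \<in> PA" if "\<And>i. i \<in> S \<Longrightarrow> f i \<in> PA" for f and S :: "nat set"
    using that by (induction S rule: infinite_finite_induct) (auto intro: PA_add PA_0)
  have PA_gen: "p * x \<in> PA" if p: "p \<in> P" "x \<in> A" for p x
  proof -
    obtain a where "\<forall>j<n. a j \<in> OX" "x = (\<Sum>j<n. a j * w j)" using w_span[OF p(2)] by blast
    then show ?thesis unfolding PA_def using Pm[OF p(1)]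
      by (intro CollectI exI[of _ "\<lambda>j. a j * p"]) (simp add: sum_distrib_left mult.assoc mult.left_commute[of p])
  qed
  have PA_mult: "y * x \<in> PA" if xy: "x \<in> PA" "y \<in> A" for x y
  proof -
    obtain a where a: "\<forall>j<n. a j \<in> P" "x = (\<Sum>j<n. a j * w j)" using xy unfolding PA_def by blast
    have "y * x = (\<Sum>j<n. a j * (w j * y))" unfolding a(2) by (simp add: sum_distrib_left mult_ac)
    also have "\<dots> \<in> PA" using a(1) xy(2) w_A by (intro PA_sum PA_gen A_mult) auto
    finally show ?thesis .
  qed
  have PA_coeff: "a 0 \<in> P" if a: "\<forall>j<n. a j \<in> OX" "(\<Sum>j<n. a j * w j) \<in> PA" for a
  proof -
    obtain b where b: "\<forall>j<n. b j \<in> P" "(\<Sum>j<n. a j * w j) = (\<Sum>j<n. b j * w j)" using a(2) unfolding PA_def by blast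
    have "a 0 = b 0" using a(1) b PO n_pos by (intro w_unique[of a b 0]) auto
    then show ?thesis using b(1) n_pos by simp
  qed
  interpret B: cring cover_ring by (rule cring_cover)
  have "subgroup (enc ` PA) (add_monoid cover_ring)"
  proof (rule B.add.subgroupI)
    show "enc ` PA \<subseteq> carrier cover_ring" using PA_A by auto
    show "enc ` PA \<noteq> {}" using PA_0 by blast
    fix x assume "x \<in> enc ` PA"
    then obtain a where a: "x = enc a" "a \<in> PA" by blast
    have na: "- a \<in> PA" using PA_mult[OF a(2) A_uminus[OF A_01(2)]] by simp
    have aA: "a \<in> A" "- a \<in> A" using a na PA_A by auto
    have "\<ominus>\<^bsub>cover_ring\<^esub> x = enc (- a)" using a aA by (intro B.minus_equality) auto
    then show "\<ominus>\<^bsub>cover_ring\<^esub> x \<in> enc ` PA" using na by blast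
  next
    fix x y assume "x \<in> enc ` PA" "y \<in> enc ` PA"
    then obtain a b where ab: "x = enc a" "a \<in> PA" "y = enc b" "b \<in> PA" by blast
    then have "x \<oplus>\<^bsub>cover_ring\<^esub> y = enc (a + b)" using PA_A by (auto simp: subset_iff)
    then show "x \<oplus>\<^bsub>cover_ring\<^esub> y \<in> enc ` PA" using PA_add ab by blast
  qed
  then have I: "ideal (enc ` PA) cover_ring"
  proof (intro idealI B.ring_axioms)
    fix x y assume "x \<in> enc ` PA" "y \<in> carrier cover_ring"
    then obtain a b where ab: "x = enc a" "a \<in> PA" "y = enc b" "b \<in> A" by auto
    then have "y \<otimes>\<^bsub>cover_ring\<^esub> x = enc (b * a)" "x \<otimes>\<^bsub>cover_ring\<^esub> y = enc (b * a)" using PA_A by (auto simp: subset_iff mult.commute)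
    then show "y \<otimes>\<^bsub>cover_ring\<^esub> x \<in> enc ` PA" "x \<otimes>\<^bsub>cover_ring\<^esub> y \<in> enc ` PA" using PA_mult ab by auto
  qed
  define T where "T = enc ` (OX - P)"
  have disj: "enc ` PA \<inter> T = {}"
  proof (rule ccontr)
    assume "enc ` PA \<inter> T \<noteq> {}"
    then obtain s x where s: "s \<in> OX" "s \<notin> P" "x \<in> PA" "enc x = enc s" by (auto simp: T_def)
    then have "s \<in> PA" using enc_inj[of x s] PA_A A_OX by auto
    then have "w 0 * s \<in> PA" using PA_mult w_A n_pos by blast
    moreover have "w 0 * s = (\<Sum>j<n. (if j = 0 then s else 0) * w j)"
    proof -
      have "(\<Sum>j<n. (if j = 0 then s else 0) * w j) = (\<Sum>j<n. if j = 0 then s * w j else 0)" by (intro sum.cong) auto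
      then show ?thesis using n_pos by (simp add: mult.commute)
    qed
    ultimately have "(if (0::nat) = 0 then s else 0) \<in> P" using s(1) by (intro PA_coeff[of "\<lambda>j. if j = 0 then s else 0"]) auto
    then show False using s(2) by simp
  qed
  obtain Q where Q: "primeideal Q cover_ring" "enc ` PA \<subseteq> Q" "Q \<inter> T = {}"
  proof (rule prime_ideal_avoiding[OF cring_cover I _ _ _ disj])
    show "T \<subseteq> carrier cover_ring" using A_OX by (auto simp: T_def)
    show "\<one>\<^bsub>cover_ring\<^esub> \<in> T" using primeideal_not_1[OF P] by (auto simp: T_def)
    fix x y assume "x \<in> T" "y \<in> T"
    then obtain a b where ab: "x = enc a" "y = enc b" "a \<in> OX" "b \<in> OX" "a \<notin> P" "b \<notin> P" by (auto simp: T_def)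
    then have "a * b \<notin> P" using primeideal.I_prime[OF P, of a b] by auto
    then show "x \<otimes>\<^bsub>cover_ring\<^esub> y \<in> T" using ab A_OX by (auto simp: T_def)
  qed (use that in blast)
  have "{a \<in> OX. enc a \<in> Q} = P"
  proof (intro subset_antisym subsetI)
    fix a assume "a \<in> {a \<in> OX. enc a \<in> Q}"
    then show "a \<in> P" using Q(3) by (auto simp: T_def)
  next
    fix a assume a: "a \<in> P"
    then have "a * 1 \<in> PA" by (rule PA_gen) simp
    then show "a \<in> {a \<in> OX. enc a \<in> Q}" using Q(2) PO a by auto
  qed
  then show ?thesis using Q(1) by blast
qed

end

context finite_differential_algebra
begin

section \<open>Differentials of the cover\<close>

abbreviation "K \<equiv> kaehler_rels O_X cover_ring enc"

text \<open>
  The symbol \<open>s dt\<close> as a generator of the module of differentials.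
\<close>

definition dsym :: "rat fps \<Rightarrow> rat fps \<Rightarrow> nat \<times> nat \<Rightarrow>\<^sub>0 int" where
  "dsym s t = frag_of (enc s, enc t)"

lemma kaehler_subgroup: "subgroup K (free_Abelian_group (enc ` A \<times> enc ` A))"
proof -
  interpret B: cring cover_ring by (rule cring_cover)
  have d: "x \<in> {x. Poly_Mapping.keys x \<subseteq> C} \<Longrightarrow> y \<in> {x. Poly_Mapping.keys x \<subseteq> C} \<Longrightarrow> x - y \<in> {x. Poly_Mapping.keys x \<subseteq> C}"
    for x y and C :: "(nat \<times> nat) set" using keys_diff[of x y] by auto
  have o: "a \<in> C \<Longrightarrow> frag_of a \<in> {x. Poly_Mapping.keys x \<subseteq> C}" for a and C :: "(nat \<times> nat) set" by simp
  have "subgroup K (free_Abelian_group (carrier cover_ring \<times> carrier cover_ring))"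
    unfolding kaehler_rels_def
  proof (rule group.generate_is_subgroup[OF group_free_Abelian_group], simp only: carrier_free_Abelian_group_iff[symmetric] subset_iff Un_iff)
    show "\<forall>x. (((x \<in> {frag_of (s \<oplus>\<^bsub>cover_ring\<^esub> s', t) - frag_of (s, t) - frag_of (s', t) |s s' t. s \<in> carrier cover_ring \<and> s' \<in> carrier cover_ring \<and> t \<in> carrier cover_ring} \<or>
           x \<in> {frag_of (s, t \<oplus>\<^bsub>cover_ring\<^esub> t') - frag_of (s, t) - frag_of (s, t') |s t t'. s \<in> carrier cover_ring \<and> t \<in> carrier cover_ring \<and> t' \<in> carrier cover_ring}) \<or>
          x \<in> {frag_of (s, t \<otimes>\<^bsub>cover_ring\<^esub> t') - frag_of (s \<otimes>\<^bsub>cover_ring\<^esub> t, t') - frag_of (s \<otimes>\<^bsub>cover_ring\<^esub> t', t) |s t t'. s \<in> carrier cover_ring \<and> t \<in> carrier cover_ring \<and> t' \<in> carrier cover_ring}) \<or>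
         x \<in> {frag_of (s, enc a) |s a. s \<in> carrier cover_ring \<and> a \<in> OX}) \<longrightarrow>
        x \<in> carrier (free_Abelian_group (carrier cover_ring \<times> carrier cover_ring))"
      unfolding carrier_free_Abelian_group_iff
      apply (intro allI impI)
      apply (elim disjE CollectE exE conjE; simp only:)
      apply (rule d[unfolded mem_Collect_eq] o[unfolded mem_Collect_eq] SigmaI B.add.m_closed B.m_closed | assumption | simp add: A_OX del: cover_ring_simps(2,5))+
      done
  qed
  then show ?thesis by simp
qed

lemma kaehler_closed: "0 \<in> K" "x \<in> K \<Longrightarrow> y \<in> K \<Longrightarrow> x + y \<in> K" "x \<in> K \<Longrightarrow> - x \<in> K"
  "x \<in> K \<Longrightarrow> y \<in> K \<Longrightarrow> x - y \<in> K"
proof -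
  show "0 \<in> K" using subgroup.one_closed[OF kaehler_subgroup] by simp
  show a: "x + y \<in> K" if "x \<in> K" "y \<in> K" for x y
    using subgroup.m_closed[OF kaehler_subgroup that] by simp
  show m: "- x \<in> K" if "x \<in> K" for x
    using subgroup.m_inv_closed[OF kaehler_subgroup that] subgroup.mem_carrier[OF kaehler_subgroup that] by simp
  show "x - y \<in> K" if "x \<in> K" "y \<in> K" for x y
    using a[OF that(1) m[OF that(2)]] by simp
qed

lemma dsym_add_left:
  assumes "s \<in> A" "s' \<in> A" "t \<in> A" shows "dsym (s + s') t - dsym s t - dsym s' t \<in> K"
proof -
  have "frag_of (enc s \<oplus>\<^bsub>cover_ring\<^esub> enc s', enc t) - frag_of (enc s, enc t) - frag_of (enc s', enc t) \<in> K"
    unfolding kaehler_rels_def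
    by (rule generate.incl, rule UnI1, rule UnI1, rule UnI1, intro CollectI exI[of _ "enc s"] exI[of _ "enc s'"] exI[of _ "enc t"])
      (use assms in \<open>simp only: cover_ring_simps(1) imageI simp_thms\<close>)
  then show ?thesis using assms by (simp add: dsym_def)
qed

lemma dsym_add_right:
  assumes "s \<in> A" "t \<in> A" "t' \<in> A" shows "dsym s (t + t') - dsym s t - dsym s t' \<in> K"
proof -
  have "frag_of (enc s, enc t \<oplus>\<^bsub>cover_ring\<^esub> enc t') - frag_of (enc s, enc t) - frag_of (enc s, enc t') \<in> K"
    unfolding kaehler_rels_def
    by (rule generate.incl, rule UnI1, rule UnI1, rule UnI2, intro CollectI exI[of _ "enc s"] exI[of _ "enc t"] exI[of _ "enc t'"])
      (use assms in \<open>simp only: cover_ring_simps(1) imageI simp_thms\<close>)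
  then show ?thesis using assms by (simp add: dsym_def)
qed

lemma dsym_mult:
  assumes "s \<in> A" "t \<in> A" "t' \<in> A" shows "dsym s (t * t') - dsym (s * t) t' - dsym (s * t') t \<in> K"
proof -
  have "frag_of (enc s, enc t \<otimes>\<^bsub>cover_ring\<^esub> enc t') - frag_of (enc s \<otimes>\<^bsub>cover_ring\<^esub> enc t, enc t') - frag_of (enc s \<otimes>\<^bsub>cover_ring\<^esub> enc t', enc t) \<in> K"
    unfolding kaehler_rels_def
    by (rule generate.incl, rule UnI1, rule UnI2, intro CollectI exI[of _ "enc s"] exI[of _ "enc t"] exI[of _ "enc t'"])
      (use assms in \<open>simp only: cover_ring_simps(1) imageI simp_thms\<close>)
  then show ?thesis using assms by (simp add: dsym_def)
qed

lemma dsym_const: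
  assumes "s \<in> A" "a \<in> OX" shows "dsym s a \<in> K"
  unfolding kaehler_rels_def dsym_def
  by (rule generate.incl, rule UnI2, intro CollectI exI[of _ "enc s"] exI[of _ a])
    (use assms in \<open>simp only: cover_ring_simps(1) imageI simp_thms\<close>)

lemma kaehler_induct [consumes 1, case_names zero add minus add_left add_right mult const]:
  assumes "x \<in> K" "P 0" "\<And>x y. P x \<Longrightarrow> P y \<Longrightarrow> P (x + y)" "\<And>x. P x \<Longrightarrow> P (- x)"
    and "\<And>s s' t. s \<in> A \<Longrightarrow> s' \<in> A \<Longrightarrow> t \<in> A \<Longrightarrow> P (dsym (s + s') t - dsym s t - dsym s' t)"
    and "\<And>s t t'. s \<in> A \<Longrightarrow> t \<in> A \<Longrightarrow> t' \<in> A \<Longrightarrow> P (dsym s (t + t') - dsym s t - dsym s t')"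
    and "\<And>s t t'. s \<in> A \<Longrightarrow> t \<in> A \<Longrightarrow> t' \<in> A \<Longrightarrow> P (dsym s (t * t') - dsym (s * t) t' - dsym (s * t') t)"
    and "\<And>s a. s \<in> A \<Longrightarrow> a \<in> OX \<Longrightarrow> P (dsym s a)"
  shows "P x"
proof -
  let ?R = "{frag_of (s \<oplus>\<^bsub>cover_ring\<^esub> s', t) - frag_of (s, t) - frag_of (s', t) | s s' t.
         s \<in> carrier cover_ring \<and> s' \<in> carrier cover_ring \<and> t \<in> carrier cover_ring} \<union>
      {frag_of (s, t \<oplus>\<^bsub>cover_ring\<^esub> t') - frag_of (s, t) - frag_of (s, t') | s t t'.
         s \<in> carrier cover_ring \<and> t \<in> carrier cover_ring \<and> t' \<in> carrier cover_ring} \<union>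
      {frag_of (s, t \<otimes>\<^bsub>cover_ring\<^esub> t') - frag_of (s \<otimes>\<^bsub>cover_ring\<^esub> t, t') - frag_of (s \<otimes>\<^bsub>cover_ring\<^esub> t', t) | s t t'.
         s \<in> carrier cover_ring \<and> t \<in> carrier cover_ring \<and> t' \<in> carrier cover_ring} \<union>
      {frag_of (s, enc a) | s a. s \<in> carrier cover_ring \<and> a \<in> carrier O_X}"
  have R: "P h" if "h \<in> ?R" for h
  proof -
    consider (l) s s' t where "h = frag_of (s \<oplus>\<^bsub>cover_ring\<^esub> s', t) - frag_of (s, t) - frag_of (s', t)" "s \<in> enc ` A" "s' \<in> enc ` A" "t \<in> enc ` A"
      | (r) s t t' where "h = frag_of (s, t \<oplus>\<^bsub>cover_ring\<^esub> t') - frag_of (s, t) - frag_of (s, t')" "s \<in> enc ` A" "t \<in> enc ` A" "t' \<in> enc ` A"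
      | (m) s t t' where "h = frag_of (s, t \<otimes>\<^bsub>cover_ring\<^esub> t') - frag_of (s \<otimes>\<^bsub>cover_ring\<^esub> t, t') - frag_of (s \<otimes>\<^bsub>cover_ring\<^esub> t', t)" "s \<in> enc ` A" "t \<in> enc ` A" "t' \<in> enc ` A"
      | (c) s a where "h = frag_of (s, enc a)" "s \<in> enc ` A" "a \<in> OX"
      using \<open>h \<in> ?R\<close> unfolding cover_ring_simps(1) by blast
    then show ?thesis
    proof cases
      case l
      then obtain a b c where "s = enc a" "s' = enc b" "t = enc c" "a \<in> A" "b \<in> A" "c \<in> A" by blast
      then show ?thesis using assms(5)[of a b c] l(1) by (simp add: dsym_def)
    next
      case r
      then obtain a b c where "s = enc a" "t = enc b" "t' = enc c" "a \<in> A" "b \<in> A" "c \<in> A" by blast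
      then show ?thesis using assms(6)[of a b c] r(1) by (simp add: dsym_def)
    next
      case m
      then obtain a b c where "s = enc a" "t = enc b" "t' = enc c" "a \<in> A" "b \<in> A" "c \<in> A" by blast
      then show ?thesis using assms(7)[of a b c] m(1) by (simp add: dsym_def)
    next
      case c
      then obtain b where "s = enc b" "b \<in> A" by blast
      then show ?thesis using assms(8)[of b a] c by (simp add: dsym_def)
    qed
  qed
  have RK: "h \<in> K" if "h \<in> ?R" for h unfolding kaehler_rels_def using that by (rule generate.incl)
  have "x \<in> generate (free_Abelian_group (carrier cover_ring \<times> carrier cover_ring)) ?R"
    using assms(1) unfolding kaehler_rels_def .
  then show ?thesis
  proof (induction rule: generate.induct)
    case one then show ?case using assms(2) by simp
  next
    case (incl h) then show ?case by (rule R)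
  next
    case (inv h)
    have "h \<in> carrier (free_Abelian_group (carrier cover_ring \<times> carrier cover_ring))"
      using subgroup.mem_carrier[OF kaehler_subgroup RK[OF inv]] by simp
    then show ?case using assms(4)[OF R[OF inv]] by simp
  next
    case (eng h1 h2)
    then show ?case using assms(3) by simp
  qed
qed

text \<open>
  The Lie derivative of differentials along \<open>d/dx\<close>, on the free group of symbols.
\<close>

definition lie :: "(nat \<times> nat \<Rightarrow>\<^sub>0 int) \<Rightarrow> (nat \<times> nat \<Rightarrow>\<^sub>0 int)" where
  "lie = frag_extend (\<lambda>(s, t). dsym (fps_deriv (dec s)) (dec t) + dsym (dec s) (fps_deriv (dec t)))"

lemma lie_simps:
  "lie 0 = 0" "lie (x + y) = lie x + lie y" "lie (x - y) = lie x - lie y" "lie (- x) = - lie x"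
  "s \<in> A \<Longrightarrow> t \<in> A \<Longrightarrow> lie (dsym s t) = dsym (fps_deriv s) t + dsym s (fps_deriv t)"
  by (simp_all add: lie_def frag_extend_add frag_extend_diff frag_extend_minus) (simp add: dsym_def)

text \<open>
  The relations are natural, so they are preserved by the Lie derivative.
\<close>

lemma lie_kaehler: "x \<in> K \<Longrightarrow> lie x \<in> K"
proof (induction x rule: kaehler_induct)
  case zero then show ?case by (simp add: lie_simps kaehler_closed)
next
  case (add x y) then show ?case by (simp add: lie_simps kaehler_closed)
next
  case (minus x) then show ?case by (simp add: lie_simps kaehler_closed)
next
  case (add_left s s' t)
  have e: "lie (dsym (s + s') t - dsym s t - dsym s' t) =
     (dsym (fps_deriv s + fps_deriv s') t - dsym (fps_deriv s) t - dsym (fps_deriv s') t) +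
     (dsym (s + s') (fps_deriv t) - dsym s (fps_deriv t) - dsym s' (fps_deriv t))"
    using add_left A_add by (simp add: lie_simps)
  show ?case unfolding e using add_left by (intro kaehler_closed(2) dsym_add_left A_deriv)
next
  case (add_right s t t')
  have e: "lie (dsym s (t + t') - dsym s t - dsym s t') =
     (dsym s (fps_deriv t + fps_deriv t') - dsym s (fps_deriv t) - dsym s (fps_deriv t')) +
     (dsym (fps_deriv s) (t + t') - dsym (fps_deriv s) t - dsym (fps_deriv s) t')"
    using add_right A_add by (simp add: lie_simps)
  show ?case unfolding e using add_right by (intro kaehler_closed(2) dsym_add_right A_deriv)
next
  case (mult s t t')
  let ?s = "fps_deriv s" and ?t = "fps_deriv t" and ?t' = "fps_deriv t'"
  have e: "lie (dsym s (t * t') - dsym (s * t) t' - dsym (s * t') t) =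
      (dsym ?s (t * t') - dsym (?s * t) t' - dsym (?s * t') t) +
      (dsym s (t * ?t' + ?t * t') - dsym s (t * ?t') - dsym s (?t * t')) +
      (dsym s (t * ?t') - dsym (s * t) ?t' - dsym (s * ?t') t) +
      (dsym s (?t * t') - dsym (s * ?t) t' - dsym (s * t') ?t) -
      (dsym (s * ?t + ?s * t) t' - dsym (s * ?t) t' - dsym (?s * t) t') -
      (dsym (s * ?t' + ?s * t') t - dsym (s * ?t') t - dsym (?s * t') t)"
    using mult A_mult by (simp add: lie_simps)
  show ?case unfolding e using mult
    by (intro kaehler_closed(2,4) dsym_add_left dsym_add_right dsym_mult A_deriv A_mult)
next
  case (const s a)
  then show ?case by (simp add: lie_simps A_OX kaehler_closed dsym_const A_deriv)
qed

text \<open>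
  The relation \<open>dx = u dt\<close> between differentials.
\<close>

definition has_differential :: "rat fps \<Rightarrow> rat fps \<Rightarrow> rat fps \<Rightarrow> bool" where
  "has_differential t x u \<longleftrightarrow> x \<in> A \<and> u \<in> A \<and> (\<forall>s\<in>A. dsym s x - dsym (s * u) t \<in> K)"

lemma dsym_zero_left: "t \<in> A \<Longrightarrow> dsym 0 t \<in> K"
  using kaehler_closed(3)[OF dsym_add_left[of 0 0 t]] by simp

lemma has_differential_const: "t \<in> A \<Longrightarrow> a \<in> OX \<Longrightarrow> has_differential t a 0"
  unfolding has_differential_def by (auto intro!: kaehler_closed(4) dsym_const dsym_zero_left A_OX)

lemma has_differential_self: "t \<in> A \<Longrightarrow> has_differential t t 1"
  unfolding has_differential_def by (simp add: kaehler_closed)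

lemma has_differential_add:
  assumes t: "t \<in> A" and x: "has_differential t x u" and y: "has_differential t y v"
  shows "has_differential t (x + y) (u + v)"
  unfolding has_differential_def
proof (intro conjI ballI)
  have A: "x \<in> A" "y \<in> A" "u \<in> A" "v \<in> A" using x y by (auto simp: has_differential_def)
  then show "x + y \<in> A" "u + v \<in> A" by (auto intro: A_add)
  fix s assume s: "s \<in> A"
  have xy: "dsym s x - dsym (s * u) t \<in> K" "dsym s y - dsym (s * v) t \<in> K"
    using x y s by (auto simp: has_differential_def)
  have e: "dsym s (x + y) - dsym (s * (u + v)) t = (dsym s (x + y) - dsym s x - dsym s y)
     + (dsym s x - dsym (s * u) t) + (dsym s y - dsym (s * v) t)
     - (dsym (s * u + s * v) t - dsym (s * u) t - dsym (s * v) t)"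
    by (simp add: distrib_left)
  show "dsym s (x + y) - dsym (s * (u + v)) t \<in> K"
    unfolding e
    by (rule kaehler_closed(4)[OF kaehler_closed(2)[OF kaehler_closed(2)[OF dsym_add_right xy(1)] xy(2)] dsym_add_left])
      (simp_all add: s A t A_mult)
qed

lemma has_differential_mult:
  assumes t: "t \<in> A" and x: "has_differential t x u" and y: "has_differential t y v"
  shows "has_differential t (x * y) (x * v + y * u)"
  unfolding has_differential_def
proof (intro conjI ballI)
  have A: "x \<in> A" "y \<in> A" "u \<in> A" "v \<in> A" using x y by (auto simp: has_differential_def)
  then show "x * y \<in> A" "x * v + y * u \<in> A" by (auto intro: A_add A_mult)
  fix s assume s: "s \<in> A"
  have 1: "dsym (s * y) x - dsym (s * y * u) t \<in> K" "dsym (s * x) y - dsym (s * x * v) t \<in> K"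
    using x y A_mult[OF s A(1)] A_mult[OF s A(2)] by (auto simp: has_differential_def)
  have e: "dsym s (x * y) - dsym (s * (x * v + y * u)) t = (dsym s (x * y) - dsym (s * x) y - dsym (s * y) x)
     + (dsym (s * y) x - dsym (s * y * u) t) + (dsym (s * x) y - dsym (s * x * v) t)
     - (dsym (s * x * v + s * y * u) t - dsym (s * x * v) t - dsym (s * y * u) t)"
    by (simp add: distrib_left mult.assoc)
  show "dsym s (x * y) - dsym (s * (x * v + y * u)) t \<in> K"
    unfolding e
    by (rule kaehler_closed(4)[OF kaehler_closed(2)[OF kaehler_closed(2)[OF dsym_mult 1(1)] 1(2)] dsym_add_left])
      (simp_all add: s A t A_mult)
qed

lemma has_differential_sum:
  assumes t: "t \<in> A" and "\<And>i. i \<in> S \<Longrightarrow> has_differential t (f i) (g i)"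
  shows "has_differential t (sum f S) (sum g S)"
  using assms(2)
  by (induction S rule: infinite_finite_induct) (auto intro: has_differential_add[OF t] has_differential_const[OF t])

lemma has_differential_power:
  assumes t: "t \<in> A"
  shows "has_differential t (t ^ i) (of_nat i * t ^ (i - 1))"
proof (induction i)
  case 0 show ?case using has_differential_const[OF t OX_1] by simp
next
  case (Suc i)
  have "t * (of_nat i * t ^ (i - 1)) + t ^ i * 1 = of_nat (Suc i) * t ^ (Suc i - 1)"
    by (cases i) (simp_all add: algebra_simps)
  then show ?case using has_differential_mult[OF t has_differential_self[OF t] Suc] by simp
qed

text \<open>
  Differentiating a minimal relation \<open>P(t) = 0\<close> gives \<open>P'(t) dt = 0\<close>. Here \<open>P'(t)\<close> is nonzero by
  minimality, and it divides a nonzero element of the coordinate ring.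
\<close>

lemma differential_torsion:
  assumes t: "t \<in> A"
  shows "\<exists>a\<in>OX. a \<noteq> 0 \<and> (\<forall>s\<in>A. dsym (a * s) t \<in> K)"
proof -
  obtain d c where c: "relation t (Suc d) c" "\<forall>e b. relation t e b \<longrightarrow> Suc d \<le> e"
    using minimal_relation[OF t] by (elim exE conjE)
  have cO: "c i \<in> OX" if "i \<le> Suc d" for i using c(1) that by (simp add: relation_def)
  define u where "u = (\<Sum>i\<le>Suc d. c i * (of_nat i * t ^ (i - 1)))"
  have "has_differential t (\<Sum>i\<le>Suc d. c i * t ^ i) (\<Sum>i\<le>Suc d. c i * (of_nat i * t ^ (i - 1)) + t ^ i * 0)"
  proof (rule has_differential_sum[OF t])
    fix i assume "i \<in> {..Suc d}"
    then show "has_differential t (c i * t ^ i) (c i * (of_nat i * t ^ (i - 1)) + t ^ i * 0)"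
      by (intro has_differential_mult[OF t] has_differential_const[OF t] has_differential_power[OF t] cO) simp
  qed
  then have h: "has_differential t 0 u" using c(1) by (simp add: relation_def u_def)
  have u0: "u \<noteq> 0"
  proof
    assume "u = 0"
    moreover have "u = (\<Sum>i\<le>d. (c (Suc i) * of_nat (Suc i)) * t ^ i)"
      unfolding u_def by (subst sum.atMost_Suc_shift) (simp add: mult.assoc)
    ultimately have z: "(\<Sum>i\<le>d. (c (Suc i) * of_nat (Suc i)) * t ^ i) = 0" by (simp only:)
    have nz: "(of_nat (Suc d) :: rat fps) \<noteq> 0" by (simp only: of_nat_eq_0_iff)
    have "of_nat m \<in> OX" for m by (induction m) auto
    then have "relation t d (\<lambda>i. c (Suc i) * of_nat (Suc i))"
      unfolding relation_def using z c(1) cO nz by (auto simp: relation_def simp del: of_nat_Suc)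
    then have "Suc d \<le> d" using c(2) by blast
    then show False by simp
  qed
  have uA: "u \<in> A" using h by (simp add: has_differential_def)
  have hs: "dsym (s * u) t \<in> K" if s: "s \<in> A" for s
  proof -
    have "dsym s 0 - (dsym s 0 - dsym (s * u) t) \<in> K"
      by (rule kaehler_closed(4)[OF dsym_const[OF s OX_0]]) (use h s in \<open>simp add: has_differential_def\<close>)
    then show ?thesis by simp
  qed
  obtain v where v: "v \<in> A" "u * v \<in> OX" "u * v \<noteq> 0" using nonzero_divides_OX[OF uA u0] by blast
  have "dsym (u * v * s) t \<in> K" if "s \<in> A" for s
    using hs[OF A_mult[OF v(1) that]] by (simp add: mult_ac)
  then show ?thesis using v by blast
qed

text \<open>
  The differentials are generated by those of the basis elements, each of which is torsion. So some
  nonzero function annihilates all differentials. The annihilator is stable under differentiation, as the Lie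
  derivative shows, so it contains 1.
\<close>

lemma unramified_cover: "unramified O_X cover_ring enc"
proof -
  have "\<forall>j. \<exists>a. j < n \<longrightarrow> a \<in> OX \<and> a \<noteq> 0 \<and> (\<forall>s\<in>A. dsym (a * s) (w j) \<in> K)"
    using differential_torsion[OF w_A] by blast
  from choice[OF this] obtain a where a: "\<And>j. j < n \<Longrightarrow> a j \<in> OX" "\<And>j. j < n \<Longrightarrow> a j \<noteq> 0"
    "\<And>j s. j < n \<Longrightarrow> s \<in> A \<Longrightarrow> dsym (a j * s) (w j) \<in> K" by blast
  define I where "I = {f \<in> OX. \<forall>s\<in>A. \<forall>t\<in>A. dsym (f * s) t \<in> K}"
  define \<pi> where "\<pi> = (\<Prod>j<n. a j)"
  have \<pi>: "\<pi> \<in> OX" "\<pi> \<noteq> 0" unfolding \<pi>_def using a by (auto intro!: OX_prod)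
  have \<pi>w: "dsym (\<pi> * s) (w j) \<in> K" if j: "j < n" and s: "s \<in> A" for j s
  proof -
    have e: "\<pi> * s = a j * ((\<Prod>i\<in>{..<n} - {j}. a i) * s)"
      using prod.remove[of "{..<n}" j a] j by (simp add: \<pi>_def mult_ac)
    show ?thesis unfolding e
      by (rule a(3)[OF j A_mult[OF A_OX[OF OX_prod] s]]) (use a(1) in auto)
  qed
  have "\<pi> \<in> I" unfolding I_def
  proof (intro CollectI conjI ballI \<pi>(1))
    fix s t assume s: "s \<in> A" and t: "t \<in> A"
    have \<pi>s: "\<pi> * s \<in> A" using A_mult[OF A_OX[OF \<pi>(1)] s] .
    obtain b where b: "\<forall>j<n. b j \<in> OX" "t = (\<Sum>j<n. b j * w j)" using w_span[OF t] by blast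
    have bA: "b j * w j \<in> A" if "j < n" for j by (rule A_mult[OF A_OX w_A]) (use that b in auto)
    have one: "dsym (\<pi> * s) (b j * w j) \<in> K" if j: "j < n" for j
    proof -
      have bj: "b j \<in> OX" using b(1) j by blast
      have "dsym (\<pi> * s * b j) (w j) \<in> K" using \<pi>w[OF j A_mult[OF s A_OX[OF bj]]] by (simp add: mult.assoc)
      moreover have "dsym (\<pi> * s * w j) (b j) \<in> K" by (rule dsym_const[OF A_mult[OF \<pi>s w_A[OF j]] bj])
      ultimately have "(dsym (\<pi> * s) (b j * w j) - dsym (\<pi> * s * b j) (w j) - dsym (\<pi> * s * w j) (b j))
         + dsym (\<pi> * s * b j) (w j) + dsym (\<pi> * s * w j) (b j) \<in> K"
        by (intro kaehler_closed(2) dsym_mult \<pi>s A_OX bj w_A j)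
      then show ?thesis by simp
    qed
    have "(\<Sum>j\<in>J. b j * w j) \<in> A \<and> dsym (\<pi> * s) (\<Sum>j\<in>J. b j * w j) \<in> K" if J: "J \<subseteq> {..<n}" for J
    proof -
      have "finite J" using J finite_subset by blast
      then show ?thesis using J
      proof (induction J rule: finite_induct)
        case empty then show ?case using dsym_const[OF \<pi>s OX_0] by simp
      next
        case (insert j J)
        then have A: "b j * w j \<in> A" "(\<Sum>j\<in>J. b j * w j) \<in> A" "dsym (\<pi> * s) (b j * w j) \<in> K" "dsym (\<pi> * s) (\<Sum>j\<in>J. b j * w j) \<in> K"
          using bA one by auto
        let ?x = "b j * w j" and ?y = "\<Sum>j\<in>J. b j * w j"
        have "(dsym (\<pi> * s) (?x + ?y) - dsym (\<pi> * s) ?x - dsym (\<pi> * s) ?y) + dsym (\<pi> * s) ?x + dsym (\<pi> * s) ?y \<in> K"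
          by (intro kaehler_closed(2) dsym_add_right \<pi>s A)
        then have "dsym (\<pi> * s) (?x + ?y) \<in> K" by simp
        then show ?case using insert A A_add by simp
      qed
    qed
    then show "dsym (\<pi> * s) t \<in> K" using b(2) by blast
  qed
  have "1 \<in> I"
  proof (rule derivation_stable_ideal_unit[OF _ _ \<open>\<pi> \<in> I\<close>])
    fix f g assume f: "f \<in> I" and g: "g \<in> OX"
    show "g * f \<in> I" unfolding I_def
    proof (intro CollectI conjI ballI)
      show "g * f \<in> OX" using f g by (auto simp: I_def)
      fix s t assume "s \<in> A" "t \<in> A"
      then have "dsym (f * (g * s)) t \<in> K" using f A_mult[OF A_OX[OF g]] by (auto simp: I_def)
      then show "dsym (g * f * s) t \<in> K" by (simp add: mult_ac)
    qed
  next
    fix f assume f: "f \<in> I"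
    show "fps_deriv f \<in> I" unfolding I_def
    proof (intro CollectI conjI ballI)
      show f': "fps_deriv f \<in> OX" using f by (auto simp: I_def)
      have fO: "f \<in> OX" and fK: "\<And>s t. s \<in> A \<Longrightarrow> t \<in> A \<Longrightarrow> dsym (f * s) t \<in> K" using f by (auto simp: I_def)
      fix s t assume s: "s \<in> A" and t: "t \<in> A"
      have fs: "f * s \<in> A" "f * fps_deriv s \<in> A" "fps_deriv f * s \<in> A"
        using A_mult[OF A_OX[OF fO]] A_mult[OF A_OX[OF f']] A_deriv s by auto
      have "lie (dsym (f * s) t) \<in> K" by (rule lie_kaehler[OF fK[OF s t]])
      then have "dsym (f * fps_deriv s + fps_deriv f * s) t + dsym (f * s) (fps_deriv t) \<in> K"
        using fs(1) t by (simp add: lie_simps)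
      then have "dsym (f * fps_deriv s + fps_deriv f * s) t + dsym (f * s) (fps_deriv t) - dsym (f * s) (fps_deriv t)
         - (dsym (f * fps_deriv s + fps_deriv f * s) t - dsym (f * fps_deriv s) t - dsym (fps_deriv f * s) t)
         - dsym (f * fps_deriv s) t \<in> K"
        by (intro kaehler_closed(4) fK dsym_add_left fs A_deriv s t)
      then show "dsym (fps_deriv f * s) t \<in> K" by simp
    qed
  qed (use \<pi> in auto)
  then have sym: "dsym s t \<in> K" if "s \<in> A" "t \<in> A" for s t
    using that by (auto simp: I_def)
  show ?thesis unfolding unramified_def
  proof (intro subset_antisym subsetI)
    fix x assume "x \<in> K"
    then show "x \<in> carrier (free_Abelian_group (carrier cover_ring \<times> carrier cover_ring))"
      using subgroup.mem_carrier[OF kaehler_subgroup] by simp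
  next
    fix x assume "x \<in> carrier (free_Abelian_group (carrier cover_ring \<times> carrier cover_ring))"
    then have "Poly_Mapping.keys x \<subseteq> enc ` A \<times> enc ` A" by simp
    then show "x \<in> K"
    proof (rule free_Abelian_group_induct)
      fix p assume "p \<in> enc ` A \<times> enc ` A"
      then show "frag_of p \<in> K" using sym by (auto simp: dsym_def)
    qed (auto intro: kaehler_closed)
  qed
qed

lemma finite_etale_cover: "finite_etale_cover O_X cover_ring enc"
  unfolding finite_etale_cover_def
  using cring_cover enc_ring_hom vector_bundle_cover unramified_cover lying_over by blast

end

section \<open>Trivialising the connection\<close>

text \<open>
  The algebra generated by Y over the coordinate ring is spanned by monomials of bounded degree; being
  a finitely generated module without torsion, it is free.
\<close>

lemma algebraic_sections_generate:
  assumes Y: "finite Y" "\<And>y. y \<in> Y \<Longrightarrow> alg_fps y" "\<And>y. y \<in> Y \<Longrightarrow> fps_deriv y \<in> OXspan Y"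
  shows "\<exists>A n w. finite_differential_algebra A n w \<and> Y \<subseteq> A"
proof -
  obtain d where d: "\<And>e x. x \<in> OXspan (monomials Y e) \<Longrightarrow> x \<in> OXspan (monomials Y d)"
    by (rule differential_algebra_finite[OF Y(1)]) (rule Y(2) Y(3) that | assumption)+
  define T where "T = monomials Y d"
  define A where "A = OXspan T"
  have T: "finite T" unfolding T_def by (rule finite_monomials[OF Y(1)])
  have mon: "prod_list xs \<in> A" if "set xs \<subseteq> Y" for xs
    unfolding A_def T_def by (rule d[OF OXspan_base[OF monomialsI[OF that order_refl]]])
  \<comment> \<open>the freeness theorem is about vectors of series; a series is a vector supported at index 0\<close>
  define emb where "emb = (\<lambda>(t :: rat fps) (i :: nat). if i = 0 then t else 0)"
  have emb_sum: "(\<Sum>t\<in>S. a t * emb t i) = emb (\<Sum>t\<in>S. a t * t) i" for S i and a :: "rat fps \<Rightarrow> rat fps"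
    by (simp add: emb_def)
  define W where "W = span_OX T emb"
  have W1: "emb x \<in> W" if x: "x \<in> A" for x
  proof -
    obtain a where "\<forall>t\<in>T. a t \<in> OX" "x = (\<Sum>t\<in>T. a t * t)" using OXspan_finite[OF T] x unfolding A_def by blast
    then show ?thesis unfolding W_def span_OX_def by (intro CollectI exI[of _ a]) (simp add: emb_sum)
  qed
  have W2: "v 0 \<in> A \<and> v = emb (v 0)" if v: "v \<in> W" for v
  proof -
    obtain a where a: "\<forall>t\<in>T. a t \<in> OX" "\<forall>i. v i = (\<Sum>t\<in>T. a t * emb t i)" using v unfolding W_def span_OX_def by blast
    have "v i = emb (\<Sum>t\<in>T. a t * t) i" for i using a(2) by (simp add: emb_sum)
    then have 1: "v = emb (\<Sum>t\<in>T. a t * t)" by blast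
    then have 2: "v 0 = (\<Sum>t\<in>T. a t * t)" by (simp add: emb_def)
    have "(\<Sum>t\<in>T. a t * t) \<in> A" unfolding A_def
      by (rule OXspan_sum, rule OXspan_smult[OF OXspan_base]) (use a in auto)
    then show ?thesis using 1 2 by simp
  qed
  obtain n and b :: "nat \<Rightarrow> nat \<Rightarrow> rat fps" where b: "W = span_OX {..<n} b" "indep_OX {..<n} b"
    by (rule finitely_generated_free[OF T W_def]) (rule that)
  have bW: "b j \<in> W" if j: "j < n" for j
  proof -
    have "(\<Sum>l<n. (if l = j then 1 else 0) * b l i) = (\<Sum>l<n. if l = j then b l i else 0)" for i by (intro sum.cong) auto
    then have "b j i = (\<Sum>l<n. (if l = j then 1 else 0) * b l i)" for i using j by simp
    then show ?thesis unfolding b(1) span_OX_def by (intro CollectI exI[of _ "\<lambda>l. if l = j then 1 else 0"]) auto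
  qed
  define w where "w = (\<lambda>j. b j 0)"
  have bw: "w j \<in> A" "b j = emb (w j)" if "j < n" for j using W2[OF bW[OF that]] by (auto simp: w_def)
  have "finite_differential_algebra A n w"
  proof
    show "OX \<subseteq> A"
    proof
      fix a assume "a \<in> OX"
      then have "a * prod_list [] \<in> OXspan T" using mon[of "[]"] unfolding A_def by (intro OXspan_smult) auto
      then show "a \<in> A" by (simp add: A_def)
    qed
    show "x + y \<in> A" if "x \<in> A" "y \<in> A" for x y using that unfolding A_def by (rule OXspan_add)
    show "x * y \<in> A" if xy: "x \<in> A" "y \<in> A" for x y
      using xy unfolding A_def
    proof (rule OXspan_mult)
      fix t u assume "t \<in> T" "u \<in> T"
      then obtain xs ys where "t = prod_list xs" "u = prod_list ys" "set xs \<subseteq> Y" "set ys \<subseteq> Y"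
        by (auto simp: T_def monomials_def)
      then show "t * u \<in> OXspan T" using mon[of "xs @ ys"] by (simp add: A_def)
    qed
    show "fps_deriv x \<in> A" if "x \<in> A" for x
      using that unfolding A_def T_def by (intro OXspan_monomials_deriv Y(3))
    show "w j \<in> A" if "j < n" for j using bw that by blast
    show "\<exists>a. (\<forall>j<n. a j \<in> OX) \<and> x = (\<Sum>j<n. a j * w j)" if "x \<in> A" for x
    proof -
      obtain a where a: "\<forall>j<n. a j \<in> OX" "\<forall>i. emb x i = (\<Sum>j<n. a j * b j i)"
        using W1[OF \<open>x \<in> A\<close>] unfolding b(1) span_OX_def by auto
      have "x = (\<Sum>j<n. a j * w j)" using a(2)[rule_format, of 0] by (simp add: emb_def w_def)
      then show ?thesis using a(1) by blast
    qed
    show "a j = 0" if a: "\<And>j. j < n \<Longrightarrow> a j \<in> OX" "(\<Sum>j<n. a j * w j) = 0" "j < n" for a j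
    proof -
      have "(\<Sum>j<n. a j * b j i) = 0" for i
      proof (cases "i = 0")
        case True then show ?thesis using a(2) by (simp add: w_def)
      next
        case False
        then have "b j i = 0" if "j < n" for j using bw(2)[OF that] by (simp add: emb_def)
        then show ?thesis by simp
      qed
      then show ?thesis using b(2) a(1,3) unfolding indep_OX_def by auto
    qed
  qed
  moreover have "Y \<subseteq> A"
  proof
    fix y assume "y \<in> Y"
    then show "y \<in> A" using mon[of "[y]"] by simp
  qed
  ultimately show ?thesis by blast
qed

text \<open>
  In coordinates the pullback of M to the cover is the trivial bundle with connection \<open>d + G\<close>. The matrix Z
  inverse to Y has entries in A and satisfies \<open>Z' = Z G\<close>, so multiplication by Z turns this connection
  into d.
\<close>

lemma (in finite_differential_algebra) cover_trivialises:
  fixes M :: "(rat fps, 'm) module"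
  assumes co: "coordinates M r \<kappa>" and con: "is_connection O_X fps_deriv M nabla"
    and G: "\<And>i j. i < r \<Longrightarrow> j < r \<Longrightarrow> G i j \<in> OX"
      "\<And>m i. m \<in> carrier M \<Longrightarrow> i < r \<Longrightarrow> \<kappa> (nabla m) i = fps_deriv (\<kappa> m i) + (\<Sum>j<r. G i j * \<kappa> m j)"
    and Y: "\<And>i k. i < r \<Longrightarrow> k < r \<Longrightarrow> taylor_section G r (\<lambda>i. if i = k then 1 else 0) i \<in> A"
  shows "etale_locally_trivial M nabla r"
proof -
  define Y where "Y = (\<lambda>i k. taylor_section G r (\<lambda>i. if i = k then 1 else 0) i)"
  define Z where "Z = (\<lambda>k j. taylor_section (\<lambda>j i. - G i j) r (\<lambda>i. if i = k then 1 else 0) j)"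
  have YA: "Y i k \<in> A" if "i < r" "k < r" for i k using Y[OF that] by (simp add: Y_def)
  have Yd: "fps_deriv (Y i k) = - (\<Sum>j<r. G i j * Y j k)" for i k
    unfolding Y_def by (rule taylor_section_deriv)
  have Zd: "fps_deriv (Z k j) = (\<Sum>i<r. Z k i * G i j)" for k j
    unfolding Z_def taylor_section_deriv by (simp add: sum_negf mult.commute)
  have Y0: "fps_nth (Y i k) 0 = (if i = k then 1 else 0)" for i k by (simp add: Y_def taylor_section_0)
  have Z0: "fps_nth (Z i k) 0 = (if i = k then 1 else 0)" for i k by (auto simp: Z_def taylor_section_0)
  have ZY: "(\<Sum>j<r. Z k j * Y j l) = (if k = l then 1 else 0)" if "k < r" "l < r" for k l
    by (rule inverse_system[of r Y G Z k l, OF Yd Zd Y0 Z0 that])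
  have ZA: "Z k l \<in> A" if "k < r" "l < r" for k l
    by (rule inverse_matrix_entries[of r Y G Z k l, OF YA G(1) Zd ZY that])
  interpret B: base_change M r \<kappa> cover_ring enc dec
    by (rule base_change.intro[OF co cring_cover]) (auto simp: A_OX A_add A_mult)
  have \<theta>A: "B.\<theta> x i \<in> A" if "x \<in> B.gens" "i < r" for x i using B.theta_range[OF that] by auto
  define v where "v = (\<lambda>x k. \<Sum>j<r. Z k j * B.\<theta> x j)"
  have vA: "v x k \<in> A" if "x \<in> B.gens" "k < r" for x k
    unfolding v_def by (rule A_sum, rule A_mult[OF ZA \<theta>A]) (use that in auto)
  define rep where "rep = (\<lambda>U. SOME x. x \<in> B.gens \<and> U = B.cl x)"
  define f where "f = (\<lambda>U. \<lambda>k\<in>{..<r}. enc (v (rep U) k))"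
  have f: "f (B.cl x) = (\<lambda>k\<in>{..<r}. enc (v x k))" if x: "x \<in> B.gens" for x
  proof -
    have "rep (B.cl x) \<in> B.gens \<and> B.cl x = B.cl (rep (B.cl x))"
      unfolding rep_def by (rule someI[of _ x]) (use x in simp)
    then have "\<forall>i<r. B.\<theta> x i = B.\<theta> (rep (B.cl x)) i" using B.cl_eq_iff[OF x] by blast
    then have "v (rep (B.cl x)) k = v x k" for k unfolding v_def by (intro sum.cong) auto
    then show ?thesis by (simp add: f_def)
  qed
  define \<delta> where "\<delta> = enc \<circ> fps_deriv \<circ> dec"
  have \<delta>: "\<delta> (enc x) = enc (fps_deriv x)" if "x \<in> A" for x using that by (simp add: \<delta>_def)
  have der: "derivation cover_ring \<delta>"
    unfolding derivation_def by (auto simp: \<delta> A_deriv A_add A_mult algebra_simps)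
  have \<delta>\<phi>: "\<forall>a\<in>carrier O_X. \<delta> (enc a) = enc (fps_deriv a)" using \<delta> A_OX by blast
  have \<delta>C: "\<delta> c \<in> carrier cover_ring" "dec (\<delta> c) = fps_deriv (dec c)" if "c \<in> carrier cover_ring" for c
    using that by (auto simp: \<delta> A_deriv)
  have nabla: "nabla m \<in> carrier M" if "m \<in> carrier M" for m using con that by (auto simp: is_connection_def)
  have "connection_iso cover_ring B.PB (pullback_connection O_X cover_ring enc M \<delta> nabla)
      (trivial_bundle cover_ring r) (trivial_connection \<delta> r) f"
    unfolding connection_iso_def
  proof (intro conjI ballI)
    show "bij_betw f (carrier B.PB) (carrier (trivial_bundle cover_ring r))"
      unfolding bij_betw_def
    proof
      show "inj_on f (carrier B.PB)"
      proof (rule inj_onI)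
        fix U V assume "U \<in> carrier B.PB" "V \<in> carrier B.PB" and e: "f U = f V"
        then obtain x y where xy: "x \<in> B.gens" "U = B.cl x" "y \<in> B.gens" "V = B.cl y" unfolding B.carrier_PB by blast
        have vv: "v x k = v y k" if k: "k < r" for k
        proof -
          have "f U k = f V k" using e by simp
          then have "enc (v x k) = enc (v y k)" using k by (simp only: xy(2,4) f[OF xy(1)] f[OF xy(3)] restrict_apply lessThan_iff if_True)
          then show ?thesis using enc_inj vA xy k by blast
        qed
        have "B.\<theta> x i - B.\<theta> y i = 0" if i: "i < r" for i
        proof (rule unipotent_injective[of r Z "\<lambda>i. B.\<theta> x i - B.\<theta> y i"])
          fix k assume "k < r"
          then show "(\<Sum>j<r. Z k j * (B.\<theta> x j - B.\<theta> y j)) = 0"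
            using vv[of k] by (simp add: v_def right_diff_distrib sum_subtractf)
        qed (use Z0 i in auto)
        then have "\<forall>i<r. B.\<theta> x i = B.\<theta> y i" by (metis right_minus_eq)
        then have "B.cl x = B.cl y" by (rule iffD2[OF B.cl_eq_iff[OF xy(1,3)]])
        then show "U = V" by (simp only: xy(2,4))
      qed
      show "f ` carrier B.PB = carrier (trivial_bundle cover_ring r)"
      proof (intro subset_antisym subsetI)
        fix u assume "u \<in> f ` carrier B.PB"
        then obtain U where U: "u = f U" "U \<in> carrier B.PB" by (rule imageE)
        then obtain x where x: "x \<in> B.gens" "U = B.cl x" unfolding B.carrier_PB by blast
        show "u \<in> carrier (trivial_bundle cover_ring r)"
          unfolding U(1) x(2) f[OF x(1)] using vA[OF x(1)] by (simp add: trivial_bundle_def)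
      next
        fix u assume "u \<in> carrier (trivial_bundle cover_ring r)"
        then have u: "u \<in> {..<r} \<rightarrow>\<^sub>E enc ` A" by (simp add: trivial_bundle_def)
        have uA: "dec (u l) \<in> A" "enc (dec (u l)) = u l" if "l < r" for l
          using PiE_mem[OF u, of l] that by auto
        define a where "a = (\<lambda>i. \<Sum>l<r. Y i l * dec (u l))"
        have aA: "a i \<in> A" if "i < r" for i
          unfolding a_def by (rule A_sum, rule A_mult[OF YA uA(1)]) (use that in auto)
        have "a i \<in> dec ` carrier cover_ring" if "i < r" for i
          using aA[OF that] by (auto simp: image_image)
        then obtain x where x: "x \<in> B.gens" "\<And>i. i < r \<Longrightarrow> B.\<theta> x i = a i"
          using B.theta_surj[of a] by blast
        have "v x k = dec (u k)" if k: "k < r" for k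
        proof -
          have "v x k = (\<Sum>j<r. \<Sum>l<r. Z k j * Y j l * dec (u l))"
            unfolding v_def using x(2) by (simp add: a_def sum_distrib_left mult.assoc)
          also have "\<dots> = (\<Sum>l<r. (\<Sum>j<r. Z k j * Y j l) * dec (u l))"
            unfolding sum_distrib_right by (rule sum.swap)
          also have "\<dots> = (\<Sum>l<r. if l = k then dec (u l) else 0)" using ZY[OF k] by (intro sum.cong) auto
          finally show ?thesis using k by simp
        qed
        then have "f (B.cl x) = (\<lambda>k\<in>{..<r}. u k)" unfolding f[OF x(1)] using uA(2) by (intro restrict_ext) simp
        also have "\<dots> = u" by (rule PiE_restrict[OF u])
        finally show "u \<in> f ` carrier B.PB" using x(1) B.carrier_PB by (metis image_eqI)
      qed
    qed
  next
    fix U V assume "U \<in> carrier B.PB" "V \<in> carrier B.PB"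
    then obtain x y where xy: "x \<in> B.gens" "U = B.cl x" "y \<in> B.gens" "V = B.cl y" unfolding B.carrier_PB by blast
    have "v (x + y) k = v x k + v y k" for k by (simp add: v_def distrib_left sum.distrib)
    then show "f (U \<oplus>\<^bsub>B.PB\<^esub> V) = f U \<oplus>\<^bsub>trivial_bundle cover_ring r\<^esub> f V"
      unfolding xy(2,4) B.add_PB[OF xy(1,3)] f[OF xy(1)] f[OF xy(3)] f[OF B.gens_closed(1)[OF xy(1,3)]]
      unfolding trivial_bundle_def using vA[OF xy(1)] vA[OF xy(3)] by (auto intro!: restrict_ext)
  next
    fix c U assume "c \<in> carrier cover_ring" and "U \<in> carrier B.PB"
    then obtain x where c: "c \<in> carrier cover_ring" "dec c \<in> A" and x: "x \<in> B.gens" "U = B.cl x" unfolding B.carrier_PB by auto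
    obtain y where y: "y \<in> B.gens" "c \<odot>\<^bsub>B.PB\<^esub> B.cl x = B.cl y" "\<And>i. i < r \<Longrightarrow> B.\<theta> y i = dec c * B.\<theta> x i"
      by (rule B.smult_PB[OF c(1) x(1)]) (rule that)
    have "v y k = dec c * v x k" for k using y(3) by (simp add: v_def sum_distrib_left mult.left_commute)
    then show "f (c \<odot>\<^bsub>B.PB\<^esub> U) = c \<odot>\<^bsub>trivial_bundle cover_ring r\<^esub> f U"
      unfolding x(2) y(2) f[OF y(1)] f[OF x(1)]
      unfolding trivial_bundle_def using vA[OF x(1)] by (auto intro!: restrict_ext)
  next
    fix U assume "U \<in> carrier B.PB"
    then obtain x where x: "x \<in> B.gens" "U = B.cl x" unfolding B.carrier_PB by blast
    obtain y where y: "y \<in> B.gens" "pullback_connection O_X cover_ring enc M \<delta> nabla (B.cl x) = B.cl y"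
      "\<And>i. i < r \<Longrightarrow> B.\<theta> y i = fps_deriv (B.\<theta> x i) + (\<Sum>j<r. G i j * B.\<theta> x j)"
      by (rule B.connection_PB[where \<delta> = \<delta> and nabla = nabla and G = G, OF _ _ _ _ x(1)])
        ((rule \<delta>C nabla G(2); assumption)+, rule that)
    have "v y k = fps_deriv (v x k)" for k
    proof -
      have "v y k = (\<Sum>j<r. Z k j * fps_deriv (B.\<theta> x j)) + (\<Sum>j<r. \<Sum>l<r. Z k j * G j l * B.\<theta> x l)"
        unfolding v_def using y(3) by (simp add: distrib_left sum.distrib sum_distrib_left mult.assoc)
      also have "(\<Sum>j<r. \<Sum>l<r. Z k j * G j l * B.\<theta> x l) = (\<Sum>l<r. fps_deriv (Z k l) * B.\<theta> x l)"
        unfolding Zd sum_distrib_right by (rule sum.swap)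
      finally show ?thesis by (simp add: v_def fps_deriv_sum sum.distrib)
    qed
    then show "f (pullback_connection O_X cover_ring enc M \<delta> nabla U) = trivial_connection \<delta> r (f U)"
      unfolding x(2) y(2) f[OF y(1)] f[OF x(1)]
      unfolding trivial_connection_def using vA[OF x(1)] by (auto intro!: restrict_ext simp: \<delta>)
  qed
  then show ?thesis unfolding etale_locally_trivial_def using finite_etale_cover der \<delta>\<phi> by blast
qed

theorem proposition7p2p1:
  fixes M :: "(rat fps, 'm) module" and nabla :: "'m \<Rightarrow> 'm" and r :: nat
  assumes "vector_bundle O_X M r"
    and "is_connection O_X fps_deriv M nabla"
    and "p_curvatures_vanish M nabla r"
    and "\<forall>p\<in>{3, 5}. horizontal_sections_converge M nabla p 1"
  shows "etale_locally_trivial M nabla r"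
proof -
  obtain \<kappa> where co: "coordinates M r \<kappa>" by (rule vector_bundle_coordinates[OF assms(1)]) (rule that)
  obtain G where G: "\<And>i j. i < r \<Longrightarrow> j < r \<Longrightarrow> G i j \<in> OX"
    "\<And>m i. m \<in> carrier M \<Longrightarrow> i < r \<Longrightarrow> \<kappa> (nabla m) i = fps_deriv (\<kappa> m i) + (\<Sum>j<r. G i j * \<kappa> m j)"
    by (rule connection_matrix[OF co assms(2)]) (rule that)
  define y where "y = (\<lambda>i k. taylor_section G r (\<lambda>i. if i = k then 1 else 0) i)"
  define Y where "Y = (\<lambda>(i, k). y i k) ` ({..<r} \<times> {..<r})"
  have y: "y i k \<in> Y" if "i < r" "k < r" for i k using that by (auto simp: Y_def)
  have "\<exists>A n w. finite_differential_algebra A n w \<and> Y \<subseteq> A"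
  proof (rule algebraic_sections_generate)
    show "finite Y" by (simp add: Y_def)
    fix t assume "t \<in> Y"
    then obtain i k where t: "t = y i k" "i < r" "k < r" by (auto simp: Y_def)
    show "alg_fps t" unfolding t(1) y_def
      by (rule horizontal_sections_algebraic[where G = G and \<kappa> = \<kappa>, OF co assms(2) _ _ assms(3,4) t(3,2)]) (rule G; assumption)+
    have "fps_deriv t = (\<Sum>j<r. - G i j * y j k)"
      unfolding t(1) y_def taylor_section_deriv by (simp add: sum_negf)
    also have "\<dots> \<in> OXspan Y"
    proof (rule OXspan_sum)
      fix j assume "j \<in> {..<r}"
      then show "- G i j * y j k \<in> OXspan Y"
        by (intro OXspan_smult OXspan_base y OX_uminus G(1)) (use t in auto)
    qed
    finally show "fps_deriv t \<in> OXspan Y" .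
  qed
  then obtain A n w where A: "finite_differential_algebra A n w" "Y \<subseteq> A" by (elim exE conjE)
  show ?thesis
  proof (rule finite_differential_algebra.cover_trivialises[where G = G and \<kappa> = \<kappa>, OF A(1) co assms(2)])
    fix i k assume "i < r" "k < r"
    then show "G i k \<in> OX" "taylor_section G r (\<lambda>i. if i = k then 1 else 0) i \<in> A"
      using y[of i k] A(2) G(1) by (auto simp: y_def)
  qed (rule G(2); assumption)
qed

end
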